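(* Let $p:\mathbb{R}^n\to[1,\infty)$ be a (globally) log-Hölder continuous variable exponent with $p^+=\operatorname{ess\,sup}_{\mathbb{R}^n}p<\infty$ and let $E\subset\mathbb{R}^n$. Then $C_{p(\cdot)}(E)=0$ if and only if $C_{\widetilde{\mathrm{BV}}^{p(\cdot)}}(E)=0$.
   Context: Here $\Omega=\mathbb{R}^n$. Log-Hölder continuity on an unbounded set means global log-Hölder continuity: there are $c_1,c_2>0$ and $p_\infty\ge1$ with $|p(x)-p(y)|\le \dfrac{c_1}{\log(e+1/|x-y|)}$ for all $x\neq y$ and $|p(x)-p_\infty|\le\dfrac{c_2}{\log(e+|x|)}$ for all $x$. $L^{p(\cdot)}(\mathbb{R}^n)$ is the variable exponent Lebesgue space of measurable $u:\mathbb{R}^n\to\mathbb{R}$ (identified when equal a.e.) with $\int_{\mathbb{R}^n} |u/\lambda|^{p(x)}dx<\infty$ for some $\lambda>0$, with Luxemburg norm $\|u\|_{p(\cdot)}=\inf\{\lambda>0:\int_{\mathbb{R}^n}|u/\lambda|^{p(x)}dx\le 1\}$; $\varrho_{p(\cdot)}(u)=\int_{\mathbb{R}^n}|u(x)|^{p(x)}dx$. $W^{1,p(\cdot)}(\mathbb{R}^n)$ is the space of $u\in L^{p(\cdot)}(\mathbb{R}^n)$ whose distributional gradient satisfies $|\nabla u|\in L^{p(\cdot)}(\mathbb{R}^n)$. Sobolev $p(\cdot)$-capacity: $$C_{p(\cdot)}(E)=\inf\int_{\mathbb{R}^n}|u|^{p(x)}+|\nabla u|^{p(x)}\,dx,$$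 the infimum over all $u\in W^{1,p(\cdot)}(\mathbb{R}^n)$ with $u\ge1$ in an open set containing $E$. Mixed capacity: $\mathrm{Lip}_{\mathrm{loc}}(\mathbb{R}^n)$ denotes the locally Lipschitz functions. For $u\in L^{p(\cdot)}(\mathbb{R}^n)$ let $$\varrho_{\widetilde{\mathrm{BV}}^{p(\cdot)}}(u)=\inf\Big\{\liminf_{i\to\infty}\int_{\mathbb{R}^n}|\nabla u_i(x)|^{p(x)}dx\Big\},$$ the infimum being over all sequences $(u_i)$ in $\mathrm{Lip}_{\mathrm{loc}}(\mathbb{R}^n)\cap L^{p(\cdot)}(\mathbb{R}^n)$ with $u_i\to u$ in $L^{p(\cdot)}(\mathbb{R}^n)$, and let $\widetilde{\mathrm{BV}}^{p(\cdot)}(\mathbb{R}^n)=\{u\in L^{p(\cdot)}(\mathbb{R}^n):\varrho_{\widetilde{\mathrm{BV}}^{p(\cdot)}}(u)<\infty\}$. Then $$C_{\widetilde{\mathrm{BV}}^{p(\cdot)}}(E)=\inf\{\varrho_{p(\cdot)}(u)+\varrho_{\widetilde{\mathrm{BV}}^{p(\cdot)}}(u)\},$$ the infimum over all $u\in\widetilde{\mathrm{BV}}^{p(\cdot)}(\mathbb{R}^n)$ with $0\le u\le1$ and $u=1$ in an open neighbourhood of $E$. In both capacities $\inf\varnothing=\infty$. *)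

theory Defs
  imports "HOL-Analysis.Analysis" "HOL-Probability.Essential_Supremum"
begin

text \<open>Euclidean space \<open>\<real>\<^sup>n\<close>, \<open>n \<ge> 1\<close>, is a type of class \<open>euclidean_space\<close>. Functions are
  representatives of their almost-everywhere classes, so every pointwise condition on an element
  of a Lebesgue or Sobolev space is imposed almost everywhere.\<close>

definition global_log_Holder :: "('a::euclidean_space \<Rightarrow> real) \<Rightarrow> bool" where
  "global_log_Holder p \<longleftrightarrow>
     (\<exists>c1>0. \<exists>c2>0. \<exists>pinf\<ge>1.
        (\<forall>x y. x \<noteq> y \<longrightarrow> \<bar>p x - p y\<bar> \<le> c1 / ln (exp 1 + 1 / norm (x - y))) \<and>
        (\<forall>x. \<bar>p x - pinf\<bar> \<le> c2 / ln (exp 1 + norm x)))"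

definition modular :: "('a::euclidean_space \<Rightarrow> real) \<Rightarrow> ('a \<Rightarrow> real) \<Rightarrow> ennreal" where
  "modular p u = (\<integral>\<^sup>+ x. ennreal (\<bar>u x\<bar> powr p x) \<partial>lebesgue)"

definition var_Lebesgue :: "('a::euclidean_space \<Rightarrow> real) \<Rightarrow> ('a \<Rightarrow> real) set" where
  "var_Lebesgue p =
     {u \<in> borel_measurable lebesgue. \<exists>lam>0. modular p (\<lambda>x. u x / lam) < \<infinity>}"

definition Luxemburg_norm :: "('a::euclidean_space \<Rightarrow> real) \<Rightarrow> ('a \<Rightarrow> real) \<Rightarrow> real" where
  "Luxemburg_norm p u = Inf {lam. lam > 0 \<and> modular p (\<lambda>x. u x / lam) \<le> 1}"

primrec k_times_continuously_differentiable ::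
    "nat \<Rightarrow> ('a::euclidean_space \<Rightarrow> real) \<Rightarrow> bool" where
  "k_times_continuously_differentiable 0 f \<longleftrightarrow> continuous_on UNIV f"
| "k_times_continuously_differentiable (Suc k) f \<longleftrightarrow>
     f differentiable_on UNIV \<and>
     (\<forall>b\<in>Basis. k_times_continuously_differentiable k (\<lambda>x. frechet_derivative f (at x) b))"

definition test_functions :: "('a::euclidean_space \<Rightarrow> real) set" where
  "test_functions =
     {\<phi>. (\<forall>k. k_times_continuously_differentiable k \<phi>) \<and> compact (closure {x. \<phi> x \<noteq> 0})}"

definition locally_integrable ::
    "('a::euclidean_space \<Rightarrow> 'b::{banach, second_countable_topology}) \<Rightarrow> bool" where
  "locally_integrable f \<longleftrightarrow> (\<forall>K. compact K \<longrightarrow> set_integrable lebesgue K f)"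

definition has_weak_gradient ::
    "('a::euclidean_space \<Rightarrow> real) \<Rightarrow> ('a \<Rightarrow> 'a) \<Rightarrow> bool" (infix "has'_weak'_gradient" 50) where
  "u has_weak_gradient g \<longleftrightarrow>
     locally_integrable u \<and> locally_integrable g \<and>
     (\<forall>\<phi>\<in>test_functions. \<forall>b\<in>Basis.
        (LINT x|lebesgue. u x * frechet_derivative \<phi> (at x) b)
          = - (LINT x|lebesgue. (g x \<bullet> b) * \<phi> x))"

definition var_Sobolev :: "('a::euclidean_space \<Rightarrow> real) \<Rightarrow> ('a \<Rightarrow> real) set" where
  "var_Sobolev p =
     {u \<in> var_Lebesgue p. \<exists>g. u has_weak_gradient g \<and> (\<lambda>x. norm (g x)) \<in> var_Lebesgue p}"

text \<open>The integral of \<open>|\<nabla>u|\<^bsup>p(x)\<^esup>\<close>. A weak gradient is unique up to null sets, so the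
  infimum is over a single value; it is \<open>\<infinity>\<close> if there is no weak gradient. Locally Lipschitz
  functions have one: by Rademacher's theorem it is their classical gradient, which exists almost
  everywhere.\<close>

definition gradient_modular :: "('a::euclidean_space \<Rightarrow> real) \<Rightarrow> ('a \<Rightarrow> real) \<Rightarrow> ennreal" where
  "gradient_modular p u = (INF g\<in>{g. u has_weak_gradient g}. modular p (\<lambda>x. norm (g x)))"

definition Sobolev_capacity :: "('a::euclidean_space \<Rightarrow> real) \<Rightarrow> 'a set \<Rightarrow> ennreal" where
  "Sobolev_capacity p E =
     (INF u\<in>{u \<in> var_Sobolev p.
              \<exists>U. open U \<and> E \<subseteq> U \<and> (AE x in lebesgue. x \<in> U \<longrightarrow> u x \<ge> 1)}.
        modular p u + gradient_modular p u)"

definition locally_Lipschitz :: "('a::euclidean_space \<Rightarrow> real) set" where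
  "locally_Lipschitz = {u. \<forall>x. \<exists>r>0. \<exists>L. L-lipschitz_on (ball x r) u}"

definition mixed_BV_modular :: "('a::euclidean_space \<Rightarrow> real) \<Rightarrow> ('a \<Rightarrow> real) \<Rightarrow> ennreal" where
  "mixed_BV_modular p u =
     (INF w\<in>{w :: nat \<Rightarrow> 'a \<Rightarrow> real.
              (\<forall>i. w i \<in> locally_Lipschitz \<inter> var_Lebesgue p) \<and>
              (\<lambda>i. Luxemburg_norm p (\<lambda>x. w i x - u x)) \<longlonglongrightarrow> 0}.
        liminf (\<lambda>i. gradient_modular p (w i)))"

definition mixed_BV :: "('a::euclidean_space \<Rightarrow> real) \<Rightarrow> ('a \<Rightarrow> real) set" where
  "mixed_BV p = {u \<in> var_Lebesgue p. mixed_BV_modular p u < \<infinity>}"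

definition mixed_BV_capacity :: "('a::euclidean_space \<Rightarrow> real) \<Rightarrow> 'a set \<Rightarrow> ennreal" where
  "mixed_BV_capacity p E =
     (INF u\<in>{u \<in> mixed_BV p.
              (AE x in lebesgue. 0 \<le> u x \<and> u x \<le> 1) \<and>
              (\<exists>U. open U \<and> E \<subseteq> U \<and> (AE x in lebesgue. x \<in> U \<longrightarrow> u x = 1))}.
        modular p u + mixed_BV_modular p u)"

end

theory Submission
  imports Defs
begin

text \<open>A Sobolev function of small energy becomes admissible for the mixed capacity, at comparable
  cost, after composition with a \<open>C\<^sup>1\<close> step: it is approximated by cutting off the stepped
  mollifications, and log-Hoelder continuity bounds the modular of a mollified gradient by that of
  the gradient.

  Conversely, let \<open>E\<close> have mixed capacity zero. Near a point with \<open>p > 1\<close> the gradients of the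
  approximants of an admissible function \<open>u\<close> are equi-integrable, so \<open>u\<close> is locally a Sobolev
  function. On \<open>{p = 1}\<close> a coarea argument yields superlevel sets of \<open>u\<close> of small perimeter, and
  the boxing argument (relative isoperimetric inequality and Vitali covering) covers the bounded
  parts of \<open>E\<close> by balls with small sum of \<open>r ^ (n - 1)\<close>. As \<open>p = 1\<close> at the centres, log-Hoelder
  continuity bounds the modulars of bump functions divided by \<open>r ^ (n - 1)\<close>, and by convexity of
  the modular the sum of these bumps has small energy. Finally, null sets are countably stable.\<close>

section \<open>Smooth functions\<close>

text \<open>The obstacle is {p = 1}: there a bound on the gradients gives no weak limit in L^1, and
  an admissible function for the mixed capacity may be genuinely of bounded variation, such as an
  indicator. It is not repaired but discarded once its level sets have produced a covering, and new
  functions are built from the balls. Moreover p may approach 1 at the boundary of {p > 1} without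
  any gap, so no open neighbourhood separates the two regimes and E itself is split pointwise. The
  covering argument never sees the exponent: on a bounded set a small modular forces a small L^1
  norm, so it runs on plain L^1 data in a ball, and the exponent returns only in the energy of the
  bumps. In the other direction mollification costs an additive error per unit volume; a
  mollification radius chosen separately for each cutoff ball makes the integral of that error
  small. Functions are glued by convex series and not by maxima, as the modular is convex but not
  subadditive.\<close>

definition C1_gradient :: "('a::euclidean_space \<Rightarrow> real) \<Rightarrow> ('a \<Rightarrow> 'a) \<Rightarrow> bool" where
  "C1_gradient f G \<longleftrightarrow>
     (\<forall>x. (f has_derivative (\<lambda>v. G x \<bullet> v)) (at x)) \<and> continuous_on UNIV G"

lemma C1_gradientD:
  assumes "C1_gradient f G"
  shows "(f has_derivative (\<lambda>v. G x \<bullet> v)) (at x)"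
    and "continuous_on S G" and "continuous_on S f"
    and "frechet_derivative f (at x) v = G x \<bullet> v"
proof -
  show d: "(f has_derivative (\<lambda>v. G x \<bullet> v)) (at x)" for x
    using assms by (auto simp: C1_gradient_def)
  show "continuous_on S G"
    using assms continuous_on_subset by (auto simp: C1_gradient_def)
  show "continuous_on S f"
    by (meson d continuous_at_imp_continuous_on has_derivative_continuous)
  show "frechet_derivative f (at x) v = G x \<bullet> v"
    using frechet_derivative_at[OF d[of x]] by metis
qed

lemma C1_gradient_compose:
  assumes f: "C1_gradient f G"
    and h: "\<And>s. (h has_real_derivative h' s) (at s)" "continuous_on UNIV h'"
  shows "C1_gradient (\<lambda>x. h (f x)) (\<lambda>x. h' (f x) *\<^sub>R G x)"
  unfolding C1_gradient_def
proof
  show "\<forall>x. ((\<lambda>x. h (f x)) has_derivative (\<lambda>v. h' (f x) *\<^sub>R G x \<bullet> v)) (at x)"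
  proof
    fix x
    have "((h \<circ> f) has_derivative ((*) (h' (f x)) \<circ> (\<lambda>v. G x \<bullet> v))) (at x)"
      by (rule diff_chain_at[OF C1_gradientD(1)[OF f]])
         (use h(1)[of "f x"] in \<open>simp add: has_field_derivative_def\<close>)
    then show "((\<lambda>x. h (f x)) has_derivative (\<lambda>v. h' (f x) *\<^sub>R G x \<bullet> v)) (at x)"
      by (simp add: o_def)
  qed
  show "continuous_on UNIV (\<lambda>x. h' (f x) *\<^sub>R G x)"
    by (intro continuous_intros continuous_on_compose2[OF h(2)] C1_gradientD[OF f]) auto
qed

lemma C1_gradient_mult:
  assumes f: "C1_gradient f F" and g: "C1_gradient g G"
  shows "C1_gradient (\<lambda>x. f x * g x) (\<lambda>x. f x *\<^sub>R G x + g x *\<^sub>R F x)"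
  unfolding C1_gradient_def
proof
  show "\<forall>x. ((\<lambda>x. f x * g x) has_derivative (\<lambda>v. (f x *\<^sub>R G x + g x *\<^sub>R F x) \<bullet> v)) (at x)"
    by (auto intro!: derivative_eq_intros C1_gradientD(1)[OF f] C1_gradientD(1)[OF g]
        simp: inner_add_left)
  show "continuous_on UNIV (\<lambda>x. f x *\<^sub>R G x + g x *\<^sub>R F x)"
    by (intro continuous_intros C1_gradientD[OF f] C1_gradientD[OF g])
qed

lemma C1_gradient_affine:
  assumes f: "C1_gradient f F"
  shows "C1_gradient (\<lambda>x. f (a *\<^sub>R x + c)) (\<lambda>x. a *\<^sub>R F (a *\<^sub>R x + c))"
  unfolding C1_gradient_def
proof
  show "\<forall>x. ((\<lambda>x. f (a *\<^sub>R x + c)) has_derivative (\<lambda>v. a *\<^sub>R F (a *\<^sub>R x + c) \<bullet> v)) (at x)"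
  proof
    fix x
    have "((\<lambda>x. a *\<^sub>R x + c) has_derivative (\<lambda>v. a *\<^sub>R v)) (at x)"
      by (auto intro!: derivative_eq_intros)
    from diff_chain_at[OF this C1_gradientD(1)[OF f]]
    show "((\<lambda>x. f (a *\<^sub>R x + c)) has_derivative (\<lambda>v. a *\<^sub>R F (a *\<^sub>R x + c) \<bullet> v)) (at x)"
      by (simp add: o_def)
  qed
  show "continuous_on UNIV (\<lambda>x. a *\<^sub>R F (a *\<^sub>R x + c))"
    by (intro continuous_intros continuous_on_compose2[OF C1_gradientD(2)[OF f, of UNIV]]) auto
qed

text \<open>The gradient is bounded on a closed unit ball by compactness, so the mean value
  inequality applies. This makes cut-off mollifications legitimate competitors in
  \<open>mixed_BV_modular\<close>.\<close>

lemma C1_gradient_imp_locally_Lipschitz: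
  assumes f: "C1_gradient f G"
  shows "f \<in> locally_Lipschitz"
  unfolding locally_Lipschitz_def
proof (intro CollectI allI)
  fix x :: 'a
  have "compact (G ` cball x 1)"
    by (intro compact_continuous_image C1_gradientD[OF f]) auto
  then obtain B where B: "\<And>y. y \<in> cball x 1 \<Longrightarrow> norm (G y) \<le> B"
    using compact_imp_bounded bounded_iff by (metis imageI)
  have "0 \<le> B"
    using order_trans[OF norm_ge_zero B[of x]] by simp
  have "B-lipschitz_on (ball x 1) f"
  proof (rule bounded_derivative_imp_lipschitz)
    show "(f has_derivative (\<lambda>v. G y \<bullet> v)) (at y within ball x 1)" for y
      using C1_gradientD(1)[OF f] has_derivative_at_withinI by blast
    show "onorm (\<lambda>v. G y \<bullet> v) \<le> B" if "y \<in> ball x 1" for y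
    proof (rule onorm_le)
      show "norm (G y \<bullet> v) \<le> B * norm v" for v
        by (metis B Cauchy_Schwarz_ineq2 ball_subset_cball mult_right_mono norm_ge_zero order_trans
            real_norm_def subsetD that)
    qed
  qed (use \<open>0 \<le> B\<close> in auto)
  then show "\<exists>r>0. \<exists>L. L-lipschitz_on (ball x r) f"
    by (intro exI[of _ 1]) auto
qed

text \<open>Serves at the seams of the piecewise definitions below, at 0 for
  \<open>pos_square\<close> and at 1 for \<open>exp_bump\<close>, where neither one-sided formula is
  valid on a whole neighbourhood.\<close>

lemma DERIV_zero_of_quadratic_bound:
  fixes f :: "real \<Rightarrow> real"
  assumes "\<And>t. \<bar>f (x + t) - f x\<bar> \<le> C * t\<^sup>2"
  shows "(f has_real_derivative 0) (at x)"
proof -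
  have "(\<lambda>t. (f (x + t) - f x) / t) \<midarrow>0\<rightarrow> 0"
  proof (rule Lim_null_comparison)
    show "\<forall>\<^sub>F t in at 0. norm ((f (x + t) - f x) / t) \<le> C * \<bar>t\<bar>"
      unfolding eventually_at_filter
    proof (intro always_eventually allI impI)
      fix t :: real assume "t \<noteq> 0"
      then show "norm ((f (x + t) - f x) / t) \<le> C * \<bar>t\<bar>"
        using assms[of t] by (simp add: abs_divide divide_le_eq power2_eq_square)
    qed
    show "((\<lambda>t. C * \<bar>t\<bar>) \<longlongrightarrow> 0) (at 0)"
      by (auto intro!: tendsto_eq_intros)
  qed
  then show ?thesis
    by (simp add: DERIV_def)
qed

section \<open>A C^1 step built from truncated squares\<close>

definition pos_square :: "real \<Rightarrow> real" where
  "pos_square s = (max 0 s)\<^sup>2"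

lemma DERIV_pos_square: "(pos_square has_real_derivative 2 * max 0 s) (at s)"
proof -
  consider "s < 0" | "s = 0" | "s > 0" by linarith
  then show ?thesis
  proof cases
    case 1
    have "((\<lambda>_. 0) has_real_derivative 0) (at s)"
      by simp
    then have "(pos_square has_real_derivative 0) (at s)"
      by (rule has_field_derivative_transform_within_open[of _ _ _ "{..<0}"])
         (use 1 in \<open>auto simp: pos_square_def max_def\<close>)
    then show ?thesis using 1 by simp
  next
    case 2
    have "(pos_square has_real_derivative 0) (at 0)"
      by (rule DERIV_zero_of_quadratic_bound[where C=1]) (auto simp: pos_square_def max_def)
    then show ?thesis using 2 by simp
  next
    case 3
    have "((\<lambda>t. t\<^sup>2) has_real_derivative 2 * s) (at s)"
      by (auto intro!: derivative_eq_intros)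
    then have "(pos_square has_real_derivative 2 * s) (at s)"
      by (rule has_field_derivative_transform_within_open[of _ _ _ "{0<..}"])
         (use 3 in \<open>auto simp: pos_square_def max_def\<close>)
    then show ?thesis using 3 by simp
  qed
qed

text \<open>A \<open>C\<^sup>1\<close> step from 0 to 1 on \<open>[0,1]\<close> whose derivative is a tent of height 2.\<close>

definition smooth_step :: "real \<Rightarrow> real" where
  "smooth_step s = 2 * pos_square s - 4 * pos_square (s - 1/2) + 2 * pos_square (s - 1)"

definition smooth_step' :: "real \<Rightarrow> real" where
  "smooth_step' s = 4 * max 0 s - 8 * max 0 (s - 1/2) + 4 * max 0 (s - 1)"

lemma DERIV_smooth_step: "(smooth_step has_real_derivative smooth_step' s) (at s)"
  unfolding smooth_step_def[abs_def] smooth_step'_def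
  by (rule derivative_eq_intros DERIV_pos_square DERIV_chain2[OF DERIV_pos_square] refl | simp)+

lemma continuous_smooth_step': "continuous_on S smooth_step'"
  unfolding smooth_step'_def[abs_def] by (intro continuous_intros)

lemma continuous_smooth_step: "continuous_on S smooth_step"
  by (meson DERIV_smooth_step DERIV_isCont continuous_at_imp_continuous_on)

lemma smooth_step'_bounds: "0 \<le> smooth_step' s" "smooth_step' s \<le> 2"
  unfolding smooth_step'_def by (auto simp: max_def)

lemma smooth_step'_eq_0: "s \<le> 0 \<or> 1 \<le> s \<Longrightarrow> smooth_step' s = 0"
  unfolding smooth_step'_def by (auto simp: max_def)

lemma smooth_step_eq_0: "s \<le> 0 \<Longrightarrow> smooth_step s = 0"
  unfolding smooth_step_def pos_square_def by (auto simp: max_def)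

lemma smooth_step_eq_1: "1 \<le> s \<Longrightarrow> smooth_step s = 1"
  unfolding smooth_step_def pos_square_def by (auto simp: max_def power2_eq_square algebra_simps)

lemma smooth_step_mono: "s \<le> t \<Longrightarrow> smooth_step s \<le> smooth_step t"
  using DERIV_nonneg_imp_nondecreasing DERIV_smooth_step smooth_step'_bounds(1) by metis

lemma smooth_step_bounds: "0 \<le> smooth_step s" "smooth_step s \<le> 1"
  using smooth_step_mono[of "min s 0" s] smooth_step_mono[of s "max s 1"]
  by (auto simp: smooth_step_eq_0 smooth_step_eq_1)

lemma smooth_step_lipschitz: "\<bar>smooth_step s - smooth_step t\<bar> \<le> 2 * \<bar>s - t\<bar>"
proof -
  have "2-lipschitz_on UNIV smooth_step"
  proof (rule bounded_derivative_imp_lipschitz)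
    show "(smooth_step has_derivative (*) (smooth_step' s)) (at s within UNIV)" for s
      using DERIV_smooth_step[of s] by (simp add: has_field_derivative_def)
    show "onorm ((*) (smooth_step' s)) \<le> 2" for s
      using smooth_step'_bounds[of s] by (intro onorm_le) (auto simp: abs_mult intro!: mult_right_mono)
  qed auto
  then show ?thesis
    by (metis UNIV_I dist_real_def lipschitz_onD)
qed

lemma smooth_step_abs_le: "\<bar>smooth_step s\<bar> \<le> 2 * \<bar>s\<bar>"
  using smooth_step_lipschitz[of s 0] by (simp add: smooth_step_eq_0)

lemma borel_measurable_smooth_step [measurable]: "smooth_step \<in> borel_measurable borel"
  by (simp add: borel_measurable_continuous_onI continuous_smooth_step)

lemma borel_measurable_smooth_step' [measurable]: "smooth_step' \<in> borel_measurable borel"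
  by (simp add: borel_measurable_continuous_onI continuous_smooth_step')

subsection \<open>Test functions\<close>

abbreviation "ktcd \<equiv> k_times_continuously_differentiable"

text \<open>Derivatives are unique, so any explicit formula may stand in for
  \<open>frechet_derivative\<close>. This turns the closure properties below into inductions on the
  order.\<close>

lemma ktcd_SucI:
  assumes "\<And>x. (f has_derivative f' x) (at x)" "\<And>b. b \<in> Basis \<Longrightarrow> ktcd k (\<lambda>x. f' x b)"
  shows "ktcd (Suc k) f"
proof -
  have "frechet_derivative f (at x) = f' x" for x
    using frechet_derivative_at[OF assms(1)] by simp
  then show ?thesis
    using assms by (auto simp: differentiable_on_def differentiable_def)
qed

lemma ktcd_has_derivative:
  assumes "ktcd (Suc k) f"
  shows "(f has_derivative frechet_derivative f (at x)) (at x)"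
  using assms by (simp add: differentiable_on_def frechet_derivative_works)

lemma ktcd_SucD: "ktcd (Suc k) f \<Longrightarrow> ktcd k f"
proof (induction k arbitrary: f)
  case 0
  then show ?case
    by (auto intro: differentiable_imp_continuous_on)
next
  case (Suc k)
  then show ?case
    by (metis k_times_continuously_differentiable.simps(2))
qed

lemma ktcd_const: "ktcd k (\<lambda>_. c)"
proof (induction k arbitrary: c)
  case (Suc k)
  show ?case
    by (rule ktcd_SucI[where f'="\<lambda>_ _. 0"]) (auto intro: Suc)
qed auto

lemma ktcd_inner: "ktcd k (\<lambda>x. x \<bullet> b)"
proof (cases k)
  case (Suc k)
  show ?thesis
    unfolding Suc
    by (rule ktcd_SucI[where f'="\<lambda>_ v. v \<bullet> b"]) (auto intro!: derivative_eq_intros ktcd_const)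
qed (auto intro!: continuous_intros)

lemma ktcd_add: "ktcd k f \<Longrightarrow> ktcd k g \<Longrightarrow> ktcd k (\<lambda>x. f x + g x)"
proof (induction k arbitrary: f g)
  case (Suc k)
  show ?case
    by (rule ktcd_SucI[OF has_derivative_add[OF ktcd_has_derivative[OF Suc.prems(1)]
            ktcd_has_derivative[OF Suc.prems(2)]]])
       (use Suc in auto)
qed (auto intro: continuous_intros)

lemma ktcd_mult: "ktcd k f \<Longrightarrow> ktcd k g \<Longrightarrow> ktcd k (\<lambda>x. f x * g x)"
proof (induction k arbitrary: f g)
  case (Suc k)
  show ?case
  proof (rule ktcd_SucI[OF has_derivative_mult[OF ktcd_has_derivative[OF Suc.prems(1)]
            ktcd_has_derivative[OF Suc.prems(2)]]])
    fix b :: 'a assume b: "b \<in> Basis"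
    show "ktcd k (\<lambda>x. f x * frechet_derivative g (at x) b + frechet_derivative f (at x) b * g x)"
      by (intro ktcd_add Suc.IH) (use b Suc.prems ktcd_SucD in auto)
  qed
qed (auto intro: continuous_intros)

lemma ktcd_affine: "ktcd k f \<Longrightarrow> ktcd k (\<lambda>x. f (a *\<^sub>R x + c))"
proof (induction k arbitrary: f)
  case 0
  then show ?case
    by (auto intro!: continuous_intros continuous_on_compose2[of UNIV f])
next
  case (Suc k)
  show ?case
  proof (rule ktcd_SucI[where f'="\<lambda>x v. a * frechet_derivative f (at (a *\<^sub>R x + c)) v"])
    fix x
    have lin: "linear (frechet_derivative f (at y))" for y
      using ktcd_has_derivative[OF Suc.prems] has_derivative_linear by blast
    have "((\<lambda>x. a *\<^sub>R x + c) has_derivative (\<lambda>v. a *\<^sub>R v)) (at x)"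
      by (auto intro!: derivative_eq_intros)
    from diff_chain_at[OF this ktcd_has_derivative[OF Suc.prems]]
    show "((\<lambda>x. f (a *\<^sub>R x + c)) has_derivative
        (\<lambda>v. a * frechet_derivative f (at (a *\<^sub>R x + c)) v)) (at x)"
      using linear_cmul[OF lin] by (simp add: o_def)
  next
    fix b :: 'a assume "b \<in> Basis"
    then show "ktcd k (\<lambda>x. a * frechet_derivative f (at (a *\<^sub>R x + c)) b)"
      using Suc.prems by (intro ktcd_mult ktcd_const Suc.IH) auto
  qed
qed

text \<open>The derivatives of \<open>exp (-1/(1-t))\<close> are combinations of these functions.\<close>

definition exp_bump :: "nat \<Rightarrow> real \<Rightarrow> real" where
  "exp_bump m t = (if t < 1 then exp (- 1 / (1 - t)) / (1 - t) ^ m else 0)"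

text \<open>A single term of the exponential series is at most its sum. This yields the decay of
  \<open>exp_bump\<close> at 1.\<close>

lemma power_le_fact_exp: "0 \<le> s \<Longrightarrow> s ^ k \<le> fact k * exp (s::real)"
proof -
  assume "0 \<le> s"
  have "s ^ k /\<^sub>R fact k \<le> (\<Sum>n. s ^ n /\<^sub>R fact n)"
    using sum_le_suminf[OF summable_exp_generic[of s], of "{k}"] \<open>0 \<le> s\<close> by simp
  then show ?thesis
    by (simp add: exp_def divide_simps mult.commute)
qed

lemma DERIV_exp_bump:
  "(exp_bump m has_real_derivative real m * exp_bump (Suc m) t - exp_bump (Suc (Suc m)) t) (at t)"
proof -
  consider "t < 1" | "t = 1" | "t > 1" by linarith
  then show ?thesis
  proof cases
    case 1
    have "((\<lambda>t. exp (- 1 / (1 - t)) * inverse (1 - t) ^ m) has_real_derivative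
       real m * (exp (- 1 / (1 - t)) * inverse (1 - t) ^ Suc m)
         - exp (- 1 / (1 - t)) * inverse (1 - t) ^ Suc (Suc m)) (at t)"
    proof -
      have i: "((\<lambda>t. inverse (1 - t)) has_real_derivative inverse (1 - t) ^ 2) (at t)"
        using 1 by (auto intro!: derivative_eq_intros simp: power2_eq_square)
      have p: "((\<lambda>t. inverse (1 - t) ^ m) has_real_derivative real m * inverse (1 - t) ^ Suc m) (at t)"
        using DERIV_power[OF i, of m] by (cases m) (simp_all add: power2_eq_square mult_ac)
      have "((\<lambda>t. - inverse (1 - t)) has_real_derivative - (inverse (1 - t) ^ 2)) (at t)"
        by (rule DERIV_minus[OF i])
      from DERIV_mult[OF DERIV_fun_exp[OF this] p]
      show ?thesis
        by (simp add: divide_inverse power2_eq_square algebra_simps)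
    qed
    then have "(exp_bump m has_real_derivative
       real m * (exp (- 1 / (1 - t)) * inverse (1 - t) ^ Suc m)
         - exp (- 1 / (1 - t)) * inverse (1 - t) ^ Suc (Suc m)) (at t)"
      by (rule has_field_derivative_transform_within_open[of _ _ _ "{..<1}"])
         (use 1 in \<open>auto simp: exp_bump_def divide_inverse power_inverse\<close>)
    then show ?thesis
      using 1 by (simp add: exp_bump_def divide_inverse power_inverse)
  next
    case 2
    have "(exp_bump m has_real_derivative 0) (at 1)"
    \<comment> \<open>For s = -t > 0 the series bound at 1/s with exponent m + 2 reads s^(-m-2) <=
      (m+2)! exp(1/s), that is, exp(-1/s)/s^m <= (m+2)! s^2; hence the constant.\<close>
    proof (rule DERIV_zero_of_quadratic_bound[where C="fact (m + 2)"])
      fix t :: real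
      show "\<bar>exp_bump m (1 + t) - exp_bump m 1\<bar> \<le> fact (m + 2) * t\<^sup>2"
      proof (cases "t < 0")
        case True
        define s where "s = - t"
        have s: "s > 0" using True s_def by simp
        have "(1/s) ^ (m + 2) \<le> fact (m + 2) * exp (1/s)"
          using s by (intro power_le_fact_exp) auto
        then have "exp (- (1 / s)) / s ^ m \<le> fact (m + 2) * s\<^sup>2"
          using s by (simp add: exp_minus divide_simps power_add mult_ac power2_eq_square)
        moreover have "exp_bump m (1 + t) = exp (- (1 / s)) / s ^ m"
          using True by (simp add: exp_bump_def s_def)
        ultimately have "exp_bump m (1 + t) \<le> fact (m + 2) * t\<^sup>2"
          by (simp add: s_def)
        moreover have "0 \<le> exp_bump m (1 + t)" "exp_bump m 1 = 0"
          by (simp_all add: exp_bump_def)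
        ultimately show ?thesis by linarith
      qed (simp add: exp_bump_def)
    qed
    then show ?thesis
      using 2 by (simp add: exp_bump_def)
  next
    case 3
    have "((\<lambda>_. 0) has_real_derivative 0) (at t)"
      by simp
    then have "(exp_bump m has_real_derivative 0) (at t)"
      by (rule has_field_derivative_transform_within_open[of _ _ _ "{1<..}"])
         (use 3 in \<open>auto simp: exp_bump_def\<close>)
    then show ?thesis using 3 by (simp add: exp_bump_def)
  qed
qed

text \<open>Differentiation raises the index m and multiplies by linear functions of x, so the
  family is closed under it; the induction therefore has to run over all m at once.\<close>

lemma ktcd_exp_bump: "ktcd k (\<lambda>x::'a::euclidean_space. exp_bump m (c * (x \<bullet> x)))"
proof (induction k arbitrary: m)
  case 0
  have "continuous_on UNIV (exp_bump m)"
    by (meson DERIV_exp_bump DERIV_isCont continuous_at_imp_continuous_on)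
  then show ?case
    by (auto intro!: continuous_intros continuous_on_compose2[of UNIV "exp_bump m"])
next
  case (Suc k)
  show ?case
  proof (rule ktcd_SucI)
    fix x :: 'a
    have "((\<lambda>x. c * (x \<bullet> x)) has_derivative (\<lambda>v. c * (2 * (x \<bullet> v)))) (at x)"
      by (auto intro!: derivative_eq_intros simp: inner_commute)
    from diff_chain_at[OF this DERIV_exp_bump[unfolded has_field_derivative_def]]
    show "((\<lambda>x. exp_bump m (c * (x \<bullet> x))) has_derivative
       (\<lambda>v. (real m * exp_bump (Suc m) (c * (x \<bullet> x)) + (-1) * exp_bump (Suc (Suc m)) (c * (x \<bullet> x)))
          * (c * (2 * (x \<bullet> v))))) (at x)"
      by (simp add: o_def)
  qed (intro ktcd_mult ktcd_add ktcd_const ktcd_inner Suc)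
qed

text \<open>The factor 1/4 puts the support into the ball of radius 2. On the unit ball the exponent
  -1/(1 - |x|^2/4) is at least -2, so the factor \<open>exp 2\<close> lifts the values to at least
  1.\<close>

definition bump :: "'a::euclidean_space \<Rightarrow> real" where
  "bump x = exp 2 * exp_bump 0 ((1/4) * (x \<bullet> x))"

lemma bump_nonneg: "0 \<le> bump x"
  by (simp add: bump_def exp_bump_def)

lemma bump_le: "bump x \<le> exp 2"
  by (simp add: bump_def exp_bump_def)

lemma bump_ge_1:
  assumes "norm x \<le> 1"
  shows "1 \<le> bump x"
proof -
  have "x \<bullet> x \<le> 1"
    using assms by (simp add: dot_square_norm power_le_one)
  then have "1 / (1 - (x \<bullet> x) / 4) \<le> 2"
    by (simp add: divide_simps)
  then show ?thesis
    using \<open>x \<bullet> x \<le> 1\<close> by (simp add: bump_def exp_bump_def flip: exp_add)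
qed

lemma bump_eq_0:
  assumes "2 \<le> norm x"
  shows "bump x = 0"
proof -
  have "2\<^sup>2 \<le> (norm x)\<^sup>2"
    using assms by (intro power_mono) auto
  then show ?thesis
    by (simp add: bump_def exp_bump_def dot_square_norm)
qed

lemma ktcd_bump: "ktcd k bump"
  unfolding bump_def[abs_def] by (intro ktcd_mult ktcd_const ktcd_exp_bump)

lemma compact_closure_support:
  fixes f :: "'a::euclidean_space \<Rightarrow> 'b::zero"
  shows "compact (closure {x. f x \<noteq> 0}) \<longleftrightarrow> (\<exists>R. \<forall>x. R \<le> norm x \<longrightarrow> f x = 0)"
proof
  assume "compact (closure {x. f x \<noteq> 0})"
  then have "bounded {x. f x \<noteq> 0}"
    by (metis bounded_subset closure_subset compact_imp_bounded)
  then obtain R where "\<And>x. f x \<noteq> 0 \<Longrightarrow> norm x \<le> R"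
    by (auto simp: bounded_iff)
  then show "\<exists>R. \<forall>x. R \<le> norm x \<longrightarrow> f x = 0"
    by (intro exI[of _ "R + 1"]) force
next
  assume "\<exists>R. \<forall>x. R \<le> norm x \<longrightarrow> f x = 0"
  then obtain R where "\<And>x. f x \<noteq> 0 \<Longrightarrow> norm x \<le> R"
    by (meson linorder_linear)
  then have "bounded {x. f x \<noteq> 0}"
    by (auto simp: bounded_iff)
  then show "compact (closure {x. f x \<noteq> 0})"
    by (simp add: compact_closure)
qed

lemma test_functions_iff:
  "\<phi> \<in> test_functions \<longleftrightarrow> (\<forall>k. ktcd k \<phi>) \<and> (\<exists>R. \<forall>x. R \<le> norm x \<longrightarrow> \<phi> x = 0)"
  unfolding test_functions_def compact_closure_support by simp

lemma bump_test: "bump \<in> test_functions"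
  using bump_eq_0 by (auto simp: test_functions_iff ktcd_bump)

lemma test_functions_affine:
  assumes "\<phi> \<in> test_functions" "a \<noteq> 0"
  shows "(\<lambda>x. \<phi> (a *\<^sub>R x + c)) \<in> test_functions"
proof -
  obtain R where R: "\<And>x. R \<le> norm x \<Longrightarrow> \<phi> x = 0"
    using assms by (auto simp: test_functions_iff)
  have "\<phi> (a *\<^sub>R x + c) = 0" if "(R + norm c) / \<bar>a\<bar> \<le> norm x" for x
  proof (rule R)
    have "R + norm c \<le> norm (a *\<^sub>R x)"
      using that assms by (simp add: divide_simps mult.commute)
    also have "\<dots> \<le> norm (a *\<^sub>R x + c) + norm c"
      by (metis add_diff_cancel norm_triangle_ineq4)
    finally show "R \<le> norm (a *\<^sub>R x + c)" by simp
  qed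
  then show ?thesis
    using assms unfolding test_functions_iff by (auto intro: ktcd_affine)
qed

lemma test_functions_mult:
  assumes "\<phi> \<in> test_functions" "\<psi> \<in> test_functions"
  shows "(\<lambda>x. \<phi> x * \<psi> x) \<in> test_functions"
proof -
  obtain R where "\<And>x. R \<le> norm x \<Longrightarrow> \<phi> x = 0"
    using assms by (auto simp: test_functions_iff)
  then have "\<exists>R. \<forall>x. R \<le> norm x \<longrightarrow> \<phi> x * \<psi> x = 0"
    by (intro exI[of _ R]) simp
  then show ?thesis
    using assms ktcd_mult unfolding test_functions_iff by blast
qed

lemma test_functions_cmult:
  assumes "\<phi> \<in> test_functions"
  shows "(\<lambda>x. c * \<phi> x) \<in> test_functions"
proof -
  obtain R where "\<And>x. R \<le> norm x \<Longrightarrow> \<phi> x = 0"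
    using assms by (auto simp: test_functions_iff)
  then have "\<exists>R. \<forall>x. R \<le> norm x \<longrightarrow> c * \<phi> x = 0"
    by (intro exI[of _ R]) simp
  then show ?thesis
    using assms ktcd_mult[OF ktcd_const] unfolding test_functions_iff by blast
qed

section \<open>Compactly supported C^1 functions with explicit gradient\<close>

definition C1c_gradient :: "('a::euclidean_space \<Rightarrow> real) \<Rightarrow> ('a \<Rightarrow> 'a) \<Rightarrow> real \<Rightarrow> bool" where
  "C1c_gradient f G R \<longleftrightarrow> C1_gradient f G \<and> (\<forall>x. R \<le> norm x \<longrightarrow> f x = 0 \<and> G x = 0)"

text \<open>Outside the closed ball f vanishes on an open set. Points of the sphere itself are
  approached radially from outside, using continuity of G.\<close>

lemma C1_gradient_zero_outside:
  assumes f: "C1_gradient f G" and 0: "\<And>x. R \<le> norm x \<Longrightarrow> f x = 0"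
    and x: "R \<le> norm x"
  shows "G x = 0"
proof -
  have out: "G x = 0" if "R < norm x" for x
  proof -
    have "open {x::'a. R < norm x}"
      by (intro open_Collect_less continuous_intros)
    then have "(f has_derivative (\<lambda>v. 0)) (at x)"
      using that 0 by (intro has_derivative_transform_within_open[OF has_derivative_const[of 0]]) auto
    then have "(\<lambda>v. G x \<bullet> v) = (\<lambda>v. 0)"
      using C1_gradientD(1)[OF f] has_derivative_unique by blast
    then show ?thesis
      by (metis inner_eq_zero_iff)
  qed
  show ?thesis
  \<comment> \<open>For R <= 0 the point 0 belongs to the region and cannot be approached by
    scaling; in that case f vanishes identically.\<close>
  proof (cases "R \<le> 0")
    case True
    then have "f = (\<lambda>_. 0)"
      using 0 by (auto intro!: ext simp: order_trans[OF True norm_ge_zero])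
    then have "(\<lambda>v. G x \<bullet> v) = (\<lambda>v. 0)"
      using C1_gradientD(1)[OF f] has_derivative_unique by (metis has_derivative_const)
    then show ?thesis
      by (metis inner_eq_zero_iff)
  next
    case False
    have "((\<lambda>t. G (t *\<^sub>R x)) \<longlongrightarrow> G (1 *\<^sub>R x)) (at_right 1)"
    proof (rule tendsto_within_subset[of _ _ 1 UNIV])
      have "isCont (\<lambda>t. G (t *\<^sub>R x)) (1::real)"
        using continuous_on_compose2[OF C1_gradientD(2)[OF f, of UNIV], of UNIV "\<lambda>t::real. t *\<^sub>R x"]
        by (simp add: continuous_on_eq_continuous_at continuous_intros)
      then show "((\<lambda>t. G (t *\<^sub>R x)) \<longlongrightarrow> G (1 *\<^sub>R x)) (at 1)"
        by (simp add: isCont_def)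
    qed auto
    moreover have "\<forall>\<^sub>F t in at_right (1::real). G (t *\<^sub>R x) = 0"
      unfolding eventually_at_right_field
    proof (intro exI[of _ 2] conjI allI impI)
      fix t :: real assume t: "1 < t"
      have "norm x > 0" using False x by linarith
      then have "norm x < t * norm x" using t by simp
      then have "R < norm (t *\<^sub>R x)" using t x by simp
      then show "G (t *\<^sub>R x) = 0" by (rule out)
    qed auto
    ultimately have "((\<lambda>_. 0) \<longlongrightarrow> G x) (at_right (1::real))"
      using tendsto_cong[of "\<lambda>t. G (t *\<^sub>R x)" "\<lambda>_. 0"] by force
    then show ?thesis
      using tendsto_unique[OF trivial_limit_at_right_real] tendsto_const by metis
  qed
qed

lemma test_function_C1_gradient:
  assumes "\<phi> \<in> test_functions"
  obtains G R where "C1c_gradient \<phi> G R"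
proof -
  define G where "G x = (\<Sum>b\<in>Basis. frechet_derivative \<phi> (at x) b *\<^sub>R b)" for x
  have k: "ktcd (Suc 0) \<phi>" using assms by (auto simp: test_functions_iff)
  have lin: "linear (frechet_derivative \<phi> (at x))" for x
    using ktcd_has_derivative[OF k] has_derivative_linear by blast
  have "frechet_derivative \<phi> (at x) = (\<lambda>v. G x \<bullet> v)" for x
  proof
    fix v
    have "frechet_derivative \<phi> (at x) v = frechet_derivative \<phi> (at x) (\<Sum>b\<in>Basis. (v \<bullet> b) *\<^sub>R b)"
      by (simp add: euclidean_representation)
    also have "\<dots> = (\<Sum>b\<in>Basis. (v \<bullet> b) * frechet_derivative \<phi> (at x) b)"
      by (simp add: linear_sum[OF lin] linear_cmul[OF lin])
    also have "\<dots> = G x \<bullet> v"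
      unfolding G_def inner_sum_left by (rule sum.cong) (auto simp: inner_commute)
    finally show "frechet_derivative \<phi> (at x) v = G x \<bullet> v" .
  qed
  then have "C1_gradient \<phi> G"
    unfolding C1_gradient_def
    using ktcd_has_derivative[OF k] k by (auto simp: G_def intro!: continuous_intros)
  moreover obtain R where "\<And>x. R \<le> norm x \<Longrightarrow> \<phi> x = 0"
    using assms by (auto simp: test_functions_iff)
  ultimately have "C1c_gradient \<phi> G R"
    using C1_gradient_zero_outside[of \<phi> G R] unfolding C1c_gradient_def by blast
  then show thesis by (rule that)
qed

lemma compact_support_bounded:
  fixes f :: "'a::euclidean_space \<Rightarrow> 'b::real_normed_vector"
  assumes "continuous_on UNIV f" "\<And>x. R \<le> norm x \<Longrightarrow> f x = 0"
  obtains B where "0 < B" "\<And>x. norm (f x) \<le> B"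
proof -
  have "compact (f ` cball 0 R)"
    using assms(1) by (intro compact_continuous_image) (auto intro: continuous_on_subset)
  then have "bounded (f ` cball 0 R)" by (rule compact_imp_bounded)
  then obtain B where "0 < B" "\<And>x. x \<in> cball 0 R \<Longrightarrow> norm (f x) \<le> B"
    by (auto simp: bounded_pos)
  then have "norm (f x) \<le> B" for x
    by (cases "norm x \<le> R") (use assms(2) in auto)
  then show thesis using that \<open>0 < B\<close> by blast
qed

section \<open>Local integrability and convolution\<close>

lemma borel_imp_lebesgue: "f \<in> borel_measurable borel \<Longrightarrow> f \<in> borel_measurable lebesgue"
  by (intro measurable_completion) simp

lemma lebesgue_sets_basic [measurable, simp]:
  fixes x :: "'a::euclidean_space"
  shows "cball x r \<in> sets lebesgue" "ball x r \<in> sets lebesgue"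
  by auto

lemma indicator_ball_lebesgue [measurable]:
  fixes x :: "'a::euclidean_space"
  shows "indicator (cball x r) \<in> borel_measurable lebesgue"
    and "indicator (ball x r) \<in> borel_measurable lebesgue"
  by (auto intro!: borel_measurable_indicator)

text \<open>The definition controls u on compact sets only; u is the pointwise limit of its
  restrictions to balls of integer radius, a sequence that is eventually constant at each
  point.\<close>

lemma locally_integrable_measurable:
  fixes u :: "'a::euclidean_space \<Rightarrow> 'b::{banach, second_countable_topology}"
  assumes "locally_integrable u"
  shows "u \<in> borel_measurable lebesgue"
proof (rule borel_measurable_LIMSEQ_metric)
  show "(\<lambda>x. indicator (cball 0 (real n)) x *\<^sub>R u x) \<in> borel_measurable lebesgue" for n
    using assms unfolding locally_integrable_def set_integrable_def
    by (simp add: borel_measurable_integrable)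
  fix x :: 'a
  obtain N :: nat where N: "norm x \<le> real N"
    using real_arch_simple by blast
  have "\<forall>\<^sub>F n in sequentially. indicator (cball 0 (real n)) x *\<^sub>R u x = u x"
    using eventually_ge_at_top[of N] by eventually_elim (use N in \<open>auto simp: indicator_def\<close>)
  then show "(\<lambda>n. indicator (cball 0 (real n)) x *\<^sub>R u x) \<longlonglongrightarrow> u x"
    by (rule tendsto_eventually)
qed

text \<open>Every compact set lies in a ball about 0. Nonnegative integrals keep the later estimates
  free of integrability side conditions.\<close>

lemma locally_integrable_iff:
  fixes u :: "'a::euclidean_space \<Rightarrow> 'b::{banach, second_countable_topology}"
  shows "locally_integrable u \<longleftrightarrow> u \<in> borel_measurable lebesgue \<and>
    (\<forall>R. (\<integral>\<^sup>+x\<in>cball 0 R. ennreal (norm (u x)) \<partial>lebesgue) < \<infinity>)" (is "?L \<longleftrightarrow> ?R")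
proof
  assume L: ?L
  have "(\<integral>\<^sup>+x\<in>cball 0 R. ennreal (norm (u x)) \<partial>lebesgue) < \<infinity>" for R
  proof -
    have "integrable lebesgue (\<lambda>x. indicator (cball 0 R) x *\<^sub>R u x)"
      using L unfolding locally_integrable_def set_integrable_def by simp
    moreover have "(\<integral>\<^sup>+x\<in>cball 0 R. ennreal (norm (u x)) \<partial>lebesgue)
       = (\<integral>\<^sup>+x. ennreal (norm (indicator (cball 0 R) x *\<^sub>R u x)) \<partial>lebesgue)"
      by (rule nn_integral_cong) (auto simp: indicator_def)
    ultimately show ?thesis
      by (simp add: integrable_iff_bounded)
  qed
  then show ?R using locally_integrable_measurable[OF L] by blast
next
  assume R: ?R
  show ?L
    unfolding locally_integrable_def set_integrable_def
  proof (intro allI impI)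
    fix K :: "'a set" assume K: "compact K"
    then obtain r where r: "\<And>x. x \<in> K \<Longrightarrow> norm x \<le> r"
      using compact_imp_bounded bounded_iff by metis
    have meas: "K \<in> sets lebesgue" using K by (simp add: lmeasurable_compact fmeasurableD)
    show "integrable lebesgue (\<lambda>x. indicator K x *\<^sub>R u x)"
      unfolding integrable_iff_bounded
    proof
      show "(\<lambda>x. indicator K x *\<^sub>R u x) \<in> borel_measurable lebesgue"
        using R meas by (intro borel_measurable_scaleR borel_measurable_indicator) auto
      have "(\<integral>\<^sup>+x. ennreal (norm (indicator K x *\<^sub>R u x)) \<partial>lebesgue)
         \<le> (\<integral>\<^sup>+x\<in>cball 0 r. ennreal (norm (u x)) \<partial>lebesgue)"
        by (rule nn_integral_mono) (auto simp: indicator_def r)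
      then show "(\<integral>\<^sup>+x. ennreal (norm (indicator K x *\<^sub>R u x)) \<partial>lebesgue) < \<infinity>"
        using R le_less_trans by blast
    qed
  qed
qed

lemma continuous_imp_locally_integrable:
  fixes u :: "'a::euclidean_space \<Rightarrow> 'b::{banach, second_countable_topology}"
  assumes "continuous_on UNIV u"
  shows "locally_integrable u"
  unfolding locally_integrable_iff
proof (intro conjI allI)
  show "u \<in> borel_measurable lebesgue"
    using assms by (intro borel_imp_lebesgue borel_measurable_continuous_onI)
  fix R
  have "bounded (u ` cball 0 R)"
    using assms by (intro compact_imp_bounded compact_continuous_image) (auto intro: continuous_on_subset)
  then obtain B where B: "\<And>x. x \<in> cball 0 R \<Longrightarrow> norm (u x) \<le> B"
    unfolding bounded_iff by blast
  have "(\<integral>\<^sup>+x\<in>cball 0 R. ennreal (norm (u x)) \<partial>lebesgue)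
      \<le> (\<integral>\<^sup>+x. ennreal B * indicator (cball 0 R :: 'a set) x \<partial>lebesgue)"
    by (rule nn_integral_mono) (use B in \<open>auto simp: indicator_def intro!: ennreal_leI\<close>)
  also have "\<dots> = ennreal B * emeasure lebesgue (cball 0 R :: 'a set)"
    by (subst nn_integral_cmult_indicator) auto
  also have "\<dots> < \<infinity>"
    using emeasure_lborel_cball_finite[of "0::'a" R] by (simp add: ennreal_mult_less_top)
  finally show "(\<integral>\<^sup>+x\<in>cball 0 R. ennreal (norm (u x)) \<partial>lebesgue) < \<infinity>" .
qed

lemma locally_integrable_set_le:
  fixes u :: "'a::euclidean_space \<Rightarrow> 'b::{banach, second_countable_topology}"
  assumes "locally_integrable u" "bounded S"
  shows "(\<integral>\<^sup>+x\<in>S. ennreal (norm (u x)) \<partial>lebesgue) < \<infinity>"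
proof -
  obtain R where R: "\<And>x. x \<in> S \<Longrightarrow> norm x \<le> R"
    using assms(2) bounded_iff by metis
  have "(\<integral>\<^sup>+x\<in>S. ennreal (norm (u x)) \<partial>lebesgue)
     \<le> (\<integral>\<^sup>+x\<in>cball 0 R. ennreal (norm (u x)) \<partial>lebesgue)"
    by (rule nn_integral_mono) (auto simp: indicator_def R)
  then show ?thesis
    using assms(1) le_less_trans unfolding locally_integrable_iff by blast
qed

lemma integrable_mult_bounded_support:
  fixes u :: "'a::euclidean_space \<Rightarrow> 'b::{banach, second_countable_topology}"
  assumes u: "locally_integrable u" and \<phi>: "\<phi> \<in> borel_measurable lebesgue"
    and B: "\<And>x. \<bar>\<phi> x\<bar> \<le> B" and S: "bounded S" "\<And>x. x \<notin> S \<Longrightarrow> \<phi> x = 0"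
  shows "integrable lebesgue (\<lambda>x. \<phi> x *\<^sub>R u x)"
    and "ennreal (norm (LINT x|lebesgue. \<phi> x *\<^sub>R u x))
           \<le> ennreal B * (\<integral>\<^sup>+x\<in>S. ennreal (norm (u x)) \<partial>lebesgue)"
proof -
  have B0: "0 \<le> B" using B[of 0] by linarith
  have le: "(\<integral>\<^sup>+x. ennreal (norm (\<phi> x *\<^sub>R u x)) \<partial>lebesgue)
     \<le> ennreal B * (\<integral>\<^sup>+x\<in>S. ennreal (norm (u x)) \<partial>lebesgue)"
  proof -
    obtain R where R: "\<And>x. x \<in> S \<Longrightarrow> norm x \<le> R"
      using S bounded_iff by metis
    have u': "(\<lambda>x. ennreal (norm (u x))) \<in> borel_measurable lebesgue"
      using locally_integrable_measurable[OF u] by measurable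
    \<comment> \<open>S is not assumed measurable, so linearity of the integral is used on the
      nonvanishing set of \<open>\<phi>\<close>, and S enters by monotonicity.\<close>
    have S': "(\<lambda>x. if \<phi> x = 0 then 0 else ennreal (norm (u x))) \<in> borel_measurable lebesgue"
      using u' \<phi> by measurable
    have "(\<integral>\<^sup>+x. ennreal (norm (\<phi> x *\<^sub>R u x)) \<partial>lebesgue)
       \<le> (\<integral>\<^sup>+x. ennreal B * (if \<phi> x = 0 then 0 else ennreal (norm (u x))) \<partial>lebesgue)"
      by (rule nn_integral_mono)
         (auto simp: B0 ennreal_mult'[symmetric] intro!: ennreal_leI mult_right_mono B)
    also have "\<dots> = ennreal B * (\<integral>\<^sup>+x. (if \<phi> x = 0 then 0 else ennreal (norm (u x))) \<partial>lebesgue)"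
      using S' by (rule nn_integral_cmult)
    also have "\<dots> \<le> ennreal B * (\<integral>\<^sup>+x\<in>S. ennreal (norm (u x)) \<partial>lebesgue)"
      by (intro mult_left_mono nn_integral_mono) (use S in \<open>auto simp: indicator_def\<close>)
    finally show ?thesis .
  qed
  have "(\<integral>\<^sup>+x\<in>S. ennreal (norm (u x)) \<partial>lebesgue) < \<infinity>"
    by (rule locally_integrable_set_le[OF u S(1)])
  then have fin: "(\<integral>\<^sup>+x. ennreal (norm (\<phi> x *\<^sub>R u x)) \<partial>lebesgue) < \<infinity>"
    using le by (simp add: ennreal_mult_less_top order_le_less_trans)
  show "integrable lebesgue (\<lambda>x. \<phi> x *\<^sub>R u x)"
    unfolding integrable_iff_bounded
    using fin \<phi> locally_integrable_measurable[OF u] by (auto intro: borel_measurable_scaleR)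
  then show "ennreal (norm (LINT x|lebesgue. \<phi> x *\<^sub>R u x))
           \<le> ennreal B * (\<integral>\<^sup>+x\<in>S. ennreal (norm (u x)) \<partial>lebesgue)"
    using integral_norm_bound_ennreal le order_trans by blast
qed

section \<open>Convolution with compactly supported kernels\<close>

lemma borel_shift [measurable]:
  assumes "f \<in> borel_measurable borel"
  shows "(\<lambda>y. f (x - y)) \<in> borel_measurable (borel :: 'a::euclidean_space measure)"
  using assms by measurable

lemma lborel_distr_reflect: "distr lborel borel (\<lambda>y. x - y) = (lborel :: 'a::euclidean_space measure)"
  using lborel_affine[of "-1" x] by (simp add: density_1)

lemma integral_reflect:
  fixes f :: "'a::euclidean_space \<Rightarrow> 'b::{banach, second_countable_topology}"
  assumes [measurable]: "f \<in> borel_measurable borel"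
  shows "(LINT y|lebesgue. f (x - y)) = (LINT y|lebesgue. f y)"
proof -
  have "(LINT y|lborel. f y) = (LINT y|lborel. f (x - y))"
    by (subst (1) lborel_distr_reflect[symmetric, of x]) (simp add: integral_distr)
  then show ?thesis
    by (simp add: integral_completion)
qed

text \<open>The codomain is an arbitrary Banach space, so that functions and their vector-valued
  gradients are mollified by the same operator.\<close>

definition conv :: "('a::euclidean_space \<Rightarrow> real) \<Rightarrow> ('a \<Rightarrow> 'b) \<Rightarrow> 'a \<Rightarrow> 'b::{banach, second_countable_topology}" where
  "conv K u x = (LINT y|lebesgue. K (x - y) *\<^sub>R u y)"

lemma integrable_conv:
  fixes u :: "'a::euclidean_space \<Rightarrow> 'b::{banach, second_countable_topology}"
  assumes u: "locally_integrable u" and K: "continuous_on UNIV K" "\<And>x. R \<le> norm x \<Longrightarrow> K x = 0"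
  shows "integrable lebesgue (\<lambda>y. K (x - y) *\<^sub>R u y)"
proof -
  obtain B where B: "\<And>x. norm (K x) \<le> B"
    using compact_support_bounded[OF K] by blast
  have [measurable]: "K \<in> borel_measurable borel"
    using K by (intro borel_measurable_continuous_onI)
  show ?thesis
  proof (rule integrable_mult_bounded_support(1)[OF u, where S = "cball x R"])
    show "(\<lambda>y. K (x - y)) \<in> borel_measurable lebesgue"
      by (rule borel_imp_lebesgue) measurable
  qed (use B K in \<open>auto simp: dist_norm\<close>)
qed

text \<open>Because d <= 1, two points that close either both have norm at least R, where G
  vanishes, or both lie in the ball of radius R + 1, where G is uniformly continuous.\<close>

lemma compact_support_uniform:
  fixes G :: "'a::euclidean_space \<Rightarrow> 'b::real_normed_vector"
  assumes G: "continuous_on UNIV G" "\<And>x. R \<le> norm x \<Longrightarrow> G x = 0" and e: "0 < e"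
  obtains d where "0 < d" "d \<le> 1" "\<And>x y. norm (x - y) \<le> d \<Longrightarrow> norm (G x - G y) \<le> e"
proof -
  have "uniformly_continuous_on (cball 0 (R + 1)) G"
    by (rule compact_uniformly_continuous) (use G in \<open>auto intro: continuous_on_subset\<close>)
  then obtain d where d: "d > 0"
      "\<And>x y. x \<in> cball 0 (R + 1) \<Longrightarrow> y \<in> cball 0 (R + 1) \<Longrightarrow> dist x y < d \<Longrightarrow> dist (G x) (G y) < e"
    using e unfolding uniformly_continuous_on_def by metis
  show thesis
  proof (rule that[of "min 1 (d/2)"])
    fix x y :: 'a assume xy: "norm (x - y) \<le> min 1 (d/2)"
    show "norm (G x - G y) \<le> e"
    proof (cases "R \<le> norm x \<and> R \<le> norm y")
      case True
      then show ?thesis using G e by simp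
    next
      case False
      have "norm x \<le> norm y + 1" "norm y \<le> norm x + 1"
        using xy norm_triangle_ineq2[of x y] norm_triangle_ineq2[of y x] by (auto simp: norm_minus_commute)
      then have "x \<in> cball 0 (R + 1)" "y \<in> cball 0 (R + 1)"
        using False by auto
      then have "dist (G x) (G y) < e"
        using d xy by (auto simp: dist_norm)
      then show ?thesis by (simp add: dist_norm)
    qed
  qed (use d in auto)
qed

text \<open>Differentiation under the integral by a uniform estimate: for |v| < d the linearisation
  error of K is at most e' |v| and vanishes off a ball of radius R + 1 about x, so the total error
  is at most e' |v| times the mass of u on that ball. Local integrability of u makes this mass
  finite.\<close>

lemma C1_gradient_conv:
  assumes u: "locally_integrable u" and K: "C1c_gradient K G R"
  shows "C1_gradient (conv K u) (\<lambda>x. LINT y|lebesgue. u y *\<^sub>R G (x - y))"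
proof -
  have KG: "C1_gradient K G" and K0: "\<And>x. R \<le> norm x \<Longrightarrow> K x = 0" and G0: "\<And>x. R \<le> norm x \<Longrightarrow> G x = 0"
    using K by (auto simp: C1c_gradient_def)
  note cK = C1_gradientD(3)[OF KG, of UNIV] and cG = C1_gradientD(2)[OF KG, of UNIV]
  have [measurable]: "K \<in> borel_measurable borel" "G \<in> borel_measurable borel"
    using cK cG by (auto intro: borel_measurable_continuous_onI)
  obtain BG where BG: "\<And>x. norm (G x) \<le> BG"
    using compact_support_bounded[OF cG G0] by blast
  have intG: "integrable lebesgue (\<lambda>y. u y *\<^sub>R G (x - y))" for x
  proof (rule Bochner_Integration.integrable_bound)
    have "integrable lebesgue (\<lambda>y. norm (G (x - y)) *\<^sub>R u y)"
      by (rule integrable_conv[OF u, where K = "\<lambda>z. norm (G z)" and R = R])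
         (use cG G0 in \<open>auto intro: continuous_intros\<close>)
    then show "integrable lebesgue (\<lambda>y. norm (norm (G (x - y)) *\<^sub>R u y))"
      by (rule integrable_norm)
    show "(\<lambda>y. u y *\<^sub>R G (x - y)) \<in> borel_measurable lebesgue"
      by (intro borel_measurable_scaleR locally_integrable_measurable[OF u] borel_imp_lebesgue) measurable
  qed (simp add: abs_mult mult.commute)
  have intK: "integrable lebesgue (\<lambda>y. K (x - y) *\<^sub>R u y)" for x
    by (rule integrable_conv[OF u cK K0])
  \<comment> \<open>The radius R + 1 covers the supports of all kernels y \<mapsto> K (x' - y) with
    x' within distance 1 of x.\<close>
  define I where "I x = enn2real (\<integral>\<^sup>+y\<in>cball x (R + 1). ennreal (norm (u y)) \<partial>lebesgue)" for x
  have I: "(\<integral>\<^sup>+y\<in>cball x (R + 1). ennreal (norm (u y)) \<partial>lebesgue) = ennreal (I x)" for x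
    unfolding I_def using locally_integrable_set_le[OF u, of "cball x (R + 1)"] by (simp add: less_top)
  have I0: "0 \<le> I x" for x by (simp add: I_def)
  have bound: "norm (LINT y|lebesgue. u y *\<^sub>R H y) \<le> c * I x"
    if "H \<in> borel_measurable borel" "\<And>y. norm (H y) \<le> c" "\<And>y. y \<notin> cball x (R + 1) \<Longrightarrow> H y = 0"
      "integrable lebesgue (\<lambda>y. u y *\<^sub>R H y)"
    for H :: "'a \<Rightarrow> 'b::{banach,second_countable_topology}" and c x
  proof -
    have c: "0 \<le> c" using order_trans[OF norm_ge_zero that(2)] by simp
    have "norm (LINT y|lebesgue. u y *\<^sub>R H y) \<le> (LINT y|lebesgue. norm (u y *\<^sub>R H y))"
      by (rule integral_norm_bound)
    also have "(LINT y|lebesgue. norm (u y *\<^sub>R H y)) = (LINT y|lebesgue. norm (H y) *\<^sub>R norm (u y))"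
      by (simp add: mult.commute)
    also have "\<dots> \<le> c * I x"
    proof -
      have nu: "locally_integrable (\<lambda>y. norm (u y))"
        using u by (auto simp: locally_integrable_iff)
      have "ennreal (norm (LINT y|lebesgue. norm (H y) *\<^sub>R norm (u y))) \<le> ennreal c *
          (\<integral>\<^sup>+y\<in>cball x (R + 1). ennreal (norm (norm (u y))) \<partial>lebesgue)"
        by (rule integrable_mult_bounded_support(2)[OF nu])
           (use that in \<open>auto intro!: borel_imp_lebesgue\<close>)
      then have "ennreal (norm (LINT y|lebesgue. norm (H y) *\<^sub>R norm (u y))) \<le> ennreal (c * I x)"
        using I c I0 by (simp add: ennreal_mult)
      then show ?thesis
        using c I0 by (subst (asm) ennreal_le_iff) auto
    qed
    finally show ?thesis .
  qed
  have uni: "\<exists>d>0. d \<le> 1 \<and> (\<forall>x y. norm (x - y) \<le> d \<longrightarrow> norm (G x - G y) \<le> e)" if "0 < e" for e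
    using compact_support_uniform[OF cG G0 that] by metis
  have supp: "R + 1 < norm (x - y) \<Longrightarrow> norm v \<le> 1 \<Longrightarrow> R \<le> norm (x + v - y)" for x y v :: 'a
    using norm_triangle_ineq2[of "x - y" "-v"] by (simp add: algebra_simps)
  show ?thesis
    unfolding C1_gradient_def
  proof (intro conjI allI)
    fix x
    show "(conv K u has_derivative (\<bullet>) (LINT y|lebesgue. u y *\<^sub>R G (x - y))) (at x)"
      unfolding has_derivative_at_alt
    proof (intro conjI allI impI)
      show "bounded_linear ((\<bullet>) (LINT y|lebesgue. u y *\<^sub>R G (x - y)))"
        by (rule bounded_linear_inner_right)
      fix e :: real assume "0 < e"
      define e' where "e' = e / (I x + 1)"
      have e': "0 < e'" "e' * I x \<le> e"
        using \<open>0 < e\<close> I0[of x] by (auto simp: e'_def field_simps)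
      obtain d where d: "0 < d" "d \<le> 1" "\<And>x y. norm (x - y) \<le> d \<Longrightarrow> norm (G x - G y) \<le> e'"
        using uni[OF e'(1)] by blast
      show "\<exists>d>0. \<forall>y. norm (y - x) < d \<longrightarrow>
          norm (conv K u y - conv K u x - (LINT y|lebesgue. u y *\<^sub>R G (x - y)) \<bullet> (y - x)) \<le> e * norm (y - x)"
      proof (intro exI[of _ d] conjI allI impI)
        fix x' assume x': "norm (x' - x) < d"
        define v where "v = x' - x"
        have v: "norm v < d" "x' = x + v" using x' by (auto simp: v_def)
        define H where "H y = K (x + v - y) - K (x - y) - G (x - y) \<bullet> v" for y
        have lin: "norm (K (z + v) - K z - G z \<bullet> v) \<le> e' * norm v" for z
        proof -
          have "norm (K (z + v) - K z - G z \<bullet> (z + v - z)) \<le> norm (z + v - z) * e'"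
          proof (rule differentiable_bound_linearization[where S = "cball z d" and f' = "\<lambda>y. (\<bullet>) (G y)"])
            show "z + t *\<^sub>R (z + v - z) \<in> cball z d" if "t \<in> {0..1}" for t
            proof -
              have "\<bar>t\<bar> * norm v \<le> 1 * norm v" using that by (intro mult_right_mono) auto
              then show ?thesis using v by (simp add: dist_norm)
            qed
            show "(K has_derivative (\<bullet>) (G y)) (at y within cball z d)" for y
              using C1_gradientD(1)[OF KG] has_derivative_at_withinI by blast
            have eq: "(\<bullet>) (G y) - (\<bullet>) (G z) = (\<lambda>w. G y \<bullet> w - G z \<bullet> w)" for y
              by (simp add: fun_eq_iff)
            show "onorm ((\<bullet>) (G y) - (\<bullet>) (G z)) \<le> e'" if "y \<in> cball z d" for y
              unfolding eq
            proof (rule onorm_le)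
              fix w
              have "norm (G y \<bullet> w - G z \<bullet> w) \<le> norm (G y - G z) * norm w"
                by (metis Cauchy_Schwarz_ineq2 inner_diff_left real_norm_def)
              also have "\<dots> \<le> e' * norm w"
                using d(3)[of y z] that by (intro mult_right_mono) (auto simp: dist_norm norm_minus_commute)
              finally show "norm (G y \<bullet> w - G z \<bullet> w) \<le> e' * norm w" .
            qed
            show "z \<in> cball z d" using d by simp
          qed
          then show ?thesis by (simp add: mult.commute)
        qed
        have Hb: "norm (H y) \<le> e' * norm v" for y
          using lin[of "x - y"] by (simp add: H_def algebra_simps)
        have H0: "H y = 0" if "y \<notin> cball x (R + 1)" for y
        proof -
          have *: "R + 1 < norm (x - y)" using that by (simp add: dist_norm)
          show ?thesis
            using K0[of "x - y"] G0[of "x - y"] K0[OF supp[OF *, of v]] * v d by (simp add: H_def)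
        qed
        have Hint: "u y *\<^sub>R H y = K (x' - y) *\<^sub>R u y - K (x - y) *\<^sub>R u y - (u y *\<^sub>R G (x - y)) \<bullet> v" for y
          by (simp add: H_def v algebra_simps)
        have "norm (LINT y|lebesgue. u y *\<^sub>R H y) \<le> (e' * norm v) * I x"
        proof (rule bound[OF _ Hb H0])
          show "H \<in> borel_measurable borel" unfolding H_def by measurable
          show "integrable lebesgue (\<lambda>y. u y *\<^sub>R H y)"
            unfolding Hint by (intro Bochner_Integration.integrable_diff integrable_inner_left intK intG)
        qed
        also have "(LINT y|lebesgue. u y *\<^sub>R H y)
            = conv K u x' - conv K u x - (LINT y|lebesgue. u y *\<^sub>R G (x - y)) \<bullet> v"
        proof -
          have i: "integrable lebesgue (\<lambda>y. (u y *\<^sub>R G (x - y)) \<bullet> v)"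
            by (rule integrable_inner_left) (rule intG)
          have e: "(LINT y|lebesgue. (u y *\<^sub>R G (x - y)) \<bullet> v) = (LINT y|lebesgue. u y *\<^sub>R G (x - y)) \<bullet> v"
            by (rule integral_inner_left) (rule intG)
          show ?thesis
            unfolding Hint conv_def
            by (simp only: Bochner_Integration.integral_diff[OF Bochner_Integration.integrable_diff[OF intK intK] i]
                Bochner_Integration.integral_diff[OF intK intK] e)
        qed
        also have "(e' * norm v) * I x \<le> e * norm v"
          using mult_right_mono[OF e'(2), of "norm v"] by (simp add: mult_ac)
        finally show "norm (conv K u x' - conv K u x
            - (LINT y|lebesgue. u y *\<^sub>R G (x - y)) \<bullet> (x' - x)) \<le> e * norm (x' - x)"
          by (simp add: v_def)
      qed (use d in auto)
    qed
  next
    show "continuous_on UNIV (\<lambda>x. LINT y|lebesgue. u y *\<^sub>R G (x - y))"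
      unfolding continuous_on_iff
    proof (intro ballI allI impI)
      fix x :: 'a and e :: real assume "0 < e"
      define e' where "e' = e / (I x + 1) / 2"
      have e': "0 < e'" "e' * I x < e"
        using \<open>0 < e\<close> I0[of x] by (auto simp: e'_def field_simps intro!: add_pos_nonneg add_nonneg_pos)
      obtain d where d: "0 < d" "d \<le> 1" "\<And>x y. norm (x - y) \<le> d \<Longrightarrow> norm (G x - G y) \<le> e'"
        using uni[OF e'(1)] by blast
      show "\<exists>d>0. \<forall>x'\<in>UNIV. dist x' x < d \<longrightarrow>
          dist (LINT y|lebesgue. u y *\<^sub>R G (x' - y)) (LINT y|lebesgue. u y *\<^sub>R G (x - y)) < e"
      proof (intro exI[of _ d] conjI ballI impI)
        fix x' assume x': "dist x' x < d"
        have "norm (LINT y|lebesgue. u y *\<^sub>R (G (x' - y) - G (x - y))) \<le> e' * I x"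
        proof (rule bound)
          show "(\<lambda>y. G (x' - y) - G (x - y)) \<in> borel_measurable borel" by measurable
          show "norm (G (x' - y) - G (x - y)) \<le> e'" for y
            using d(3)[of "x' - y" "x - y"] x' by (simp add: dist_norm)
          show "G (x' - y) - G (x - y) = 0" if "y \<notin> cball x (R + 1)" for y
          proof -
            have *: "R + 1 < norm (x - y)" using that by (simp add: dist_norm)
            show ?thesis
              using G0[of "x - y"] G0[OF supp[OF *, of "x' - x"]] * x' d by (simp add: dist_norm)
          qed
          show "integrable lebesgue (\<lambda>y. u y *\<^sub>R (G (x' - y) - G (x - y)))"
            by (simp add: scaleR_diff_right intG)
        qed
        then show "dist (LINT y|lebesgue. u y *\<^sub>R G (x' - y)) (LINT y|lebesgue. u y *\<^sub>R G (x - y)) < e"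
          using e' intG by (simp add: scaleR_diff_right dist_norm)
      qed (use d in auto)
    qed
  qed
qed

section \<open>Weak gradients\<close>

text \<open>Convolving K with the constant function 1 yields a constant, whose gradient is zero; by
  the differentiation formula this gradient is the integral of G. It is the form of the divergence
  theorem behind integration by parts.\<close>

lemma C1c_gradient_integral_zero:
  assumes K: "C1c_gradient K G R"
  shows "(LINT y|lebesgue. G y) = 0"
proof -
  have KG: "C1_gradient K G"
    using K by (auto simp: C1c_gradient_def)
  have [measurable]: "K \<in> borel_measurable borel" "G \<in> borel_measurable borel"
    using C1_gradientD(2,3)[OF KG, of UNIV] by (auto intro: borel_measurable_continuous_onI)
  have "locally_integrable (\<lambda>_::'a. 1::real)"
    by (rule continuous_imp_locally_integrable) auto
  note C1_gradient_conv[OF this K]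
  moreover have "conv K (\<lambda>_. 1::real) = (\<lambda>x. LINT y|lebesgue. K y)"
    using integral_reflect[of K] by (auto simp: conv_def)
  moreover have "(LINT y|lebesgue. 1 *\<^sub>R G (x - y)) = (LINT y|lebesgue. G y)" for x
    using integral_reflect[of G] by auto
  ultimately have "C1_gradient (\<lambda>x. LINT y|lebesgue. K y) (\<lambda>x. LINT y|lebesgue. G y)"
    by simp
  from C1_gradientD(1)[OF this] have "(\<bullet>) (LINT y|lebesgue. G y) = (\<lambda>v. 0)"
    using has_derivative_unique has_derivative_const by blast
  then show ?thesis
    by (metis inner_eq_zero_iff)
qed

lemma has_weak_gradientI:
  fixes u :: "'a::euclidean_space \<Rightarrow> real"
  assumes "locally_integrable u" "locally_integrable g"
    and "\<And>\<phi> \<Phi> R b. \<phi> \<in> test_functions \<Longrightarrow> C1c_gradient \<phi> \<Phi> R \<Longrightarrow> b \<in> Basis \<Longrightarrow>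
      (LINT x|lebesgue. u x * (\<Phi> x \<bullet> b)) = - (LINT x|lebesgue. (g x \<bullet> b) * \<phi> x)"
  shows "u has_weak_gradient g"
  unfolding has_weak_gradient_def
proof (intro conjI ballI)
  fix \<phi> :: "'a \<Rightarrow> real" and b :: 'a assume \<phi>: "\<phi> \<in> test_functions" and b: "b \<in> Basis"
  obtain \<Phi> R where \<Phi>: "C1c_gradient \<phi> \<Phi> R"
    using test_function_C1_gradient[OF \<phi>] by blast
  then have "frechet_derivative \<phi> (at x) b = \<Phi> x \<bullet> b" for x
    unfolding C1c_gradient_def using C1_gradientD(4) by blast
  then show "(LINT x|lebesgue. u x * frechet_derivative \<phi> (at x) b)
     = - (LINT x|lebesgue. (g x \<bullet> b) * \<phi> x)"
    using assms(3)[OF \<phi> \<Phi> b] by simp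
qed (use assms in auto)

lemma has_weak_gradientD:
  assumes "u has_weak_gradient g"
  shows "locally_integrable u" "locally_integrable g"
    and "\<phi> \<in> test_functions \<Longrightarrow> C1_gradient \<phi> \<Phi> \<Longrightarrow> b \<in> Basis \<Longrightarrow>
      (LINT x|lebesgue. u x * (\<Phi> x \<bullet> b)) = - (LINT x|lebesgue. (g x \<bullet> b) * \<phi> x)"
  using assms C1_gradientD(4) unfolding has_weak_gradient_def by force+

lemma C1c_gradient_facts:
  assumes "C1c_gradient f G R"
  obtains B where "C1_gradient f G" "\<And>x. R \<le> norm x \<Longrightarrow> f x = 0" "\<And>x. R \<le> norm x \<Longrightarrow> G x = 0"
    "0 < B" "\<And>x. \<bar>f x\<bar> \<le> B" "\<And>x. norm (G x) \<le> B" "f \<in> borel_measurable lebesgue" "G \<in> borel_measurable lebesgue"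
proof -
  have f: "C1_gradient f G" and 0: "\<And>x. R \<le> norm x \<Longrightarrow> f x = 0" "\<And>x. R \<le> norm x \<Longrightarrow> G x = 0"
    using assms by (auto simp: C1c_gradient_def)
  obtain B1 where B1: "0 < B1" "\<And>x. norm (f x) \<le> B1"
    using compact_support_bounded[OF C1_gradientD(3)[OF f] 0(1)] by blast
  obtain B2 where B2: "0 < B2" "\<And>x. norm (G x) \<le> B2"
    using compact_support_bounded[OF C1_gradientD(2)[OF f] 0(2)] by blast
  have "f \<in> borel_measurable lebesgue" "G \<in> borel_measurable lebesgue"
    using C1_gradientD(2,3)[OF f, of UNIV] by (auto intro!: borel_imp_lebesgue borel_measurable_continuous_onI)
  then show thesis
    using that[of "max B1 B2"] f 0 B1 B2 by (simp add: max.coboundedI1 max.coboundedI2)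
qed

lemma integrable_times_C1c:
  fixes u :: "'a::euclidean_space \<Rightarrow> real" and g :: "'a \<Rightarrow> 'a"
  assumes \<phi>: "C1c_gradient \<phi> \<Phi> R"
  shows "locally_integrable u \<Longrightarrow> integrable lebesgue (\<lambda>x. u x * (\<Phi> x \<bullet> b))"
    and "locally_integrable g \<Longrightarrow> integrable lebesgue (\<lambda>x. (g x \<bullet> b) * \<phi> x)"
    and "locally_integrable u \<Longrightarrow> integrable lebesgue (\<lambda>x. u x * \<phi> x)"
proof -
  obtain B where B: "C1_gradient \<phi> \<Phi>" "\<And>x. R \<le> norm x \<Longrightarrow> \<phi> x = 0" "\<And>x. R \<le> norm x \<Longrightarrow> \<Phi> x = 0"
    "0 < B" "\<And>x. \<bar>\<phi> x\<bar> \<le> B" "\<And>x. norm (\<Phi> x) \<le> B"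
    "\<phi> \<in> borel_measurable lebesgue" "\<Phi> \<in> borel_measurable lebesgue"
    using C1c_gradient_facts[OF \<phi>] by blast
  show "integrable lebesgue (\<lambda>x. u x * (\<Phi> x \<bullet> b))" if "locally_integrable u"
  proof -
    have "\<bar>\<Phi> x \<bullet> b\<bar> \<le> B * norm b" for x
      by (rule order_trans[OF Cauchy_Schwarz_ineq2 mult_right_mono]) (use B in auto)
    then have "integrable lebesgue (\<lambda>x. (\<Phi> x \<bullet> b) *\<^sub>R u x)"
      by (intro integrable_mult_bounded_support(1)[OF that, where S = "cball 0 R"]) (use B in auto)
    then show ?thesis by (simp add: mult.commute)
  qed
  show "integrable lebesgue (\<lambda>x. u x * \<phi> x)" if "locally_integrable u"
  proof -
    have "integrable lebesgue (\<lambda>x. \<phi> x *\<^sub>R u x)"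
      by (intro integrable_mult_bounded_support(1)[OF that, where S = "cball 0 R"]) (use B in auto)
    then show ?thesis by (simp add: mult.commute)
  qed
  show "integrable lebesgue (\<lambda>x. (g x \<bullet> b) * \<phi> x)" if "locally_integrable g"
  proof -
    have "integrable lebesgue (\<lambda>x. \<phi> x *\<^sub>R g x)"
      by (intro integrable_mult_bounded_support(1)[OF that, where S = "cball 0 R"]) (use B in auto)
    then have "integrable lebesgue (\<lambda>x. (\<phi> x *\<^sub>R g x) \<bullet> b)"
      by (rule integrable_inner_left)
    then show ?thesis by (simp add: mult.commute)
  qed
qed

text \<open>The product of f with a test function is C^1 with compact support, so its gradient has
  integral zero, and the product rule turns this into integration by parts.\<close>

lemma C1_gradient_weak:
  assumes f: "C1_gradient f F"
  shows "f has_weak_gradient F"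
proof (rule has_weak_gradientI)
  show li: "locally_integrable f" "locally_integrable F"
    using C1_gradientD[OF f] by (auto intro: continuous_imp_locally_integrable)
  fix \<phi> :: "'a \<Rightarrow> real" and \<Phi> :: "'a \<Rightarrow> 'a" and R :: real and b :: 'a assume \<phi>: "C1c_gradient \<phi> \<Phi> R"
  then have c: "C1c_gradient (\<lambda>x. f x * \<phi> x) (\<lambda>x. f x *\<^sub>R \<Phi> x + \<phi> x *\<^sub>R F x) R"
    using C1_gradient_mult[OF f, of \<phi> \<Phi>] by (auto simp: C1c_gradient_def)
  let ?H = "\<lambda>x. f x *\<^sub>R \<Phi> x + \<phi> x *\<^sub>R F x"
  have "continuous_on UNIV ?H"
    using c C1_gradientD(2) by (auto simp: C1c_gradient_def)
  have iH: "integrable lebesgue ?H"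
  proof -
    have "integrable lebesgue (\<lambda>x. indicator (cball 0 R) x *\<^sub>R ?H x)"
      using continuous_imp_locally_integrable[OF \<open>continuous_on UNIV ?H\<close>]
      unfolding locally_integrable_def set_integrable_def by simp
    moreover have "(\<lambda>x. indicator (cball 0 R) x *\<^sub>R ?H x) = ?H"
      using c by (auto simp: indicator_def C1c_gradient_def fun_eq_iff)
    ultimately show ?thesis by simp
  qed
  have "0 = (LINT x|lebesgue. ?H x) \<bullet> b"
    using C1c_gradient_integral_zero[OF c] by simp
  also have "\<dots> = (LINT x|lebesgue. ?H x \<bullet> b)"
    using iH by (simp add: integral_inner_left)
  also have "(\<lambda>x. ?H x \<bullet> b) = (\<lambda>x. f x * (\<Phi> x \<bullet> b) + (F x \<bullet> b) * \<phi> x)"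
    by (simp add: inner_add_left mult.commute)
  also have "(LINT x|lebesgue. f x * (\<Phi> x \<bullet> b) + (F x \<bullet> b) * \<phi> x)
     = (LINT x|lebesgue. f x * (\<Phi> x \<bullet> b)) + (LINT x|lebesgue. (F x \<bullet> b) * \<phi> x)"
    by (intro Bochner_Integration.integral_add integrable_times_C1c[OF \<phi>] li)
  finally show "(LINT x|lebesgue. f x * (\<Phi> x \<bullet> b)) = - (LINT x|lebesgue. (F x \<bullet> b) * \<phi> x)"
    by simp
qed

text \<open>Testing with y \<mapsto> K (x - y), whose gradient carries a minus sign, moves the
  derivative from the kernel to u. Hence the mollified weak gradient is the classical gradient of
  the mollification.\<close>

lemma C1_gradient_conv_weak:
  assumes u: "u has_weak_gradient g" and K: "K \<in> test_functions"
  shows "C1_gradient (conv K u) (conv K g)"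
proof -
  obtain G R where G: "C1c_gradient K G R"
    using test_function_C1_gradient[OF K] by blast
  then obtain B where B: "C1_gradient K G" "\<And>x. R \<le> norm x \<Longrightarrow> K x = 0" "\<And>x. R \<le> norm x \<Longrightarrow> G x = 0"
    "0 < B" "\<And>x. norm (G x) \<le> B"
    using C1c_gradient_facts by metis
  note li = has_weak_gradientD(1,2)[OF u]
  have "(LINT y|lebesgue. u y *\<^sub>R G (x - y)) = conv K g x" for x
  proof (rule euclidean_eqI)
    fix b :: 'a assume b: "b \<in> Basis"
    have t: "(\<lambda>y. K ((-1) *\<^sub>R y + x)) \<in> test_functions"
      using K by (rule test_functions_affine) simp
    have d: "C1_gradient (\<lambda>y. K ((-1) *\<^sub>R y + x)) (\<lambda>y. (-1) *\<^sub>R G ((-1) *\<^sub>R y + x))"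
      by (rule C1_gradient_affine[OF B(1)])
    have ig: "integrable lebesgue (\<lambda>y. u y *\<^sub>R G (x - y))"
    proof (rule Bochner_Integration.integrable_bound)
      have "integrable lebesgue (\<lambda>y. norm (G (x - y)) *\<^sub>R u y)"
        by (rule integrable_conv[OF li(1), where K = "\<lambda>z. norm (G z)" and R = R])
           (use C1_gradientD(2)[OF B(1)] B in \<open>auto intro: continuous_intros\<close>)
      then show "integrable lebesgue (\<lambda>y. norm (norm (G (x - y)) *\<^sub>R u y))"
        by (rule integrable_norm)
      have [measurable]: "G \<in> borel_measurable borel"
        using C1_gradientD(2)[OF B(1)] by (auto intro: borel_measurable_continuous_onI)
      show "(\<lambda>y. u y *\<^sub>R G (x - y)) \<in> borel_measurable lebesgue"
        by (intro borel_measurable_scaleR locally_integrable_measurable[OF li(1)] borel_imp_lebesgue) measurable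
    qed (simp add: abs_mult mult.commute)
    have iK: "integrable lebesgue (\<lambda>y. K (x - y) *\<^sub>R g y)"
      by (rule integrable_conv[OF li(2) C1_gradientD(3)[OF B(1)] B(2)])
    have "(LINT y|lebesgue. u y * (G (x - y) \<bullet> b)) = (LINT y|lebesgue. (g y \<bullet> b) * K (x - y))"
      using has_weak_gradientD(3)[OF u t d b] by (simp add: algebra_simps)
    then show "(LINT y|lebesgue. u y *\<^sub>R G (x - y)) \<bullet> b = conv K g x \<bullet> b"
      using ig iK unfolding conv_def
      by (simp flip: integral_inner_left) (simp add: mult.commute)
  qed
  then show ?thesis
    using C1_gradient_conv[OF li(1) G] by simp
qed

lemma locally_integrable_add_scale:
  fixes f g :: "'a::euclidean_space \<Rightarrow> 'b::{banach, second_countable_topology}"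
  assumes "locally_integrable f" "locally_integrable g"
  shows "locally_integrable (\<lambda>x. a *\<^sub>R f x + b *\<^sub>R g x)"
  using assms unfolding locally_integrable_def set_integrable_def
  by (auto simp: scaleR_add_right scaleR_left_commute intro!: Bochner_Integration.integrable_add
      integrable_scaleR_right simp del: scaleR_scaleR)

lemma has_weak_gradient_linear:
  assumes "u has_weak_gradient g" "v has_weak_gradient h"
  shows "(\<lambda>x. a * u x + b * v x) has_weak_gradient (\<lambda>x. a *\<^sub>R g x + b *\<^sub>R h x)"
proof (rule has_weak_gradientI)
  note li = has_weak_gradientD(1,2)[OF assms(1)] has_weak_gradientD(1,2)[OF assms(2)]
  show "locally_integrable (\<lambda>x. a * u x + b * v x)"
    using locally_integrable_add_scale[OF li(1,3), of a b] by simp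
  show "locally_integrable (\<lambda>x. a *\<^sub>R g x + b *\<^sub>R h x)"
    using locally_integrable_add_scale[OF li(2,4)] .
  fix \<phi> :: "'a \<Rightarrow> real" and \<Phi> :: "'a \<Rightarrow> 'a" and R :: real and c :: 'a assume \<phi>: "\<phi> \<in> test_functions" "C1c_gradient \<phi> \<Phi> R" and c: "c \<in> Basis"
  have d: "C1_gradient \<phi> \<Phi>" using \<phi> by (simp add: C1c_gradient_def)
  note i = integrable_times_C1c[OF \<phi>(2)]
  have "(LINT x|lebesgue. (a * u x + b * v x) * (\<Phi> x \<bullet> c))
     = (LINT x|lebesgue. a * (u x * (\<Phi> x \<bullet> c)) + b * (v x * (\<Phi> x \<bullet> c)))"
    by (simp add: algebra_simps)
  also have "\<dots> = a * (LINT x|lebesgue. u x * (\<Phi> x \<bullet> c)) + b * (LINT x|lebesgue. v x * (\<Phi> x \<bullet> c))"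
    using i li by simp
  also have "\<dots> = - (a * (LINT x|lebesgue. (g x \<bullet> c) * \<phi> x) + b * (LINT x|lebesgue. (h x \<bullet> c) * \<phi> x))"
    using has_weak_gradientD(3)[OF assms(1) \<phi>(1) d c] has_weak_gradientD(3)[OF assms(2) \<phi>(1) d c]
    by simp
  also have "\<dots> = - (LINT x|lebesgue. a * ((g x \<bullet> c) * \<phi> x) + b * ((h x \<bullet> c) * \<phi> x))"
    using i li by simp
  also have "\<dots> = - (LINT x|lebesgue. ((a *\<^sub>R g x + b *\<^sub>R h x) \<bullet> c) * \<phi> x)"
    by (simp add: algebra_simps inner_add_left)
  finally show "(LINT x|lebesgue. (a * u x + b * v x) * (\<Phi> x \<bullet> c))
     = - (LINT x|lebesgue. ((a *\<^sub>R g x + b *\<^sub>R h x) \<bullet> c) * \<phi> x)" .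
qed

lemma locally_integrable_mult_bounded:
  fixes u :: "'a::euclidean_space \<Rightarrow> 'b::{banach, second_countable_topology}"
  assumes u: "locally_integrable u" and Z: "Z \<in> borel_measurable lebesgue" "\<And>x. \<bar>Z x\<bar> \<le> B"
  shows "locally_integrable (\<lambda>x. Z x *\<^sub>R u x)"
  unfolding locally_integrable_def set_integrable_def
proof (intro allI impI)
  fix K :: "'a set" assume K: "compact K"
  have "integrable lebesgue (\<lambda>x. (indicator K x * Z x) *\<^sub>R u x)"
  proof (rule integrable_mult_bounded_support(1)[OF u, where S = K])
    show "(\<lambda>x. indicator K x * Z x) \<in> borel_measurable lebesgue"
      using K Z by (intro borel_measurable_times borel_measurable_indicator)
        (auto simp: lmeasurable_compact fmeasurableD)
    show "\<bar>indicator K x * Z x\<bar> \<le> B" for x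
      using Z(2)[of x] by (auto simp: indicator_def)
  qed (use K in \<open>auto simp: compact_imp_bounded\<close>)
  then show "integrable lebesgue (\<lambda>x. indicator K x *\<^sub>R Z x *\<^sub>R u x)"
    by simp
qed

text \<open>The product of \<open>\<zeta>\<close> with a test function is again one; inserting it
  into the identity for u and expanding gives the Leibniz rule. It serves to localise u to a
  ball.\<close>

lemma has_weak_gradient_mult_test:
  assumes u: "u has_weak_gradient g" and Z: "\<zeta> \<in> test_functions" "C1c_gradient \<zeta> Z r"
  shows "(\<lambda>x. \<zeta> x * u x) has_weak_gradient (\<lambda>x. \<zeta> x *\<^sub>R g x + u x *\<^sub>R Z x)"
proof (rule has_weak_gradientI)
  note li = has_weak_gradientD(1,2)[OF u]
  obtain B where B: "C1_gradient \<zeta> Z" "\<And>x. \<bar>\<zeta> x\<bar> \<le> B" "\<And>x. norm (Z x) \<le> B"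
    "\<zeta> \<in> borel_measurable lebesgue" "Z \<in> borel_measurable lebesgue"
    using C1c_gradient_facts[OF Z(2)] by metis
  show l1: "locally_integrable (\<lambda>x. \<zeta> x * u x)"
    using locally_integrable_mult_bounded[OF li(1) B(4,2)] by simp
  have lg: "locally_integrable (\<lambda>x. \<zeta> x *\<^sub>R g x)"
    using locally_integrable_mult_bounded[OF li(2) B(4,2)] by simp
  have lZ: "locally_integrable (\<lambda>x. u x *\<^sub>R Z x)"
    unfolding locally_integrable_iff
  proof (intro conjI allI)
    show "(\<lambda>x. u x *\<^sub>R Z x) \<in> borel_measurable lebesgue"
      using locally_integrable_measurable[OF li(1)] B by (intro borel_measurable_scaleR)
    have "locally_integrable (\<lambda>x. norm (Z x) *\<^sub>R u x)"
      using B by (intro locally_integrable_mult_bounded[OF li(1), where B=B]) auto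
    then show "(\<integral>\<^sup>+x\<in>cball 0 R. ennreal (norm (u x *\<^sub>R Z x)) \<partial>lebesgue) < \<infinity>" for R
      unfolding locally_integrable_iff by (simp add: abs_mult mult.commute)
  qed
  show "locally_integrable (\<lambda>x. \<zeta> x *\<^sub>R g x + u x *\<^sub>R Z x)"
    using locally_integrable_add_scale[OF lg lZ, of 1 1] by simp
  fix \<phi> :: "'a \<Rightarrow> real" and \<Phi> :: "'a \<Rightarrow> 'a" and R :: real and c :: 'a assume \<phi>: "\<phi> \<in> test_functions" "C1c_gradient \<phi> \<Phi> R" and c: "c \<in> Basis"
  have d: "C1_gradient \<phi> \<Phi>" using \<phi> by (simp add: C1c_gradient_def)
  have t: "(\<lambda>x. \<zeta> x * \<phi> x) \<in> test_functions"
    by (rule test_functions_mult) fact+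
  have dt: "C1_gradient (\<lambda>x. \<zeta> x * \<phi> x) (\<lambda>x. \<zeta> x *\<^sub>R \<Phi> x + \<phi> x *\<^sub>R Z x)"
    by (rule C1_gradient_mult) fact+
  note i = integrable_times_C1c[OF \<phi>(2)]
  have i1: "integrable lebesgue (\<lambda>x. (\<zeta> x * u x) * (\<Phi> x \<bullet> c))"
    by (rule i(1)[OF l1])
  have i2: "integrable lebesgue (\<lambda>x. (u x *\<^sub>R Z x \<bullet> c) * \<phi> x)"
    by (rule i(2)[OF lZ])
  have i3: "integrable lebesgue (\<lambda>x. (\<zeta> x *\<^sub>R g x \<bullet> c) * \<phi> x)"
    by (rule i(2)[OF lg])
  have "(LINT x|lebesgue. (\<zeta> x * u x) * (\<Phi> x \<bullet> c)) + (LINT x|lebesgue. (u x *\<^sub>R Z x \<bullet> c) * \<phi> x)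
     = (LINT x|lebesgue. (\<zeta> x * u x) * (\<Phi> x \<bullet> c) + (u x *\<^sub>R Z x \<bullet> c) * \<phi> x)"
    using i1 i2 by simp
  also have "\<dots> = (LINT x|lebesgue. u x * ((\<zeta> x *\<^sub>R \<Phi> x + \<phi> x *\<^sub>R Z x) \<bullet> c))"
    by (simp add: algebra_simps inner_add_left)
  also have "\<dots> = - (LINT x|lebesgue. (g x \<bullet> c) * (\<zeta> x * \<phi> x))"
    by (rule has_weak_gradientD(3)[OF u t dt c])
  also have "\<dots> = - (LINT x|lebesgue. (\<zeta> x *\<^sub>R g x \<bullet> c) * \<phi> x)"
    by (simp add: mult_ac)
  finally have "(LINT x|lebesgue. (\<zeta> x * u x) * (\<Phi> x \<bullet> c))
     = - ((LINT x|lebesgue. (\<zeta> x *\<^sub>R g x \<bullet> c) * \<phi> x) + (LINT x|lebesgue. (u x *\<^sub>R Z x \<bullet> c) * \<phi> x))"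
    by simp
  also have "\<dots> = - (LINT x|lebesgue. (\<zeta> x *\<^sub>R g x \<bullet> c) * \<phi> x + (u x *\<^sub>R Z x \<bullet> c) * \<phi> x)"
    using i2 i3 by simp
  finally show "(LINT x|lebesgue. (\<zeta> x * u x) * (\<Phi> x \<bullet> c))
     = - (LINT x|lebesgue. ((\<zeta> x *\<^sub>R g x + u x *\<^sub>R Z x) \<bullet> c) * \<phi> x)"
    by (simp add: algebra_simps inner_add_left)
qed

lemma locally_integrable_limit:
  fixes f :: "nat \<Rightarrow> 'a::euclidean_space \<Rightarrow> 'b::{banach, second_countable_topology}"
  assumes f: "\<And>k. locally_integrable (f k)" and g: "g \<in> borel_measurable lebesgue"
    and lim: "(\<lambda>k. \<integral>\<^sup>+x\<in>cball 0 R. ennreal (norm (f k x - g x)) \<partial>lebesgue) \<longlonglongrightarrow> 0"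
  shows "(\<integral>\<^sup>+x\<in>cball 0 R. ennreal (norm (g x)) \<partial>lebesgue) < \<infinity>"
proof -
  have "\<forall>\<^sub>F k in sequentially. (\<integral>\<^sup>+x\<in>cball 0 R. ennreal (norm (f k x - g x)) \<partial>lebesgue) < 1"
    using lim by (intro order_tendstoD) auto
  then obtain k where k: "(\<integral>\<^sup>+x\<in>cball 0 R. ennreal (norm (f k x - g x)) \<partial>lebesgue) < 1"
    by (meson eventually_sequentially order_refl)
  note m = locally_integrable_measurable[OF f]
  have "(\<integral>\<^sup>+x\<in>cball 0 R. ennreal (norm (g x)) \<partial>lebesgue)
     \<le> (\<integral>\<^sup>+x. ennreal (norm (f k x - g x)) * indicator (cball 0 R) x
           + ennreal (norm (f k x)) * indicator (cball 0 R) x \<partial>lebesgue)"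
  proof (rule nn_integral_mono)
    fix x
    have "norm (g x) \<le> norm (f k x - g x) + norm (f k x)"
      by (metis norm_minus_commute norm_triangle_sub add.commute)
    then have "ennreal (norm (g x)) \<le> ennreal (norm (f k x - g x)) + ennreal (norm (f k x))"
      by (metis ennreal_leI ennreal_plus norm_ge_zero)
    then show "ennreal (norm (g x)) * indicator (cball 0 R) x
      \<le> ennreal (norm (f k x - g x)) * indicator (cball 0 R) x
           + ennreal (norm (f k x)) * indicator (cball 0 R) x"
      by (auto simp: indicator_def)
  qed
  also have "\<dots> = (\<integral>\<^sup>+x\<in>cball 0 R. ennreal (norm (f k x - g x)) \<partial>lebesgue)
      + (\<integral>\<^sup>+x\<in>cball 0 R. ennreal (norm (f k x)) \<partial>lebesgue)"
    by (rule nn_integral_add; use m[of k] g in measurable)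
  also have "\<dots> < \<infinity>"
    using less_trans[OF k ennreal_one_less_top] f[of k] unfolding locally_integrable_iff
    by (simp add: ennreal_add_less_top)
  finally show ?thesis .
qed

lemma integral_limit_compact_support:
  fixes f :: "nat \<Rightarrow> 'a::euclidean_space \<Rightarrow> 'b::{banach, second_countable_topology}"
  assumes f: "\<And>k. locally_integrable (f k)" and g: "locally_integrable g"
    and lim: "(\<lambda>k. \<integral>\<^sup>+x\<in>cball 0 R. ennreal (norm (f k x - g x)) \<partial>lebesgue) \<longlonglongrightarrow> 0"
    and \<phi>: "\<phi> \<in> borel_measurable lebesgue" "\<And>x. \<bar>\<phi> x\<bar> \<le> B" "\<And>x. R \<le> norm x \<Longrightarrow> \<phi> x = 0"
  shows "(\<lambda>k. LINT x|lebesgue. \<phi> x *\<^sub>R f k x) \<longlonglongrightarrow> (LINT x|lebesgue. \<phi> x *\<^sub>R g x)"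
proof -
  have S: "bounded (cball 0 R :: 'a set)" "\<And>x. x \<notin> cball 0 R \<Longrightarrow> \<phi> x = 0"
    using \<phi> by auto
  note ic = integrable_mult_bounded_support[OF _ \<phi>(1,2) S]
  have d: "locally_integrable (\<lambda>x. f k x - g x)" for k
    using locally_integrable_add_scale[OF f g, of 1 k "-1"] by simp
  have eq: "(LINT x|lebesgue. \<phi> x *\<^sub>R (f k x - g x))
     = (LINT x|lebesgue. \<phi> x *\<^sub>R f k x) - (LINT x|lebesgue. \<phi> x *\<^sub>R g x)" for k
    using ic(1)[OF f[of k]] ic(1)[OF g] by (simp add: scaleR_diff_right)
  have "(\<lambda>k. ennreal (norm ((LINT x|lebesgue. \<phi> x *\<^sub>R f k x) - (LINT x|lebesgue. \<phi> x *\<^sub>R g x)))) \<longlonglongrightarrow> 0"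
  proof (rule tendsto_sandwich[OF _ _ tendsto_const])
    show "(\<lambda>k. ennreal B * (\<integral>\<^sup>+x\<in>cball 0 R. ennreal (norm (f k x - g x)) \<partial>lebesgue)) \<longlonglongrightarrow> 0"
      using ennreal_tendsto_cmult[OF _ lim, of "ennreal B"] by simp
    show "\<forall>\<^sub>F k in sequentially. ennreal (norm ((LINT x|lebesgue. \<phi> x *\<^sub>R f k x) - (LINT x|lebesgue. \<phi> x *\<^sub>R g x)))
        \<le> ennreal B * (\<integral>\<^sup>+x\<in>cball 0 R. ennreal (norm (f k x - g x)) \<partial>lebesgue)"
      using ic(2)[OF d] by (simp add: eq)
  qed auto
  then have "(\<lambda>k. norm ((LINT x|lebesgue. \<phi> x *\<^sub>R f k x) - (LINT x|lebesgue. \<phi> x *\<^sub>R g x))) \<longlonglongrightarrow> 0"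
    by (subst (asm) ennreal_tendsto_0_iff) auto
  then show ?thesis
    using LIM_zero_iff tendsto_norm_zero_iff by blast
qed

text \<open>For a fixed test function both sides of the defining identity are continuous under L^1
  convergence on balls, since the test function and its gradient are bounded with bounded
  support.\<close>

lemma has_weak_gradient_limit:
  assumes f: "\<And>k. f k has_weak_gradient F k"
    and u: "u \<in> borel_measurable lebesgue" and g: "g \<in> borel_measurable lebesgue"
    and lim: "\<And>R. (\<lambda>k. \<integral>\<^sup>+x\<in>cball 0 R. ennreal (norm (f k x - u x)) \<partial>lebesgue) \<longlonglongrightarrow> 0"
      "\<And>R. (\<lambda>k. \<integral>\<^sup>+x\<in>cball 0 R. ennreal (norm (F k x - g x)) \<partial>lebesgue) \<longlonglongrightarrow> 0"
  shows "u has_weak_gradient g"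
proof (rule has_weak_gradientI)
  note lf = has_weak_gradientD(1)[OF f] and lF = has_weak_gradientD(2)[OF f]
  show lu: "locally_integrable u" and lg: "locally_integrable g"
    using locally_integrable_limit[OF lf u lim(1)] locally_integrable_limit[OF lF g lim(2)] u g
    unfolding locally_integrable_iff by blast+
  fix \<phi> :: "'a \<Rightarrow> real" and \<Phi> :: "'a \<Rightarrow> 'a" and R :: real and c :: 'a assume \<phi>: "\<phi> \<in> test_functions" "C1c_gradient \<phi> \<Phi> R" and c: "c \<in> Basis"
  obtain B where B: "C1_gradient \<phi> \<Phi>" "\<And>x. R \<le> norm x \<Longrightarrow> \<phi> x = 0" "\<And>x. R \<le> norm x \<Longrightarrow> \<Phi> x = 0"
    "0 < B" "\<And>x. \<bar>\<phi> x\<bar> \<le> B" "\<And>x. norm (\<Phi> x) \<le> B"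
    "\<phi> \<in> borel_measurable lebesgue" "\<Phi> \<in> borel_measurable lebesgue"
    using C1c_gradient_facts[OF \<phi>(2)] by blast
  have Bc: "\<bar>\<Phi> x \<bullet> c\<bar> \<le> B * norm c" for x
    by (rule order_trans[OF Cauchy_Schwarz_ineq2 mult_right_mono]) (use B in auto)
  have 1: "(\<lambda>k. LINT x|lebesgue. (\<Phi> x \<bullet> c) *\<^sub>R f k x) \<longlonglongrightarrow> (LINT x|lebesgue. (\<Phi> x \<bullet> c) *\<^sub>R u x)"
    by (rule integral_limit_compact_support[OF lf lu lim(1)[of R] _ Bc]) (use B in auto)
  have "(\<lambda>k. LINT x|lebesgue. \<phi> x *\<^sub>R F k x) \<longlonglongrightarrow> (LINT x|lebesgue. \<phi> x *\<^sub>R g x)"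
    by (rule integral_limit_compact_support[OF lF lg lim(2)[of R] _ B(5)]) (use B in auto)
  then have "(\<lambda>k. (LINT x|lebesgue. \<phi> x *\<^sub>R F k x) \<bullet> c) \<longlonglongrightarrow> (LINT x|lebesgue. \<phi> x *\<^sub>R g x) \<bullet> c"
    by (intro tendsto_inner tendsto_const)
  moreover have "(LINT x|lebesgue. \<phi> x *\<^sub>R G x) \<bullet> c = (LINT x|lebesgue. (G x \<bullet> c) * \<phi> x)"
    if "locally_integrable G" for G
  proof -
    have "integrable lebesgue (\<lambda>x. \<phi> x *\<^sub>R G x)"
      by (rule integrable_mult_bounded_support(1)[OF that, where S = "cball 0 R"]) (use B in auto)
    then show ?thesis
      by (simp flip: integral_inner_left add: mult.commute)
  qed
  ultimately have 2: "(\<lambda>k. LINT x|lebesgue. (F k x \<bullet> c) * \<phi> x) \<longlonglongrightarrow> (LINT x|lebesgue. (g x \<bullet> c) * \<phi> x)"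
    using lF lg by simp
  have "(LINT x|lebesgue. (\<Phi> x \<bullet> c) *\<^sub>R f k x) = - (LINT x|lebesgue. (F k x \<bullet> c) * \<phi> x)" for k
    using has_weak_gradientD(3)[OF f \<phi>(1) B(1) c, of k] by (simp add: mult.commute)
  then have "(\<lambda>k. - (LINT x|lebesgue. (F k x \<bullet> c) * \<phi> x)) \<longlonglongrightarrow> (LINT x|lebesgue. (\<Phi> x \<bullet> c) *\<^sub>R u x)"
    using 1 by simp
  then show "(LINT x|lebesgue. u x * (\<Phi> x \<bullet> c)) = - (LINT x|lebesgue. (g x \<bullet> c) * \<phi> x)"
    using LIMSEQ_unique[OF _ tendsto_minus[OF 2]] by (simp add: mult.commute)
qed

section \<open>The modular\<close>

lemma ennreal_mult_add_mult:
  assumes "0 \<le> a" "0 \<le> b" "0 \<le> c" "0 \<le> d"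
  shows "ennreal a * ennreal b + ennreal c * ennreal d = ennreal (a * b + c * d)"
  using assms by (simp add: ennreal_mult ennreal_plus)

text \<open>Convexity: the power lies above its tangent at a. Summed or integrated with a equal to
  the mean, this becomes Jensen's inequality, both for finite sums and for mollifications. The point
  t = 0 is not interior to the domain of convexity and is checked directly.\<close>

lemma powr_ge_tangent:
  fixes a t q :: real
  assumes "0 < a" "0 \<le> t" "1 \<le> q"
  shows "a powr q + q * a powr (q - 1) * (t - a) \<le> t powr q"
proof (cases "t = 0")
  case True
  have "a powr (q - 1) * a = a powr q"
    using assms by (simp add: powr_diff)
  then have "a powr q + q * a powr (q - 1) * (t - a) = (1 - q) * a powr q"
    using True by (simp add: algebra_simps)
  also have "\<dots> \<le> 0"
    using assms by (intro mult_nonpos_nonneg) auto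
  finally show ?thesis using True by simp
next
  case False
  have "q * a powr (q - 1) * (t - a) \<le> t powr q - a powr q"
  proof (rule convex_on_imp_above_tangent[OF powr_convex[OF assms(3)]])
    show "((\<lambda>x. x powr q) has_real_derivative q * a powr (q - 1)) (at a within {0<..})"
      using assms by (auto intro!: derivative_eq_intros has_field_derivative_at_within[OF has_real_derivative_powr])
  qed (use assms False in \<open>auto simp: interior_open\<close>)
  then show ?thesis by simp
qed

text \<open>Jensen's inequality with weights of total at most 1: the missing mass may be thought of
  as sitting at 0, where the power vanishes.\<close>

lemma sum_powr_le:
  fixes q :: real
  assumes q: "1 \<le> q" and l: "\<And>k. 0 \<le> l k" "(\<Sum>k<N::nat. l k) \<le> 1" and t: "\<And>k. 0 \<le> t k"
  shows "(\<Sum>k<N. l k * t k) powr q \<le> (\<Sum>k<N. l k * t k powr q)"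
proof -
  define a where "a = (\<Sum>k<N. l k * t k)"
  have a0: "0 \<le> a" unfolding a_def by (intro sum_nonneg mult_nonneg_nonneg l t)
  show ?thesis
  proof (cases "a = 0")
    case True
    then show ?thesis
      using l unfolding a_def by (auto intro!: sum_nonneg)
  next
    case False
    then have a: "0 < a" using a0 by simp
    define L where "L = (\<Sum>k<N. l k)"
    have *: "a powr (q - 1) * a = a powr q"
      using a by (simp add: powr_diff)
    \<comment> \<open>The weighted tangents at a add up to \<open>a powr q\<close> plus this slack,
      which is nonnegative because the weights sum to L <= 1.\<close>
    have "a powr q \<le> a powr q + (q - 1) * (1 - L) * a powr q"
      using q l by (auto simp: L_def)
    also have "\<dots> = L * a powr q + q * (1 - L) * (a powr (q - 1) * a)"
      unfolding * by (simp add: algebra_simps)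
    also have "\<dots> = L * a powr q + q * a powr (q - 1) * (a - L * a)"
      by (simp add: algebra_simps)
    also have "\<dots> = (\<Sum>k<N. l k * (a powr q + q * a powr (q - 1) * (t k - a)))"
    proof -
      have "(\<Sum>k<N. l k * (A + c * (t k - b))) = (\<Sum>k<N. l k) * A + c * ((\<Sum>k<N. l k * t k) - (\<Sum>k<N. l k) * b)"
        for A b c
        by (simp add: sum_distrib_left sum_distrib_right sum.distrib sum_subtractf algebra_simps)
      then show ?thesis
        unfolding L_def a_def by simp
    qed
    also have "\<dots> \<le> (\<Sum>k<N. l k * t k powr q)"
      by (intro sum_mono mult_left_mono powr_ge_tangent a t q l)
    finally show ?thesis by (simp add: a_def)
  qed
qed

lemma powr_add_le:
  fixes a b q :: real
  assumes "0 \<le> a" "0 \<le> b" "1 \<le> q" "q \<le> P"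
  shows "(a + b) powr q \<le> 2 powr P * (a powr q + b powr q)"
proof -
  have "(a + b) powr q \<le> (2 * max a b) powr q"
    using assms by (intro powr_mono2) auto
  also have "\<dots> = 2 powr q * (max a b) powr q"
    using assms by (simp add: powr_mult)
  also have "\<dots> \<le> 2 powr P * (a powr q + b powr q)"
    using assms by (intro mult_mono) (auto simp: max_def)
  finally show ?thesis .
qed

section \<open>Modular and Luxemburg norm for a bounded continuous exponent\<close>

locale exponent =
  fixes p :: "'a::euclidean_space \<Rightarrow> real" and P :: real
  assumes p_ge: "1 \<le> p x" and p_le: "p x \<le> P" and p_cont: "continuous_on UNIV p"
begin

lemma P_ge: "1 \<le> P"
  using p_ge p_le order_trans by blast

lemma p_borel [measurable]: "p \<in> borel_measurable borel"
  using p_cont by (rule borel_measurable_continuous_onI)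

lemma p_lebesgue [measurable]: "p \<in> borel_measurable lebesgue"
  by (rule borel_imp_lebesgue) simp

lemma modular_mono_AE:
  assumes "AE x in lebesgue. \<bar>u x\<bar> \<le> \<bar>v x\<bar>"
  shows "modular p u \<le> modular p v"
  unfolding modular_def
  by (rule nn_integral_mono_AE, rule eventually_mono[OF assms])
     (auto intro!: ennreal_leI powr_mono2 simp: order_trans[OF zero_le_one p_ge])

lemma modular_mono: "(\<And>x. \<bar>u x\<bar> \<le> \<bar>v x\<bar>) \<Longrightarrow> modular p u \<le> modular p v"
  by (rule modular_mono_AE) simp

lemma modular_cong_AE:
  assumes "AE x in lebesgue. u x = v x"
  shows "modular p u = modular p v"
  unfolding modular_def by (rule nn_integral_cong_AE, rule eventually_mono[OF assms]) auto

lemma modular_add_le: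
  assumes [measurable]: "u \<in> borel_measurable lebesgue" "v \<in> borel_measurable lebesgue"
  shows "modular p (\<lambda>x. u x + v x) \<le> ennreal (2 powr P) * (modular p u + modular p v)"
proof -
  have "modular p (\<lambda>x. u x + v x)
     \<le> (\<integral>\<^sup>+x. ennreal (2 powr P) * (ennreal (\<bar>u x\<bar> powr p x) + ennreal (\<bar>v x\<bar> powr p x)) \<partial>lebesgue)"
    unfolding modular_def
  proof (rule nn_integral_mono)
    fix x
    have "\<bar>u x + v x\<bar> powr p x \<le> (\<bar>u x\<bar> + \<bar>v x\<bar>) powr p x"
      using p_ge[of x] by (intro powr_mono2) auto
    also have "\<dots> \<le> 2 powr P * (\<bar>u x\<bar> powr p x + \<bar>v x\<bar> powr p x)"
      by (intro powr_add_le p_ge p_le) auto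
    finally show "ennreal (\<bar>u x + v x\<bar> powr p x)
      \<le> ennreal (2 powr P) * (ennreal (\<bar>u x\<bar> powr p x) + ennreal (\<bar>v x\<bar> powr p x))"
      by (simp add: ennreal_leI flip: ennreal_plus ennreal_mult')
  qed
  also have "\<dots> = ennreal (2 powr P) * (modular p u + modular p v)"
    unfolding modular_def by (subst nn_integral_cmult, measurable, subst nn_integral_add, measurable)
  finally show ?thesis .
qed

text \<open>The modular is not homogeneous. A factor c >= 1 costs at most its power with the largest
  exponent P; a factor c <= 1 gains at least one full power, since p >= 1.\<close>

lemma modular_scale_ge1:
  assumes [measurable]: "u \<in> borel_measurable lebesgue" and c: "1 \<le> c"
  shows "modular p (\<lambda>x. c * u x) \<le> ennreal (c powr P) * modular p u"
proof -
  have "modular p (\<lambda>x. c * u x) \<le> (\<integral>\<^sup>+x. ennreal (c powr P) * ennreal (\<bar>u x\<bar> powr p x) \<partial>lebesgue)"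
    unfolding modular_def
  proof (rule nn_integral_mono)
    fix x
    have "\<bar>c * u x\<bar> powr p x = c powr p x * \<bar>u x\<bar> powr p x"
      using c by (simp add: abs_mult powr_mult)
    also have "\<dots> \<le> c powr P * \<bar>u x\<bar> powr p x"
      using c p_le by (intro mult_right_mono powr_mono) auto
    finally show "ennreal (\<bar>c * u x\<bar> powr p x) \<le> ennreal (c powr P) * ennreal (\<bar>u x\<bar> powr p x)"
      by (simp add: ennreal_leI flip: ennreal_mult')
  qed
  also have "\<dots> = ennreal (c powr P) * modular p u"
    unfolding modular_def by (subst nn_integral_cmult, measurable)
  finally show ?thesis .
qed

lemma modular_scale_le1:
  assumes [measurable]: "u \<in> borel_measurable lebesgue" and c: "0 \<le> c" "c \<le> 1"
  shows "modular p (\<lambda>x. c * u x) \<le> ennreal c * modular p u"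
proof -
  have "modular p (\<lambda>x. c * u x) \<le> (\<integral>\<^sup>+x. ennreal c * ennreal (\<bar>u x\<bar> powr p x) \<partial>lebesgue)"
    unfolding modular_def
  proof (rule nn_integral_mono)
    fix x
    have "\<bar>c * u x\<bar> powr p x = c powr p x * \<bar>u x\<bar> powr p x"
      using c by (simp add: abs_mult powr_mult)
    also have "\<dots> \<le> c powr 1 * \<bar>u x\<bar> powr p x"
      using c p_ge by (intro mult_right_mono powr_mono') auto
    finally show "ennreal (\<bar>c * u x\<bar> powr p x) \<le> ennreal c * ennreal (\<bar>u x\<bar> powr p x)"
      using c by (simp add: ennreal_leI flip: ennreal_mult')
  qed
  also have "\<dots> = ennreal c * modular p u"
    unfolding modular_def by (subst nn_integral_cmult, measurable)
  finally show ?thesis .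
qed

text \<open>As p <= P, rescaling multiplies the modular by a finite factor at most, so the scale in
  the definition can be taken to be 1.\<close>

lemma var_Lebesgue_iff:
  "u \<in> var_Lebesgue p \<longleftrightarrow> u \<in> borel_measurable lebesgue \<and> modular p u < \<infinity>"
proof
  assume u: "u \<in> var_Lebesgue p"
  then obtain l where m: "u \<in> borel_measurable lebesgue" and l: "0 < l" "modular p (\<lambda>x. u x / l) < \<infinity>"
    unfolding var_Lebesgue_def by auto
  have m': "(\<lambda>x. u x / l) \<in> borel_measurable lebesgue" using m by measurable
  have "modular p u \<le> modular p (\<lambda>x. max 1 l * (u x / l))"
  proof (rule modular_mono)
    fix x
    have "\<bar>u x\<bar> = l * \<bar>u x / l\<bar>" using l by simp
    also have "\<dots> \<le> max 1 l * \<bar>u x / l\<bar>" by (intro mult_right_mono) auto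
    finally show "\<bar>u x\<bar> \<le> \<bar>max 1 l * (u x / l)\<bar>" by (simp add: abs_mult)
  qed
  also have "\<dots> \<le> ennreal (max 1 l powr P) * modular p (\<lambda>x. u x / l)"
    by (rule modular_scale_ge1[OF m']) simp
  also have "\<dots> < \<infinity>" using l by (simp add: ennreal_mult_less_top)
  finally show "u \<in> borel_measurable lebesgue \<and> modular p u < \<infinity>" using m by simp
next
  assume "u \<in> borel_measurable lebesgue \<and> modular p u < \<infinity>"
  then show "u \<in> var_Lebesgue p"
    unfolding var_Lebesgue_def by (auto intro!: exI[of _ 1])
qed

lemma Luxemburg_norm_le:
  assumes "0 < l" "modular p (\<lambda>x. u x / l) \<le> 1"
  shows "0 \<le> Luxemburg_norm p u" "Luxemburg_norm p u \<le> l"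
proof -
  let ?A = "{l. 0 < l \<and> modular p (\<lambda>x. u x / l) \<le> 1}"
  have "l \<in> ?A" "bdd_below ?A"
    using assms by (auto intro!: bdd_belowI[of _ 0])
  then show "0 \<le> Luxemburg_norm p u" "Luxemburg_norm p u \<le> l"
    unfolding Luxemburg_norm_def by (auto intro!: cInf_greatest cInf_lower)
qed

text \<open>Dividing by a fixed l <= 1 multiplies the modular by at most (1/l)^P, a constant that
  disappears in the limit; this is where boundedness of the exponent enters.\<close>

lemma modular_tendsto_imp_Luxemburg:
  assumes m: "\<And>k. u k \<in> borel_measurable lebesgue" and lim: "(\<lambda>k. modular p (u k)) \<longlonglongrightarrow> 0"
  shows "(\<lambda>k. Luxemburg_norm p (u k)) \<longlonglongrightarrow> 0"
proof (rule LIMSEQ_I)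
  fix r :: real assume r: "0 < r"
  define l where "l = min 1 (r/2)"
  have l: "0 < l" "l \<le> 1" "l < r" using r by (auto simp: l_def)
  have "(\<lambda>k. ennreal ((1 / l) powr P) * modular p (u k)) \<longlonglongrightarrow> ennreal ((1 / l) powr P) * 0"
    by (intro ennreal_tendsto_cmult lim) simp
  then have "\<forall>\<^sub>F k in sequentially. ennreal ((1 / l) powr P) * modular p (u k) < 1"
    by (intro order_tendstoD(2)[where a=1]) auto
  then obtain N where N: "\<And>k. N \<le> k \<Longrightarrow> ennreal ((1 / l) powr P) * modular p (u k) < 1"
    unfolding eventually_sequentially by blast
  have "norm (Luxemburg_norm p (u k) - 0) < r" if "N \<le> k" for k
  proof -
    have "modular p (\<lambda>x. (1 / l) * u k x) \<le> ennreal ((1 / l) powr P) * modular p (u k)"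
      using l by (intro modular_scale_ge1 m) auto
    then have "modular p (\<lambda>x. u k x / l) \<le> 1"
      using N[OF that] by (simp add: field_simps)
    from Luxemburg_norm_le[OF l(1) this] show ?thesis
      using l by simp
  qed
  then show "\<exists>N. \<forall>k\<ge>N. norm (Luxemburg_norm p (u k) - 0) < r" by blast
qed

text \<open>If the norm is below l, then u = k (u/k) with k < l and the modular of u/k at most 1,
  and the factor k <= 1 comes out linearly.\<close>

lemma modular_le_of_Luxemburg:
  assumes u: "u \<in> var_Lebesgue p" and l: "Luxemburg_norm p u < l" "l \<le> 1"
  shows "modular p u \<le> ennreal l"
proof -
  let ?A = "{l. 0 < l \<and> modular p (\<lambda>x. u x / l) \<le> 1}"
  have m: "u \<in> borel_measurable lebesgue" and fin: "modular p u < \<infinity>"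
    using u by (auto simp: var_Lebesgue_iff)
  obtain M where M: "modular p u = ennreal M" "0 \<le> M"
    using fin by (cases "modular p u") auto
  \<comment> \<open>An element of the set is exhibited first, because the infimum of an empty set of
    reals carries no information.\<close>
  define s where "s = max 1 M"
  have "modular p (\<lambda>x. (1 / s) * u x) \<le> ennreal (1 / s) * modular p u"
    by (intro modular_scale_le1 m) (auto simp: s_def divide_simps max_def)
  also have "\<dots> = ennreal (1 / s * M)"
    unfolding M(1) by (rule ennreal_mult'[symmetric]) (simp add: s_def)
  also have "\<dots> \<le> 1"
    by (auto simp: s_def max_def divide_simps)
  finally have "s \<in> ?A" by (simp add: s_def)
  then have "?A \<noteq> {}" by blast
  from cInf_lessD[OF this l(1)[unfolded Luxemburg_norm_def]]
  obtain k where k: "k \<in> ?A" "k < l"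
    by blast
  have m': "(\<lambda>x. u x / k) \<in> borel_measurable lebesgue" using m by measurable
  have "modular p u = modular p (\<lambda>x. k * (u x / k))"
    using k by simp
  also have "\<dots> \<le> ennreal k * modular p (\<lambda>x. u x / k)"
    using k l by (intro modular_scale_le1[OF m']) auto
  also have "\<dots> \<le> ennreal l * 1"
    using k by (intro mult_mono ennreal_leI) auto
  finally show ?thesis by simp
qed

lemma Luxemburg_tendsto_imp_modular:
  assumes u: "\<And>k. u k \<in> var_Lebesgue p" and lim: "(\<lambda>k. Luxemburg_norm p (u k)) \<longlonglongrightarrow> 0"
  shows "(\<lambda>k. modular p (u k)) \<longlonglongrightarrow> 0"
proof (rule order_tendstoI)
  fix a :: ennreal assume "0 < a"
  then obtain e where e: "0 < e" "ennreal e < a"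
  proof (cases a rule: ennreal_cases)
    case (real r)
    then have "0 < r" using \<open>0 < a\<close> by simp
    then have "ennreal (r / 2) < a" unfolding real(2) by (subst ennreal_less_iff) auto
    with \<open>0 < r\<close> show ?thesis using that[of "r/2"] by simp
  next
    case top
    then show ?thesis by (intro that[of 1]) auto
  qed
  define l where "l = min 1 e"
  have "\<forall>\<^sub>F k in sequentially. Luxemburg_norm p (u k) < l"
    using lim e by (intro order_tendstoD(2)[where a=l]) (auto simp: l_def)
  then show "\<forall>\<^sub>F k in sequentially. modular p (u k) < a"
  proof eventually_elim
    case (elim k)
    have "modular p (u k) \<le> ennreal l"
      by (rule modular_le_of_Luxemburg[OF u elim]) (simp add: l_def)
    also have "\<dots> \<le> ennreal e" by (intro ennreal_leI) (simp add: l_def)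
    finally show ?case using e by simp
  qed
qed simp

lemma var_Lebesgue_diff:
  assumes "u \<in> var_Lebesgue p" "v \<in> var_Lebesgue p"
  shows "(\<lambda>x. u x - v x) \<in> var_Lebesgue p"
proof -
  have [measurable]: "u \<in> borel_measurable lebesgue" "v \<in> borel_measurable lebesgue"
    using assms by (auto simp: var_Lebesgue_iff)
  have "modular p (\<lambda>x. - v x) = modular p v" by (simp add: modular_def)
  then have "modular p (\<lambda>x. u x + - v x) < \<infinity>"
    using modular_add_le[of u "\<lambda>x. - v x"] assms
    by (auto simp: var_Lebesgue_iff ennreal_mult_less_top ennreal_add_less_top intro: le_less_trans)
  then show ?thesis
    by (simp add: var_Lebesgue_iff)
qed

text \<open>Values above \<open>\<delta>\<close> satisfy t = t^(1-p(x)) t^p(x), and the first factor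
  is at most \<open>\<delta> powr (1 - P)\<close>, uniformly in x. On sets of finite measure this
  takes the place of Hoelder's inequality: a small modular forces a small L^1 norm.\<close>

lemma le_const_plus_powr:
  fixes t \<delta> :: real
  assumes "0 < \<delta>" "\<delta> \<le> 1" "0 \<le> t"
  shows "t \<le> \<delta> + \<delta> powr (1 - P) * t powr p x"
proof (cases "t \<le> \<delta>")
  case True
  then show ?thesis by (simp add: add_increasing2)
next
  case False
  then have t: "\<delta> < t" by simp
  have "t = t powr (1 - p x) * t powr p x"
    using t assms by (simp flip: powr_add)
  also have "\<dots> \<le> \<delta> powr (1 - P) * t powr p x"
  proof (intro mult_right_mono)
    have "t powr (1 - p x) \<le> \<delta> powr (1 - p x)"
      using t assms p_ge[of x] by (intro powr_mono2') auto
    also have "\<dots> \<le> \<delta> powr (1 - P)"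
      using assms p_le[of x] by (intro powr_mono') auto
    finally show "t powr (1 - p x) \<le> \<delta> powr (1 - P)" .
  qed simp
  finally show ?thesis using assms by simp
qed

lemma set_integral_le_modular:
  fixes f :: "'a \<Rightarrow> 'b::real_normed_vector"
  assumes f: "(\<lambda>x. norm (f x)) \<in> borel_measurable lebesgue" and S: "S \<in> sets lebesgue" and \<delta>: "0 < \<delta>" "\<delta> \<le> 1"
  shows "(\<integral>\<^sup>+x\<in>S. ennreal (norm (f x)) \<partial>lebesgue)
    \<le> ennreal \<delta> * emeasure lebesgue S + ennreal (\<delta> powr (1 - P)) * modular p (\<lambda>x. norm (f x))"
proof -
  note [measurable] = f
  have "(\<integral>\<^sup>+x\<in>S. ennreal (norm (f x)) \<partial>lebesgue)
     \<le> (\<integral>\<^sup>+x. ennreal \<delta> * indicator S x + ennreal (\<delta> powr (1 - P)) * ennreal (\<bar>norm (f x)\<bar> powr p x) \<partial>lebesgue)"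
  proof (rule nn_integral_mono)
    fix x
    have "ennreal (norm (f x)) \<le> ennreal (\<delta> + \<delta> powr (1 - P) * norm (f x) powr p x)"
      using \<delta> by (intro ennreal_leI le_const_plus_powr) auto
    also have "\<dots> = ennreal \<delta> + ennreal (\<delta> powr (1 - P)) * ennreal (\<bar>norm (f x)\<bar> powr p x)"
      using \<delta> by (simp add: ennreal_plus ennreal_mult')
    finally show "ennreal (norm (f x)) * indicator S x
       \<le> ennreal \<delta> * indicator S x + ennreal (\<delta> powr (1 - P)) * ennreal (\<bar>norm (f x)\<bar> powr p x)"
      by (auto simp: indicator_def)
  qed
  also have "\<dots> = ennreal \<delta> * emeasure lebesgue S + ennreal (\<delta> powr (1 - P)) * modular p (\<lambda>x. norm (f x))"
    unfolding modular_def using S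
    by (subst nn_integral_add) (auto simp: nn_integral_cmult_indicator nn_integral_cmult)
  finally show ?thesis .
qed

lemma modular_Fatou:
  assumes m: "\<And>k. u k \<in> borel_measurable lebesgue" 
    and lim: "AE x in lebesgue. (\<lambda>k. u k x) \<longlonglongrightarrow> v x"
    and le: "\<And>k. modular p (u k) \<le> e"
  shows "modular p v \<le> e"
proof -
  have "modular p v \<le> (\<integral>\<^sup>+x. liminf (\<lambda>k. ennreal (\<bar>u k x\<bar> powr p x)) \<partial>lebesgue)"
    unfolding modular_def
  proof (rule nn_integral_mono_AE, rule eventually_mono[OF lim])
    fix x assume x: "(\<lambda>k. u k x) \<longlonglongrightarrow> v x"
    have "(\<lambda>k. \<bar>u k x\<bar> powr p x) \<longlonglongrightarrow> \<bar>v x\<bar> powr p x"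
      using p_ge[of x] by (intro tendsto_powr2 tendsto_intros x) auto
    then have "(\<lambda>k. ennreal (\<bar>u k x\<bar> powr p x)) \<longlonglongrightarrow> ennreal (\<bar>v x\<bar> powr p x)"
      by (rule tendsto_ennrealI)
    from lim_imp_Liminf[OF _ this]
    show "ennreal (\<bar>v x\<bar> powr p x) \<le> liminf (\<lambda>k. ennreal (\<bar>u k x\<bar> powr p x))" by simp
  qed
  also have "\<dots> \<le> liminf (\<lambda>k. modular p (u k))"
    unfolding modular_def by (rule nn_integral_liminf) (use m in measurable)
  also have "\<dots> \<le> e"
  proof -
    have "liminf (\<lambda>k. modular p (u k)) \<le> liminf (\<lambda>k::nat. e)"
      by (intro Liminf_mono always_eventually allI le)
    then show ?thesis by (simp add: Liminf_const)
  qed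
  finally show ?thesis .
qed

section \<open>Convex combinations and convex series\<close>

lemma modular_weighted_sum_le:
  assumes l: "\<And>k. 0 \<le> l k" "(\<Sum>k<N::nat. l k) \<le> 1"
    and m: "\<And>k. v k \<in> borel_measurable lebesgue"
    and le: "\<And>x. \<bar>w x\<bar> \<le> (\<Sum>k<N. l k * \<bar>v k x\<bar>)"
  shows "modular p w \<le> (\<Sum>k<N. ennreal (l k) * modular p (v k))"
proof -
  have [measurable]: "v k \<in> borel_measurable lebesgue" for k by (rule m)
  have "modular p w \<le> (\<integral>\<^sup>+x. (\<Sum>k<N. ennreal (l k) * ennreal (\<bar>v k x\<bar> powr p x)) \<partial>lebesgue)"
    unfolding modular_def
  proof (rule nn_integral_mono)
    fix x
    have "\<bar>w x\<bar> powr p x \<le> (\<Sum>k<N. l k * \<bar>v k x\<bar>) powr p x"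
      using p_ge[of x] by (intro powr_mono2 le) auto
    also have "\<dots> \<le> (\<Sum>k<N. l k * \<bar>v k x\<bar> powr p x)"
      by (intro sum_powr_le p_ge l) auto
    finally have "ennreal (\<bar>w x\<bar> powr p x) \<le> ennreal (\<Sum>k<N. l k * \<bar>v k x\<bar> powr p x)"
      by (rule ennreal_leI)
    also have "\<dots> = (\<Sum>k<N. ennreal (l k) * ennreal (\<bar>v k x\<bar> powr p x))"
      using l by (subst sum_ennreal[symmetric]) (auto simp: ennreal_mult')
    finally show "ennreal (\<bar>w x\<bar> powr p x) \<le> (\<Sum>k<N. ennreal (l k) * ennreal (\<bar>v k x\<bar> powr p x))" .
  qed
  also have "\<dots> = (\<Sum>k<N. ennreal (l k) * modular p (v k))"
    unfolding modular_def by (subst nn_integral_sum, measurable) (simp add: nn_integral_cmult)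
  finally show ?thesis .
qed

text \<open>With weights of total at most 1, the inequality t <= 1 + t^p(x) bounds the summed L^1
  norms on a ball by its volume plus e, so the series converges absolutely almost everywhere and in
  L^1 of every ball. The modular of the sum follows from convexity for the partial sums and Fatou's
  lemma.\<close>

lemma weighted_series_L1:
  fixes f :: "nat \<Rightarrow> 'a \<Rightarrow> 'b::{banach, second_countable_topology}"
  assumes l: "\<And>k. 0 \<le> l k" "\<And>N. (\<Sum>k<N. l k) \<le> 1"
    and m: "\<And>k. f k \<in> borel_measurable lebesgue"
    and e: "\<And>N. (\<Sum>k<N. ennreal (l k) * modular p (\<lambda>x. norm (f k x))) \<le> ennreal e"
  shows "AE x in lebesgue. summable (\<lambda>k. norm (l k *\<^sub>R f k x))"
    and "(\<lambda>N. \<integral>\<^sup>+x\<in>cball 0 R. ennreal (norm ((\<Sum>k<N. l k *\<^sub>R f k x) - (\<Sum>k. l k *\<^sub>R f k x))) \<partial>lebesgue) \<longlonglongrightarrow> 0"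
    and "modular p (\<lambda>x. norm (\<Sum>k. l k *\<^sub>R f k x)) \<le> ennreal e"
proof -
  have [measurable]: "f k \<in> borel_measurable lebesgue" for k by (rule m)
  define W where "W x = (\<Sum>k. ennreal (norm (l k *\<^sub>R f k x)))" for x
  have [measurable]: "W \<in> borel_measurable lebesgue" unfolding W_def by measurable
  have W: "(\<integral>\<^sup>+x\<in>cball 0 R. W x \<partial>lebesgue) < \<infinity>" for R
  proof -
    have "(\<integral>\<^sup>+x\<in>cball 0 R. W x \<partial>lebesgue) = (\<integral>\<^sup>+x. (\<Sum>k. ennreal (norm (l k *\<^sub>R f k x)) * indicator (cball 0 R) x) \<partial>lebesgue)"
      unfolding W_def by (simp add: ennreal_suminf_multc)
    also have "\<dots> = (\<Sum>k. \<integral>\<^sup>+x\<in>cball 0 R. ennreal (norm (l k *\<^sub>R f k x)) \<partial>lebesgue)"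
      by (rule nn_integral_suminf) measurable
    also have "\<dots> \<le> emeasure lebesgue (cball (0::'a) R) + ennreal e"
    proof (rule suminf_le_const)
      show "(\<Sum>k<N. \<integral>\<^sup>+x\<in>cball 0 R. ennreal (norm (l k *\<^sub>R f k x)) \<partial>lebesgue)
         \<le> emeasure lebesgue (cball (0::'a) R) + ennreal e" for N
      proof -
        have "(\<Sum>k<N. \<integral>\<^sup>+x\<in>cball 0 R. ennreal (norm (l k *\<^sub>R f k x)) \<partial>lebesgue)
           = (\<Sum>k<N. ennreal (l k) * (\<integral>\<^sup>+x\<in>cball 0 R. ennreal (norm (f k x)) \<partial>lebesgue))"
          by (rule sum.cong) (auto simp: l ennreal_mult mult.assoc nn_integral_cmult)
        also have "\<dots> \<le> (\<Sum>k<N. ennreal (l k) * (emeasure lebesgue (cball (0::'a) R) + modular p (\<lambda>x. norm (f k x))))"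
        proof (intro sum_mono mult_left_mono)
          show "(\<integral>\<^sup>+x\<in>cball 0 R. ennreal (norm (f k x)) \<partial>lebesgue)
            \<le> emeasure lebesgue (cball (0::'a) R) + modular p (\<lambda>x. norm (f k x))" for k
            using set_integral_le_modular[of "f k" "cball 0 R" 1] by simp
        qed simp
        also have "\<dots> = ennreal (\<Sum>k<N. l k) * emeasure lebesgue (cball (0::'a) R) + (\<Sum>k<N. ennreal (l k) * modular p (\<lambda>x. norm (f k x)))"
          by (simp add: distrib_left sum.distrib sum_distrib_right l flip: sum_ennreal)
        also have "\<dots> \<le> 1 * emeasure lebesgue (cball (0::'a) R) + ennreal e"
          using l(2)[of N] by (intro add_mono mult_right_mono e) (auto simp: ennreal_le_1)
        finally show ?thesis by simp
      qed
    qed auto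
    also have "\<dots> < \<infinity>"
      using emeasure_lborel_cball_finite[of "0::'a" R] by (simp add: ennreal_add_less_top)
    finally show ?thesis .
  qed
  have "AE x in lebesgue. \<forall>n::nat. W x * indicator (cball 0 (real n)) x \<noteq> \<infinity>"
    unfolding AE_all_countable
  proof
    show "AE x in lebesgue. W x * indicator (cball 0 (real n)) x \<noteq> \<infinity>" for n
      by (rule nn_integral_PInf_AE) (use W[of "real n"] in auto)
  qed
  then show sm: "AE x in lebesgue. summable (\<lambda>k. norm (l k *\<^sub>R f k x))"
  proof eventually_elim
    case (elim x)
    obtain n :: nat where "norm x \<le> real n" using real_arch_simple by blast
    then have "W x \<noteq> \<infinity>" using elim[rule_format, of n] by (auto simp: indicator_def)
    then show ?case
      unfolding W_def by (intro summable_suminf_not_top) auto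
  qed
  show "(\<lambda>N. \<integral>\<^sup>+x\<in>cball 0 R. ennreal (norm ((\<Sum>k<N. l k *\<^sub>R f k x) - (\<Sum>k. l k *\<^sub>R f k x))) \<partial>lebesgue) \<longlonglongrightarrow> 0"
  proof -
    have "(\<lambda>N. \<integral>\<^sup>+x\<in>cball 0 R. ennreal (norm ((\<Sum>k<N. l k *\<^sub>R f k x) - (\<Sum>k. l k *\<^sub>R f k x))) \<partial>lebesgue)
       \<longlonglongrightarrow> (\<integral>\<^sup>+x. 0 \<partial>(lebesgue :: 'a measure))"
    proof (rule nn_integral_dominated_convergence[where w = "\<lambda>x. W x * indicator (cball 0 R) x"])
      show "AE x in lebesgue. ennreal (norm ((\<Sum>k<N. l k *\<^sub>R f k x) - (\<Sum>k. l k *\<^sub>R f k x))) * indicator (cball 0 R) x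
         \<le> W x * indicator (cball 0 R) x" for N
        using sm
      proof eventually_elim
        case (elim x)
        have s: "summable (\<lambda>k. l k *\<^sub>R f k x)" by (rule summable_norm_cancel[OF elim])
        have "(\<Sum>k. l k *\<^sub>R f k x) = (\<Sum>k. l (k + N) *\<^sub>R f (k + N) x) + (\<Sum>k<N. l k *\<^sub>R f k x)"
          by (rule suminf_split_initial_segment[OF s])
        then have "norm ((\<Sum>k<N. l k *\<^sub>R f k x) - (\<Sum>k. l k *\<^sub>R f k x)) = norm (\<Sum>k. l (k + N) *\<^sub>R f (k + N) x)"
          by simp
        also have "\<dots> \<le> (\<Sum>k. norm (l (k + N) *\<^sub>R f (k + N) x))"
          using summable_ignore_initial_segment[OF elim, of N] by (rule summable_norm)
        also have "\<dots> \<le> (\<Sum>k. norm (l k *\<^sub>R f k x))"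
          using suminf_split_initial_segment[OF elim, of N] by (simp add: sum_nonneg)
        finally have "ennreal (norm ((\<Sum>k<N. l k *\<^sub>R f k x) - (\<Sum>k. l k *\<^sub>R f k x))) \<le> W x"
          unfolding W_def using elim by (subst suminf_ennreal2) (auto intro: ennreal_leI)
        then show ?case by (intro mult_right_mono) auto
      qed
      show "AE x in lebesgue. (\<lambda>N. ennreal (norm ((\<Sum>k<N. l k *\<^sub>R f k x) - (\<Sum>k. l k *\<^sub>R f k x))) * indicator (cball 0 R) x)
         \<longlonglongrightarrow> 0"
        using sm
      proof eventually_elim
        case (elim x)
        have s: "summable (\<lambda>k. l k *\<^sub>R f k x)" by (rule summable_norm_cancel[OF elim])
        have "(\<lambda>N. norm ((\<Sum>k<N. l k *\<^sub>R f k x) - (\<Sum>k. l k *\<^sub>R f k x))) \<longlonglongrightarrow> 0"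
          using summable_LIMSEQ[OF s] by (simp add: LIM_zero tendsto_norm_zero)
        then have "(\<lambda>N. ennreal (norm ((\<Sum>k<N. l k *\<^sub>R f k x) - (\<Sum>k. l k *\<^sub>R f k x)))) \<longlonglongrightarrow> 0"
          by (subst ennreal_tendsto_0_iff) auto
        then show ?case
          by (cases "x \<in> cball 0 R") (auto simp: indicator_def)
      qed
      show "(\<lambda>x. ennreal (norm ((\<Sum>k<N. l k *\<^sub>R f k x) - (\<Sum>k. l k *\<^sub>R f k x))) * indicator (cball 0 R) x)
        \<in> borel_measurable lebesgue" for N
        by measurable
    qed (use W in auto)
    then show ?thesis by simp
  qed
  show "modular p (\<lambda>x. norm (\<Sum>k. l k *\<^sub>R f k x)) \<le> ennreal e"
  proof (rule modular_Fatou)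
    show "(\<lambda>x. norm (\<Sum>k<N. l k *\<^sub>R f k x)) \<in> borel_measurable lebesgue" for N by measurable
    show "AE x in lebesgue. (\<lambda>N. norm (\<Sum>k<N. l k *\<^sub>R f k x)) \<longlonglongrightarrow> norm (\<Sum>k. l k *\<^sub>R f k x)"
      using sm
    proof eventually_elim
      case (elim x)
      show ?case by (rule tendsto_norm[OF summable_LIMSEQ[OF summable_norm_cancel[OF elim]]])
    qed
    show "modular p (\<lambda>x. norm (\<Sum>k<N. l k *\<^sub>R f k x)) \<le> ennreal e" for N
    proof (rule order_trans[OF _ e])
      show "modular p (\<lambda>x. norm (\<Sum>k<N. l k *\<^sub>R f k x)) \<le> (\<Sum>k<N. ennreal (l k) * modular p (\<lambda>x. norm (f k x)))"
      proof (rule modular_weighted_sum_le)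
        show "\<bar>norm (\<Sum>k<N. l k *\<^sub>R f k x)\<bar> \<le> (\<Sum>k<N. l k * \<bar>norm (f k x)\<bar>)" for x
          unfolding abs_norm_cancel by (rule sum_norm_le) (simp add: l(1))
        show "(\<lambda>x. norm (f k x)) \<in> borel_measurable lebesgue" for k by measurable
      qed (rule l)+
    qed
  qed
qed

text \<open>The device for assembling countably many admissible functions. The series takes the role
  of a supremum: nonnegativity makes it dominate every term, and by convexity the modulars of the
  sum and of its gradient stay below weighted averages, without constants that grow with the number
  of terms.\<close>

lemma has_weak_gradient_weighted_series:
  fixes l :: "nat \<Rightarrow> real"
  assumes l: "\<And>k. 0 \<le> l k" "\<And>N. (\<Sum>k<N. l k) \<le> 1"
    and v: "\<And>k. v k has_weak_gradient G k" "\<And>k. AE x in lebesgue. 0 \<le> v k x"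
    and e: "\<And>N. (\<Sum>k<N. ennreal (l k) * modular p (v k)) \<le> ennreal e"
      "\<And>N. (\<Sum>k<N. ennreal (l k) * modular p (\<lambda>x. norm (G k x))) \<le> ennreal e"
  obtains u g where "u has_weak_gradient g" "AE x in lebesgue. 0 \<le> u x" "modular p u \<le> ennreal e"
    "modular p (\<lambda>x. norm (g x)) \<le> ennreal e" "AE x in lebesgue. \<forall>k. l k * v k x \<le> u x"
proof -
  note li = has_weak_gradientD(1,2)[OF v(1)]
  have mv [measurable]: "v k \<in> borel_measurable lebesgue" for k
    by (rule locally_integrable_measurable[OF li(1)])
  have mG [measurable]: "G k \<in> borel_measurable lebesgue" for k
    by (rule locally_integrable_measurable[OF li(2)])
  have ev: "(\<Sum>k<N. ennreal (l k) * modular p (\<lambda>x. norm (v k x))) \<le> ennreal e" for N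
    using e(1)[of N] by (simp add: modular_def)
  note A = weighted_series_L1[OF l mv ev] and B = weighted_series_L1[OF l mG e(2)]
  define u where "u x = (\<Sum>k. l k * v k x)" for x
  define g where "g x = (\<Sum>k. l k *\<^sub>R G k x)" for x
  have partial: "(\<lambda>x. \<Sum>k<N. l k * v k x) has_weak_gradient (\<lambda>x. \<Sum>k<N. l k *\<^sub>R G k x)" for N
  proof (induction N)
    case 0
    have "C1_gradient (\<lambda>x::'a. 0::real) (\<lambda>x. 0)" by (simp add: C1_gradient_def)
    then show ?case using C1_gradient_weak by simp
  next
    case (Suc N)
    from has_weak_gradient_linear[OF Suc v(1)[of N], of 1 "l N"] show ?case by simp
  qed
  have wg: "u has_weak_gradient g"
  proof (rule has_weak_gradient_limit[OF partial])
    show "u \<in> borel_measurable lebesgue" "g \<in> borel_measurable lebesgue"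
      unfolding u_def g_def by measurable
    show "(\<lambda>N. \<integral>\<^sup>+x\<in>cball 0 R. ennreal (norm ((\<Sum>k<N. l k * v k x) - u x)) \<partial>lebesgue) \<longlonglongrightarrow> 0" for R
      using A(2)[of R] by (simp add: u_def)
    show "(\<lambda>N. \<integral>\<^sup>+x\<in>cball 0 R. ennreal (norm ((\<Sum>k<N. l k *\<^sub>R G k x) - g x)) \<partial>lebesgue) \<longlonglongrightarrow> 0" for R
      using B(2)[of R] by (simp add: g_def)
  qed
  have v0: "AE x in lebesgue. \<forall>k. 0 \<le> v k x"
    using v(2) by (simp add: AE_all_countable)
  have "AE x in lebesgue. \<forall>k. l k * v k x \<le> u x"
    using A(1) v0
  proof eventually_elim
    case (elim x)
    have s: "summable (\<lambda>k. l k * v k x)"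
      using summable_norm_cancel[OF elim(1)] by simp
    show ?case
      unfolding u_def using sum_le_suminf[OF s, of "{k}" for k] l elim by simp
  qed
  moreover from this v0 have "AE x in lebesgue. 0 \<le> u x"
    by eventually_elim (meson l(1) mult_nonneg_nonneg order_trans)
  moreover have "modular p u \<le> ennreal e"
    using A(3) by (simp add: u_def modular_def)
  moreover have "modular p (\<lambda>x. norm (g x)) \<le> ennreal e"
    using B(3) by (simp add: g_def)
  ultimately show thesis using that wg by blast
qed

end

section \<open>Mollification\<close>

definition moll_mass :: "real \<Rightarrow> 'a::euclidean_space itself \<Rightarrow> real" where
  "moll_mass e _ = (LINT x|lebesgue. bump ((2 / e) *\<^sub>R (x::'a)))"

definition moll :: "real \<Rightarrow> 'a::euclidean_space \<Rightarrow> real" where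
  "moll e x = bump ((2 / e) *\<^sub>R x) / moll_mass e TYPE('a)"

text \<open>The bound \<open>exp 2\<close> of the bump divided by the lower bound for its mass, with
  e^n split off: \<open>moll e\<close> is at most this constant over e^n. It is kept at least 1 so
  that its powers increase with the exponent.\<close>

definition moll_const :: "'a::euclidean_space itself \<Rightarrow> real" where
  "moll_const _ = max 1 (exp 2 * 2 ^ DIM('a) / unit_ball_vol (real DIM('a)))"

lemma bump_scale_test: "0 < e \<Longrightarrow> (\<lambda>x. bump ((2 / e) *\<^sub>R x)) \<in> test_functions"
  using test_functions_affine[OF bump_test, of "2 / e" 0] by simp

lemma test_function_integrable:
  fixes f :: "'a::euclidean_space \<Rightarrow> real"
  assumes "f \<in> test_functions"
  shows "integrable lebesgue f"
proof -
  obtain G R where "C1c_gradient f G R"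
    using test_function_C1_gradient[OF assms] by blast
  then show ?thesis
    using integrable_times_C1c(3)[of f G R "\<lambda>_. 1"] continuous_imp_locally_integrable[of "\<lambda>_. 1"]
    by simp
qed

lemma test_function_continuous: "f \<in> test_functions \<Longrightarrow> continuous_on UNIV f"
  by (metis k_times_continuously_differentiable.simps(1) test_functions_iff)

lemma bump_borel [measurable]: "bump \<in> borel_measurable borel"
  using test_function_continuous[OF bump_test] by (rule borel_measurable_continuous_onI)

lemma moll_mass_ge:
  assumes e: "0 < e"
  shows "unit_ball_vol (real DIM('a)) * (e / 2) ^ DIM('a) \<le> moll_mass e TYPE('a::euclidean_space)"
proof -
  have m: "(\<lambda>x::'a. bump ((2 / e) *\<^sub>R x)) \<in> borel_measurable borel" by measurable
  have "unit_ball_vol (real DIM('a)) * (e / 2) ^ DIM('a) = measure lebesgue (ball (0::'a) (e / 2))"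
    using e by (simp add: content_ball)
  also have "\<dots> = (LINT x|lebesgue. indicator (ball (0::'a) (e / 2)) x)"
    by simp
  also have "\<dots> \<le> moll_mass e TYPE('a)"
    unfolding moll_mass_def
  proof (rule integral_mono)
    show "integrable lebesgue (\<lambda>x::'a. bump ((2 / e) *\<^sub>R x))"
      by (rule test_function_integrable[OF bump_scale_test[OF e]])
    show "integrable lebesgue (indicator (ball (0::'a) (e / 2)) :: 'a \<Rightarrow> real)"
      using emeasure_lborel_ball_finite[of "0::'a" "e/2"] by (intro integrable_real_indicator) auto
    show "indicator (ball 0 (e / 2)) x \<le> bump ((2 / e) *\<^sub>R x)" for x :: 'a
      using e bump_nonneg by (auto simp: indicator_def divide_simps intro!: bump_ge_1)
  qed
  finally show ?thesis .
qed

lemma moll_mass_pos: "0 < e \<Longrightarrow> 0 < moll_mass e TYPE('a::euclidean_space)"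
  by (rule less_le_trans[OF _ moll_mass_ge]) auto

context
  fixes e :: real
  assumes e: "0 < e"
begin

lemma moll_test: "(moll e :: 'a::euclidean_space \<Rightarrow> real) \<in> test_functions"
  unfolding moll_def[abs_def]
  using test_functions_cmult[OF bump_scale_test[OF e], of "1 / moll_mass e TYPE('a)"] by simp

lemma moll_nonneg: "0 \<le> moll e (x :: 'a::euclidean_space)"
  unfolding moll_def by (intro divide_nonneg_pos bump_nonneg moll_mass_pos e)

lemma moll_eq_0: "e \<le> norm x \<Longrightarrow> moll e (x :: 'a::euclidean_space) = 0"
  unfolding moll_def using e by (subst bump_eq_0) (auto simp: divide_simps)

lemma moll_continuous: "continuous_on UNIV (moll e :: 'a::euclidean_space \<Rightarrow> real)"
  by (rule test_function_continuous[OF moll_test])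

lemma moll_borel [measurable]: "(moll e :: 'a::euclidean_space \<Rightarrow> real) \<in> borel_measurable borel"
  by (rule borel_measurable_continuous_onI[OF moll_continuous])

lemma moll_minus: "moll e (x - y) = moll e (y - x)" for x y :: "'a::euclidean_space"
proof -
  have "bump (- z) = bump z" for z :: 'a by (simp add: bump_def)
  then have "bump ((2 / e) *\<^sub>R (x - y)) = bump ((2 / e) *\<^sub>R (y - x))"
    by (metis minus_diff_eq scaleR_minus_right)
  then show ?thesis by (simp add: moll_def)
qed

lemma moll_integral: "(LINT x|lebesgue. moll e (x::'a::euclidean_space)) = 1"
  using moll_mass_pos[OF e, where 'a='a] by (simp add: moll_def moll_mass_def)

lemma moll_le: "moll e (x::'a::euclidean_space) \<le> moll_const TYPE('a) / e ^ DIM('a)"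
proof -
  have "moll e x \<le> exp 2 / (unit_ball_vol (real DIM('a)) * (e / 2) ^ DIM('a))"
    unfolding moll_def using e moll_mass_ge[OF e, where 'a='a]
    by (intro frac_le bump_le) auto
  also have "\<dots> = (exp 2 * 2 ^ DIM('a) / unit_ball_vol (real DIM('a))) / e ^ DIM('a)"
    by (simp add: power_divide)
  also have "\<dots> \<le> moll_const TYPE('a) / e ^ DIM('a)"
    unfolding moll_const_def using e by (intro divide_right_mono) auto
  finally show ?thesis .
qed

lemma moll_shift_integral: "(LINT y|lebesgue. moll e (x - y)) = 1" for x :: "'a::euclidean_space"
  using integral_reflect[of "moll e" x] moll_integral by simp

lemma moll_shift_integrable: "integrable lebesgue (\<lambda>y. moll e (x - y))" for x :: "'a::euclidean_space"
proof -
  have "(\<lambda>y. moll e ((-1) *\<^sub>R y + x)) \<in> test_functions"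
    by (rule test_functions_affine[OF moll_test]) simp
  from test_function_integrable[OF this] show ?thesis by (simp add: algebra_simps)
qed

lemma moll_shift_nn_integral: "(\<integral>\<^sup>+y. ennreal (moll e (x - y)) \<partial>lebesgue) = 1" for x :: "'a::euclidean_space"
  using nn_integral_eq_integral[OF moll_shift_integrable[of x]]
  by (simp add: moll_nonneg moll_shift_integral)

text \<open>Every y receives total weight 1 from the kernel. F is replaced by a Borel
  representative, because Fubini's theorem is applied to the product of the uncompleted
  measures.\<close>

lemma moll_Tonelli:
  fixes F :: "'a::euclidean_space \<Rightarrow> ennreal"
  assumes F: "F \<in> borel_measurable lebesgue"
  shows "(\<integral>\<^sup>+x. (\<integral>\<^sup>+y. ennreal (moll e (x - y)) * F y \<partial>lebesgue) \<partial>lebesgue) = (\<integral>\<^sup>+y. F y \<partial>lebesgue)"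
proof -
  obtain F' where [measurable]: "F' \<in> borel_measurable borel" and ae: "AE x in lborel. F x = F' x"
    using completion_ex_borel_measurable[OF F] by auto
  have "(\<integral>\<^sup>+x. (\<integral>\<^sup>+y. ennreal (moll e (x - y)) * F y \<partial>lebesgue) \<partial>lebesgue)
      = (\<integral>\<^sup>+x. (\<integral>\<^sup>+y. ennreal (moll e (x - y)) * F' y \<partial>lborel) \<partial>lborel)"
    unfolding nn_integral_completion
    by (rule nn_integral_cong, rule nn_integral_cong_AE, rule eventually_mono[OF ae]) simp
  also have "\<dots> = (\<integral>\<^sup>+y. (\<integral>\<^sup>+x. ennreal (moll e (x - y)) * F' y \<partial>lborel) \<partial>lborel)"
    by (rule lborel_pair.Fubini') measurable
  also have "\<dots> = (\<integral>\<^sup>+y. F' y \<partial>lborel)"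
  proof (rule nn_integral_cong)
    fix y :: 'a
    have "(\<integral>\<^sup>+x. ennreal (moll e (x - y)) * F' y \<partial>lborel) = (\<integral>\<^sup>+x. ennreal (moll e (x - y)) \<partial>lborel) * F' y"
      by (rule nn_integral_multc) measurable
    also have "(\<integral>\<^sup>+x. ennreal (moll e (x - y)) \<partial>lborel) = 1"
      using moll_shift_nn_integral[of y] by (simp add: moll_minus[of _ y] nn_integral_completion)
    finally show "(\<integral>\<^sup>+x. ennreal (moll e (x - y)) * F' y \<partial>lborel) = F' y" by simp
  qed
  also have "\<dots> = (\<integral>\<^sup>+y. F y \<partial>lebesgue)"
    unfolding nn_integral_completion
    by (rule nn_integral_cong_AE, rule eventually_mono[OF ae]) simp
  finally show ?thesis .
qed

lemma moll_Tonelli_set: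
  fixes F :: "'a::euclidean_space \<Rightarrow> ennreal"
  assumes F: "F \<in> borel_measurable lebesgue" and D: "D' \<in> sets lebesgue" "\<And>x. x \<in> D \<Longrightarrow> cball x e \<subseteq> D'"
  shows "(\<integral>\<^sup>+x\<in>D. (\<integral>\<^sup>+y. ennreal (moll e (x - y)) * F y \<partial>lebesgue) \<partial>lebesgue) \<le> (\<integral>\<^sup>+y\<in>D'. F y \<partial>lebesgue)"
proof -
  have "(\<integral>\<^sup>+x\<in>D. (\<integral>\<^sup>+y. ennreal (moll e (x - y)) * F y \<partial>lebesgue) \<partial>lebesgue)
     \<le> (\<integral>\<^sup>+x. (\<integral>\<^sup>+y. ennreal (moll e (x - y)) * (F y * indicator D' y) \<partial>lebesgue) \<partial>lebesgue)"
  proof (rule nn_integral_mono)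
    fix x
    have "(\<integral>\<^sup>+y. ennreal (moll e (x - y)) * F y \<partial>lebesgue)
      \<le> (\<integral>\<^sup>+y. ennreal (moll e (x - y)) * (F y * indicator D' y) \<partial>lebesgue)" if "x \<in> D"
    proof (rule nn_integral_mono)
      fix y
      show "ennreal (moll e (x - y)) * F y \<le> ennreal (moll e (x - y)) * (F y * indicator D' y)"
      proof (cases "norm (x - y) \<le> e")
        case True
        then have "y \<in> D'" using D(2)[OF that] by (auto simp: dist_norm)
        then show ?thesis by simp
      next
        case False
        then show ?thesis using moll_eq_0[of "x - y"] by simp
      qed
    qed
    then show "(\<integral>\<^sup>+y. ennreal (moll e (x - y)) * F y \<partial>lebesgue) * indicator D x
      \<le> (\<integral>\<^sup>+y. ennreal (moll e (x - y)) * (F y * indicator D' y) \<partial>lebesgue)"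
      by (auto simp: indicator_def)
  qed
  also have "\<dots> = (\<integral>\<^sup>+y\<in>D'. F y \<partial>lebesgue)"
    by (rule moll_Tonelli) (use F D in \<open>auto intro!: borel_measurable_times_ennreal borel_measurable_indicator\<close>)
  finally show ?thesis .
qed

lemma norm_conv_moll_le:
  fixes u :: "'a::euclidean_space \<Rightarrow> 'b::{banach, second_countable_topology}"
  assumes u: "locally_integrable u"
  shows "ennreal (norm (conv (moll e) u x)) \<le> (\<integral>\<^sup>+y. ennreal (moll e (x - y)) * ennreal (norm (u y)) \<partial>lebesgue)"
proof -
  have "integrable lebesgue (\<lambda>y. moll e (x - y) *\<^sub>R u y)"
    by (rule integrable_conv[OF u moll_continuous moll_eq_0])
  from integral_norm_bound_ennreal[OF this]
  show ?thesis
    unfolding conv_def by (simp add: moll_nonneg ennreal_mult')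
qed

lemma conv_moll_L1:
  fixes u :: "'a::euclidean_space \<Rightarrow> 'b::{banach, second_countable_topology}"
  assumes u: "locally_integrable u" and D: "D' \<in> sets lebesgue" "\<And>x. x \<in> D \<Longrightarrow> cball x e \<subseteq> D'"
  shows "(\<integral>\<^sup>+x\<in>D. ennreal (norm (conv (moll e) u x)) \<partial>lebesgue) \<le> (\<integral>\<^sup>+x\<in>D'. ennreal (norm (u x)) \<partial>lebesgue)"
proof -
  have "(\<integral>\<^sup>+x\<in>D. ennreal (norm (conv (moll e) u x)) \<partial>lebesgue)
    \<le> (\<integral>\<^sup>+x\<in>D. (\<integral>\<^sup>+y. ennreal (moll e (x - y)) * ennreal (norm (u y)) \<partial>lebesgue) \<partial>lebesgue)"
    by (intro nn_integral_mono mult_right_mono norm_conv_moll_le u) simp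
  also have "\<dots> \<le> (\<integral>\<^sup>+x\<in>D'. ennreal (norm (u x)) \<partial>lebesgue)"
    using locally_integrable_measurable[OF u] by (intro moll_Tonelli_set D) measurable
  finally show ?thesis .
qed

lemma conv_moll_close:
  fixes w :: "'a::euclidean_space \<Rightarrow> real"
  assumes w: "locally_integrable w" and d: "\<And>y. norm (x - y) \<le> e \<Longrightarrow> \<bar>w y - w x\<bar> \<le> d"
  shows "\<bar>conv (moll e) w x - w x\<bar> \<le> d"
proof -
  have i: "integrable lebesgue (\<lambda>y. moll e (x - y) *\<^sub>R w y)"
    by (rule integrable_conv[OF w moll_continuous moll_eq_0])
  note i1 = moll_shift_integrable[of x]
  have "conv (moll e) w x - w x = (LINT y|lebesgue. moll e (x - y) *\<^sub>R w y) - (LINT y|lebesgue. w x * moll e (x - y))"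
    using moll_shift_integral[of x] by (simp add: conv_def)
  also have "\<dots> = (LINT y|lebesgue. moll e (x - y) * (w y - w x))"
    using i i1 by (subst Bochner_Integration.integral_diff[symmetric]) (auto simp: algebra_simps)
  also have "\<bar>\<dots>\<bar> \<le> (LINT y|lebesgue. d * moll e (x - y))"
    unfolding real_norm_def[symmetric]
  proof (rule order_trans[OF integral_norm_bound integral_mono[OF integrable_norm]])
    show "integrable lebesgue (\<lambda>y. moll e (x - y) * (w y - w x))"
      using Bochner_Integration.integrable_diff[OF i integrable_mult_right[OF i1, of "w x"]]
      by (simp add: algebra_simps)
    show "integrable lebesgue (\<lambda>y. d * moll e (x - y))" using i1 by simp
    fix y
    show "norm (moll e (x - y) * (w y - w x)) \<le> d * moll e (x - y)"
    proof (cases "norm (x - y) \<le> e")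
      case True
      have "\<bar>w y - w x\<bar> * moll e (x - y) \<le> d * moll e (x - y)"
        by (intro mult_right_mono d True moll_nonneg)
      then show ?thesis by (simp add: abs_mult moll_nonneg mult.commute)
    qed (use moll_eq_0[of "x - y"] in simp)
  qed
  also have "\<dots> = d" using moll_shift_integral[of x] by simp
  finally show ?thesis .
qed

end

section \<open>Convergence of mollifications in L^1 on balls\<close>

lemma conv_moll_uniform:
  fixes w :: "'a::euclidean_space \<Rightarrow> real"
  assumes w: "continuous_on UNIV w" and d: "0 < d"
  obtains e0 where "0 < e0" "e0 \<le> 1"
    "\<And>e x. 0 < e \<Longrightarrow> e \<le> e0 \<Longrightarrow> norm x \<le> R \<Longrightarrow> \<bar>conv (moll e) w x - w x\<bar> \<le> d"
proof -
  have "uniformly_continuous_on (cball 0 (R + 1)) w"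
    by (rule compact_uniformly_continuous) (use w in \<open>auto intro: continuous_on_subset\<close>)
  then obtain r where r: "r > 0"
      "\<And>x y. x \<in> cball 0 (R + 1) \<Longrightarrow> y \<in> cball 0 (R + 1) \<Longrightarrow> dist x y < r \<Longrightarrow> dist (w x) (w y) < d"
    using d unfolding uniformly_continuous_on_def by metis
  show thesis
  proof (rule that[of "min 1 (r/2)"])
    fix e :: real and x :: 'a assume e: "0 < e" "e \<le> min 1 (r / 2)" and x: "norm x \<le> R"
    show "\<bar>conv (moll e) w x - w x\<bar> \<le> d"
    proof (rule conv_moll_close[OF e(1) continuous_imp_locally_integrable[OF w]])
      fix y assume y: "norm (x - y) \<le> e"
      have "norm y \<le> norm x + norm (x - y)"
        using norm_triangle_ineq4[of x "x - y"] by simp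
      then have "dist (w y) (w x) < d"
        using x y e r(1) by (intro r(2)) (auto simp: dist_norm norm_minus_commute)
      then show "\<bar>w y - w x\<bar> \<le> d" by (simp add: dist_real_def)
    qed
  qed (use r in auto)
qed

text \<open>Truncation reduces to bounded u by dominated convergence. A measurable function is an
  almost everywhere limit of continuous ones; clamped to the same bounds, these converge in L^1 of
  the ball, again by dominated convergence.\<close>

lemma L1_approx_continuous:
  fixes u :: "'a::euclidean_space \<Rightarrow> real"
  assumes u: "locally_integrable u" and d: "0 < d"
  obtains w where "continuous_on UNIV w" "(\<integral>\<^sup>+x\<in>cball 0 R. ennreal \<bar>u x - w x\<bar> \<partial>lebesgue) \<le> ennreal d"
proof -
  define B where "B = cball (0::'a) R"
  have um [measurable]: "u \<in> borel_measurable lebesgue"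
    by (rule locally_integrable_measurable[OF u])
  have uB: "(\<integral>\<^sup>+x\<in>B. ennreal \<bar>u x\<bar> \<partial>lebesgue) < \<infinity>"
    using u unfolding locally_integrable_iff B_def by simp
  have mB [measurable]: "indicator B \<in> borel_measurable lebesgue" unfolding B_def by measurable
  define cl where "cl M t = max (- M) (min M t)" for M t :: real
  have cl_abs: "\<bar>t - cl M t\<bar> \<le> \<bar>t\<bar>" "0 \<le> M \<Longrightarrow> \<bar>cl M t\<bar> \<le> M" if "0 \<le> M" for M t
    using that by (auto simp: cl_def)
  have [measurable]: "cl M \<in> borel_measurable borel" for M
    unfolding cl_def[abs_def] by measurable
  have "(\<lambda>n. \<integral>\<^sup>+x\<in>B. ennreal \<bar>u x - cl (real n) (u x)\<bar> \<partial>lebesgue) \<longlonglongrightarrow> (\<integral>\<^sup>+x. 0 \<partial>(lebesgue :: 'a measure))"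
  proof (rule nn_integral_dominated_convergence[where w = "\<lambda>x. ennreal \<bar>u x\<bar> * indicator B x"])
    show "AE x in lebesgue. ennreal \<bar>u x - cl (real n) (u x)\<bar> * indicator B x \<le> ennreal \<bar>u x\<bar> * indicator B x" for n
      using cl_abs(1)[of "real n"] by (intro always_eventually allI mult_right_mono ennreal_leI) auto
    show "AE x in lebesgue. (\<lambda>n. ennreal \<bar>u x - cl (real n) (u x)\<bar> * indicator B x) \<longlonglongrightarrow> 0"
    proof (intro always_eventually allI)
      fix x
      obtain N :: nat where N: "\<bar>u x\<bar> \<le> real N" using real_arch_simple by blast
      have "\<forall>\<^sub>F n in sequentially. ennreal \<bar>u x - cl (real n) (u x)\<bar> * indicator B x = 0"
        using eventually_ge_at_top[of N] by eventually_elim (use N in \<open>auto simp: cl_def\<close>)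
      then show "(\<lambda>n. ennreal \<bar>u x - cl (real n) (u x)\<bar> * indicator B x) \<longlonglongrightarrow> 0"
        by (rule tendsto_eventually)
    qed
  qed (use uB in \<open>auto\<close>)
  then have "\<forall>\<^sub>F n in sequentially. (\<integral>\<^sup>+x\<in>B. ennreal \<bar>u x - cl (real n) (u x)\<bar> \<partial>lebesgue) < ennreal (d/2)"
    using d by (intro order_tendstoD(2)[where a="ennreal (d/2)"]) auto
  then obtain n where n: "(\<integral>\<^sup>+x\<in>B. ennreal \<bar>u x - cl (real n) (u x)\<bar> \<partial>lebesgue) < ennreal (d/2)"
    by (meson eventually_sequentially order_refl)
  have "u measurable_on UNIV"
    by (rule lebesgue_measurable_imp_measurable_on_real) auto
  then obtain N g where N: "negligible N" and g: "\<And>k. continuous_on UNIV (g k)"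
      "\<And>x. x \<notin> N \<Longrightarrow> (\<lambda>k. g k x) \<longlonglongrightarrow> u x"
    unfolding measurable_on_def by auto
  have gm [measurable]: "g k \<in> borel_measurable lebesgue" for k
    by (intro borel_imp_lebesgue borel_measurable_continuous_onI g)
  have ccl: "continuous_on UNIV (cl M)" for M
    unfolding cl_def[abs_def] by (intro continuous_intros)
  have "(\<lambda>k. \<integral>\<^sup>+x\<in>B. ennreal \<bar>cl (real n) (u x) - cl (real n) (g k x)\<bar> \<partial>lebesgue) \<longlonglongrightarrow> (\<integral>\<^sup>+x. 0 \<partial>(lebesgue :: 'a measure))"
  proof (rule nn_integral_dominated_convergence[where w = "\<lambda>x. ennreal (2 * real n) * indicator B x"])
    show "AE x in lebesgue. ennreal \<bar>cl (real n) (u x) - cl (real n) (g k x)\<bar> * indicator B x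
       \<le> ennreal (2 * real n) * indicator B x" for k
    proof (intro always_eventually allI mult_right_mono ennreal_leI)
      fix x
      show "\<bar>cl (real n) (u x) - cl (real n) (g k x)\<bar> \<le> 2 * real n"
        using cl_abs(2)[of "real n" "u x"] cl_abs(2)[of "real n" "g k x"] by simp
    qed auto
    have "AE x in lebesgue. x \<notin> N"
      using N by (intro AE_not_in) (simp add: negligible_iff_null_sets)
    then show "AE x in lebesgue. (\<lambda>k. ennreal \<bar>cl (real n) (u x) - cl (real n) (g k x)\<bar> * indicator B x) \<longlonglongrightarrow> 0"
    proof eventually_elim
      case (elim x)
      have "(\<lambda>k. cl (real n) (g k x)) \<longlonglongrightarrow> cl (real n) (u x)"
        using continuous_on_tendsto_compose[OF ccl[of "real n"] g(2)[OF elim]] by simp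
      then have "(\<lambda>k. \<bar>cl (real n) (u x) - cl (real n) (g k x)\<bar>) \<longlonglongrightarrow> \<bar>cl (real n) (u x) - cl (real n) (u x)\<bar>"
        by (intro tendsto_intros)
      then have "(\<lambda>k. ennreal \<bar>cl (real n) (u x) - cl (real n) (g k x)\<bar>) \<longlonglongrightarrow> 0"
        by (subst ennreal_tendsto_0_iff) auto
      then show ?case by (cases "x \<in> B") auto
    qed
    show "(\<integral>\<^sup>+x\<in>B. ennreal (2 * real n) \<partial>lebesgue) < \<infinity>"
      using emeasure_lborel_cball_finite[of "0::'a" R]
      by (subst nn_integral_cmult_indicator) (auto simp: B_def ennreal_mult_less_top)
  qed auto
  then have "\<forall>\<^sub>F k in sequentially. (\<integral>\<^sup>+x\<in>B. ennreal \<bar>cl (real n) (u x) - cl (real n) (g k x)\<bar> \<partial>lebesgue) < ennreal (d/2)"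
    using d by (intro order_tendstoD(2)[where a="ennreal (d/2)"]) auto
  then obtain k where k: "(\<integral>\<^sup>+x\<in>B. ennreal \<bar>cl (real n) (u x) - cl (real n) (g k x)\<bar> \<partial>lebesgue) < ennreal (d/2)"
    by (meson eventually_sequentially order_refl)
  show thesis
  proof (rule that)
    show "continuous_on UNIV (\<lambda>x. cl (real n) (g k x))"
      by (rule continuous_on_compose2[OF ccl g(1)]) auto
    have "(\<integral>\<^sup>+x\<in>B. ennreal \<bar>u x - cl (real n) (g k x)\<bar> \<partial>lebesgue)
       \<le> (\<integral>\<^sup>+x. ennreal \<bar>u x - cl (real n) (u x)\<bar> * indicator B x
            + ennreal \<bar>cl (real n) (u x) - cl (real n) (g k x)\<bar> * indicator B x \<partial>lebesgue)"
      by (intro nn_integral_mono) (auto simp: indicator_def intro!: ennreal_leI simp flip: ennreal_plus)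
    also have "\<dots> = (\<integral>\<^sup>+x\<in>B. ennreal \<bar>u x - cl (real n) (u x)\<bar> \<partial>lebesgue)
       + (\<integral>\<^sup>+x\<in>B. ennreal \<bar>cl (real n) (u x) - cl (real n) (g k x)\<bar> \<partial>lebesgue)"
      by (rule nn_integral_add; measurable)
    also have "\<dots> \<le> ennreal (d/2) + ennreal (d/2)"
      using n k by (intro add_mono) auto
    also have "\<dots> = ennreal d"
      using d by (simp flip: ennreal_plus)
    finally show "(\<integral>\<^sup>+x\<in>cball 0 R. ennreal \<bar>u x - cl (real n) (g k x)\<bar> \<partial>lebesgue) \<le> ennreal d"
      by (simp add: B_def)
  qed
qed

lemma conv_diff:
  fixes u w :: "'a::euclidean_space \<Rightarrow> 'b::{banach, second_countable_topology}"
  assumes "0 < e" "locally_integrable u" "locally_integrable w"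
  shows "conv (moll e) (\<lambda>x. u x - w x) x = conv (moll e) u x - conv (moll e) w x"
  unfolding conv_def scaleR_diff_right
  by (intro Bochner_Integration.integral_diff integrable_conv[OF _ moll_continuous moll_eq_0] assms)

lemma continuous_conv_moll:
  fixes u :: "'a::euclidean_space \<Rightarrow> real"
  assumes "0 < e" "locally_integrable u"
  shows "continuous_on UNIV (conv (moll e) u)"
proof -
  obtain G R where "C1c_gradient (moll e :: 'a \<Rightarrow> real) G R"
    using test_function_C1_gradient[OF moll_test[OF assms(1)]] by blast
  from C1_gradient_conv[OF assms(2) this] show ?thesis
    by (rule C1_gradientD(3))
qed

text \<open>Three terms: u - w is small in L^1 of a ball one unit larger, mollification maps that
  norm to the smaller ball without increase, and for continuous w the convergence is uniform. The
  threshold form, for all e <= e0, allows the radius to be shrunk further for other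
  purposes.\<close>

lemma conv_moll_L1_tendsto:
  fixes u :: "'a::euclidean_space \<Rightarrow> real"
  assumes u: "locally_integrable u" and d: "0 < d"
  obtains e0 where "0 < e0" "e0 \<le> 1"
    "\<And>e. 0 < e \<Longrightarrow> e \<le> e0 \<Longrightarrow> (\<integral>\<^sup>+x\<in>cball 0 R. ennreal \<bar>conv (moll e) u x - u x\<bar> \<partial>lebesgue) \<le> ennreal d"
proof -
  obtain w where w: "continuous_on UNIV w" "(\<integral>\<^sup>+x\<in>cball 0 (R + 1). ennreal \<bar>u x - w x\<bar> \<partial>lebesgue) \<le> ennreal (d/3)"
    using L1_approx_continuous[OF u, of "d/3" "R + 1"] d by auto
  define V where "V = measure lebesgue (cball (0::'a) R)"
  have V: "emeasure lebesgue (cball (0::'a) R) = ennreal V" "0 \<le> V"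
    unfolding V_def using emeasure_lborel_cball_finite[of "0::'a" R]
    by (auto intro!: emeasure_eq_ennreal_measure)
  define r where "r = d / 3 / (V + 1)"
  have r: "0 < r" "r * V \<le> d / 3"
    using d V(2) by (auto simp: r_def field_simps)
  obtain e0 where e0: "0 < e0" "e0 \<le> 1"
    "\<And>e x. 0 < e \<Longrightarrow> e \<le> e0 \<Longrightarrow> norm x \<le> R \<Longrightarrow> \<bar>conv (moll e) w x - w x\<bar> \<le> r"
    using conv_moll_uniform[OF w(1) r(1)] by metis
  have wl: "locally_integrable w" by (rule continuous_imp_locally_integrable[OF w(1)])
  have uw: "locally_integrable (\<lambda>x. u x - w x)"
    using locally_integrable_add_scale[OF u wl, of 1 "-1"] by simp
  have [measurable]: "u \<in> borel_measurable lebesgue" "w \<in> borel_measurable lebesgue"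
    using locally_integrable_measurable u wl by blast+
  show thesis
  proof (rule that[OF e0(1,2)])
    fix e assume e: "0 < e" "e \<le> e0"
    have [measurable]: "conv (moll e) u \<in> borel_measurable lebesgue" "conv (moll e) w \<in> borel_measurable lebesgue"
      "conv (moll e) (\<lambda>x. u x - w x) \<in> borel_measurable lebesgue"
      using continuous_conv_moll[OF e(1)] u wl uw by (auto intro!: borel_imp_lebesgue borel_measurable_continuous_onI)
    have "(\<integral>\<^sup>+x\<in>cball 0 R. ennreal \<bar>conv (moll e) u x - u x\<bar> \<partial>lebesgue)
      \<le> (\<integral>\<^sup>+x. ennreal \<bar>conv (moll e) (\<lambda>x. u x - w x) x\<bar> * indicator (cball 0 R) x
          + (ennreal r * indicator (cball 0 R) x + ennreal \<bar>u x - w x\<bar> * indicator (cball 0 R) x) \<partial>lebesgue)"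
    proof (rule nn_integral_mono)
      fix x
      have "\<bar>conv (moll e) u x - u x\<bar> \<le> \<bar>conv (moll e) (\<lambda>x. u x - w x) x\<bar> + (r + \<bar>u x - w x\<bar>)" if "norm x \<le> R"
        using e0(3)[OF e that] conv_diff[OF e(1) u wl, of x] by simp
      then show "ennreal \<bar>conv (moll e) u x - u x\<bar> * indicator (cball 0 R) x
        \<le> ennreal \<bar>conv (moll e) (\<lambda>x. u x - w x) x\<bar> * indicator (cball 0 R) x
          + (ennreal r * indicator (cball 0 R) x + ennreal \<bar>u x - w x\<bar> * indicator (cball 0 R) x)"
        using r by (auto simp: indicator_def intro!: ennreal_leI simp flip: ennreal_plus)
    qed
    also have "\<dots> = (\<integral>\<^sup>+x\<in>cball 0 R. ennreal \<bar>conv (moll e) (\<lambda>x. u x - w x) x\<bar> \<partial>lebesgue)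
      + ((\<integral>\<^sup>+x\<in>cball (0::'a) R. ennreal r \<partial>lebesgue) + (\<integral>\<^sup>+x\<in>cball 0 R. ennreal \<bar>u x - w x\<bar> \<partial>lebesgue))"
    proof -
      have 1: "(\<lambda>x. ennreal \<bar>conv (moll e) (\<lambda>x. u x - w x) x\<bar> * indicator (cball 0 R) x) \<in> borel_measurable lebesgue"
        and 2: "(\<lambda>x. ennreal r * indicator (cball (0::'a) R) x) \<in> borel_measurable lebesgue"
        and 3: "(\<lambda>x. ennreal \<bar>u x - w x\<bar> * indicator (cball 0 R) x) \<in> borel_measurable lebesgue"
        by measurable
      show ?thesis
        by (simp only: nn_integral_add[OF 1 borel_measurable_add[OF 2 3]] nn_integral_add[OF 2 3])
    qed
    also have "\<dots> \<le> ennreal (d/3) + (ennreal (d/3) + ennreal (d/3))"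
    proof (intro add_mono)
      have sub: "cball x e \<subseteq> cball 0 (R + 1)" if "x \<in> cball 0 R" for x :: 'a
        using that e e0 by (simp add: cball_subset_cball_iff)
      have "(\<integral>\<^sup>+x\<in>cball 0 R. ennreal \<bar>conv (moll e) (\<lambda>x. u x - w x) x\<bar> \<partial>lebesgue)
        \<le> (\<integral>\<^sup>+x\<in>cball 0 (R + 1). ennreal \<bar>u x - w x\<bar> \<partial>lebesgue)"
        using conv_moll_L1[OF e(1) uw lebesgue_sets_basic(1), of "cball 0 R" 0 "R + 1"] sub by simp
      then show "(\<integral>\<^sup>+x\<in>cball 0 R. ennreal \<bar>conv (moll e) (\<lambda>x. u x - w x) x\<bar> \<partial>lebesgue) \<le> ennreal (d/3)"
        using w(2) by (rule order_trans)
      show "(\<integral>\<^sup>+x\<in>cball (0::'a) R. ennreal r \<partial>lebesgue) \<le> ennreal (d/3)"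
        using r V by (subst nn_integral_cmult_indicator) (auto simp flip: ennreal_mult intro: ennreal_leI)
      have "(\<integral>\<^sup>+x\<in>cball 0 R. ennreal \<bar>u x - w x\<bar> \<partial>lebesgue) \<le> (\<integral>\<^sup>+x\<in>cball 0 (R + 1). ennreal \<bar>u x - w x\<bar> \<partial>lebesgue)"
        by (intro nn_integral_mono) (auto simp: indicator_def)
      then show "(\<integral>\<^sup>+x\<in>cball 0 R. ennreal \<bar>u x - w x\<bar> \<partial>lebesgue) \<le> ennreal (d/3)"
        using w(2) by (rule order_trans)
    qed
    also have "\<dots> = ennreal d" using d by (simp flip: ennreal_plus)
    finally show "(\<integral>\<^sup>+x\<in>cball 0 R. ennreal \<bar>conv (moll e) u x - u x\<bar> \<partial>lebesgue) \<le> ennreal d" .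
  qed
qed

section \<open>Mollification in the variable exponent space\<close>

locale log_Holder_exponent = exponent p P for p :: "'a::euclidean_space \<Rightarrow> real" and P +
  fixes c1 :: real
  assumes c1: "0 < c1"
    and log_Holder: "x \<noteq> y \<Longrightarrow> \<bar>p x - p y\<bar> \<le> c1 / ln (exp 1 + 1 / norm (x - y))"
begin

text \<open>The modulus of continuity of p. It is used through two properties: it tends to 0, and
  \<open>osc e * ln (1 / e)\<close> stays below c1, so that e^(-osc e) is bounded.\<close>

definition osc :: "real \<Rightarrow> real" where "osc e = c1 / ln (exp 1 + 1 / e)"

lemma ln_osc_ge_1:
  fixes e :: real
  assumes "0 < e"
  shows "1 \<le> ln (exp 1 + 1 / e)"
proof -
  have "ln (exp 1) \<le> ln (exp 1 + 1 / e)"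
    using assms by (subst ln_le_cancel_iff) (auto intro: add_pos_pos)
  then show ?thesis by simp
qed

lemma osc_pos: "0 < e \<Longrightarrow> 0 < osc e"
  unfolding osc_def using ln_osc_ge_1[of e] c1 by simp

lemma osc_le: "0 < e \<Longrightarrow> osc e \<le> c1"
  unfolding osc_def using ln_osc_ge_1[of e] c1 by (simp add: divide_le_eq)

lemma osc_ln_le: "0 < e \<Longrightarrow> osc e * ln (1 / e) \<le> c1"
proof -
  assume e: "0 < e"
  have "ln (1 / e) \<le> ln (exp 1 + 1 / e)"
    using e by (subst ln_le_cancel_iff) (auto intro: add_pos_pos)
  then show ?thesis
    unfolding osc_def using ln_osc_ge_1[OF e] c1 by (simp add: divide_le_eq)
qed

lemma p_osc:
  assumes "norm (x - y) \<le> e" "0 < e"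
  shows "\<bar>p x - p y\<bar> \<le> osc e"
proof (cases "x = y")
  case True
  then show ?thesis using osc_pos assms by (simp add: less_imp_le)
next
  case False
  then have n: "0 < norm (x - y)" by simp
  have "\<bar>p x - p y\<bar> \<le> c1 / ln (exp 1 + 1 / norm (x - y))"
    by (rule log_Holder[OF False])
  also have "\<dots> \<le> osc e"
    unfolding osc_def using n assms c1 ln_osc_ge_1[OF assms(2)]
    by (intro divide_left_mono ln_mono add_left_mono mult_pos_pos frac_le)
       (auto intro!: add_pos_pos less_le_trans[OF _ ln_osc_ge_1[OF n]])
  finally show ?thesis .
qed

lemma osc_tendsto:
  assumes "0 < d"
  obtains e0 where "0 < e0" "\<And>e. 0 < e \<Longrightarrow> e \<le> e0 \<Longrightarrow> osc e \<le> d"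
proof (rule that[of "exp (- c1 / d)"])
  fix e assume e: "0 < e" "e \<le> exp (- c1 / d)"
  have "ln e \<le> - c1 / d"
    using e by (metis exp_gt_zero ln_exp ln_le_cancel_iff)
  then have "c1 / d \<le> ln (1 / e)" using e by (simp add: ln_div)
  also have "\<dots> \<le> ln (exp 1 + 1 / e)"
    using e by (subst ln_le_cancel_iff) (auto intro: add_pos_pos)
  finally show "osc e \<le> d"
    unfolding osc_def using ln_osc_ge_1[OF e(1)] assms by (simp add: divide_le_eq mult.commute)
qed simp

text \<open>Bounds (C/e^n)^(osc e) with C = \<open>moll_const\<close>: the part with C is at most
  C^c1, and the power of 1/e is at most exp (n c1) by the logarithmic modulus.\<close>

definition moll_bound :: real where
  "moll_bound = moll_const TYPE('a) powr c1 * exp (real DIM('a) * c1)"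

lemma moll_bound_ge_1: "1 \<le> moll_bound"
proof -
  have "1 \<le> moll_const TYPE('a) powr c1"
    using c1 by (intro ge_one_powr_ge_zero) (auto simp: moll_const_def)
  moreover have "1 \<le> exp (real DIM('a) * c1)" using c1 by simp
  ultimately have "1 * 1 \<le> moll_const TYPE('a) powr c1 * exp (real DIM('a) * c1)"
    by (intro mult_mono) auto
  then show ?thesis by (simp add: moll_bound_def)
qed

text \<open>Jensen's inequality with variable exponent for functions without small values. Within
  distance e of x the exponent is at least q, so Jensen holds with q. Passing from q to p(x) costs
  at most A^(osc e) when A > 1, and A is at most the kernel bound C/e^n because the modular is at
  most 1; log-Hoelder continuity bounds that factor.\<close>

lemma moll_powr_large:
  assumes e: "0 < e" "e \<le> 1" and F: "F \<in> borel_measurable lebesgue" "\<And>y. F y = 0 \<or> 1 \<le> F y"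
    and mod: "modular p F \<le> 1"
  shows "integrable lebesgue (\<lambda>y. moll e (x - y) * F y)"
    and "integrable lebesgue (\<lambda>y. moll e (x - y) * F y powr p y)"
    and "(LINT y|lebesgue. moll e (x - y) * F y) powr p x
       \<le> moll_bound * (LINT y|lebesgue. moll e (x - y) * F y powr p y)"
proof -
  note [measurable] = F(1)
  have F0: "0 \<le> F y" for y using F(2)[of y] by auto
  define S where "S = moll_const TYPE('a) / e ^ DIM('a)"
  have S1: "1 \<le> S"
    using e by (auto simp: S_def moll_const_def le_divide_eq power_le_one intro: order_trans[OF power_le_one])
  have mS: "moll e (z::'a) \<le> S" for z unfolding S_def by (rule moll_le[OF e(1)])
  have mm [measurable]: "(\<lambda>y. moll e (x - y)) \<in> borel_measurable lebesgue"
    using e(1) by (intro borel_imp_lebesgue) measurable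
  note m0 = moll_nonneg[OF e(1), where 'a='a]
  have le: "(\<integral>\<^sup>+y. ennreal (moll e (x - y) * F y powr p y) \<partial>lebesgue) \<le> ennreal S"
  proof -
    have "(\<integral>\<^sup>+y. ennreal (moll e (x - y) * F y powr p y) \<partial>lebesgue)
       \<le> (\<integral>\<^sup>+y. ennreal S * ennreal (\<bar>F y\<bar> powr p y) \<partial>lebesgue)"
      using S1 F0 by (intro nn_integral_mono) (auto simp: mS intro!: ennreal_leI mult_right_mono simp flip: ennreal_mult')
    also have "\<dots> = ennreal S * modular p F"
      unfolding modular_def by (rule nn_integral_cmult) measurable
    also have "\<dots> \<le> ennreal S * 1" by (intro mult_left_mono mod) simp
    finally show ?thesis by simp
  qed
  show iM: "integrable lebesgue (\<lambda>y. moll e (x - y) * F y powr p y)"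
    unfolding integrable_iff_bounded using le m0
    by (auto simp: abs_mult order_le_less_trans)
  have F_le: "F y \<le> F y powr p y" for y
    using F(2)[of y] powr_mono[of 1 "p y" "F y"] p_ge[of y] by auto
  show iA: "integrable lebesgue (\<lambda>y. moll e (x - y) * F y)"
  proof (rule Bochner_Integration.integrable_bound[OF iM])
    show "AE y in lebesgue. norm (moll e (x - y) * F y) \<le> norm (moll e (x - y) * F y powr p y)"
      using m0 F0 F_le by (intro always_eventually allI) (auto simp: abs_mult intro!: mult_left_mono)
  qed measurable
  define A where "A = (LINT y|lebesgue. moll e (x - y) * F y)"
  define M where "M = (LINT y|lebesgue. moll e (x - y) * F y powr p y)"
  have A0: "0 \<le> A" unfolding A_def using m0 F0 by (intro integral_nonneg_AE) auto
  have M0: "0 \<le> M" unfolding M_def using m0 by (intro integral_nonneg_AE) auto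
  have MS: "M \<le> S"
  proof -
    have "ennreal M \<le> ennreal S"
      using nn_integral_eq_integral[OF iM] m0 le by (simp add: M_def)
    then show ?thesis using S1 by simp
  qed
  have AM: "A \<le> M"
    unfolding A_def M_def using m0 F_le by (intro integral_mono iA iM mult_left_mono) auto
  \<comment> \<open>The maximum with 1 keeps q admissible for the tangent inequality when p(x) is
    close to 1.\<close>
  define q where "q = max 1 (p x - osc e)"
  have q: "1 \<le> q" "q \<le> p x" "p x - q \<le> osc e"
    using p_ge[of x] osc_pos[OF e(1)] by (auto simp: q_def)
  have qy: "q \<le> p y" if "norm (x - y) \<le> e" for y
    using p_osc[OF that e(1)] p_ge[of y] by (auto simp: q_def)
  have "A powr p x \<le> moll_bound * M"
  proof (cases "A = 0")
    case True
    then show ?thesis using M0 moll_bound_ge_1 by simp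
  next
    case False
    then have A: "0 < A" using A0 by simp
    \<comment> \<open>The tangent at the mean A is integrated against the kernel. Beyond distance e
      the kernel vanishes, so q <= p(y) is needed only where it is known.\<close>
    have Aq: "A powr q \<le> M"
    proof -
      define k where "k = q * A powr (q - 1)"
      have "A powr q = (LINT y|lebesgue. (A powr q - k * A) * moll e (x - y) + k * (moll e (x - y) * F y))"
        using iA moll_shift_integrable[OF e(1), of x] moll_shift_integral[OF e(1), of x]
        by (simp add: A_def[symmetric])
      also have "\<dots> \<le> M"
        unfolding M_def
      proof (rule integral_mono[OF _ iM])
        show "integrable lebesgue (\<lambda>y. (A powr q - k * A) * moll e (x - y) + k * (moll e (x - y) * F y))"
          using iA moll_shift_integrable[OF e(1), of x] by simp
        fix y
        show "(A powr q - k * A) * moll e (x - y) + k * (moll e (x - y) * F y) \<le> moll e (x - y) * F y powr p y"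
        proof (cases "norm (x - y) \<le> e")
          case True
          have "A powr q + k * (F y - A) \<le> F y powr q"
            unfolding k_def by (rule powr_ge_tangent[OF A F0 q(1)])
          also have "\<dots> \<le> F y powr p y"
            using F(2)[of y] qy[OF True] by (cases "F y = 0") (simp_all add: powr_mono)
          finally have "moll e (x - y) * (A powr q + k * (F y - A)) \<le> moll e (x - y) * F y powr p y"
            by (intro mult_left_mono m0)
          then show ?thesis by (simp add: algebra_simps)
        next
          case False
          then show ?thesis using moll_eq_0[OF e(1), of "x - y"] by simp
        qed
      qed
      finally show ?thesis .
    qed
    show ?thesis
    proof (cases "A \<le> 1")
      case True
      have "A powr p x \<le> A powr q" using A True q by (intro powr_mono') auto
      also have "\<dots> \<le> 1 * M" using Aq by simp
      also have "\<dots> \<le> moll_bound * M" using moll_bound_ge_1 M0 by (intro mult_right_mono)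
      finally show ?thesis .
    next
      case False
      have "A powr p x = A powr (p x - q) * A powr q" using A by (simp flip: powr_add)
      also have "\<dots> \<le> S powr osc e * M"
      proof (intro mult_mono Aq)
        have "A powr (p x - q) \<le> A powr osc e" using False q by (intro powr_mono) auto
        also have "\<dots> \<le> S powr osc e" using A AM MS osc_pos[OF e(1)] by (intro powr_mono2) auto
        finally show "A powr (p x - q) \<le> S powr osc e" .
      qed auto
      also have "\<dots> \<le> moll_bound * M"
      proof (intro mult_right_mono M0)
        have "S powr osc e = moll_const TYPE('a) powr osc e * (1 / e) powr (real DIM('a) * osc e)"
          unfolding S_def using e
          by (simp add: powr_divide powr_mult powr_powr[symmetric] powr_realpow divide_inverse power_inverse
              moll_const_def inverse_powr)
        also have "\<dots> \<le> moll_bound"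
          unfolding moll_bound_def
        proof (intro mult_mono)
          show "moll_const TYPE('a) powr osc e \<le> moll_const TYPE('a) powr c1"
            using osc_le[OF e(1)] by (intro powr_mono) (auto simp: moll_const_def)
          have "(1 / e) powr (real DIM('a) * osc e) = exp (real DIM('a) * (osc e * ln (1 / e)))"
            using e by (simp add: powr_def mult_ac)
          also have "\<dots> \<le> exp (real DIM('a) * c1)"
            using osc_ln_le[OF e(1)] by (auto intro!: mult_left_mono)
          finally show "(1 / e) powr (real DIM('a) * osc e) \<le> exp (real DIM('a) * c1)" .
        qed auto
        finally show "S powr osc e \<le> moll_bound" .
      qed
      finally show ?thesis .
    qed
  qed
  then show "(LINT y|lebesgue. moll e (x - y) * F y) powr p x
       \<le> moll_bound * (LINT y|lebesgue. moll e (x - y) * F y powr p y)"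
    unfolding A_def M_def .
qed

text \<open>For t <= 1 and a < b the difference is t^a (1 - t^(b-a)), at most (b - a) t ln(1/t), and
  t ln(1/t) <= 1.\<close>

lemma powr_exponent_change:
  fixes t a b :: real
  assumes "0 \<le> t" "t \<le> 1" "1 \<le> a" "1 \<le> b"
  shows "t powr a \<le> t powr b + \<bar>a - b\<bar>"
proof (cases "t = 0 \<or> b \<le> a")
  case True
  then show ?thesis using assms powr_mono'[of b a t] by auto
next
  case False
  then have t: "0 < t" and ab: "a < b" using assms by auto
  define s where "s = (b - a) * (- ln t)"
  have s0: "0 \<le> s" using assms t ab by (auto simp: s_def mult_le_0_iff)
  have "t powr b = t powr a * exp (- s)"
    using t by (simp add: powr_def s_def algebra_simps flip: exp_add)
  then have "t powr a - t powr b = t powr a * (1 - exp (- s))" by (simp add: algebra_simps)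
  also have "\<dots> \<le> t powr 1 * s"
    using exp_ge_add_one_self[of "-s"] assms s0 by (intro mult_mono powr_mono') auto
  also have "\<dots> = (b - a) * (t * (- ln t))" using t by (simp add: s_def)
  also have "\<dots> \<le> (b - a) * 1"
  proof (intro mult_left_mono)
    have "ln (1 / t) \<le> 1 / t - 1" using t by (intro ln_le_minus_one) auto
    then have "t * ln (1 / t) \<le> t * (1 / t - 1)" using t by (intro mult_left_mono) auto
    also have "\<dots> \<le> 1" using t by (simp add: algebra_simps)
    finally show "t * (- ln t) \<le> 1" using t by (simp add: ln_div)
  qed (use ab in auto)
  finally show ?thesis using ab by simp
qed

lemma moll_powr_small:
  assumes e: "0 < e" "e \<le> 1" and F: "F \<in> borel_measurable lebesgue" "\<And>y. 0 \<le> F y" "\<And>y. F y \<le> 1"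
  shows "integrable lebesgue (\<lambda>y. moll e (x - y) * F y)"
    and "integrable lebesgue (\<lambda>y. moll e (x - y) * F y powr p y)"
    and "(LINT y|lebesgue. moll e (x - y) * F y) powr p x
       \<le> (LINT y|lebesgue. moll e (x - y) * F y powr p y) + osc e"
proof -
  note [measurable] = F(1)
  have mm [measurable]: "(\<lambda>y. moll e (x - y)) \<in> borel_measurable lebesgue"
    using e(1) by (intro borel_imp_lebesgue) measurable
  note m0 = moll_nonneg[OF e(1), where 'a='a] and i1 = moll_shift_integrable[OF e(1), of x]
  have bd: "integrable lebesgue (\<lambda>y. moll e (x - y) * H y)"
    if [measurable]: "H \<in> borel_measurable lebesgue" and "\<And>y. \<bar>H y\<bar> \<le> 1" for H
    by (rule Bochner_Integration.integrable_bound[OF i1])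
       (use that m0 in \<open>auto simp: abs_mult intro!: mult_left_le always_eventually\<close>)
  show iA: "integrable lebesgue (\<lambda>y. moll e (x - y) * F y)"
    by (rule bd) (use F in auto)
  show iM: "integrable lebesgue (\<lambda>y. moll e (x - y) * F y powr p y)"
    by (rule bd) (use F p_ge in \<open>auto intro!: powr_le1 simp: order_trans[OF zero_le_one]\<close>)
  have iQ: "integrable lebesgue (\<lambda>y. moll e (x - y) * F y powr p x)"
    by (rule bd) (use F p_ge in \<open>auto intro!: powr_le1 simp: order_trans[OF zero_le_one]\<close>)
  define A where "A = (LINT y|lebesgue. moll e (x - y) * F y)"
  have A0: "0 \<le> A" unfolding A_def using m0 F by (intro integral_nonneg_AE) auto
  have "A powr p x \<le> (LINT y|lebesgue. moll e (x - y) * F y powr p x)"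
  proof (cases "A = 0")
    case True
    then show ?thesis using m0 by (auto intro!: integral_nonneg_AE)
  next
    case False
    then have A: "0 < A" using A0 by simp
    define k where "k = p x * A powr (p x - 1)"
    have "A powr p x = (LINT y|lebesgue. (A powr p x - k * A) * moll e (x - y) + k * (moll e (x - y) * F y))"
      using iA i1 moll_shift_integral[OF e(1), of x]
      by (simp add: A_def[symmetric])
    also have "\<dots> \<le> (LINT y|lebesgue. moll e (x - y) * F y powr p x)"
    proof (rule integral_mono[OF _ iQ])
      show "integrable lebesgue (\<lambda>y. (A powr p x - k * A) * moll e (x - y) + k * (moll e (x - y) * F y))"
        using iA i1 by simp
      fix y
      have "A powr p x + k * (F y - A) \<le> F y powr p x"
        unfolding k_def by (rule powr_ge_tangent[OF A F(2) p_ge])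
      then have "moll e (x - y) * (A powr p x + k * (F y - A)) \<le> moll e (x - y) * F y powr p x"
        by (intro mult_left_mono m0)
      then show "(A powr p x - k * A) * moll e (x - y) + k * (moll e (x - y) * F y) \<le> moll e (x - y) * F y powr p x"
        by (simp add: algebra_simps)
    qed
    finally show ?thesis .
  qed
  also have "\<dots> \<le> (LINT y|lebesgue. moll e (x - y) * F y powr p y + osc e * moll e (x - y))"
  proof (rule integral_mono[OF iQ])
    show "integrable lebesgue (\<lambda>y. moll e (x - y) * F y powr p y + osc e * moll e (x - y))"
      using iM i1 by simp
    fix y
    show "moll e (x - y) * F y powr p x \<le> moll e (x - y) * F y powr p y + osc e * moll e (x - y)"
    proof (cases "norm (x - y) \<le> e")
      case True
      have "F y powr p x \<le> F y powr p y + \<bar>p x - p y\<bar>"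
        by (rule powr_exponent_change[OF F(2,3) p_ge p_ge])
      also have "\<dots> \<le> F y powr p y + osc e" using p_osc[OF True e(1)] by simp
      finally have "moll e (x - y) * F y powr p x \<le> moll e (x - y) * (F y powr p y + osc e)"
        by (intro mult_left_mono m0)
      then show ?thesis by (simp add: algebra_simps)
    next
      case False
      then show ?thesis using moll_eq_0[OF e(1), of "x - y"] by simp
    qed
  qed
  also have "\<dots> = (LINT y|lebesgue. moll e (x - y) * F y powr p y) + osc e"
    using iM i1 moll_shift_integral[OF e(1), of x] by simp
  finally show "(LINT y|lebesgue. moll e (x - y) * F y) powr p x
       \<le> (LINT y|lebesgue. moll e (x - y) * F y powr p y) + osc e"
    unfolding A_def .
qed

text \<open>|g| is split at level 1, since exponents are compared multiplicatively for large values
  and additively for small ones.\<close>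

lemma conv_moll_powr_le:
  fixes g :: "'a \<Rightarrow> 'a"
  assumes e: "0 < e" "e \<le> 1" and g: "g \<in> borel_measurable lebesgue"
    and mod: "modular p (\<lambda>x. norm (g x)) \<le> 1"
  shows "ennreal (norm (conv (moll e) g x) powr p x)
    \<le> ennreal (2 powr P * moll_bound) *
       ((\<integral>\<^sup>+y. ennreal (moll e (x - y)) * ennreal (norm (g y) powr p y) \<partial>lebesgue) + ennreal (osc e))"
proof -
  note [measurable] = g
  define F1 where "F1 y = (if 1 \<le> norm (g y) then norm (g y) else 0)" for y
  define F2 where "F2 y = (if 1 \<le> norm (g y) then 0 else norm (g y))" for y
  have [measurable]: "F1 \<in> borel_measurable lebesgue" "F2 \<in> borel_measurable lebesgue"
    unfolding F1_def F2_def by measurable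
  have "modular p F1 \<le> modular p (\<lambda>x. norm (g x))"
    by (rule modular_mono) (auto simp: F1_def)
  then have m1: "modular p F1 \<le> 1" using mod by (rule order_trans)
  have F1: "F1 y = 0 \<or> 1 \<le> F1 y" for y by (auto simp: F1_def)
  have F2: "0 \<le> F2 y" "F2 y \<le> 1" for y by (auto simp: F2_def)
  note L = moll_powr_large[OF e _ F1 m1, where x=x] and S = moll_powr_small[OF e _ F2, where x=x]
  have mm: "F1 \<in> borel_measurable lebesgue" "F2 \<in> borel_measurable lebesgue" by measurable
  note L = L[OF mm(1)] and S = S[OF mm(2)]
  note m0 = moll_nonneg[OF e(1), where 'a='a]
  let ?A1 = "LINT y|lebesgue. moll e (x - y) * F1 y" and ?A2 = "LINT y|lebesgue. moll e (x - y) * F2 y"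
  let ?M1 = "LINT y|lebesgue. moll e (x - y) * F1 y powr p y" and ?M2 = "LINT y|lebesgue. moll e (x - y) * F2 y powr p y"
  have A0: "0 \<le> ?A1" "0 \<le> ?A2" "0 \<le> ?M1" "0 \<le> ?M2"
    using m0 F1 F2 by (auto intro!: integral_nonneg_AE simp: F1_def)
  have "norm (conv (moll e) g x) \<le> (LINT y|lebesgue. norm (moll e (x - y) *\<^sub>R g y))"
    unfolding conv_def by (rule integral_norm_bound)
  also have "(\<lambda>y. norm (moll e (x - y) *\<^sub>R g y)) = (\<lambda>y. moll e (x - y) * F1 y + moll e (x - y) * F2 y)"
    using m0 by (auto simp: F1_def F2_def)
  also have "(LINT y|lebesgue. moll e (x - y) * F1 y + moll e (x - y) * F2 y) = ?A1 + ?A2"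
    using L(1) S(1) by simp
  finally have "norm (conv (moll e) g x) powr p x \<le> (?A1 + ?A2) powr p x"
    using p_ge[of x] by (intro powr_mono2) auto
  also have "\<dots> \<le> 2 powr P * (?A1 powr p x + ?A2 powr p x)"
    by (rule powr_add_le[OF A0(1,2) p_ge p_le])
  also have "\<dots> \<le> 2 powr P * (moll_bound * ?M1 + (?M2 + osc e))"
    by (intro mult_left_mono add_mono L(3) S(3)) simp
  also have "\<dots> \<le> 2 powr P * (moll_bound * ?M1 + moll_bound * (?M2 + osc e))"
    using moll_bound_ge_1 A0 osc_pos[OF e(1)]
    by (intro mult_left_mono add_left_mono mult_le_cancel_right1[THEN iffD2]) auto
  also have "\<dots> = (2 powr P * moll_bound) * ((?M1 + ?M2) + osc e)"
    by (simp add: algebra_simps)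
  finally have "ennreal (norm (conv (moll e) g x) powr p x) \<le> ennreal ((2 powr P * moll_bound) * ((?M1 + ?M2) + osc e))"
    by (rule ennreal_leI)
  also have "\<dots> = ennreal (2 powr P * moll_bound) * (ennreal (?M1 + ?M2) + ennreal (osc e))"
    using A0 osc_pos[OF e(1)] moll_bound_ge_1 by (simp add: ennreal_mult' flip: ennreal_plus)
  also have "ennreal (?M1 + ?M2) = (\<integral>\<^sup>+y. ennreal (moll e (x - y)) * ennreal (norm (g y) powr p y) \<partial>lebesgue)"
  proof -
    have "ennreal (?M1 + ?M2) = ennreal (LINT y|lebesgue. moll e (x - y) * F1 y powr p y + moll e (x - y) * F2 y powr p y)"
      using L(2) S(2) by simp
    also have "\<dots> = (\<integral>\<^sup>+y. ennreal (moll e (x - y) * F1 y powr p y + moll e (x - y) * F2 y powr p y) \<partial>lebesgue)"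
      using L(2) S(2) m0 by (intro nn_integral_eq_integral[symmetric]) auto
    also have "\<dots> = (\<integral>\<^sup>+y. ennreal (moll e (x - y)) * ennreal (norm (g y) powr p y) \<partial>lebesgue)"
      by (intro nn_integral_cong) (auto simp: F1_def F2_def m0 ennreal_mult')
    finally show ?thesis .
  qed
  finally show ?thesis .
qed

end

section \<open>From Sobolev capacity to mixed capacity\<close>

text \<open>A function of |x|^2 rather than of |x|, hence differentiable at the origin. It is 1 for
  |x| <= r and 0 as soon as |x|^2 >= 2 r^2.\<close>

definition cutoff :: "real \<Rightarrow> 'a::euclidean_space \<Rightarrow> real" where
  "cutoff r x = smooth_step (2 - (x \<bullet> x) / r\<^sup>2)"

definition cutoff' :: "real \<Rightarrow> 'a::euclidean_space \<Rightarrow> 'a" where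
  "cutoff' r x = smooth_step' (2 - (x \<bullet> x) / r\<^sup>2) *\<^sub>R ((- 2 / r\<^sup>2) *\<^sub>R x)"

lemma C1_gradient_cutoff: "C1_gradient (cutoff r) (cutoff' r)"
proof -
  have "C1_gradient (\<lambda>x::'a. 2 - (x \<bullet> x) / r\<^sup>2) (\<lambda>x. (- 2 / r\<^sup>2) *\<^sub>R x)"
    unfolding C1_gradient_def
    by (intro conjI allI continuous_intros)
       (auto intro!: derivative_eq_intros simp: inner_commute divide_inverse)
  from C1_gradient_compose[OF this DERIV_smooth_step continuous_smooth_step']
  show ?thesis
    unfolding cutoff_def[abs_def] cutoff'_def[abs_def] .
qed

lemma cutoff_bounds: "0 \<le> cutoff r x" "cutoff r x \<le> 1"
  unfolding cutoff_def by (rule smooth_step_bounds)+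

lemma cutoff_eq_1: "0 < r \<Longrightarrow> norm x \<le> r \<Longrightarrow> cutoff r x = 1"
  unfolding cutoff_def
  by (rule smooth_step_eq_1) (simp add: dot_square_norm divide_le_eq power_mono)

lemma cutoff_eq_0:
  assumes "0 < r" "2 * r \<le> norm x"
  shows "cutoff r x = 0" "cutoff' r x = 0"
proof -
  have "(2 * r)\<^sup>2 \<le> (norm x)\<^sup>2"
    using assms by (intro power_mono) auto
  then have "4 * r\<^sup>2 \<le> (norm x)\<^sup>2"
    by (simp add: power_mult_distrib)
  moreover have "0 \<le> r\<^sup>2" by simp
  ultimately have "2 * r\<^sup>2 \<le> (norm x)\<^sup>2"
    by linarith
  then have "2 - (x \<bullet> x) / r\<^sup>2 \<le> 0"
    using assms by (simp add: dot_square_norm le_divide_eq)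
  then show "cutoff r x = 0" "cutoff' r x = 0"
    by (auto simp: cutoff_def cutoff'_def smooth_step_eq_0 smooth_step'_eq_0)
qed

lemma norm_cutoff'_le:
  assumes "1 \<le> r"
  shows "norm (cutoff' r x) \<le> 8"
proof (cases "2 * r \<le> norm x")
  case True
  then show ?thesis using cutoff_eq_0(2)[of r x] assms by simp
next
  case False
  have "norm (cutoff' r x) = \<bar>smooth_step' (2 - (x \<bullet> x) / r\<^sup>2)\<bar> * (2 / r\<^sup>2 * norm x)"
    by (simp add: cutoff'_def abs_mult)
  also have "\<dots> \<le> 2 * (2 / r\<^sup>2 * (2 * r))"
    using False assms smooth_step'_bounds by (intro mult_mono) auto
  also have "\<dots> = 8 / r"
    using assms by (simp add: power2_eq_square)
  also have "\<dots> \<le> 8" using assms by (simp add: divide_le_eq)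
  finally show ?thesis .
qed

lemma powr_le_self:
  assumes "0 \<le> (t::real)" "t \<le> 1" "1 \<le> q"
  shows "t powr q \<le> t"
  using powr_mono'[of 1 q t] assms by simp

text \<open>The step is composed with mollifications in the approximants, so the chain rule is
  needed for C^1 functions only, and no weak gradient of v has to be found: the mixed modular looks
  at approximants alone. Their gradients consist of a mollified part, controlled by the variable
  exponent Jensen estimate, and a cutoff part, controlled by the values of the stepped
  mollification.\<close>

lemma (in log_Holder_exponent) smooth_step_mixed_BV:
  assumes u: "u has_weak_gradient g" and d: "0 < d" "d \<le> 1"
    and mu: "modular p u \<le> ennreal d" and mg: "modular p (\<lambda>x. norm (g x)) \<le> ennreal d"
  defines "v \<equiv> \<lambda>x. smooth_step (u x)"
  shows "v \<in> mixed_BV p"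
    and "modular p v + mixed_BV_modular p v
       \<le> ennreal ((2 powr P + 2 * 32 powr P * (2 powr P * moll_bound * 2 + 1 + 2 powr P)) * d)"
proof -
  note li = has_weak_gradientD(1,2)[OF u]
  have um [measurable]: "u \<in> borel_measurable lebesgue" and gm [measurable]: "g \<in> borel_measurable lebesgue"
    using li locally_integrable_measurable by blast+
  have vm [measurable]: "v \<in> borel_measurable lebesgue" unfolding v_def by measurable
  have v01: "0 \<le> v x" "v x \<le> 1" for x unfolding v_def by (rule smooth_step_bounds)+
  have mv: "modular p v \<le> ennreal (2 powr P * d)"
  proof -
    have "modular p v \<le> modular p (\<lambda>x. 2 * u x)"
      unfolding v_def using smooth_step_abs_le by (intro modular_mono) (simp add: abs_mult)
    also have "\<dots> \<le> ennreal (2 powr P) * modular p u"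
      by (rule modular_scale_ge1[OF um]) simp
    also have "\<dots> \<le> ennreal (2 powr P) * ennreal d"
      by (intro mult_left_mono mu) simp
    finally show ?thesis by (simp add: ennreal_mult')
  qed
  then have mv_fin: "modular p v < \<infinity>" using le_less_trans by fastforce
  \<comment> \<open>The cutoff at radius k + 1 and its gradient vanish off this ball.\<close>
  define B where "B k = cball (0::'a) (2 * (real k + 1))" for k :: nat
  define V where "V k = measure lebesgue (B k)" for k
  have V: "emeasure lebesgue (B k) = ennreal (V k)" "0 \<le> V k" for k
    unfolding V_def B_def using emeasure_lborel_cball_finite[of "0::'a"]
    by (auto intro!: emeasure_eq_ennreal_measure simp: less_top[symmetric])
  have [measurable]: "indicator (B k) \<in> borel_measurable lebesgue" for k
    unfolding B_def by measurable
  \<comment> \<open>Two independent demands on the radius: the additive mollification error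
    integrates to at most d over B k, and u is approximated in L^1 there. In the latter, d keeps the
    gradient modulars below a multiple of d, while 1/(k+1) drives the convergence.\<close>
  have "\<exists>e. 0 < e \<and> e \<le> 1 \<and> osc e * V k \<le> d \<and>
      (\<integral>\<^sup>+x\<in>B k. ennreal \<bar>conv (moll e) u x - u x\<bar> \<partial>lebesgue) \<le> ennreal (min d (1 / (real k + 1)))" for k
  proof -
    have "0 < min d (1 / (real k + 1))" using d by simp
    from conv_moll_L1_tendsto[OF li(1) this, where R = "2 * (real k + 1)"]
    obtain e0 where e0: "0 < e0" "e0 \<le> 1"
      "\<And>e. 0 < e \<Longrightarrow> e \<le> e0 \<Longrightarrow> (\<integral>\<^sup>+x\<in>B k. ennreal \<bar>conv (moll e) u x - u x\<bar> \<partial>lebesgue) \<le> ennreal (min d (1 / (real k + 1)))"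
      unfolding B_def by blast
    have "0 < d / (V k + 1)" using d V(2)[of k] by simp
    from osc_tendsto[OF this] obtain e1 where e1: "0 < e1" "\<And>e. 0 < e \<Longrightarrow> e \<le> e1 \<Longrightarrow> osc e \<le> d / (V k + 1)"
      by blast
    define e where "e = min e0 e1"
    have "osc e * V k \<le> d / (V k + 1) * V k"
      using e0 e1 V(2) by (intro mult_right_mono e1) (auto simp: e_def)
    also have "\<dots> \<le> d" using d V(2)[of k] by (simp add: field_simps)
    finally show ?thesis
      using e0 e1 by (intro exI[of _ e]) (auto simp: e_def)
  qed
  from choice[OF allI[OF this]] obtain e where e':
    "\<forall>k. 0 < e k \<and> e k \<le> 1 \<and> osc (e k) * V k \<le> d \<and>
      (\<integral>\<^sup>+x\<in>B k. ennreal \<bar>conv (moll (e k)) u x - u x\<bar> \<partial>lebesgue) \<le> ennreal (min d (1 / (real k + 1)))"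
    by (rule exE)
  note e = e'[rule_format, THEN conjunct1] e'[rule_format, THEN conjunct2, THEN conjunct1]
    e'[rule_format, THEN conjunct2, THEN conjunct2, THEN conjunct1]
    e'[rule_format, THEN conjunct2, THEN conjunct2, THEN conjunct2]
  define U where "U k = conv (moll (e k)) u" for k
  define G where "G k = conv (moll (e k)) g" for k
  define w where "w k x = cutoff (real k + 1) x * smooth_step (U k x)" for k x
  define W where "W k x = cutoff (real k + 1) x *\<^sub>R (smooth_step' (U k x) *\<^sub>R G k x)
      + smooth_step (U k x) *\<^sub>R cutoff' (real k + 1) x" for k x
  have UG: "C1_gradient (U k) (G k)" for k
    unfolding U_def G_def by (rule C1_gradient_conv_weak[OF u moll_test[OF e(1)]])
  have wW: "C1_gradient (w k) (W k)" for k
    unfolding w_def[abs_def] W_def[abs_def]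
    by (rule C1_gradient_mult[OF C1_gradient_cutoff
          C1_gradient_compose[OF UG DERIV_smooth_step continuous_smooth_step']])
  have [measurable]: "U k \<in> borel_measurable lebesgue" "G k \<in> borel_measurable lebesgue"
      "w k \<in> borel_measurable lebesgue" "W k \<in> borel_measurable lebesgue" for k
    using C1_gradientD(2,3)[OF UG, of UNIV k] C1_gradientD(2,3)[OF wW, of UNIV k]
    by (auto intro!: borel_imp_lebesgue borel_measurable_continuous_onI)
  define \<Delta> where "\<Delta> k x = \<bar>smooth_step (U k x) - v x\<bar>" for k x
  have \<Delta>: "0 \<le> \<Delta> k x" "\<Delta> k x \<le> 1" "\<Delta> k x \<le> 2 * \<bar>U k x - u x\<bar>" for k x
    using smooth_step_bounds[of "U k x"] v01[of x] smooth_step_lipschitz[of "U k x" "u x"]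
    by (auto simp: \<Delta>_def v_def)
  have [measurable]: "\<Delta> k \<in> borel_measurable lebesgue" for k unfolding \<Delta>_def by measurable
  have outB: "cutoff (real k + 1) x = 0 \<and> cutoff' (real k + 1) x = 0" if "x \<notin> B k" for k x
    using cutoff_eq_0[of "real k + 1" x] that by (simp add: B_def)
  have int\<Delta>: "(\<integral>\<^sup>+x\<in>B k. ennreal (\<Delta> k x) \<partial>lebesgue) \<le> ennreal (2 * min d (1 / (real k + 1)))" for k
  proof -
    have "(\<integral>\<^sup>+x\<in>B k. ennreal (\<Delta> k x) \<partial>lebesgue) \<le> (\<integral>\<^sup>+x. ennreal 2 * (ennreal \<bar>U k x - u x\<bar> * indicator (B k) x) \<partial>lebesgue)"
    proof (rule nn_integral_mono)
      fix x
      have "ennreal (\<Delta> k x) \<le> ennreal (2 * \<bar>U k x - u x\<bar>)"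
        by (rule ennreal_leI[OF \<Delta>(3)])
      also have "\<dots> = ennreal 2 * ennreal \<bar>U k x - u x\<bar>"
        by (rule ennreal_mult') simp
      finally show "ennreal (\<Delta> k x) * indicator (B k) x \<le> ennreal 2 * (ennreal \<bar>U k x - u x\<bar> * indicator (B k) x)"
        by (auto simp: indicator_def)
    qed
    also have "\<dots> = ennreal 2 * (\<integral>\<^sup>+x\<in>B k. ennreal \<bar>U k x - u x\<bar> \<partial>lebesgue)"
      by (rule nn_integral_cmult) measurable
    also have "\<dots> \<le> ennreal 2 * ennreal (min d (1 / (real k + 1)))"
      using e(4)[of k] by (intro mult_left_mono) (auto simp: U_def)
    also have "\<dots> = ennreal (2 * min d (1 / (real k + 1)))"
      using d by (intro ennreal_mult'[symmetric]) auto
    finally show ?thesis .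
  qed
  \<comment> \<open>As \<open>\<Delta>\<close> is at most 1, its powers are at most
    \<open>\<Delta>\<close> itself, so L^1 closeness of the mollifications controls the modular.
    Cutting off loses only the tail of v outside the ball of radius k + 1.\<close>
  have w_mod: "modular p (\<lambda>x. w k x - v x)
     \<le> ennreal (2 powr P) * (ennreal (2 / (real k + 1)) + (\<integral>\<^sup>+x\<in>- cball 0 (real k + 1). ennreal (\<bar>v x\<bar> powr p x) \<partial>lebesgue))" for k
  proof -
    have "modular p (\<lambda>x. w k x - v x)
      \<le> (\<integral>\<^sup>+x. ennreal (2 powr P) * (ennreal (\<Delta> k x) * indicator (B k) x
          + ennreal (\<bar>v x\<bar> powr p x) * indicator (- cball 0 (real k + 1)) x) \<partial>lebesgue)"
      unfolding modular_def
    proof (rule nn_integral_mono)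
      fix x :: 'a
      define c where "c = cutoff (real k + 1) x"
      have c: "0 \<le> c" "c \<le> 1" unfolding c_def by (rule cutoff_bounds)+
      have "\<bar>w k x - v x\<bar> \<le> c * \<Delta> k x + (1 - c) * v x"
      proof -
        have "w k x - v x = c * (smooth_step (U k x) - v x) - (1 - c) * v x"
          by (simp add: w_def c_def algebra_simps)
        also have "\<bar>\<dots>\<bar> \<le> \<bar>c * (smooth_step (U k x) - v x)\<bar> + \<bar>(1 - c) * v x\<bar>"
          by (rule abs_triangle_ineq4)
        finally show ?thesis using c v01[of x] by (simp add: abs_mult \<Delta>_def)
      qed
      then have "\<bar>w k x - v x\<bar> powr p x \<le> (c * \<Delta> k x + (1 - c) * v x) powr p x"
        using p_ge[of x] by (intro powr_mono2) auto
      also have "\<dots> \<le> 2 powr P * ((c * \<Delta> k x) powr p x + ((1 - c) * v x) powr p x)"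
        using c v01 \<Delta> by (intro powr_add_le p_ge p_le) auto
      also have "\<dots> \<le> 2 powr P * (\<Delta> k x * indicator (B k) x + \<bar>v x\<bar> powr p x * indicator (- cball 0 (real k + 1)) x)"
      proof (intro mult_left_mono add_mono)
        show "(c * \<Delta> k x) powr p x \<le> \<Delta> k x * indicator (B k) x"
        proof (cases "x \<in> B k")
          case True
          have "(c * \<Delta> k x) powr p x \<le> c * \<Delta> k x"
            using c \<Delta> p_ge by (intro powr_le_self) (auto intro: mult_le_one)
          also have "\<dots> \<le> \<Delta> k x" using c \<Delta>(1) by (intro mult_left_le_one_le) auto
          finally show ?thesis using True by simp
        next
          case False
          then have "c = 0" using outB by (simp add: c_def)
          then show ?thesis using False by simp
        qed
        show "((1 - c) * v x) powr p x \<le> \<bar>v x\<bar> powr p x * indicator (- cball 0 (real k + 1)) x"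
        proof (cases "norm x \<le> real k + 1")
          case True
          then have "c = 1" using cutoff_eq_1[of "real k + 1" x] by (simp add: c_def)
          then show ?thesis by simp
        next
          case False
          have "((1 - c) * v x) powr p x \<le> \<bar>v x\<bar> powr p x"
            using c v01[of x] p_ge[of x] by (intro powr_mono2) (auto intro: mult_left_le_one_le)
          then show ?thesis using False by simp
        qed
      qed simp
      finally have "ennreal (\<bar>w k x - v x\<bar> powr p x) \<le> ennreal (2 powr P *
          (\<Delta> k x * indicator (B k) x + \<bar>v x\<bar> powr p x * indicator (- cball 0 (real k + 1)) x))"
        by (rule ennreal_leI)
      also have "\<dots> = ennreal (2 powr P) * (ennreal (\<Delta> k x) * indicator (B k) x
          + ennreal (\<bar>v x\<bar> powr p x) * indicator (- cball 0 (real k + 1)) x)"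
        using \<Delta>(1) by (auto simp: ennreal_mult' indicator_def)
      finally show "ennreal (\<bar>w k x - v x\<bar> powr p x) \<le> ennreal (2 powr P) * (ennreal (\<Delta> k x) * indicator (B k) x
          + ennreal (\<bar>v x\<bar> powr p x) * indicator (- cball 0 (real k + 1)) x)" .
    qed
    also have "\<dots> = ennreal (2 powr P) * ((\<integral>\<^sup>+x\<in>B k. ennreal (\<Delta> k x) \<partial>lebesgue)
        + (\<integral>\<^sup>+x\<in>- cball 0 (real k + 1). ennreal (\<bar>v x\<bar> powr p x) \<partial>lebesgue))"
    proof -
      have [measurable]: "indicator (- cball (0::'a) (real k + 1)) \<in> borel_measurable lebesgue"
        by (intro borel_measurable_indicator) (auto simp: Compl_in_sets_lebesgue)
      have 1: "(\<lambda>x. ennreal (\<Delta> k x) * indicator (B k) x) \<in> borel_measurable lebesgue"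
       and 2: "(\<lambda>x. ennreal (\<bar>v x\<bar> powr p x) * indicator (- cball 0 (real k + 1)) x) \<in> borel_measurable lebesgue"
        by measurable
      show ?thesis
        by (simp only: nn_integral_cmult[OF borel_measurable_add[OF 1 2]] nn_integral_add[OF 1 2])
    qed
    also have "\<dots> \<le> ennreal (2 powr P) * (ennreal (2 / (real k + 1)) + (\<integral>\<^sup>+x\<in>- cball 0 (real k + 1). ennreal (\<bar>v x\<bar> powr p x) \<partial>lebesgue))"
      by (intro mult_left_mono add_right_mono order_trans[OF int\<Delta>] ennreal_leI) auto
    finally show ?thesis .
  qed
  have tail: "(\<lambda>k. \<integral>\<^sup>+x\<in>- cball 0 (real k + 1). ennreal (\<bar>v x\<bar> powr p x) \<partial>lebesgue) \<longlonglongrightarrow> 0"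
  proof -
    have "(\<lambda>k. \<integral>\<^sup>+x\<in>- cball 0 (real k + 1). ennreal (\<bar>v x\<bar> powr p x) \<partial>lebesgue) \<longlonglongrightarrow> (\<integral>\<^sup>+x. 0 \<partial>(lebesgue :: 'a measure))"
    proof (rule nn_integral_dominated_convergence[where w = "\<lambda>x. ennreal (\<bar>v x\<bar> powr p x)"])
      show "(\<lambda>x. ennreal (\<bar>v x\<bar> powr p x) * indicator (- cball 0 (real k + 1)) x) \<in> borel_measurable lebesgue" for k
      proof -
        have [measurable]: "indicator (- cball (0::'a) (real k + 1)) \<in> borel_measurable lebesgue"
          by (intro borel_measurable_indicator) (auto simp: Compl_in_sets_lebesgue)
        show ?thesis by measurable
      qed
      show "AE x in lebesgue. (\<lambda>k. ennreal (\<bar>v x\<bar> powr p x) * indicator (- cball 0 (real k + 1)) x) \<longlonglongrightarrow> 0"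
      proof (intro always_eventually allI)
        fix x :: 'a
        obtain N :: nat where N: "norm x \<le> real N" using real_arch_simple by blast
        have "\<forall>\<^sub>F k in sequentially. ennreal (\<bar>v x\<bar> powr p x) * indicator (- cball 0 (real k + 1)) x = 0"
          using eventually_ge_at_top[of N] by eventually_elim (use N in auto)
        then show "(\<lambda>k. ennreal (\<bar>v x\<bar> powr p x) * indicator (- cball 0 (real k + 1)) x) \<longlonglongrightarrow> 0"
          by (rule tendsto_eventually)
      qed
      show "(\<integral>\<^sup>+x. ennreal (\<bar>v x\<bar> powr p x) \<partial>lebesgue) < \<infinity>"
        using mv_fin by (simp add: modular_def)
    qed (auto simp: indicator_def)
    then show ?thesis by simp
  qed
  have w_lim: "(\<lambda>k. modular p (\<lambda>x. w k x - v x)) \<longlonglongrightarrow> 0"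
  proof (rule tendsto_sandwich[OF _ _ tendsto_const])
    have "(\<lambda>k. 2 / (real k + 1)) \<longlonglongrightarrow> 0"
      using tendsto_mult[OF tendsto_const LIMSEQ_inverse_real_of_nat, of "2::real"]
      by (simp add: divide_inverse add.commute)
    then have "(\<lambda>k. ennreal (2 / (real k + 1))) \<longlonglongrightarrow> 0"
      by (subst ennreal_tendsto_0_iff) auto
    from ennreal_tendsto_cmult[OF _ tendsto_add[OF this tail], of "ennreal (2 powr P)"]
    show "(\<lambda>k. ennreal (2 powr P) * (ennreal (2 / (real k + 1))
        + (\<integral>\<^sup>+x\<in>- cball 0 (real k + 1). ennreal (\<bar>v x\<bar> powr p x) \<partial>lebesgue))) \<longlonglongrightarrow> 0"
      by simp
  qed (use w_mod in auto)
  have w_var: "w k \<in> var_Lebesgue p" for k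
    unfolding var_Lebesgue_iff
  proof
    have "modular p (w k) \<le> (\<integral>\<^sup>+x. 1 * indicator (B k) x \<partial>lebesgue)"
      unfolding modular_def
    proof (rule nn_integral_mono)
      fix x
      have w01: "0 \<le> w k x" "w k x \<le> 1"
        using cutoff_bounds[of "real k + 1" x] smooth_step_bounds[of "U k x"]
        by (simp_all add: w_def mult_le_one)
      then have "\<bar>w k x\<bar> powr p x \<le> 1" using p_ge[of x] by (intro powr_le1) auto
      then show "ennreal (\<bar>w k x\<bar> powr p x) \<le> 1 * indicator (B k) x"
        using outB[of x k] by (cases "x \<in> B k") (auto simp: w_def ennreal_le_1)
    qed
    also have "\<dots> < \<infinity>"
      using V[of k] by (subst nn_integral_cmult_indicator) (auto simp: B_def)
    finally show "modular p (w k) < \<infinity>" .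
  qed measurable
  \<comment> \<open>The base 32 is the product of 2, 8 and 2: adding the two gradient parts, the
    bound 8 for the cutoff gradient, and splitting the stepped mollification into v and its distance
    to v. The outer 2 is the Lipschitz constant of the step.\<close>
  define c where "c = 2 * 32 powr P"
  have W_le: "norm (W k x) powr p x \<le> c * (norm (G k x) powr p x + \<bar>U k x - u x\<bar> + \<bar>v x\<bar> powr p x) * indicator (B k) x" for k x
  proof (cases "x \<in> B k")
    case False
    then show ?thesis using outB[OF False] p_ge[of x] by (simp add: W_def)
  next
    case True
    define a where "a = norm (G k x)"
    define s where "s = smooth_step (U k x)"
    have s: "0 \<le> s" "s \<le> \<Delta> k x + v x"
      using smooth_step_bounds[of "U k x"] by (auto simp: s_def \<Delta>_def)
    have "norm (W k x) \<le> 2 * a + 8 * s"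
    proof -
      have "norm (W k x) \<le> \<bar>cutoff (real k + 1) x\<bar> * (\<bar>smooth_step' (U k x)\<bar> * a) + \<bar>s\<bar> * norm (cutoff' (real k + 1) x)"
        unfolding W_def a_def s_def by (rule order_trans[OF norm_triangle_ineq]) (simp add: abs_mult)
      also have "\<dots> \<le> 1 * (2 * a) + s * 8"
        using cutoff_bounds[of "real k + 1" x] smooth_step'_bounds[of "U k x"] s norm_cutoff'_le[of "real k + 1" x]
        by (intro add_mono mult_mono) (auto simp: a_def)
      finally show ?thesis by simp
    qed
    then have "norm (W k x) powr p x \<le> (2 * a + 8 * s) powr p x"
      using p_ge[of x] by (intro powr_mono2) auto
    also have "\<dots> \<le> 2 powr P * ((2 * a) powr p x + (8 * s) powr p x)"
      using s by (intro powr_add_le p_ge p_le) (auto simp: a_def)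
    also have "(2 * a) powr p x \<le> 8 powr P * a powr p x"
      using p_le[of x] p_ge[of x] by (auto simp: powr_mult a_def intro!: mult_right_mono order_trans[OF powr_mono[of "p x" P 2] powr_mono2])
    also have "(8 * s) powr p x \<le> 8 powr P * (2 powr P * (2 * \<bar>U k x - u x\<bar> + \<bar>v x\<bar> powr p x))"
    proof -
      have "s powr p x \<le> (\<Delta> k x + v x) powr p x"
        using s p_ge[of x] by (intro powr_mono2) auto
      also have "\<dots> \<le> 2 powr P * (\<Delta> k x powr p x + v x powr p x)"
        using \<Delta> v01 by (intro powr_add_le p_ge p_le) auto
      also have "\<dots> \<le> 2 powr P * (2 * \<bar>U k x - u x\<bar> + \<bar>v x\<bar> powr p x)"
        using \<Delta>(3)[of k x] powr_le_self[OF \<Delta>(1,2) p_ge, of k x x] v01(1)[of x] by (intro mult_left_mono add_mono) auto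
      finally have "8 powr p x * s powr p x \<le> 8 powr P * (2 powr P * (2 * \<bar>U k x - u x\<bar> + \<bar>v x\<bar> powr p x))"
        using p_le[of x] by (intro mult_mono powr_mono) auto
      then show ?thesis using s by (simp add: powr_mult)
    qed
    also have "2 powr P * (8 powr P * a powr p x + 8 powr P * (2 powr P * (2 * \<bar>U k x - u x\<bar> + \<bar>v x\<bar> powr p x)))
       \<le> 2 powr P * (8 powr P * (2 powr P * (2 * a powr p x)) + 8 powr P * (2 powr P * (2 * \<bar>U k x - u x\<bar> + 2 * \<bar>v x\<bar> powr p x)))"
    proof (intro mult_left_mono add_mono)
      have "1 * a powr p x \<le> 2 powr P * (2 * a powr p x)"
        using P_ge by (intro mult_mono ge_one_powr_ge_zero) auto
      then show "a powr p x \<le> 2 powr P * (2 * a powr p x)" by simp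
    qed auto
    also have "\<dots> = (2 * (2 powr P * (8 powr P * 2 powr P))) * (a powr p x + \<bar>U k x - u x\<bar> + \<bar>v x\<bar> powr p x)"
      by (simp add: algebra_simps)
    also have "2 powr P * (8 powr P * 2 powr P) = 32 powr P"
      by (simp flip: powr_mult)
    finally show ?thesis using True by (simp add: c_def a_def)
  qed
  \<comment> \<open>By Tonelli the averaged power integrates to the modular of g itself, and the
    choice of \<open>e k\<close> keeps the additive part below d.\<close>
  have G_int: "(\<integral>\<^sup>+x\<in>B k. ennreal (norm (G k x) powr p x) \<partial>lebesgue) \<le> ennreal (2 powr P * moll_bound * 2 * d)" for k
  proof -
    let ?T = "\<lambda>x. \<integral>\<^sup>+y. ennreal (moll (e k) (x - y)) * ennreal (norm (g y) powr p y) \<partial>lebesgue"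
    have mg1: "modular p (\<lambda>x. norm (g x)) \<le> 1"
      using mg d by (meson ennreal_le_1 order_trans)
    have c0: "0 \<le> 2 powr P * moll_bound" using moll_bound_ge_1 by simp
    have "(\<integral>\<^sup>+x\<in>B k. ennreal (norm (G k x) powr p x) \<partial>lebesgue)
       \<le> (\<integral>\<^sup>+x\<in>B k. ennreal (2 powr P * moll_bound) * (?T x + ennreal (osc (e k))) \<partial>lebesgue)"
      unfolding G_def by (intro nn_integral_mono mult_right_mono conv_moll_powr_le e gm mg1) simp
    also have "\<dots> \<le> ennreal (2 powr P * moll_bound) * ((\<integral>\<^sup>+x. ?T x \<partial>lebesgue) + ennreal (osc (e k)) * emeasure lebesgue (B k))"
    proof -
      have "(\<integral>\<^sup>+x\<in>B k. ennreal (2 powr P * moll_bound) * (?T x + ennreal (osc (e k))) \<partial>lebesgue)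
        \<le> (\<integral>\<^sup>+x. ennreal (2 powr P * moll_bound) * (?T x + ennreal (osc (e k)) * indicator (B k) x) \<partial>lebesgue)"
        by (intro nn_integral_mono) (auto simp: indicator_def)
      also have "\<dots> = ennreal (2 powr P * moll_bound) * ((\<integral>\<^sup>+x. ?T x \<partial>lebesgue) + (\<integral>\<^sup>+x. ennreal (osc (e k)) * indicator (B k) x \<partial>lebesgue))"
      proof -
        have 1: "?T \<in> borel_measurable lebesgue"
        proof -
          obtain h where [measurable]: "h \<in> borel_measurable borel" and ae: "AE x in lborel. ennreal (norm (g x) powr p x) = h x"
            using completion_ex_borel_measurable[of "\<lambda>x. ennreal (norm (g x) powr p x)" lborel] by (auto simp: measurable_completion)
          have eq: "?T = (\<lambda>x. \<integral>\<^sup>+y. ennreal (moll (e k) (x - y)) * h y \<partial>lborel)"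
            unfolding nn_integral_completion
            by (rule ext, rule nn_integral_cong_AE, rule eventually_mono[OF ae]) simp
          show ?thesis
            unfolding eq using e(1)[of k] by (intro borel_imp_lebesgue) measurable
        qed
        have 2: "(\<lambda>x. ennreal (osc (e k)) * indicator (B k) x) \<in> borel_measurable lebesgue" by measurable
        show ?thesis
          by (simp only: nn_integral_cmult[OF borel_measurable_add[OF 1 2]] nn_integral_add[OF 1 2])
      qed
      also have "(\<integral>\<^sup>+x. ennreal (osc (e k)) * indicator (B k) x \<partial>lebesgue) = ennreal (osc (e k)) * emeasure lebesgue (B k)"
        by (rule nn_integral_cmult_indicator) (simp add: B_def)
      finally show ?thesis .
    qed
    also have "(\<integral>\<^sup>+x. ?T x \<partial>lebesgue) = modular p (\<lambda>x. norm (g x))"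
      unfolding modular_def by (subst moll_Tonelli[OF e(1)]) auto
    also have "ennreal (osc (e k)) * emeasure lebesgue (B k) = ennreal (osc (e k) * V k)"
      using osc_pos[OF e(1), of k] V by (simp add: ennreal_mult)
    also have "ennreal (2 powr P * moll_bound) * (modular p (\<lambda>x. norm (g x)) + ennreal (osc (e k) * V k))
       \<le> ennreal (2 powr P * moll_bound) * (ennreal d + ennreal d)"
      by (intro mult_left_mono add_mono mg ennreal_leI e) auto
    also have "\<dots> = ennreal (2 powr P * moll_bound * 2 * d)"
      using d c0 by (simp add: ennreal_mult' flip: ennreal_plus) (simp add: algebra_simps flip: ennreal_mult')
    finally show ?thesis .
  qed
  have grad: "gradient_modular p (w k) \<le> ennreal (c * (2 powr P * moll_bound * 2 + 1 + 2 powr P) * d)" for k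
  proof -
    have c0: "0 \<le> c" by (simp add: c_def)
    have "gradient_modular p (w k) \<le> modular p (\<lambda>x. norm (W k x))"
      unfolding gradient_modular_def by (rule INF_lower) (use C1_gradient_weak[OF wW] in simp)
    also have "\<dots> \<le> (\<integral>\<^sup>+x. ennreal c * (ennreal (norm (G k x) powr p x) * indicator (B k) x
       + (ennreal \<bar>U k x - u x\<bar> * indicator (B k) x + ennreal (\<bar>v x\<bar> powr p x))) \<partial>lebesgue)"
      unfolding modular_def
    proof (rule nn_integral_mono)
      fix x
      have "ennreal (\<bar>norm (W k x)\<bar> powr p x) \<le> ennreal (c * (norm (G k x) powr p x + \<bar>U k x - u x\<bar> + \<bar>v x\<bar> powr p x) * indicator (B k) x)"
        using W_le by (intro ennreal_leI) simp
      also have "\<dots> = ennreal c * (ennreal (norm (G k x) powr p x) * indicator (B k) x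
         + (ennreal \<bar>U k x - u x\<bar> * indicator (B k) x + ennreal (\<bar>v x\<bar> powr p x) * indicator (B k) x))"
        using c0 by (cases "x \<in> B k") (auto simp: ennreal_mult' ennreal_plus add.assoc)
      also have "\<dots> \<le> ennreal c * (ennreal (norm (G k x) powr p x) * indicator (B k) x
         + (ennreal \<bar>U k x - u x\<bar> * indicator (B k) x + ennreal (\<bar>v x\<bar> powr p x)))"
        by (intro mult_left_mono add_left_mono) (auto simp: indicator_def)
      finally show "ennreal (\<bar>norm (W k x)\<bar> powr p x) \<le> ennreal c * (ennreal (norm (G k x) powr p x) * indicator (B k) x
         + (ennreal \<bar>U k x - u x\<bar> * indicator (B k) x + ennreal (\<bar>v x\<bar> powr p x)))" .
    qed
    also have "\<dots> = ennreal c * ((\<integral>\<^sup>+x\<in>B k. ennreal (norm (G k x) powr p x) \<partial>lebesgue)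
       + ((\<integral>\<^sup>+x\<in>B k. ennreal \<bar>U k x - u x\<bar> \<partial>lebesgue) + modular p v))"
    proof -
      have 1: "(\<lambda>x. ennreal (norm (G k x) powr p x) * indicator (B k) x) \<in> borel_measurable lebesgue"
        and 2: "(\<lambda>x. ennreal \<bar>U k x - u x\<bar> * indicator (B k) x) \<in> borel_measurable lebesgue"
        and 3: "(\<lambda>x. ennreal (\<bar>v x\<bar> powr p x)) \<in> borel_measurable lebesgue"
        by measurable
      show ?thesis
        unfolding modular_def
        by (simp only: nn_integral_cmult[OF borel_measurable_add[OF 1 borel_measurable_add[OF 2 3]]]
            nn_integral_add[OF 1 borel_measurable_add[OF 2 3]] nn_integral_add[OF 2 3])
    qed
    also have "\<dots> \<le> ennreal c * (ennreal (2 powr P * moll_bound * 2 * d) + (ennreal d + ennreal (2 powr P * d)))"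
    proof (intro mult_left_mono add_mono G_int mv)
      show "(\<integral>\<^sup>+x\<in>B k. ennreal \<bar>U k x - u x\<bar> \<partial>lebesgue) \<le> ennreal d"
        using e(4)[of k] by (auto simp: U_def elim!: order_trans intro!: ennreal_leI)
    qed simp
    also have "\<dots> = ennreal c * ennreal (2 powr P * moll_bound * 2 * d + (d + 2 powr P * d))"
      using d moll_bound_ge_1 by (subst ennreal_plus[symmetric], simp, simp, subst ennreal_plus[symmetric]) auto
    also have "\<dots> = ennreal (c * (2 powr P * moll_bound * 2 + 1 + 2 powr P) * d)"
      using c0 by (simp add: algebra_simps flip: ennreal_mult')
    finally show ?thesis .
  qed
  have BV: "mixed_BV_modular p v \<le> ennreal (c * (2 powr P * moll_bound * 2 + 1 + 2 powr P) * d)"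
  proof -
    have "mixed_BV_modular p v \<le> liminf (\<lambda>k. gradient_modular p (w k))"
      unfolding mixed_BV_modular_def
    proof (rule INF_lower, intro CollectI conjI allI)
      show "w k \<in> locally_Lipschitz \<inter> var_Lebesgue p" for k
        using C1_gradient_imp_locally_Lipschitz[OF wW] w_var by blast
      show "(\<lambda>k. Luxemburg_norm p (\<lambda>x. w k x - v x)) \<longlonglongrightarrow> 0"
        by (rule modular_tendsto_imp_Luxemburg[OF _ w_lim]) measurable
    qed
    also have "\<dots> \<le> liminf (\<lambda>k::nat. ennreal (c * (2 powr P * moll_bound * 2 + 1 + 2 powr P) * d))"
      by (intro Liminf_mono always_eventually allI grad)
    finally show ?thesis by (simp add: Liminf_const)
  qed
  show "v \<in> mixed_BV p"
    unfolding mixed_BV_def var_Lebesgue_iff using mv_fin BV le_less_trans by fastforce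
  have "modular p v + mixed_BV_modular p v
     \<le> ennreal (2 powr P * d) + ennreal (c * (2 powr P * moll_bound * 2 + 1 + 2 powr P) * d)"
    by (intro add_mono mv BV)
  also have "\<dots> = ennreal ((2 powr P + c * (2 powr P * moll_bound * 2 + 1 + 2 powr P)) * d)"
    using d moll_bound_ge_1 by (subst ennreal_plus[symmetric]) (auto simp: c_def algebra_simps)
  finally show "modular p v + mixed_BV_modular p v
     \<le> ennreal ((2 powr P + 2 * 32 powr P * (2 powr P * moll_bound * 2 + 1 + 2 powr P)) * d)"
    by (simp add: c_def)
qed

theorem (in log_Holder_exponent) Sobolev_null_imp_mixed_BV_null:
  assumes "Sobolev_capacity p E = 0"
  shows "mixed_BV_capacity p E = 0"
proof -
  define K where "K = 2 powr P + 2 * 32 powr P * (2 powr P * moll_bound * 2 + 1 + 2 powr P)"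
  have K: "0 < K" unfolding K_def using moll_bound_ge_1 by (intro add_pos_nonneg) auto
  have *: "mixed_BV_capacity p E \<le> ennreal r" if r: "0 < r" for r
  proof -
    define d where "d = min 1 (r / K)"
    have d: "0 < d" "d \<le> 1" "K * d \<le> r"
      using r K by (auto simp: d_def field_simps min_def)
    have "Sobolev_capacity p E < ennreal d" using assms d by simp
    then obtain u U where u: "u \<in> var_Sobolev p" "open U" "E \<subseteq> U" "AE x in lebesgue. x \<in> U \<longrightarrow> u x \<ge> 1"
        and less: "modular p u + gradient_modular p u < ennreal d"
      unfolding Sobolev_capacity_def by (auto simp: INF_less_iff)
    have "gradient_modular p u < ennreal d" "modular p u \<le> ennreal d"
      using less by (auto intro: le_less_trans[OF _ less] order_trans[OF _ less_imp_le[OF less]])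
    then obtain g where g: "u has_weak_gradient g" "modular p (\<lambda>x. norm (g x)) < ennreal d"
      unfolding gradient_modular_def by (auto simp: INF_less_iff)
    let ?v = "\<lambda>x. smooth_step (u x)"
    note S = smooth_step_mixed_BV[OF g(1) d(1,2) \<open>modular p u \<le> ennreal d\<close> less_imp_le[OF g(2)]]
    have "mixed_BV_capacity p E \<le> modular p ?v + mixed_BV_modular p ?v"
      unfolding mixed_BV_capacity_def
    proof (rule INF_lower, intro CollectI conjI exI[of _ U])
      show "AE x in lebesgue. 0 \<le> ?v x \<and> ?v x \<le> 1" by (simp add: smooth_step_bounds)
      show "AE x in lebesgue. x \<in> U \<longrightarrow> ?v x = 1"
        using u(4) by eventually_elim (auto intro: smooth_step_eq_1)
      show "?v \<in> mixed_BV p" by (rule S(1))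
    qed (rule u(2) u(3))+
    also have "\<dots> \<le> ennreal (K * d)" using S(2) by (simp add: K_def)
    also have "\<dots> \<le> ennreal r" by (intro ennreal_leI d)
    finally show ?thesis .
  qed
  have "mixed_BV_capacity p E \<le> 0"
  proof (rule ennreal_le_epsilon)
    fix r :: real assume "0 < r"
    show "mixed_BV_capacity p E \<le> 0 + ennreal r"
      using *[OF \<open>0 < r\<close>] by simp
  qed
  then show ?thesis by simp
qed

section \<open>Null sets\<close>

text \<open>Compared with the capacity, both modulars are bounded separately, a weak gradient is
  fixed, and v >= 0 is demanded, which lets a series of such functions dominate each of its
  terms.\<close>

definition (in exponent) cap_null :: "'a set \<Rightarrow> bool" where
  "cap_null E \<longleftrightarrow> (\<forall>d>0. \<exists>v g U. v has_weak_gradient g \<and> (AE x in lebesgue. 0 \<le> v x) \<and>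
     open U \<and> E \<subseteq> U \<and> (AE x in lebesgue. x \<in> U \<longrightarrow> 1 \<le> v x) \<and>
     modular p v \<le> ennreal d \<and> modular p (\<lambda>x. norm (g x)) \<le> ennreal d)"

context exponent
begin

lemma cap_null_imp_Sobolev_null:
  assumes "cap_null E"
  shows "Sobolev_capacity p E = 0"
proof -
  have *: "Sobolev_capacity p E \<le> ennreal r" if r: "0 < r" for r
  proof -
    obtain v g U where v: "v has_weak_gradient g" "open U" "E \<subseteq> U" "AE x in lebesgue. x \<in> U \<longrightarrow> 1 \<le> v x"
      "modular p v \<le> ennreal (r/2)" "modular p (\<lambda>x. norm (g x)) \<le> ennreal (r/2)"
      using assms r unfolding cap_null_def by (meson half_gt_zero)
    have fin: "modular p v < \<infinity>" "modular p (\<lambda>x. norm (g x)) < \<infinity>"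
      using v(5,6) by (auto intro: le_less_trans)
    have m: "v \<in> borel_measurable lebesgue" "g \<in> borel_measurable lebesgue"
      using has_weak_gradientD(1,2)[OF v(1)] by (auto intro: locally_integrable_measurable)
    have "v \<in> var_Sobolev p"
      unfolding var_Sobolev_def var_Lebesgue_iff using v(1) m fin by (auto intro!: exI[of _ g])
    then have "Sobolev_capacity p E \<le> modular p v + gradient_modular p v"
      unfolding Sobolev_capacity_def by (intro INF_lower CollectI conjI exI[of _ U] v) auto
    also have "\<dots> \<le> ennreal (r/2) + ennreal (r/2)"
    proof (intro add_mono v(5))
      have "gradient_modular p v \<le> modular p (\<lambda>x. norm (g x))"
        unfolding gradient_modular_def by (rule INF_lower) (use v(1) in simp)
      then show "gradient_modular p v \<le> ennreal (r/2)" using v(6) by (rule order_trans)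
    qed
    also have "\<dots> = ennreal r" using r by (simp flip: ennreal_plus)
    finally show ?thesis .
  qed
  have "Sobolev_capacity p E \<le> 0"
  proof (rule ennreal_le_epsilon)
    fix r :: real assume "0 < r"
    show "Sobolev_capacity p E \<le> 0 + ennreal r"
      using *[OF \<open>0 < r\<close>] by simp
  qed
  then show ?thesis by simp
qed

lemma cap_null_mono: "cap_null F \<Longrightarrow> E \<subseteq> F \<Longrightarrow> cap_null E"
  unfolding cap_null_def by (meson order_trans)

lemma sum_half_powers_le: "(\<Sum>k<N. (1/2) ^ Suc k) \<le> (1::real)"
proof -
  have "(\<Sum>k<N. (1/2) ^ Suc k) = 1 - (1/2::real) ^ N"
    by (induction N) (auto simp: field_simps)
  then show ?thesis by simp
qed

text \<open>The sum of the v_k is read as a convex series with weights 2^-(k+1) of the amplified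
  functions 2^(k+1) v_k. Each v_k is chosen so small that the amplified modulars stay below d, and
  then so does the modular of the sum.\<close>

lemma cap_null_UN:
  assumes E: "\<And>k::nat. cap_null (E k)"
  shows "cap_null (\<Union>k. E k)"
  unfolding cap_null_def
proof (intro allI impI)
  fix d :: real assume d: "0 < d"
  define c where "c k = (2 ^ Suc k :: real)" for k
  have c1: "1 \<le> c k" for k unfolding c_def by (rule one_le_power) simp
  \<comment> \<open>Amplifying by \<open>c k\<close> multiplies modulars by at most its power with
    exponent P.\<close>
  define \<epsilon> where "\<epsilon> k = d / c k powr P" for k
  have \<epsilon>: "0 < \<epsilon> k" for k using d c1[of k] by (simp add: \<epsilon>_def)
  have "\<exists>v g U. v has_weak_gradient g \<and> (AE x in lebesgue. 0 \<le> v x) \<and>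
     open U \<and> E k \<subseteq> U \<and> (AE x in lebesgue. x \<in> U \<longrightarrow> 1 \<le> v x) \<and>
     modular p v \<le> ennreal (\<epsilon> k) \<and> modular p (\<lambda>x. norm (g x)) \<le> ennreal (\<epsilon> k)" for k
    using E[of k] \<epsilon>[of k] unfolding cap_null_def by simp
  from choice[OF allI[OF this]] obtain v where "\<forall>k. \<exists>g U. v k has_weak_gradient g \<and> (AE x in lebesgue. 0 \<le> v k x) \<and>
     open U \<and> E k \<subseteq> U \<and> (AE x in lebesgue. x \<in> U \<longrightarrow> 1 \<le> v k x) \<and>
     modular p (v k) \<le> ennreal (\<epsilon> k) \<and> modular p (\<lambda>x. norm (g x)) \<le> ennreal (\<epsilon> k)"
    by (rule exE)
  from choice[OF this] obtain g where "\<forall>k. \<exists>U. v k has_weak_gradient g k \<and> (AE x in lebesgue. 0 \<le> v k x) \<and>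
     open U \<and> E k \<subseteq> U \<and> (AE x in lebesgue. x \<in> U \<longrightarrow> 1 \<le> v k x) \<and>
     modular p (v k) \<le> ennreal (\<epsilon> k) \<and> modular p (\<lambda>x. norm (g k x)) \<le> ennreal (\<epsilon> k)"
    by (rule exE)
  from choice[OF this] obtain U where *: "\<forall>k. v k has_weak_gradient g k \<and> (AE x in lebesgue. 0 \<le> v k x) \<and>
     open (U k) \<and> E k \<subseteq> U k \<and> (AE x in lebesgue. x \<in> U k \<longrightarrow> 1 \<le> v k x) \<and>
     modular p (v k) \<le> ennreal (\<epsilon> k) \<and> modular p (\<lambda>x. norm (g k x)) \<le> ennreal (\<epsilon> k)"
    by (rule exE)
  have wg: "v k has_weak_gradient g k" and v0: "AE x in lebesgue. 0 \<le> v k x" and U: "open (U k)" "E k \<subseteq> U k"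
    and v1: "AE x in lebesgue. x \<in> U k \<longrightarrow> 1 \<le> v k x"
    and mv: "modular p (v k) \<le> ennreal (\<epsilon> k)" and mg: "modular p (\<lambda>x. norm (g k x)) \<le> ennreal (\<epsilon> k)" for k
    using * by blast+
  have meas: "v k \<in> borel_measurable lebesgue" "g k \<in> borel_measurable lebesgue" for k
    using has_weak_gradientD(1,2)[OF wg] by (auto intro: locally_integrable_measurable)
  have wg': "(\<lambda>x. c k * v k x) has_weak_gradient (\<lambda>x. c k *\<^sub>R g k x)" for k
    using has_weak_gradient_linear[OF wg[of k] wg[of k], of "c k" 0] by simp
  have sc: "modular p (\<lambda>x. c k * f x) \<le> ennreal d" if "f \<in> borel_measurable lebesgue" "modular p f \<le> ennreal (\<epsilon> k)" for f k
  proof -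
    have "modular p (\<lambda>x. c k * f x) \<le> ennreal (c k powr P) * modular p f"
      by (rule modular_scale_ge1[OF that(1) c1])
    also have "\<dots> \<le> ennreal (c k powr P) * ennreal (\<epsilon> k)"
      by (intro mult_left_mono that) simp
    also have "\<dots> = ennreal d"
      using c1[of k] \<epsilon>[of k] by (simp add: \<epsilon>_def flip: ennreal_mult')
    finally show ?thesis .
  qed
  have sumle: "(\<Sum>k<N. ennreal ((1/2) ^ Suc k) * m k) \<le> ennreal d" if "\<And>k. m k \<le> ennreal d" for m and N :: nat
  proof -
    have "(\<Sum>k<N. ennreal ((1/2) ^ Suc k) * m k) \<le> (\<Sum>k<N. ennreal ((1/2) ^ Suc k) * ennreal d)"
      by (intro sum_mono mult_left_mono that) simp
    also have "\<dots> = (\<Sum>k<N. ennreal ((1/2) ^ Suc k)) * ennreal d"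
      by (rule sum_distrib_right[symmetric])
    also have "\<dots> = ennreal (\<Sum>k<N. (1/2) ^ Suc k) * ennreal d"
      by (subst sum_ennreal) auto
    also have "\<dots> \<le> ennreal 1 * ennreal d"
      by (intro mult_right_mono ennreal_leI sum_half_powers_le) simp
    finally show ?thesis by simp
  qed
  have A1: "0 \<le> (1/2::real) ^ Suc k" for k by simp
  have A3: "AE x in lebesgue. 0 \<le> c k * v k x" for k
    by (rule eventually_mono[OF v0[of k]]) (use c1[of k] in simp)
  have A4: "(\<Sum>k<N. ennreal ((1/2) ^ Suc k) * modular p (\<lambda>x. c k * v k x)) \<le> ennreal d" for N
    by (intro sumle sc meas mv)
  have A5: "(\<Sum>k<N. ennreal ((1/2) ^ Suc k) * modular p (\<lambda>x. norm (c k *\<^sub>R g k x))) \<le> ennreal d" for N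
  proof (rule sumle)
    have "(\<lambda>x. norm (g k x)) \<in> borel_measurable lebesgue" for k using meas(2) by measurable
    then show "modular p (\<lambda>x. norm (c k *\<^sub>R g k x)) \<le> ennreal d" for k
      using sc[of "\<lambda>x. norm (g k x)" k] mg[of k] c1[of k] by simp
  qed
  obtain u G where u: "u has_weak_gradient G" "AE x in lebesgue. 0 \<le> u x" "modular p u \<le> ennreal d"
    "modular p (\<lambda>x. norm (G x)) \<le> ennreal d" "AE x in lebesgue. \<forall>k. (1/2) ^ Suc k * (c k * v k x) \<le> u x"
    by (rule has_weak_gradient_weighted_series[OF A1 sum_half_powers_le wg' A3 A4 A5])
  have "AE x in lebesgue. \<forall>k. x \<in> U k \<longrightarrow> 1 \<le> v k x"
    using v1 by (simp add: AE_all_countable)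
  with u(5) have "AE x in lebesgue. x \<in> (\<Union>k. U k) \<longrightarrow> 1 \<le> u x"
  proof eventually_elim
    case (elim x)
    have "(1/2) ^ Suc k * (c k * v k x) = v k x" for k
      by (simp add: c_def power_divide)
    then show ?case using elim by (metis UN_E order_trans)
  qed
  then show "\<exists>v g U. v has_weak_gradient g \<and> (AE x in lebesgue. 0 \<le> v x) \<and>
     open U \<and> (\<Union>k. E k) \<subseteq> U \<and> (AE x in lebesgue. x \<in> U \<longrightarrow> 1 \<le> v x) \<and>
     modular p v \<le> ennreal d \<and> modular p (\<lambda>x. norm (g x)) \<le> ennreal d"
    using u U by (intro exI[of _ u] exI[of _ G] exI[of _ "\<Union>k. U k"]) (auto intro!: open_UN)
qed

text \<open>An approximating sequence is recorded as one approximant per tolerance, with all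
  gradient modulars below the same d. The bounds 0 <= u <= 1 hold everywhere, after a change on a
  null set.\<close>

definition mixed_admissible :: "real \<Rightarrow> 'a set \<Rightarrow> 'a set \<Rightarrow> ('a \<Rightarrow> real) \<Rightarrow> bool" where
  "mixed_admissible d E U u \<longleftrightarrow> u \<in> borel_measurable lebesgue \<and> (\<forall>x. 0 \<le> u x \<and> u x \<le> 1) \<and> open U \<and> E \<subseteq> U \<and>
     (AE x in lebesgue. x \<in> U \<longrightarrow> u x = 1) \<and> modular p u \<le> ennreal d \<and>
     (\<forall>e>0. \<exists>w g. w has_weak_gradient g \<and>
        modular p (\<lambda>x. w x - u x) \<le> ennreal e \<and> modular p (\<lambda>x. norm (g x)) \<le> ennreal d)"

text \<open>A liminf below d gives infinitely many indices with small gradient modular, while the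
  distance to u is eventually small; some index has both.\<close>

lemma mixed_null_admissible:
  assumes 0: "mixed_BV_capacity p E = 0" and d: "0 < d"
  obtains u U where "mixed_admissible d E U u"
proof -
  have "mixed_BV_capacity p E < ennreal d" using 0 d by simp
  then obtain u U where u: "u \<in> mixed_BV p" "AE x in lebesgue. 0 \<le> u x \<and> u x \<le> 1" "open U" "E \<subseteq> U"
      "AE x in lebesgue. x \<in> U \<longrightarrow> u x = 1" and less: "modular p u + mixed_BV_modular p u < ennreal d"
    unfolding mixed_BV_capacity_def by (auto simp: INF_less_iff)
  have "mixed_BV_modular p u < ennreal d" "modular p u \<le> ennreal d"
    using less by (auto intro: le_less_trans[OF _ less] order_trans[OF _ less_imp_le[OF less]])
  then obtain w where w: "\<And>i. w i \<in> locally_Lipschitz \<inter> var_Lebesgue p"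
      "(\<lambda>i. Luxemburg_norm p (\<lambda>x. w i x - u x)) \<longlonglongrightarrow> 0" "liminf (\<lambda>i. gradient_modular p (w i)) < ennreal d"
    unfolding mixed_BV_modular_def by (auto simp: INF_less_iff)
  have uv: "u \<in> var_Lebesgue p" using u(1) by (simp add: mixed_BV_def)
  have um [measurable]: "u \<in> borel_measurable lebesgue" using uv by (simp add: var_Lebesgue_iff)
  define u' where "u' x = max 0 (min 1 (u x))" for x
  have ae: "AE x in lebesgue. u' x = u x"
    using u(2) by eventually_elim (auto simp: u'_def)
  have lim: "(\<lambda>i. modular p (\<lambda>x. w i x - u x)) \<longlonglongrightarrow> 0"
    using w by (intro Luxemburg_tendsto_imp_modular var_Lebesgue_diff uv) auto
  have "mixed_admissible d E U u'"
    unfolding mixed_admissible_def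
  proof (intro conjI allI impI)
    show "u' \<in> borel_measurable lebesgue" unfolding u'_def by measurable
    show "AE x in lebesgue. x \<in> U \<longrightarrow> u' x = 1"
      using ae u(5) by eventually_elim auto
    show "modular p u' \<le> ennreal d"
      using modular_cong_AE[OF ae] \<open>modular p u \<le> ennreal d\<close> by simp
    fix e :: real assume e: "0 < e"
    have "\<exists>\<^sub>F i in sequentially. gradient_modular p (w i) < ennreal d"
    proof (rule ccontr)
      assume "\<not> (\<exists>\<^sub>F i in sequentially. gradient_modular p (w i) < ennreal d)"
      then have "\<forall>\<^sub>F i in sequentially. ennreal d \<le> gradient_modular p (w i)"
        by (simp add: not_frequently not_less)
      then have "ennreal d \<le> liminf (\<lambda>i. gradient_modular p (w i))"
        by (rule Liminf_bounded)
      then show False using w(3) by simp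
    qed
    moreover have "\<forall>\<^sub>F i in sequentially. modular p (\<lambda>x. w i x - u x) < ennreal e"
      using lim e by (intro order_tendstoD(2)[where a = "ennreal e"]) auto
    ultimately have "\<exists>\<^sub>F i in sequentially. gradient_modular p (w i) < ennreal d \<and> modular p (\<lambda>x. w i x - u x) < ennreal e"
      by (rule frequently_eventually_frequently)
    then obtain i where i: "gradient_modular p (w i) < ennreal d" "modular p (\<lambda>x. w i x - u x) < ennreal e"
      by (auto dest: frequently_ex)
    obtain g where g: "w i has_weak_gradient g" "modular p (\<lambda>x. norm (g x)) < ennreal d"
      using i(1) unfolding gradient_modular_def by (auto simp: INF_less_iff)
    have "modular p (\<lambda>x. w i x - u' x) = modular p (\<lambda>x. w i x - u x)"
      by (rule modular_cong_AE, rule eventually_mono[OF ae]) simp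
    then show "\<exists>w g. w has_weak_gradient g \<and>
        modular p (\<lambda>x. w x - u' x) \<le> ennreal e \<and> modular p (\<lambda>x. norm (g x)) \<le> ennreal d"
      using w(1)[of i] g i by (intro exI[of _ "w i"] exI[of _ g]) (auto simp: less_imp_le)
  qed (use u in \<open>auto simp: u'_def\<close>)
  then show thesis by (rule that)
qed

section \<open>The region where the exponent exceeds one\<close>

text \<open>\<open>\<delta>\<close> is chosen so that its product with the measure of S is at most
  e/2, and d so that the remaining term equals e/2. The choice is independent of f, so that d can be
  fixed before an admissible function is picked.\<close>

lemma modular_small_imp_integral_small:
  assumes S: "S \<in> sets lebesgue" "emeasure lebesgue S < \<infinity>" and e: "0 < e"
  obtains d where "0 < d" "\<And>f :: 'a \<Rightarrow> 'b::{banach, second_countable_topology}.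
    f \<in> borel_measurable lebesgue \<Longrightarrow> modular p (\<lambda>x. norm (f x)) \<le> ennreal d \<Longrightarrow>
      (\<integral>\<^sup>+x\<in>S. ennreal (norm (f x)) \<partial>lebesgue) \<le> ennreal e"
proof -
  obtain V where V: "emeasure lebesgue S = ennreal V" "0 \<le> V"
    using S(2) by (cases "emeasure lebesgue S") auto
  define \<delta> where "\<delta> = min 1 (e / 2 / (V + 1))"
  have \<delta>: "0 < \<delta>" "\<delta> \<le> 1" using e V(2) by (auto simp: \<delta>_def)
  have dV: "\<delta> * V \<le> e / 2"
  proof -
    have "\<delta> * V \<le> e / 2 / (V + 1) * V" unfolding \<delta>_def using V(2) by (intro mult_right_mono) auto
    also have "\<dots> \<le> e / 2" using e V(2) by (simp add: field_simps)
    finally show ?thesis .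
  qed
  define d where "d = e / 2 / \<delta> powr (1 - P)"
  have \<delta>P: "0 < \<delta> powr (1 - P)" using \<delta> by simp
  show thesis
  proof (rule that)
    show "0 < d" using e \<delta>P by (simp add: d_def)
    fix f :: "'a \<Rightarrow> 'b" assume f: "f \<in> borel_measurable lebesgue" "modular p (\<lambda>x. norm (f x)) \<le> ennreal d"
    have "(\<integral>\<^sup>+x\<in>S. ennreal (norm (f x)) \<partial>lebesgue)
      \<le> ennreal \<delta> * emeasure lebesgue S + ennreal (\<delta> powr (1 - P)) * modular p (\<lambda>x. norm (f x))"
      by (rule set_integral_le_modular[OF _ S(1) \<delta>]) (use f in measurable)
    also have "\<dots> \<le> ennreal \<delta> * ennreal V + ennreal (\<delta> powr (1 - P)) * ennreal d"
      unfolding V(1) by (intro add_left_mono mult_left_mono f) simp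
    also have "\<dots> = ennreal (\<delta> * V + \<delta> powr (1 - P) * d)"
      using \<delta> V(2) \<open>0 < d\<close> by (intro ennreal_mult_add_mult) auto
    also have "\<dots> \<le> ennreal e"
      using dV \<delta>P by (intro ennreal_leI) (simp add: d_def)
    finally show "(\<integral>\<^sup>+x\<in>S. ennreal (norm (f x)) \<partial>lebesgue) \<le> ennreal e" .
  qed
qed

lemma integral_tendsto_0_of_modular:
  fixes f :: "nat \<Rightarrow> 'a \<Rightarrow> 'b::{banach, second_countable_topology}"
  assumes m: "\<And>k. f k \<in> borel_measurable lebesgue" and S: "S \<in> sets lebesgue" "emeasure lebesgue S < \<infinity>"
    and lim: "(\<lambda>k. modular p (\<lambda>x. norm (f k x))) \<longlonglongrightarrow> 0"
  shows "(\<lambda>k. \<integral>\<^sup>+x\<in>S. ennreal (norm (f k x)) \<partial>lebesgue) \<longlonglongrightarrow> 0"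
proof (rule tendsto_zero_ennreal)
  fix r :: real assume r: "0 < r"
  then have r2: "0 < r / 2" by simp
  obtain d where d: "0 < d" "\<And>f :: 'a \<Rightarrow> 'b. f \<in> borel_measurable lebesgue \<Longrightarrow>
      modular p (\<lambda>x. norm (f x)) \<le> ennreal d \<Longrightarrow>
      (\<integral>\<^sup>+x\<in>S. ennreal (norm (f x)) \<partial>lebesgue) \<le> ennreal (r / 2)"
    by (rule modular_small_imp_integral_small[OF S r2]) (rule that)
  have "\<forall>\<^sub>F k in sequentially. modular p (\<lambda>x. norm (f k x)) < ennreal d"
    using lim d(1) by (intro order_tendstoD(2)[where a = "ennreal d"]) auto
  then show "\<forall>\<^sub>F k in sequentially. (\<integral>\<^sup>+x\<in>S. ennreal (norm (f k x)) \<partial>lebesgue) < ennreal r"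
  proof eventually_elim
    case (elim k)
    have "(\<integral>\<^sup>+x\<in>S. ennreal (norm (f k x)) \<partial>lebesgue) \<le> ennreal (r / 2)"
      using elim by (intro d(2) m) simp
    also have "\<dots> < ennreal r" using r by (intro ennreal_lessI) auto
    finally show ?case .
  qed
qed

end

text \<open>Quantitative strict convexity of a \<mapsto> sqrt (1 + |a|^2) on the ball of radius M.
  A, B and C are the lengths of (1,a), (1,b) and their midpoint, and Lagrange's identity bounds
  |a-b|^2 by (AB)^2 - (1 + a.b)^2. In the constant, A + B + 2C contributes 4(1+M), AB contributes
  (1+M)^2, and a further 2 comes from the halved gap.\<close>

lemma sqrt_one_plus_norm_gap:
  fixes a b :: "'a::real_inner"
  assumes a: "norm a \<le> M" and b: "norm b \<le> M"
  shows "(norm (a - b))\<^sup>2 \<le> 8 * (1 + M) ^ 3 *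
     ((sqrt (1 + (norm a)\<^sup>2) + sqrt (1 + (norm b)\<^sup>2)) / 2 - sqrt (1 + (norm ((1/2) *\<^sub>R (a + b)))\<^sup>2))"
proof -
  have M: "0 \<le> M" using a norm_ge_zero order_trans by blast
  define A where "A = sqrt (1 + (norm a)\<^sup>2)"
  define B where "B = sqrt (1 + (norm b)\<^sup>2)"
  define C where "C = sqrt (1 + (norm ((1/2) *\<^sub>R (a + b)))\<^sup>2)"
  have A2: "A\<^sup>2 = 1 + a \<bullet> a" and B2: "B\<^sup>2 = 1 + b \<bullet> b"
    by (simp_all add: A_def B_def power2_norm_eq_inner)
  have C': "C\<^sup>2 = 1 + (norm ((1/2) *\<^sub>R (a + b)))\<^sup>2"
    unfolding C_def by (rule real_sqrt_pow2) simp
  have C2: "4 * C\<^sup>2 = 4 + (a \<bullet> a + 2 * (a \<bullet> b) + b \<bullet> b)"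
    unfolding C' power2_norm_eq_inner by (simp add: inner_add inner_commute algebra_simps)
  have one: "1 \<le> A" "1 \<le> B" "1 \<le> C" by (simp_all add: A_def B_def C_def)
  have le: "A \<le> 1 + M" "B \<le> 1 + M"
  proof -
    have "sqrt (1 + t\<^sup>2) \<le> 1 + M" if "0 \<le> t" "t \<le> M" for t
    proof (rule real_le_lsqrt)
      have "t\<^sup>2 \<le> M\<^sup>2" using that by (intro power_mono) auto
      then show "1 + t\<^sup>2 \<le> (1 + M)\<^sup>2" using M by (simp add: power2_sum)
    qed (use M in auto)
    then show "A \<le> 1 + M" "B \<le> 1 + M" unfolding A_def B_def using a b by auto
  qed
  define s where "s = a \<bullet> b"
  define n where "n = (norm (a - b))\<^sup>2"
  have n: "n = a \<bullet> a - 2 * s + b \<bullet> b"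
    by (simp add: n_def s_def power2_norm_eq_inner inner_diff inner_commute)
  have cs: "s\<^sup>2 \<le> (a \<bullet> a) * (b \<bullet> b)" unfolding s_def by (rule Cauchy_Schwarz_ineq)
  have AB: "0 < A * B" using one by (intro mult_pos_pos) auto
  text \<open>Lagrange's identity for the vectors \<open>(1, a)\<close> and \<open>(1, b)\<close>.\<close>
  have lag: "n \<le> (A * B)\<^sup>2 - (1 + s)\<^sup>2"
    using cs unfolding n power_mult_distrib A2 B2 by (simp add: power2_eq_square algebra_simps)
  then have abs: "\<bar>1 + s\<bar> \<le> A * B"
  proof -
    have "(1 + s)\<^sup>2 \<le> (A * B)\<^sup>2" using lag zero_le_power2[of "norm (a - b)"] unfolding n_def by linarith
    then show ?thesis using AB by (simp add: abs_le_square_iff[symmetric])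
  qed
  have 1: "n \<le> (A * B - (1 + s)) * (2 * (A * B))"
  proof -
    have "n \<le> (A * B - (1 + s)) * (A * B + (1 + s))" using lag by (simp add: power2_eq_square algebra_simps)
    also have "\<dots> \<le> (A * B - (1 + s)) * (2 * (A * B))" using abs by (intro mult_left_mono) auto
    finally show ?thesis .
  qed
  \<comment> \<open>The expansion 4 C^2 = A^2 + B^2 + 2 (1 + s) turns the right side, a difference
    of squares, into the left one.\<close>
  have 2: "2 * (A * B - (1 + s)) = (A + B - 2 * C) * (A + B + 2 * C)"
    using A2 B2 C2 by (simp add: s_def power2_eq_square algebra_simps)
  have pos: "0 < A + B + 2 * C" using one by linarith
  have gap0: "0 \<le> A + B - 2 * C"
    using 2 abs pos by (metis abs_le_D1 diff_ge_0_iff_ge mult_nonneg_nonneg zero_le_mult_iff zero_le_numeral not_le)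
  have CAB: "2 * C \<le> A + B" using gap0 by simp
  have "n \<le> (A + B - 2 * C) * (A + B + 2 * C) * (A * B)"
    unfolding 2[symmetric] using 1 by (simp add: mult_ac)
  also have "\<dots> \<le> (A + B - 2 * C) * (4 * (1 + M)) * ((1 + M) * (1 + M))"
    using gap0 CAB le one M by (intro mult_mono) (auto intro: mult_nonneg_nonneg)
  also have "\<dots> = 8 * (1 + M) ^ 3 * ((A + B) / 2 - C)"
    by (simp add: power3_eq_cube add_divide_distrib algebra_simps)
  finally show ?thesis by (simp add: n_def A_def B_def C_def)
qed

text \<open>Completeness of L^1 in Riesz-Fischer form: along a subsequence with distances at most
  2^-n the increments are summable almost everywhere. The almost everywhere convergence is recorded
  because Fatou's lemma needs it for the modular of the limit.\<close>

lemma L1_Cauchy_limit: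
  fixes f :: "nat \<Rightarrow> 'a::euclidean_space \<Rightarrow> 'b::{banach, second_countable_topology}"
  assumes m: "\<And>k. f k \<in> borel_measurable lebesgue" and S: "S \<in> sets lebesgue"
    and C: "\<And>e. 0 < e \<Longrightarrow> \<exists>N. \<forall>i\<ge>N. \<forall>j\<ge>N. (\<integral>\<^sup>+x\<in>S. ennreal (norm (f i x - f j x)) \<partial>lebesgue) \<le> ennreal e"
  obtains g k where "strict_mono (k :: nat \<Rightarrow> nat)" "g \<in> borel_measurable lebesgue"
    "AE x in lebesgue. x \<in> S \<longrightarrow> (\<lambda>n. f (k n) x) \<longlonglongrightarrow> g x"
    "(\<lambda>n. \<integral>\<^sup>+x\<in>S. ennreal (norm (f (k n) x - g x)) \<partial>lebesgue) \<longlonglongrightarrow> 0"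
proof -
  have "\<exists>N. \<forall>i\<ge>N. \<forall>j\<ge>N. (\<integral>\<^sup>+x\<in>S. ennreal (norm (f i x - f j x)) \<partial>lebesgue) \<le> ennreal ((1/2) ^ n)" for n
    by (rule C) simp
  from choice[OF allI[OF this]] obtain N where N: "\<forall>n. \<forall>i\<ge>N n. \<forall>j\<ge>N n.
      (\<integral>\<^sup>+x\<in>S. ennreal (norm (f i x - f j x)) \<partial>lebesgue) \<le> ennreal ((1/2) ^ n)"
    by (rule exE)
  \<comment> \<open>The running sum makes \<open>k n\<close> at least \<open>N n\<close>, and the
    summand n makes k strictly increasing.\<close>
  define k where "k n = n + (\<Sum>i\<le>n. N i)" for n
  have k: "strict_mono k" by (rule strict_monoI_Suc) (simp add: k_def)
  have kN: "N n \<le> k n" for n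
    using member_le_sum[of n "{..n}" N] by (simp add: k_def)
  define F where "F n = f (k n)" for n
  have [measurable]: "F n \<in> borel_measurable lebesgue" for n unfolding F_def by (rule m)
  have mS [measurable]: "indicator S \<in> borel_measurable lebesgue" using S by (rule borel_measurable_indicator)
  have FF: "(\<integral>\<^sup>+x\<in>S. ennreal (norm (F i x - F j x)) \<partial>lebesgue) \<le> ennreal ((1/2) ^ n)" if "n \<le> i" "n \<le> j" for i j n
  proof -
    have "N n \<le> k i" "N n \<le> k j"
      using kN[of n] k that by (meson le_trans strict_mono_less_eq)+
    then show ?thesis using N by (simp add: F_def)
  qed
  define W where "W x = (\<Sum>n. ennreal (norm (F (Suc n) x - F n x)) * indicator S x)" for x
  have [measurable]: "W \<in> borel_measurable lebesgue" unfolding W_def by measurable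
  have "(\<integral>\<^sup>+x. W x \<partial>lebesgue) = (\<Sum>n. \<integral>\<^sup>+x\<in>S. ennreal (norm (F (Suc n) x - F n x)) \<partial>lebesgue)"
    unfolding W_def by (rule nn_integral_suminf) measurable
  also have "\<dots> \<le> (\<Sum>n. ennreal ((1/2) ^ n))"
    by (intro suminf_le FF) auto
  also have "\<dots> = ennreal (\<Sum>n. (1/2) ^ n)"
    by (rule suminf_ennreal2) auto
  finally have "(\<integral>\<^sup>+x. W x \<partial>lebesgue) \<noteq> \<infinity>"
    by (auto simp: top_unique)
  then have "AE x in lebesgue. W x \<noteq> \<infinity>"
    by (intro nn_integral_PInf_AE) auto
  then have conv: "AE x in lebesgue. x \<in> S \<longrightarrow> convergent (\<lambda>n. F n x)"
  proof eventually_elim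
    case (elim x)
    show ?case
    proof
      assume x: "x \<in> S"
      have "(\<Sum>n. ennreal (norm (F (Suc n) x - F n x))) \<noteq> top"
        using elim x by (simp add: W_def)
      then have "summable (\<lambda>n. norm (F (Suc n) x - F n x))"
        by (intro summable_suminf_not_top) auto
      then have "summable (\<lambda>n. F (Suc n) x - F n x)"
        by (rule summable_norm_cancel)
      then have "convergent (\<lambda>n. \<Sum>i<n. F (Suc i) x - F i x)"
        by (simp add: summable_iff_convergent)
      then have "convergent (\<lambda>n. F n x - F 0 x)"
        using sum_lessThan_telescope[of "\<lambda>i. F i x"] by simp
      then have "convergent (\<lambda>n. (F n x - F 0 x) + F 0 x)"
        by (intro convergent_add convergent_const)
      then show "convergent (\<lambda>n. F n x)" by simp
    qed
  qed
  define g where "g x = lim (\<lambda>n. F n x)" for x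
  have gm [measurable]: "g \<in> borel_measurable lebesgue"
    unfolding g_def by (rule borel_measurable_lim_metric) measurable
  have Fg: "AE x in lebesgue. x \<in> S \<longrightarrow> (\<lambda>n. F n x) \<longlonglongrightarrow> g x"
    using conv by eventually_elim (simp add: g_def convergent_LIMSEQ_iff)
  have bound: "(\<integral>\<^sup>+x\<in>S. ennreal (norm (F n x - g x)) \<partial>lebesgue) \<le> ennreal ((1/2) ^ n)" for n
  proof -
    have "(\<integral>\<^sup>+x\<in>S. ennreal (norm (F n x - g x)) \<partial>lebesgue)
      \<le> (\<integral>\<^sup>+x. liminf (\<lambda>j. ennreal (norm (F n x - F j x)) * indicator S x) \<partial>lebesgue)"
    proof (rule nn_integral_mono_AE, rule eventually_mono[OF Fg])
      fix x assume x: "x \<in> S \<longrightarrow> (\<lambda>n. F n x) \<longlonglongrightarrow> g x"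
      show "ennreal (norm (F n x - g x)) * indicator S x \<le> liminf (\<lambda>j. ennreal (norm (F n x - F j x)) * indicator S x)"
      proof (cases "x \<in> S")
        case True
        then have "(\<lambda>j. ennreal (norm (F n x - F j x))) \<longlonglongrightarrow> ennreal (norm (F n x - g x))"
          using x by (intro tendsto_ennrealI tendsto_intros) auto
        from lim_imp_Liminf[OF _ this] show ?thesis using True by simp
      qed simp
    qed
    also have "\<dots> \<le> liminf (\<lambda>j. \<integral>\<^sup>+x\<in>S. ennreal (norm (F n x - F j x)) \<partial>lebesgue)"
      by (rule nn_integral_liminf) measurable
    also have "\<dots> \<le> limsup (\<lambda>j. \<integral>\<^sup>+x\<in>S. ennreal (norm (F n x - F j x)) \<partial>lebesgue)"
      by (rule Liminf_le_Limsup) simp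
    also have "\<dots> \<le> ennreal ((1/2) ^ n)"
      by (rule Limsup_bounded, rule eventually_mono[OF eventually_ge_at_top[of n]], rule FF) auto
    finally show ?thesis .
  qed
  have "(\<lambda>n. \<integral>\<^sup>+x\<in>S. ennreal (norm (F n x - g x)) \<partial>lebesgue) \<longlonglongrightarrow> 0"
  proof (rule tendsto_sandwich[OF _ _ tendsto_const])
    have "(\<lambda>n. (1/2::real) ^ n) \<longlonglongrightarrow> 0" by (rule LIMSEQ_power_zero) simp
    then show "(\<lambda>n. ennreal ((1/2) ^ n)) \<longlonglongrightarrow> 0" by (subst ennreal_tendsto_0_iff) auto
  qed (use bound in auto)
  then show thesis
    using that[OF k gm] Fg by (simp add: F_def)
qed

context exponent
begin

text \<open>Convexity with weights 1/2. Midpoints of approximants satisfy the same bounds as the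
  approximants, with no loss of a constant.\<close>

lemma modular_midpoint:
  assumes m: "a \<in> borel_measurable lebesgue" "b \<in> borel_measurable lebesgue"
    and le: "\<And>x. \<bar>f x\<bar> \<le> (\<bar>a x\<bar> + \<bar>b x\<bar>) / 2"
    and e: "modular p a \<le> ennreal e" "modular p b \<le> ennreal e"
  shows "modular p f \<le> ennreal e"
proof -
  have "modular p f \<le> (\<Sum>k<2::nat. ennreal (1/2) * modular p (if k = 0 then a else b))"
  proof (rule modular_weighted_sum_le)
    show "\<bar>f x\<bar> \<le> (\<Sum>k<2::nat. 1 / 2 * \<bar>(if k = 0 then a else b) x\<bar>)" for x
      using le[of x] by (simp add: numeral_2_eq_2)
  qed (use m in auto)
  also have "\<dots> = ennreal (1/2) * modular p a + ennreal (1/2) * modular p b"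
    by (simp add: numeral_2_eq_2)
  also have "\<dots> \<le> ennreal (1/2) * ennreal e + ennreal (1/2) * ennreal e"
    by (intro add_mono mult_left_mono e) auto
  also have "\<dots> = (ennreal (1/2) + ennreal (1/2)) * ennreal e"
    by (rule distrib_right[symmetric])
  also have "ennreal (1/2) + ennreal (1/2) = 1"
    by (subst ennreal_plus[symmetric]) auto
  finally show ?thesis by simp
qed

text \<open>Instead of extracting weakly convergent gradients, we choose approximants whose gradients
  nearly minimise a strictly convex integral; those are Cauchy in \<open>L\<^sup>1\<close>, since \<open>p\<close> is bounded away
  from 1 on \<open>S\<close> and hence the gradients are equi-integrable there.\<close>

lemma gradients_L1_Cauchy:
  fixes u :: "'a \<Rightarrow> real"
  assumes S: "S \<in> sets lebesgue" "emeasure lebesgue S < \<infinity>"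
    and \<delta>: "0 < \<delta>" "\<And>x. x \<in> S \<Longrightarrow> 1 + \<delta> \<le> p x" and d: "0 < d"
    and um: "u \<in> borel_measurable lebesgue"
    and ap: "\<And>e. 0 < e \<Longrightarrow> \<exists>w g. w has_weak_gradient g \<and> modular p (\<lambda>x. w x - u x) \<le> ennreal e \<and>
        modular p (\<lambda>x. norm (g x)) \<le> ennreal d"
  obtains w g where "\<And>i::nat. w i has_weak_gradient g i" "(\<lambda>i. modular p (\<lambda>x. w i x - u x)) \<longlonglongrightarrow> 0"
    "\<And>i. modular p (\<lambda>x. norm (g i x)) \<le> ennreal d"
    "\<And>e. 0 < e \<Longrightarrow> \<exists>N. \<forall>i\<ge>N. \<forall>j\<ge>N. (\<integral>\<^sup>+x\<in>S. ennreal (norm (g i x - g j x)) \<partial>lebesgue) \<le> ennreal e"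
proof -
  define V where "V = measure lebesgue S"
  have V: "emeasure lebesgue S = ennreal V" "0 \<le> V"
    unfolding V_def using S(2) by (auto intro!: emeasure_eq_ennreal_measure simp: less_top[symmetric])
  have iS: "integrable lebesgue (indicator S :: 'a \<Rightarrow> real)" and LS: "(LINT x|lebesgue. indicator S x) = V"
    using S by (auto simp: V_def)
  note S(1) [measurable]
  define ok where "ok g \<longleftrightarrow> g \<in> borel_measurable lebesgue \<and> modular p (\<lambda>x. norm (g x)) \<le> ennreal d" for g :: "'a \<Rightarrow> 'a"
  have ip: "integrable lebesgue (\<lambda>x. norm (g x) powr p x)" "(LINT x|lebesgue. norm (g x) powr p x) \<le> d" if "ok g" for g
  proof -
    have m [measurable]: "g \<in> borel_measurable lebesgue" using that by (simp add: ok_def)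
    have le: "(\<integral>\<^sup>+x. ennreal (norm (g x) powr p x) \<partial>lebesgue) \<le> ennreal d"
      using that by (simp add: ok_def modular_def)
    then show i: "integrable lebesgue (\<lambda>x. norm (g x) powr p x)"
      unfolding integrable_iff_bounded by (auto simp: order_le_less_trans)
    have "ennreal (LINT x|lebesgue. norm (g x) powr p x) \<le> ennreal d"
      using le nn_integral_eq_integral[OF i] by simp
    then show "(LINT x|lebesgue. norm (g x) powr p x) \<le> d" using d by simp
  qed
  \<comment> \<open>Strictly convex but of linear growth, so that its integral over S is finite for
    every gradient of finite modular.\<close>
  define \<Psi> where "\<Psi> a = sqrt (1 + (norm a)\<^sup>2)" for a :: 'a
  have \<Psi>: "0 \<le> \<Psi> a" "\<Psi> a \<le> 1 + norm a" for a
    unfolding \<Psi>_def by (auto intro!: real_le_lsqrt simp: power2_sum)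
  have [measurable]: "\<Psi> \<in> borel_measurable borel" unfolding \<Psi>_def[abs_def] by measurable
  have t_le: "t \<le> 1 + t powr p x" if "0 \<le> t" for t x
    using le_const_plus_powr[of 1 t x] that by simp
  have i\<Psi>: "integrable lebesgue (\<lambda>x. indicator S x * \<Psi> (g x))" if "ok g" for g
  proof (rule Bochner_Integration.integrable_bound)
    show "integrable lebesgue (\<lambda>x. 2 * indicator S x + norm (g x) powr p x)"
      using iS ip(1)[OF that] by simp
    have [measurable]: "g \<in> borel_measurable lebesgue" using that by (simp add: ok_def)
    show "(\<lambda>x. indicator S x * \<Psi> (g x)) \<in> borel_measurable lebesgue"
      by measurable
    have "\<Psi> (g x) \<le> 2 + norm (g x) powr p x" for x
      using \<Psi>(2)[of "g x"] t_le[of "norm (g x)" x] by simp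
    then show "AE x in lebesgue. norm (indicator S x * \<Psi> (g x)) \<le> norm (2 * indicator S x + norm (g x) powr p x)"
      using \<Psi>(1) by (auto simp: indicator_def)
  qed
  define J where "J g = (LINT x|lebesgue. indicator S x * \<Psi> (g x))" for g
  have J0: "0 \<le> J g" for g unfolding J_def using \<Psi>(1) by (auto intro!: integral_nonneg_AE)
  have J1: "J g \<le> 2 * V + d" if "ok g" for g
  proof -
    have "J g \<le> (LINT x|lebesgue. 2 * indicator S x + norm (g x) powr p x)"
      unfolding J_def
    proof (rule integral_mono[OF i\<Psi>[OF that]])
      show "integrable lebesgue (\<lambda>x. 2 * indicator S x + norm (g x) powr p x)"
        using iS ip(1)[OF that] by simp
      show "indicator S x * \<Psi> (g x) \<le> 2 * indicator S x + norm (g x) powr p x" for x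
        using \<Psi>(2)[of "g x"] t_le[of "norm (g x)" x] by (auto simp: indicator_def)
    qed
    also have "\<dots> = 2 * V + (LINT x|lebesgue. norm (g x) powr p x)"
      using iS ip(1)[OF that] LS by simp
    finally show ?thesis using ip(2)[OF that] by simp
  qed
  \<comment> \<open>Pairs of an approximant within modular distance e of u and a permitted weak
    gradient. These sets shrink with e and are closed under midpoints.\<close>
  define C where "C e = {(w, g). w has_weak_gradient g \<and> modular p (\<lambda>x. w x - u x) \<le> ennreal e \<and> ok g}" for e
  have okC: "(w, g) \<in> C e \<Longrightarrow> ok g" for w g e by (simp add: C_def)
  have C_ne: "C e \<noteq> {}" if "0 < e" for e
    using ap[OF that] has_weak_gradientD(2) locally_integrable_measurable by (fastforce simp: C_def ok_def)
  have C_mono: "C e \<subseteq> C e'" if "e \<le> e'" for e e'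
    using ennreal_leI[OF that] by (auto simp: C_def intro: order_trans)
  define avg where "avg a b = (\<lambda>x. (1/2::real) *\<^sub>R (a x + b x))" for a b :: "'a \<Rightarrow> 'a"
  have C_avg: "((\<lambda>x. (1/2) * w x + (1/2) * w' x), avg g g') \<in> C e" if "(w, g) \<in> C e" "(w', g') \<in> C e" for w g w' g' e
  proof -
    have wg: "w has_weak_gradient g" "w' has_weak_gradient g'" using that by (auto simp: C_def)
    have [measurable]: "w \<in> borel_measurable lebesgue" "w' \<in> borel_measurable lebesgue" "g \<in> borel_measurable lebesgue" "g' \<in> borel_measurable lebesgue"
      using has_weak_gradientD(1,2)[OF wg(1)] has_weak_gradientD(1,2)[OF wg(2)] by (auto intro: locally_integrable_measurable)
    note um [measurable]
    have 1: "(\<lambda>x. (1/2) * w x + (1/2) * w' x) has_weak_gradient avg g g'"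
      using has_weak_gradient_linear[OF wg, of "1/2" "1/2"] by (simp add: avg_def scaleR_add_right)
    have 2: "modular p (\<lambda>x. (1/2) * w x + (1/2) * w' x - u x) \<le> ennreal e"
    proof (rule modular_midpoint[of "\<lambda>x. w x - u x" "\<lambda>x. w' x - u x"])
      show "\<bar>(1/2) * w x + (1/2) * w' x - u x\<bar> \<le> (\<bar>w x - u x\<bar> + \<bar>w' x - u x\<bar>) / 2" for x
      proof -
        have eq: "(1/2) * w x + (1/2) * w' x - u x = ((w x - u x) + (w' x - u x)) / 2"
          by (simp add: field_simps)
        show ?thesis
          unfolding eq abs_divide using abs_triangle_ineq[of "w x - u x" "w' x - u x"] by simp
      qed
    qed (use that in \<open>auto simp: C_def\<close>)
    have 3: "modular p (\<lambda>x. norm (avg g g' x)) \<le> ennreal d"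
    proof (rule modular_midpoint[of "\<lambda>x. norm (g x)" "\<lambda>x. norm (g' x)"])
      show "\<bar>norm (avg g g' x)\<bar> \<le> (\<bar>norm (g x)\<bar> + \<bar>norm (g' x)\<bar>) / 2" for x
        using norm_triangle_ineq[of "g x" "g' x"] by (simp add: avg_def)
    qed (use that in \<open>auto simp: C_def ok_def\<close>)
    have 4: "avg g g' \<in> borel_measurable lebesgue" unfolding avg_def by measurable
    show ?thesis using 1 2 3 4 by (simp add: C_def ok_def)
  qed
  define r where "r i = 1 / (real i + 1)" for i
  have r: "0 < r i" "i \<le> j \<Longrightarrow> r j \<le> r i" for i j by (auto simp: r_def intro!: divide_left_mono)
  have rlim: "r \<longlonglongrightarrow> 0"
    using LIMSEQ_inverse_real_of_nat by (simp add: r_def[abs_def] divide_inverse add.commute)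
  \<comment> \<open>Minimal energies increase as the tolerance shrinks and are bounded above, hence
    form a Cauchy sequence.\<close>
  define m where "m i = Inf ((\<lambda>(w, g). J g) ` C (r i))" for i
  have bdd: "bdd_below ((\<lambda>(w, g). J g) ` C e)" for e
    using J0 by (auto intro!: bdd_belowI[of _ 0])
  have m_le: "m i \<le> J g" if "(w, g) \<in> C (r i)" for i w g
    unfolding m_def using that by (intro cInf_lower bdd) (auto intro!: image_eqI[of _ _ "(w, g)"])
  have "\<exists>z. z \<in> C (r i) \<and> J (snd z) < m i + r i" for i
  proof -
    have "\<exists>y\<in>(\<lambda>(w, g). J g) ` C (r i). y < m i + r i"
      unfolding m_def using C_ne[OF r(1)] r(1)[of i] by (intro cInf_lessD) auto
    then show ?thesis by fastforce
  qed
  from choice[OF allI[OF this]] obtain z where z: "\<forall>i. z i \<in> C (r i) \<and> J (snd (z i)) < m i + r i"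
    by (rule exE)
  define w where "w i = fst (z i)" for i
  define g where "g i = snd (z i)" for i
  have wg: "(w i, g i) \<in> C (r i)" and Jg: "J (g i) < m i + r i" for i
    using z by (auto simp: w_def g_def)
  have okg: "ok (g i)" for i using okC[OF wg] .
  have inc: "incseq m"
  proof (rule incseq_SucI)
    fix i
    have "C (r (Suc i)) \<subseteq> C (r i)" by (rule C_mono[OF r(2)]) simp
    then show "m i \<le> m (Suc i)"
      unfolding m_def using C_ne[OF r(1)] by (intro cInf_superset_mono bdd image_mono) auto
  qed
  have "m i \<le> 2 * V + d" for i
    using m_le[OF wg] J1[OF okg] order_trans by blast
  then have "convergent m"
    using inc by (metis incseq_convergent convergentI)
  then have Cm: "Cauchy m" by (rule convergent_Cauchy)
  \<comment> \<open>For i <= j the midpoint of the two pairs still belongs to the larger set, so its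
    energy is at least \<open>m i\<close>; near-minimality of both ends then bounds the convexity
    gap.\<close>
  have gap: "(J (g i) + J (g j)) / 2 - J (avg (g i) (g j)) \<le> (m j - m i) / 2 + r i" if "i \<le> j" for i j
  proof -
    have "(w j, g j) \<in> C (r i)" using wg[of j] C_mono[OF r(2)[OF that]] by blast
    then have "m i \<le> J (avg (g i) (g j))" using m_le C_avg wg by blast
    then show ?thesis using Jg[of i] Jg[of j] r(2)[OF that] by argo
  qed
  have main: "\<exists>N. \<forall>i\<ge>N. \<forall>j\<ge>N. (\<integral>\<^sup>+x\<in>S. ennreal (norm (g i x - g j x)) \<partial>lebesgue) \<le> ennreal e" if e: "0 < e" for e
  proof -
    \<comment> \<open>Chosen so that \<open>M powr (- \<delta>)\<close> times 12 d + e equals e,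
      which makes the contribution of gradients above level M at most e/3.\<close>
    define M where "M = (12 * d / e + 1) powr (1 / \<delta>)"
    have b1: "1 \<le> 12 * d / e + 1" using d e by simp
    have M1: "1 \<le> M" unfolding M_def using b1 \<delta>(1) by (intro ge_one_powr_ge_zero) auto
    have M\<delta>: "4 * d * M powr (- \<delta>) \<le> e / 3"
    proof -
      have "M powr (- \<delta>) = 1 / (12 * d / e + 1)"
        unfolding M_def using \<delta>(1) b1 by (simp add: powr_powr powr_minus_divide)
      then have "e * M powr (- \<delta>) + 12 * d * M powr (- \<delta>) = e"
        using d e by (simp add: field_simps)
      moreover have "0 \<le> e * M powr (- \<delta>)" using e by simp
      ultimately show ?thesis by (simp add: algebra_simps)
    qed
    define \<eta> where "\<eta> = e / 3 / (V + 1)"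
    have \<eta>: "0 < \<eta>" "\<eta> * V \<le> e / 3" using e V(2) by (auto simp: \<eta>_def field_simps)
    define K where "K = 8 * (1 + M) ^ 3 / \<eta>"
    have K: "0 < K" unfolding K_def using M1 \<eta> by simp
    define D where "D a b = (\<Psi> a + \<Psi> b) / 2 - \<Psi> ((1/2) *\<^sub>R (a + b))" for a b
    have D0: "0 \<le> D a b" for a b
    proof -
      have "0 \<le> (norm (a - b))\<^sup>2" by simp
      also have "\<dots> \<le> 8 * (1 + max (norm a) (norm b)) ^ 3 * D a b"
        unfolding D_def \<Psi>_def by (rule sqrt_one_plus_norm_gap) auto
      finally show ?thesis by (simp add: zero_le_mult_iff) (smt (verit) norm_ge_zero zero_less_power)
    qed
    \<comment> \<open>Below level M the convexity gap D controls the distance. Above it, the larger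
      norm t equals t^(1-p) t^p, and 1 - p is at most -\<open>\<delta>\<close> on S, which is where
      the gap above 1 produces equi-integrability.\<close>
    have pw: "norm (a - b) \<le> \<eta> + K * D a b + 2 * M powr (- \<delta>) * (norm a powr p x + norm b powr p x)" if x: "x \<in> S" for a b x
    proof (cases "norm a \<le> M \<and> norm b \<le> M")
      case True
      have "norm (a - b) \<le> \<eta> + (norm (a - b))\<^sup>2 / \<eta>"
      proof (cases "norm (a - b) \<le> \<eta>")
        case True
        then show ?thesis using \<eta> by (simp add: add_increasing2)
      next
        case False
        then have "norm (a - b) * \<eta> \<le> (norm (a - b))\<^sup>2"
          by (simp add: power2_eq_square mult_left_mono)
        then have "norm (a - b) \<le> (norm (a - b))\<^sup>2 / \<eta>" using \<eta> by (simp add: le_divide_eq)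
        then show ?thesis using \<eta> by simp
      qed
      also have "(norm (a - b))\<^sup>2 / \<eta> \<le> (8 * (1 + M) ^ 3 * D a b) / \<eta>"
        using \<eta> True unfolding D_def \<Psi>_def by (intro divide_right_mono sqrt_one_plus_norm_gap) auto
      also have "\<dots> = K * D a b" by (simp add: K_def)
      finally have "norm (a - b) \<le> \<eta> + K * D a b" by simp
      moreover have "0 \<le> 2 * M powr (- \<delta>) * (norm a powr p x + norm b powr p x)" by simp
      ultimately show ?thesis by linarith
    next
      case False
      define t where "t = max (norm a) (norm b)"
      have t: "M < t" using False by (auto simp: t_def)
      have "norm (a - b) \<le> norm a + norm b" by (rule norm_triangle_ineq4)
      also have "\<dots> \<le> 2 * t" by (simp add: t_def)
      also have "t = t powr (1 - p x) * t powr p x" using t M1 by (simp flip: powr_add)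
      also have "t powr (1 - p x) \<le> M powr (- \<delta>)"
      proof -
        have "t powr (1 - p x) \<le> t powr (- \<delta>)" using t M1 \<delta>(2)[OF x] by (intro powr_mono) auto
        also have "\<dots> \<le> M powr (- \<delta>)" using t M1 \<delta>(1) by (intro powr_mono2') auto
        finally show ?thesis .
      qed
      also have "t powr p x \<le> norm a powr p x + norm b powr p x" by (auto simp: t_def max_def)
      finally have "norm (a - b) \<le> 2 * (M powr (- \<delta>) * (norm a powr p x + norm b powr p x))"
        by (simp add: mult_left_mono mult_right_mono)
      moreover have "0 \<le> K * D a b" using K D0[of a b] by simp
      ultimately show ?thesis using \<eta>(1) by simp
    qed
    have est: "(\<integral>\<^sup>+x\<in>S. ennreal (norm (g i x - g j x)) \<partial>lebesgue) \<le> ennreal (\<eta> * V + K * ((m j - m i) / 2 + r i) + 4 * d * M powr (- \<delta>))"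
      if ij: "i \<le> j" for i j
    proof -
      have [measurable]: "g i \<in> borel_measurable lebesgue" "g j \<in> borel_measurable lebesgue" using okg by (auto simp: ok_def)
      have oka: "ok (avg (g i) (g j))"
        using okC[OF C_avg[OF wg]] wg[of j] C_mono[OF r(2)[OF ij]] C_avg[OF wg[of i], of "w j" "g j"] okC by blast
      note ii = i\<Psi>[OF okg[of i]] i\<Psi>[OF okg[of j]] i\<Psi>[OF oka] ip(1)[OF okg[of i]] ip(1)[OF okg[of j]] iS
      let ?R = "\<lambda>x. \<eta> * indicator S x + K * ((indicator S x * \<Psi> (g i x) + indicator S x * \<Psi> (g j x)) / 2 - indicator S x * \<Psi> (avg (g i) (g j) x))
          + 2 * M powr (- \<delta>) * (norm (g i x) powr p x + norm (g j x) powr p x)"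
      have iR: "integrable lebesgue ?R" using ii by simp
      have le: "norm (g i x - g j x) * indicator S x \<le> ?R x" for x
      proof (cases "x \<in> S")
        case True
        then show ?thesis using pw[OF True, of "g i x" "g j x"] by (simp add: D_def avg_def)
      qed simp
      have R0: "0 \<le> ?R x" for x by (rule order_trans[OF _ le]) simp
      have "(\<integral>\<^sup>+x\<in>S. ennreal (norm (g i x - g j x)) \<partial>lebesgue) \<le> (\<integral>\<^sup>+x. ennreal (?R x) \<partial>lebesgue)"
      proof (rule nn_integral_mono)
        fix x
        have "ennreal (norm (g i x - g j x)) * indicator S x = ennreal (norm (g i x - g j x) * indicator S x)"
          by (auto simp: indicator_def)
        also have "\<dots> \<le> ennreal (?R x)" by (rule ennreal_leI[OF le])
        finally show "ennreal (norm (g i x - g j x)) * indicator S x \<le> ennreal (?R x)" .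
      qed
      also have "\<dots> = ennreal (LINT x|lebesgue. ?R x)"
        using R0 by (intro nn_integral_eq_integral iR) auto
      also have "(LINT x|lebesgue. ?R x) = \<eta> * V + K * ((J (g i) + J (g j)) / 2 - J (avg (g i) (g j)))
          + 2 * M powr (- \<delta>) * ((LINT x|lebesgue. norm (g i x) powr p x) + (LINT x|lebesgue. norm (g j x) powr p x))"
        using ii LS by (simp add: J_def)
      also have "\<dots> \<le> \<eta> * V + K * ((m j - m i) / 2 + r i) + 2 * M powr (- \<delta>) * (d + d)"
        using K \<eta>(1) by (intro add_mono mult_left_mono gap[OF ij] ip(2)[OF okg]) auto
      finally show ?thesis by (simp add: ennreal_leI mult_ac)
    qed
    define e' where "e' = e / 3 / K"
    have e': "0 < e'" using e K by (simp add: e'_def)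
    obtain N1 where N1: "\<And>i j. N1 \<le> i \<Longrightarrow> N1 \<le> j \<Longrightarrow> dist (m i) (m j) < e'"
      using Cm e' unfolding Cauchy_def by metis
    have "\<forall>\<^sub>F i in sequentially. r i < e' / 2"
      using rlim e' by (intro order_tendstoD(2)[where a="e'/2"]) auto
    then obtain N2 where N2: "\<And>i. N2 \<le> i \<Longrightarrow> r i < e' / 2"
      unfolding eventually_sequentially by blast
    have le: "(\<integral>\<^sup>+x\<in>S. ennreal (norm (g i x - g j x)) \<partial>lebesgue) \<le> ennreal e"
      if "max N1 N2 \<le> i" "i \<le> j" for i j
    proof -
      have "m j - m i < e'" using N1[of j i] that by (simp add: dist_real_def)
      moreover have "r i < e' / 2" using N2[of i] that by simp
      ultimately have "(m j - m i) / 2 + r i \<le> e'" by argo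
      then have "K * ((m j - m i) / 2 + r i) \<le> K * e'" using K by (intro mult_left_mono) auto
      also have "\<dots> = e / 3" using K by (simp add: e'_def)
      finally have "\<eta> * V + K * ((m j - m i) / 2 + r i) + 4 * d * M powr (- \<delta>) \<le> e"
        using \<eta>(2) M\<delta> by linarith
      then show ?thesis using est[OF that(2)] ennreal_leI order_trans by blast
    qed
    show ?thesis
    proof (intro exI[of _ "max N1 N2"] allI impI)
      fix i j assume ij: "max N1 N2 \<le> i" "max N1 N2 \<le> j"
      show "(\<integral>\<^sup>+x\<in>S. ennreal (norm (g i x - g j x)) \<partial>lebesgue) \<le> ennreal e"
      proof (cases "i \<le> j")
        case True
        then show ?thesis using le ij by blast
      next
        case False
        then show ?thesis using le[of j i] ij by (simp add: norm_minus_commute)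
      qed
    qed
  qed
  show thesis
  proof (rule that[OF _ _ _ main])
    show "w i has_weak_gradient g i" "modular p (\<lambda>x. norm (g i x)) \<le> ennreal d" for i
      using wg[of i] by (auto simp: C_def ok_def)
    have le: "modular p (\<lambda>x. w i x - u x) \<le> ennreal (r i)" for i
      using wg[of i] by (simp add: C_def)
    have r0: "(\<lambda>i. ennreal (r i)) \<longlonglongrightarrow> 0"
      using rlim r(1) by (subst ennreal_tendsto_0_iff) (auto simp: less_imp_le)
    show "(\<lambda>i. modular p (\<lambda>x. w i x - u x)) \<longlonglongrightarrow> 0"
      by (rule tendsto_sandwich[OF _ _ tendsto_const r0]) (use le in auto)
  qed
qed

end

section \<open>Localisation to balls\<close>

lemma bump_scaled:
  fixes x0 :: "'a::euclidean_space"
  assumes r: "0 < r"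
  obtains Z R B where "(\<lambda>x. bump ((1 / r) *\<^sub>R (x - x0))) \<in> test_functions"
    "C1c_gradient (\<lambda>x. bump ((1 / r) *\<^sub>R (x - x0))) Z R"
    "\<And>x. x \<notin> ball x0 (2 * r) \<Longrightarrow> bump ((1 / r) *\<^sub>R (x - x0)) = 0 \<and> Z x = 0"
    "\<And>x. x \<in> ball x0 r \<Longrightarrow> 1 \<le> bump ((1 / r) *\<^sub>R (x - x0))"
    "1 \<le> B" "\<And>x. bump ((1 / r) *\<^sub>R (x - x0)) \<le> B" "\<And>x. norm (Z x) \<le> B"
proof -
  have t: "(\<lambda>x. bump ((1 / r) *\<^sub>R (x - x0))) \<in> test_functions"
    using test_functions_affine[OF bump_test, of "1/r" "- (1 / r) *\<^sub>R x0"] r by (simp add: scaleR_diff_right)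
  obtain D R0 where "C1c_gradient (bump :: 'a \<Rightarrow> real) D R0"
    using test_function_C1_gradient[OF bump_test] by blast
  then have D: "C1_gradient (bump :: 'a \<Rightarrow> real) D" by (simp add: C1c_gradient_def)
  define Z where "Z x = (1 / r) *\<^sub>R D ((1 / r) *\<^sub>R (x - x0))" for x
  have Z: "C1_gradient (\<lambda>x. bump ((1 / r) *\<^sub>R (x - x0))) Z"
    unfolding Z_def using C1_gradient_affine[OF D, of "1/r" "- (1 / r) *\<^sub>R x0"] by (simp add: scaleR_diff_right)
  have out: "bump ((1 / r) *\<^sub>R (x - x0)) = 0 \<and> Z x = 0" if "x \<notin> ball x0 (2 * r)" for x
  proof -
    have n: "2 \<le> norm ((1 / r) *\<^sub>R (x - x0))"
      using that r by (simp add: dist_norm norm_minus_commute le_divide_eq)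
    show ?thesis
      using bump_eq_0[OF n] C1_gradient_zero_outside[OF D bump_eq_0 n] by (simp add: Z_def)
  qed
  have c: "C1c_gradient (\<lambda>x. bump ((1 / r) *\<^sub>R (x - x0))) Z (norm x0 + 2 * r)"
    unfolding C1c_gradient_def
  proof (intro conjI allI impI Z)
    fix x :: 'a assume "norm x0 + 2 * r \<le> norm x"
    then have "x \<notin> ball x0 (2 * r)"
      using norm_triangle_ineq2[of x x0] by (simp add: dist_norm norm_minus_commute)
    then show "bump ((1 / r) *\<^sub>R (x - x0)) = 0" "Z x = 0" using out by auto
  qed
  obtain B where B: "\<And>x. \<bar>bump ((1 / r) *\<^sub>R (x - x0))\<bar> \<le> B" "\<And>x. norm (Z x) \<le> B"
    using C1c_gradient_facts[OF c] by metis
  show thesis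
  proof (rule that[OF t c out])
    show "1 \<le> bump ((1 / r) *\<^sub>R (x - x0))" if "x \<in> ball x0 r" for x
      using that r by (intro bump_ge_1) (simp add: dist_norm norm_minus_commute)
    show "1 \<le> max 1 B" by simp
    show "bump ((1 / r) *\<^sub>R (x - x0)) \<le> max 1 B" for x
      using B(1)[of x] by linarith
    show "norm (Z x) \<le> max 1 B" for x
      using B(2)[of x] by linarith
  qed
qed

context exponent
begin

lemma cap_null_empty: "cap_null {}"
  unfolding cap_null_def
proof (intro allI impI)
  fix d :: real
  have "C1_gradient (\<lambda>x::'a. 0::real) (\<lambda>x. 0)" by (simp add: C1_gradient_def)
  from C1_gradient_weak[OF this]
  show "\<exists>v g U. v has_weak_gradient g \<and> (AE x in lebesgue. 0 \<le> v x) \<and> open U \<and> {} \<subseteq> U \<and>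
      (AE x in lebesgue. x \<in> U \<longrightarrow> 1 \<le> v x) \<and> modular p v \<le> ennreal d \<and>
      modular p (\<lambda>x. norm (g x)) \<le> ennreal d"
    by (intro exI[of _ "\<lambda>x. 0"] exI[of _ "{}"]) (auto simp: modular_def)
qed

lemma cap_null_Union:
  assumes "countable A" "\<And>X. X \<in> A \<Longrightarrow> cap_null X"
  shows "cap_null (\<Union>A)"
proof (cases "A = {}")
  case False
  then have "\<Union>A = (\<Union>k. from_nat_into A k)"
    using assms(1) by (metis UNION_singleton_eq_range range_from_nat_into Union_eq image_image)
  then show ?thesis
    using cap_null_UN[of "from_nat_into A"] assms(2) from_nat_into[OF False] by simp
qed (simp add: cap_null_empty)

text \<open>The L^1 limit G of the chosen gradients is available on S only, so u is multiplied by a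
  bump supported in S, and Fatou's lemma bounds the modular of G. The gradient bound B of the bump
  depends on r, which is harmless because d is chosen after it.\<close>

lemma cap_null_ball_exponent_gt_1:
  assumes E: "mixed_BV_capacity p E = 0" and r: "0 < r" and \<delta>: "0 < \<delta>" "\<And>x. x \<in> ball x0 (2 * r) \<Longrightarrow> 1 + \<delta> \<le> p x"
  shows "cap_null (E \<inter> ball x0 r)"
  unfolding cap_null_def
proof (intro allI impI)
  fix \<epsilon> :: real assume \<epsilon>: "0 < \<epsilon>"
  define S where "S = ball x0 (2 * r)"
  have S: "S \<in> sets lebesgue" "emeasure lebesgue S < \<infinity>"
    using emeasure_lborel_ball_finite[of x0 "2 * r"] by (auto simp: S_def)
  note S(1) [measurable]
  define \<zeta> where "\<zeta> = (\<lambda>x. bump ((1 / r) *\<^sub>R (x - x0)))"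
  obtain Z R B where raw: "(\<lambda>x. bump ((1 / r) *\<^sub>R (x - x0))) \<in> test_functions"
    "C1c_gradient (\<lambda>x. bump ((1 / r) *\<^sub>R (x - x0))) Z R"
    "\<And>x. x \<notin> ball x0 (2 * r) \<Longrightarrow> bump ((1 / r) *\<^sub>R (x - x0)) = 0 \<and> Z x = 0"
    "\<And>x. x \<in> ball x0 r \<Longrightarrow> 1 \<le> bump ((1 / r) *\<^sub>R (x - x0))"
    "1 \<le> B" "\<And>x. bump ((1 / r) *\<^sub>R (x - x0)) \<le> B" "\<And>x. norm (Z x) \<le> B"
    by (rule bump_scaled[OF r, of x0]) (rule that)
  have t: "\<zeta> \<in> test_functions" and cZ: "C1c_gradient \<zeta> Z R"
    unfolding \<zeta>_def by (rule raw)+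
  have out: "\<zeta> x = 0 \<and> Z x = 0" if "x \<notin> S" for x
    using raw(3) that unfolding \<zeta>_def S_def by simp
  have one: "1 \<le> \<zeta> x" if "x \<in> ball x0 r" for x
    using raw(4)[OF that] by (simp add: \<zeta>_def)
  have B: "1 \<le> B" "\<And>x. \<zeta> x \<le> B" "\<And>x. norm (Z x) \<le> B"
    unfolding \<zeta>_def by (rule raw)+
  have \<zeta>0: "0 \<le> \<zeta> x" for x unfolding \<zeta>_def by (rule bump_nonneg)
  have [measurable]: "\<zeta> \<in> borel_measurable lebesgue" "Z \<in> borel_measurable lebesgue"
    using C1c_gradient_facts[OF cZ] by metis+
  \<comment> \<open>B^P is the price of the bump and its gradient, 2^P that of splitting the product
    gradient, which has two terms.\<close>
  define K where "K = 2 * (2 powr P * B powr P)"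
  have "1 * 1 \<le> 2 powr P * B powr P"
    using B(1) P_ge by (intro mult_mono ge_one_powr_ge_zero) auto
  then have K: "0 < K" by (simp add: K_def)
  define d where "d = \<epsilon> / K"
  have d: "0 < d" using \<epsilon> K by (simp add: d_def)
  obtain u U where "mixed_admissible d E U u"
    using mixed_null_admissible[OF E d] by blast
  then have um [measurable]: "u \<in> borel_measurable lebesgue" and u01: "\<And>x. 0 \<le> u x \<and> u x \<le> 1" and U: "open U" "E \<subseteq> U"
    and u1: "AE x in lebesgue. x \<in> U \<longrightarrow> u x = 1" and mu: "modular p u \<le> ennreal d"
    and ap: "\<And>e. 0 < e \<Longrightarrow> \<exists>w g. w has_weak_gradient g \<and>
        modular p (\<lambda>x. w x - u x) \<le> ennreal e \<and> modular p (\<lambda>x. norm (g x)) \<le> ennreal d"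
    unfolding mixed_admissible_def by blast+
  have ap': "\<exists>w g. w has_weak_gradient g \<and> modular p (\<lambda>x. w x - u x) \<le> ennreal e \<and>
        modular p (\<lambda>x. norm (g x)) \<le> ennreal d" if "0 < e" for e
    using ap[OF that] by blast
  have \<delta>S: "\<And>x. x \<in> S \<Longrightarrow> 1 + \<delta> \<le> p x" using \<delta>(2) by (simp add: S_def)
  obtain w g where w: "\<And>i::nat. w i has_weak_gradient g i" "(\<lambda>i. modular p (\<lambda>x. w i x - u x)) \<longlonglongrightarrow> 0"
    "\<And>i. modular p (\<lambda>x. norm (g i x)) \<le> ennreal d"
    "\<And>e. 0 < e \<Longrightarrow> \<exists>N. \<forall>i\<ge>N. \<forall>j\<ge>N. (\<integral>\<^sup>+x\<in>S. ennreal (norm (g i x - g j x)) \<partial>lebesgue) \<le> ennreal e"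
    using gradients_L1_Cauchy[OF S \<delta>(1) \<delta>S d um ap'] by blast
  have wm [measurable]: "w i \<in> borel_measurable lebesgue" and gm [measurable]: "g i \<in> borel_measurable lebesgue" for i
    using has_weak_gradientD(1,2)[OF w(1)] by (auto intro: locally_integrable_measurable)
  obtain G k where k: "strict_mono (k :: nat \<Rightarrow> nat)" and Gm [measurable]: "G \<in> borel_measurable lebesgue"
    and ae: "AE x in lebesgue. x \<in> S \<longrightarrow> (\<lambda>n. g (k n) x) \<longlonglongrightarrow> G x"
    and L1: "(\<lambda>n. \<integral>\<^sup>+x\<in>S. ennreal (norm (g (k n) x - G x)) \<partial>lebesgue) \<longlonglongrightarrow> 0"
    using L1_Cauchy_limit[OF gm S(1) w(4)] by blast
  have wu: "(\<lambda>n. \<integral>\<^sup>+x\<in>S. ennreal \<bar>w (k n) x - u x\<bar> \<partial>lebesgue) \<longlonglongrightarrow> 0"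
  proof -
    have "(\<lambda>n. modular p (\<lambda>x. norm (w (k n) x - u x))) \<longlonglongrightarrow> 0"
      using LIMSEQ_subseq_LIMSEQ[OF w(2) k] by (simp add: o_def modular_def)
    from integral_tendsto_0_of_modular[OF _ S this] show ?thesis by simp
  qed
  \<comment> \<open>Nothing is known about G off S; the bump vanishes there, so the truncation
    leaves the product unchanged.\<close>
  define H where "H x = indicator S x *\<^sub>R G x" for x
  have Hm [measurable]: "H \<in> borel_measurable lebesgue" unfolding H_def by measurable
  let ?v = "\<lambda>x. \<zeta> x * u x" and ?V = "\<lambda>x. \<zeta> x *\<^sub>R H x + u x *\<^sub>R Z x"
  have wg: "?v has_weak_gradient ?V"
  proof (rule has_weak_gradient_limit[OF has_weak_gradient_mult_test[OF w(1) t cZ]])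
    fix R
    show "(\<lambda>n. \<integral>\<^sup>+x\<in>cball 0 R. ennreal (norm (\<zeta> x * w (k n) x - \<zeta> x * u x)) \<partial>lebesgue) \<longlonglongrightarrow> 0"
    proof (rule tendsto_sandwich[OF _ _ tendsto_const])
      show "(\<lambda>n. ennreal B * (\<integral>\<^sup>+x\<in>S. ennreal \<bar>w (k n) x - u x\<bar> \<partial>lebesgue)) \<longlonglongrightarrow> 0"
        using ennreal_tendsto_cmult[OF _ wu, of "ennreal B"] by simp
      show "\<forall>\<^sub>F n in sequentially. (\<integral>\<^sup>+x\<in>cball 0 R. ennreal (norm (\<zeta> x * w (k n) x - \<zeta> x * u x)) \<partial>lebesgue)
         \<le> ennreal B * (\<integral>\<^sup>+x\<in>S. ennreal \<bar>w (k n) x - u x\<bar> \<partial>lebesgue)"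
      proof (intro always_eventually allI)
        fix n
        have "(\<integral>\<^sup>+x\<in>cball 0 R. ennreal (norm (\<zeta> x * w (k n) x - \<zeta> x * u x)) \<partial>lebesgue)
          \<le> (\<integral>\<^sup>+x. ennreal B * (ennreal \<bar>w (k n) x - u x\<bar> * indicator S x) \<partial>lebesgue)"
        proof (rule nn_integral_mono)
          fix x
          have "norm (\<zeta> x * w (k n) x - \<zeta> x * u x) = \<zeta> x * \<bar>w (k n) x - u x\<bar>"
            using \<zeta>0[of x] by (simp add: abs_mult flip: right_diff_distrib)
          also have "\<dots> \<le> B * (\<bar>w (k n) x - u x\<bar> * indicator S x)"
            using B(2)[of x] out[of x] by (cases "x \<in> S") (auto intro: mult_right_mono)
          finally have "ennreal (norm (\<zeta> x * w (k n) x - \<zeta> x * u x)) \<le> ennreal (B * (\<bar>w (k n) x - u x\<bar> * indicator S x))"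
            by (rule ennreal_leI)
          also have "\<dots> = ennreal B * (ennreal \<bar>w (k n) x - u x\<bar> * indicator S x)"
            using B(1) by (auto simp: indicator_def ennreal_mult')
          finally show "ennreal (norm (\<zeta> x * w (k n) x - \<zeta> x * u x)) * indicator (cball 0 R) x
             \<le> ennreal B * (ennreal \<bar>w (k n) x - u x\<bar> * indicator S x)"
            by (auto simp: indicator_def)
        qed
        also have "\<dots> = ennreal B * (\<integral>\<^sup>+x\<in>S. ennreal \<bar>w (k n) x - u x\<bar> \<partial>lebesgue)"
          by (rule nn_integral_cmult) measurable
        finally show "(\<integral>\<^sup>+x\<in>cball 0 R. ennreal (norm (\<zeta> x * w (k n) x - \<zeta> x * u x)) \<partial>lebesgue)
         \<le> ennreal B * (\<integral>\<^sup>+x\<in>S. ennreal \<bar>w (k n) x - u x\<bar> \<partial>lebesgue)" .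
      qed
    qed auto
    show "(\<lambda>n. \<integral>\<^sup>+x\<in>cball 0 R. ennreal (norm (\<zeta> x *\<^sub>R g (k n) x + w (k n) x *\<^sub>R Z x - (\<zeta> x *\<^sub>R H x + u x *\<^sub>R Z x))) \<partial>lebesgue) \<longlonglongrightarrow> 0"
    proof (rule tendsto_sandwich[OF _ _ tendsto_const])
      show "(\<lambda>n. ennreal B * ((\<integral>\<^sup>+x\<in>S. ennreal (norm (g (k n) x - G x)) \<partial>lebesgue) + (\<integral>\<^sup>+x\<in>S. ennreal \<bar>w (k n) x - u x\<bar> \<partial>lebesgue))) \<longlonglongrightarrow> 0"
        using ennreal_tendsto_cmult[OF _ tendsto_add[OF L1 wu], of "ennreal B"] by simp
      show "\<forall>\<^sub>F n in sequentially. (\<integral>\<^sup>+x\<in>cball 0 R. ennreal (norm (\<zeta> x *\<^sub>R g (k n) x + w (k n) x *\<^sub>R Z x - (\<zeta> x *\<^sub>R H x + u x *\<^sub>R Z x))) \<partial>lebesgue)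
         \<le> ennreal B * ((\<integral>\<^sup>+x\<in>S. ennreal (norm (g (k n) x - G x)) \<partial>lebesgue) + (\<integral>\<^sup>+x\<in>S. ennreal \<bar>w (k n) x - u x\<bar> \<partial>lebesgue))"
      proof (intro always_eventually allI)
        fix n
        let ?D = "\<lambda>x. \<zeta> x *\<^sub>R g (k n) x + w (k n) x *\<^sub>R Z x - (\<zeta> x *\<^sub>R H x + u x *\<^sub>R Z x)"
        have "(\<integral>\<^sup>+x\<in>cball 0 R. ennreal (norm (?D x)) \<partial>lebesgue)
          \<le> (\<integral>\<^sup>+x. ennreal B * (ennreal (norm (g (k n) x - G x)) * indicator S x + ennreal \<bar>w (k n) x - u x\<bar> * indicator S x) \<partial>lebesgue)"
        proof (rule nn_integral_mono)
          fix x
          show "ennreal (norm (?D x)) * indicator (cball 0 R) x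
             \<le> ennreal B * (ennreal (norm (g (k n) x - G x)) * indicator S x + ennreal \<bar>w (k n) x - u x\<bar> * indicator S x)"
          proof (cases "x \<in> S")
            case True
            have "?D x = \<zeta> x *\<^sub>R (g (k n) x - G x) + (w (k n) x - u x) *\<^sub>R Z x"
              using True by (simp add: H_def algebra_simps)
            then have "norm (?D x) \<le> \<bar>\<zeta> x\<bar> * norm (g (k n) x - G x) + \<bar>w (k n) x - u x\<bar> * norm (Z x)"
              by (metis norm_scaleR norm_triangle_ineq)
            also have "\<dots> \<le> B * norm (g (k n) x - G x) + \<bar>w (k n) x - u x\<bar> * B"
              using \<zeta>0[of x] B(2)[of x] B(3)[of x] by (intro add_mono mult_right_mono mult_left_mono) auto
            finally have "norm (?D x) \<le> B * (norm (g (k n) x - G x) + \<bar>w (k n) x - u x\<bar>)"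
              by (simp add: algebra_simps)
            then have "ennreal (norm (?D x)) \<le> ennreal (B * (norm (g (k n) x - G x) + \<bar>w (k n) x - u x\<bar>))"
              by (rule ennreal_leI)
            also have "\<dots> = ennreal B * (ennreal (norm (g (k n) x - G x)) + ennreal \<bar>w (k n) x - u x\<bar>)"
              using B(1) by (simp add: ennreal_mult' ennreal_plus)
            finally show ?thesis using True by (auto simp: indicator_def)
          next
            case False
            then show ?thesis using out[OF False] by simp
          qed
        qed
        also have "\<dots> = ennreal B * ((\<integral>\<^sup>+x\<in>S. ennreal (norm (g (k n) x - G x)) \<partial>lebesgue) + (\<integral>\<^sup>+x\<in>S. ennreal \<bar>w (k n) x - u x\<bar> \<partial>lebesgue))"
        proof -
          have 1: "(\<lambda>x. ennreal (norm (g (k n) x - G x)) * indicator S x) \<in> borel_measurable lebesgue"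
            and 2: "(\<lambda>x. ennreal \<bar>w (k n) x - u x\<bar> * indicator S x) \<in> borel_measurable lebesgue"
            by measurable
          show ?thesis
            by (simp only: nn_integral_cmult[OF borel_measurable_add[OF 1 2]] nn_integral_add[OF 1 2])
        qed
        finally show "(\<integral>\<^sup>+x\<in>cball 0 R. ennreal (norm (?D x)) \<partial>lebesgue)
         \<le> ennreal B * ((\<integral>\<^sup>+x\<in>S. ennreal (norm (g (k n) x - G x)) \<partial>lebesgue) + (\<integral>\<^sup>+x\<in>S. ennreal \<bar>w (k n) x - u x\<bar> \<partial>lebesgue))" .
      qed
    qed auto
  qed measurable
  have mH: "modular p (\<lambda>x. norm (H x)) \<le> ennreal d"
  proof (rule modular_Fatou)
    show "(\<lambda>x. norm (indicator S x *\<^sub>R g (k n) x)) \<in> borel_measurable lebesgue" for n by measurable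
    show "AE x in lebesgue. (\<lambda>n. norm (indicator S x *\<^sub>R g (k n) x)) \<longlonglongrightarrow> norm (H x)"
      using ae by eventually_elim (auto simp: H_def indicator_def intro!: tendsto_intros)
    have "modular p (\<lambda>x. norm (indicator S x *\<^sub>R g (k n) x)) \<le> modular p (\<lambda>x. norm (g (k n) x))" for n
      by (rule modular_mono) (auto simp: indicator_def)
    then show "modular p (\<lambda>x. norm (indicator S x *\<^sub>R g (k n) x)) \<le> ennreal d" for n
      using w(3) order_trans by blast
  qed
  have sc: "modular p (\<lambda>x. B * f x) \<le> ennreal (B powr P * d)" if "f \<in> borel_measurable lebesgue" "modular p f \<le> ennreal d" for f
  proof -
    have "modular p (\<lambda>x. B * f x) \<le> ennreal (B powr P) * modular p f"
      by (rule modular_scale_ge1[OF that(1) B(1)])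
    also have "\<dots> \<le> ennreal (B powr P) * ennreal d" by (intro mult_left_mono that) simp
    finally show ?thesis by (simp add: ennreal_mult')
  qed
  have "B powr P * d \<le> 2 powr P * (B powr P * d + B powr P * d)"
  proof -
    have "1 * (B powr P * d) \<le> 2 powr P * (B powr P * d + B powr P * d)"
      using d P_ge by (intro mult_mono ge_one_powr_ge_zero) auto
    then show ?thesis by simp
  qed
  also have "\<dots> = K * d" by (simp add: K_def algebra_simps)
  also have Kd: "\<dots> = \<epsilon>" using K by (simp add: d_def)
  finally have Bd: "B powr P * d \<le> \<epsilon>" .
  have "modular p ?v \<le> modular p (\<lambda>x. B * u x)"
    using B \<zeta>0 u01 by (intro modular_mono) (auto simp: abs_mult intro!: mult_right_mono)
  also have "\<dots> \<le> ennreal (B powr P * d)" by (rule sc[OF um mu])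
  finally have m1: "modular p ?v \<le> ennreal \<epsilon>" using ennreal_leI[OF Bd] by (rule order_trans)
  have "modular p (\<lambda>x. norm (?V x)) \<le> modular p (\<lambda>x. B * norm (H x) + B * u x)"
  proof (rule modular_mono)
    fix x
    have "norm (?V x) \<le> \<bar>\<zeta> x\<bar> * norm (H x) + \<bar>u x\<bar> * norm (Z x)"
      by (metis norm_scaleR norm_triangle_ineq)
    also have "\<dots> \<le> B * norm (H x) + u x * B"
      using \<zeta>0[of x] B(2)[of x] B(3)[of x] u01[of x] by (intro add_mono mult_right_mono mult_mono) auto
    finally show "\<bar>norm (?V x)\<bar> \<le> \<bar>B * norm (H x) + B * u x\<bar>" by (simp add: mult.commute)
  qed
  also have "\<dots> \<le> ennreal (2 powr P) * (modular p (\<lambda>x. B * norm (H x)) + modular p (\<lambda>x. B * u x))"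
    by (rule modular_add_le) measurable
  also have "\<dots> \<le> ennreal (2 powr P) * (ennreal (B powr P * d) + ennreal (B powr P * d))"
    by (intro mult_left_mono add_mono sc mH mu um) measurable
  also have "\<dots> = ennreal (K * d)"
    using d by (simp add: K_def algebra_simps flip: ennreal_plus ennreal_mult')
  finally have m2: "modular p (\<lambda>x. norm (?V x)) \<le> ennreal \<epsilon>" by (simp add: Kd)
  show "\<exists>v g U. v has_weak_gradient g \<and> (AE x in lebesgue. 0 \<le> v x) \<and> open U \<and> E \<inter> ball x0 r \<subseteq> U \<and>
      (AE x in lebesgue. x \<in> U \<longrightarrow> 1 \<le> v x) \<and> modular p v \<le> ennreal \<epsilon> \<and>
      modular p (\<lambda>x. norm (g x)) \<le> ennreal \<epsilon>"
  proof (intro exI[of _ ?v] exI[of _ ?V] exI[of _ "U \<inter> ball x0 r"] conjI wg m1 m2)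
    show "AE x in lebesgue. 0 \<le> ?v x" using \<zeta>0 u01 by simp
    show "AE x in lebesgue. x \<in> U \<inter> ball x0 r \<longrightarrow> 1 \<le> ?v x"
      using u1 by eventually_elim (use one in auto)
  qed (use U in auto)
qed

text \<open>Continuity gives each point with p > 1 a ball on which p stays away from 1, and
  Lindelof's theorem reduces these balls to countably many. No uniform gap is required across the
  balls.\<close>

lemma cap_null_exponent_gt_1:
  assumes E: "mixed_BV_capacity p E = 0"
  shows "cap_null (E \<inter> {x. 1 < p x})"
proof -
  define \<F> where "\<F> = {ball x0 r |x0 r. 0 < r \<and> (\<exists>\<delta>>0. \<forall>x\<in>ball x0 (2 * r). 1 + \<delta> \<le> p x)}"
  obtain \<F>' where F: "\<F>' \<subseteq> \<F>" "countable \<F>'" "\<Union>\<F>' = \<Union>\<F>"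
    by (rule Lindelof[of \<F>]) (auto simp: \<F>_def)
  have "{x. 1 < p x} \<subseteq> \<Union>\<F>"
  proof
    fix x0 assume "x0 \<in> {x. 1 < p x}"
    then have p: "1 < p x0" by simp
    define \<delta> where "\<delta> = (p x0 - 1) / 2"
    have "isCont p x0" using p_cont by (simp add: continuous_on_eq_continuous_at)
    then obtain s where s: "0 < s" "\<And>x. dist x x0 < s \<Longrightarrow> dist (p x) (p x0) < \<delta>"
      using p unfolding continuous_at_eps_delta \<delta>_def dist_real_def by (metis diff_gt_0_iff_gt half_gt_zero)
    have "1 + \<delta> \<le> p x" if "x \<in> ball x0 (2 * (s / 2))" for x
      using s(2)[of x] that by (auto simp: dist_commute dist_real_def \<delta>_def field_simps abs_if split: if_splits)
    then have "ball x0 (s / 2) \<in> \<F>"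
      using s(1) p unfolding \<F>_def by (intro CollectI exI[of _ x0] exI[of _ "s/2"]) (auto intro!: exI[of _ \<delta>] simp: \<delta>_def)
    then show "x0 \<in> \<Union>\<F>" using s(1) by (meson UnionI centre_in_ball half_gt_zero)
  qed
  then have sub: "E \<inter> {x. 1 < p x} \<subseteq> \<Union>((\<inter>) E ` \<F>')" using F(3) by auto
  have "cap_null (\<Union>((\<inter>) E ` \<F>'))"
  proof (rule cap_null_Union)
    fix X assume "X \<in> (\<inter>) E ` \<F>'"
    then obtain x0 r \<delta> where "X = E \<inter> ball x0 r" "0 < r" "0 < \<delta>" "\<And>x. x \<in> ball x0 (2 * r) \<Longrightarrow> 1 + \<delta> \<le> p x"
      using F(1) unfolding \<F>_def by auto
    then show "cap_null X" using cap_null_ball_exponent_gt_1[OF E] by blast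
  qed (use F(2) in auto)
  then show ?thesis using sub by (rule cap_null_mono)
qed

end

section \<open>A Poincare inequality on balls\<close>

lemma nn_integral_scale:
  fixes F :: "'a::euclidean_space \<Rightarrow> ennreal"
  assumes [measurable]: "F \<in> borel_measurable borel" and t: "0 < t"
  shows "(\<integral>\<^sup>+y. F (c + t *\<^sub>R y) \<partial>lborel) = ennreal ((1 / t) ^ DIM('a)) * (\<integral>\<^sup>+y. F y \<partial>lborel)"
proof -
  have "(\<integral>\<^sup>+y. F y \<partial>lborel) = (\<integral>\<^sup>+y. F y \<partial>(density (distr lborel borel (\<lambda>y. c + t *\<^sub>R y)) (\<lambda>_. ennreal (\<bar>t\<bar> ^ DIM('a)))))"
    using lborel_affine[of t c] t by simp
  also have "\<dots> = (\<integral>\<^sup>+y. ennreal (t ^ DIM('a)) * F (c + t *\<^sub>R y) \<partial>lborel)"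
    using t by (simp add: nn_integral_density nn_integral_distr)
  also have "\<dots> = ennreal (t ^ DIM('a)) * (\<integral>\<^sup>+y. F (c + t *\<^sub>R y) \<partial>lborel)"
    by (rule nn_integral_cmult) measurable
  finally have "ennreal ((1 / t) ^ DIM('a)) * (\<integral>\<^sup>+y. F y \<partial>lborel)
     = ennreal ((1 / t) ^ DIM('a) * t ^ DIM('a)) * (\<integral>\<^sup>+y. F (c + t *\<^sub>R y) \<partial>lborel)"
    using t by (simp add: ennreal_mult' mult.assoc)
  also have "(1 / t) ^ DIM('a) * t ^ DIM('a) = 1"
    using t by (simp flip: power_mult_distrib)
  finally show ?thesis by simp
qed

lemma C1_gradient_diff_le:
  assumes f: "C1_gradient f G"
  shows "ennreal \<bar>f x - f y\<bar>
    \<le> (\<integral>\<^sup>+t. ennreal (norm (x - y) * norm (G ((1 - t) *\<^sub>R x + t *\<^sub>R y))) * indicator {0..1} t \<partial>lborel)"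
proof -
  define \<phi>' where "\<phi>' t = G ((1 - t) *\<^sub>R x + t *\<^sub>R y) \<bullet> (y - x)" for t
  have d: "((\<lambda>t. f ((1 - t) *\<^sub>R x + t *\<^sub>R y)) has_vector_derivative \<phi>' t) (at t within {0..1})" for t
  proof -
    have "((\<lambda>t. (1 - t) *\<^sub>R x + t *\<^sub>R y) has_derivative (\<lambda>s. s *\<^sub>R (y - x))) (at t)"
      by (auto intro!: derivative_eq_intros simp: algebra_simps)
    from diff_chain_at[OF this C1_gradientD(1)[OF f]]
    have "((\<lambda>t. f ((1 - t) *\<^sub>R x + t *\<^sub>R y)) has_derivative (\<lambda>s. s *\<^sub>R \<phi>' t)) (at t)"
      by (simp add: o_def \<phi>'_def)
    then show ?thesis
      by (simp add: has_vector_derivative_def has_derivative_at_withinI)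
  qed
  have c: "continuous_on {0..1} \<phi>'"
    unfolding \<phi>'_def
    by (intro continuous_intros continuous_on_compose2[OF C1_gradientD(2)[OF f, of UNIV]]) auto
  have int: "(\<integral>t. indicator {0..1} t *\<^sub>R \<phi>' t \<partial>lborel) = f y - f x"
    using integral_FTC_Icc[of 0 1 "\<lambda>t. f ((1 - t) *\<^sub>R x + t *\<^sub>R y)" \<phi>'] d c by simp
  have i: "integrable lborel (\<lambda>t. indicator {0..1} t *\<^sub>R \<phi>' t)"
    using has_bochner_integral_FTC_Icc[of 0 1 "\<lambda>t. f ((1 - t) *\<^sub>R x + t *\<^sub>R y)" \<phi>'] d c
    by (simp add: has_bochner_integral_iff)
  have "ennreal \<bar>f x - f y\<bar> = ennreal (norm (\<integral>t. indicator {0..1} t *\<^sub>R \<phi>' t \<partial>lborel))"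
    by (simp only: int real_norm_def abs_minus_commute)
  also have "\<dots> \<le> (\<integral>\<^sup>+t. ennreal (norm (indicator {0..1} t *\<^sub>R \<phi>' t)) \<partial>lborel)"
    by (rule integral_norm_bound_ennreal[OF i])
  also have "\<dots> \<le> (\<integral>\<^sup>+t. ennreal (norm (x - y) * norm (G ((1 - t) *\<^sub>R x + t *\<^sub>R y))) * indicator {0..1} t \<partial>lborel)"
  proof (rule nn_integral_mono)
    fix t :: real
    have "\<bar>\<phi>' t\<bar> \<le> norm (x - y) * norm (G ((1 - t) *\<^sub>R x + t *\<^sub>R y))"
      unfolding \<phi>'_def using Cauchy_Schwarz_ineq2[of "G ((1 - t) *\<^sub>R x + t *\<^sub>R y)" "y - x"]
      by (simp add: norm_minus_commute mult.commute)
    then show "ennreal (norm (indicator {0..1} t *\<^sub>R \<phi>' t))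
       \<le> ennreal (norm (x - y) * norm (G ((1 - t) *\<^sub>R x + t *\<^sub>R y))) * indicator {0..1} t"
      by (auto simp: indicator_def intro: ennreal_leI)
  qed
  finally show ?thesis .
qed

text \<open>The difference is integrated along the segment from x to y. For t >= 1/2 the
  substitution is made in y, otherwise in x, so the Jacobian factor never exceeds 2^n; the factor 2
  r is the diameter. The double integral avoids mean values.\<close>

lemma Poincare_ball:
  fixes a :: "'a::euclidean_space"
  assumes f: "C1_gradient f G" and r: "0 < r"
  shows "(\<integral>\<^sup>+x\<in>ball a r. (\<integral>\<^sup>+y\<in>ball a r. ennreal \<bar>f x - f y\<bar> \<partial>lborel) \<partial>lborel)
    \<le> ennreal (2 * r * 2 ^ DIM('a)) * (emeasure lborel (ball a r) * (\<integral>\<^sup>+x\<in>ball a r. ennreal (norm (G x)) \<partial>lborel))"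
proof -
  define B where "B = ball a r"
  have [measurable]: "B \<in> sets borel" by (simp add: B_def)
  have [measurable]: "G \<in> borel_measurable borel" "f \<in> borel_measurable borel"
    using C1_gradientD(2,3)[OF f, of UNIV] by (auto intro: borel_measurable_continuous_onI)
  define F where "F z = ennreal (norm (G z)) * indicator B z" for z
  have [measurable]: "F \<in> borel_measurable borel" unfolding F_def by measurable
  define I where "I = (\<integral>\<^sup>+z. F z \<partial>lborel)"
  have conv: "(1 - t) *\<^sub>R x + t *\<^sub>R y \<in> B" if "x \<in> B" "y \<in> B" "t \<in> {0..1}" for x y and t :: real
    using convex_ball[of a r] that unfolding B_def convex_alt by auto
  let ?H = "\<lambda>x y t. F ((1 - t) *\<^sub>R x + t *\<^sub>R y) * indicator B x * indicator B y * indicator {0..1::real} t"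
  have slice: "(\<integral>\<^sup>+x. (\<integral>\<^sup>+y. ?H x y t \<partial>lborel) \<partial>lborel) \<le> ennreal (2 ^ DIM('a)) * (emeasure lborel B * I) * indicator {0..1} t" for t :: real
  proof (cases "t \<in> {0..1}")
    case t: True
    show ?thesis
    proof (cases "1/2 \<le> t")
      case True
      have "(\<integral>\<^sup>+x. (\<integral>\<^sup>+y. ?H x y t \<partial>lborel) \<partial>lborel) \<le> (\<integral>\<^sup>+x. (ennreal (2 ^ DIM('a)) * I) * indicator B x \<partial>lborel)"
      proof (rule nn_integral_mono)
        fix x
        have "(\<integral>\<^sup>+y. ?H x y t \<partial>lborel) \<le> (\<integral>\<^sup>+y. F ((1 - t) *\<^sub>R x + t *\<^sub>R y) \<partial>lborel)"
          by (rule nn_integral_mono) (auto simp: indicator_def)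
        also have "\<dots> = ennreal ((1 / t) ^ DIM('a)) * I"
          unfolding I_def by (rule nn_integral_scale) (use True in auto)
        also have "\<dots> \<le> ennreal (2 ^ DIM('a)) * I"
          using True by (intro mult_right_mono ennreal_leI power_mono) (auto simp: divide_le_eq)
        finally show "(\<integral>\<^sup>+y. ?H x y t \<partial>lborel) \<le> (ennreal (2 ^ DIM('a)) * I) * indicator B x"
          by (cases "x \<in> B") auto
      qed
      also have "\<dots> = ennreal (2 ^ DIM('a)) * I * emeasure lborel B"
        by (rule nn_integral_cmult_indicator) simp
      finally show ?thesis using t by (simp add: mult_ac)
    next
      case False
      have "(\<integral>\<^sup>+x. (\<integral>\<^sup>+y. ?H x y t \<partial>lborel) \<partial>lborel) = (\<integral>\<^sup>+y. (\<integral>\<^sup>+x. ?H x y t \<partial>lborel) \<partial>lborel)"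
        by (rule lborel_pair.Fubini') measurable
      also have "\<dots> \<le> (\<integral>\<^sup>+y. (ennreal (2 ^ DIM('a)) * I) * indicator B y \<partial>lborel)"
      proof (rule nn_integral_mono)
        fix y
        have "(\<integral>\<^sup>+x. ?H x y t \<partial>lborel) \<le> (\<integral>\<^sup>+x. F (t *\<^sub>R y + (1 - t) *\<^sub>R x) \<partial>lborel)"
          by (rule nn_integral_mono) (auto simp: indicator_def add.commute)
        also have "\<dots> = ennreal ((1 / (1 - t)) ^ DIM('a)) * I"
          unfolding I_def by (rule nn_integral_scale) (use False in auto)
        also have "\<dots> \<le> ennreal (2 ^ DIM('a)) * I"
          using False t by (intro mult_right_mono ennreal_leI power_mono) (auto simp: divide_le_eq)
        finally show "(\<integral>\<^sup>+x. ?H x y t \<partial>lborel) \<le> (ennreal (2 ^ DIM('a)) * I) * indicator B y"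
          by (cases "y \<in> B") auto
      qed
      also have "\<dots> = ennreal (2 ^ DIM('a)) * I * emeasure lborel B"
        by (rule nn_integral_cmult_indicator) simp
      finally show ?thesis using t by (simp add: mult_ac)
    qed
  qed simp
  have "(\<integral>\<^sup>+x\<in>B. (\<integral>\<^sup>+y\<in>B. ennreal \<bar>f x - f y\<bar> \<partial>lborel) \<partial>lborel)
     \<le> (\<integral>\<^sup>+x. (\<integral>\<^sup>+y. ennreal (2 * r) * (\<integral>\<^sup>+t. ?H x y t \<partial>lborel) \<partial>lborel) \<partial>lborel)"
  proof (rule nn_integral_mono)
    fix x
    show "(\<integral>\<^sup>+y\<in>B. ennreal \<bar>f x - f y\<bar> \<partial>lborel) * indicator B x \<le> (\<integral>\<^sup>+y. ennreal (2 * r) * (\<integral>\<^sup>+t. ?H x y t \<partial>lborel) \<partial>lborel)"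
    proof (cases "x \<in> B")
      case x: True
      have "(\<integral>\<^sup>+y\<in>B. ennreal \<bar>f x - f y\<bar> \<partial>lborel) \<le> (\<integral>\<^sup>+y. ennreal (2 * r) * (\<integral>\<^sup>+t. ?H x y t \<partial>lborel) \<partial>lborel)"
      proof (rule nn_integral_mono)
        fix y
        show "ennreal \<bar>f x - f y\<bar> * indicator B y \<le> ennreal (2 * r) * (\<integral>\<^sup>+t. ?H x y t \<partial>lborel)"
        proof (cases "y \<in> B")
          case y: True
          have xy: "norm (x - y) \<le> 2 * r"
            using x y dist_triangle_less_add[of x a r y r] by (simp add: B_def dist_norm dist_commute norm_minus_commute)
          have "ennreal \<bar>f x - f y\<bar>
            \<le> (\<integral>\<^sup>+t. ennreal (norm (x - y) * norm (G ((1 - t) *\<^sub>R x + t *\<^sub>R y))) * indicator {0..1} t \<partial>lborel)"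
            by (rule C1_gradient_diff_le[OF f])
          also have "\<dots> \<le> (\<integral>\<^sup>+t. ennreal (2 * r) * ?H x y t \<partial>lborel)"
          proof (rule nn_integral_mono)
            fix t :: real
            show "ennreal (norm (x - y) * norm (G ((1 - t) *\<^sub>R x + t *\<^sub>R y))) * indicator {0..1} t \<le> ennreal (2 * r) * ?H x y t"
            proof (cases "t \<in> {0..1}")
              case True
              have "ennreal (norm (x - y) * norm (G ((1 - t) *\<^sub>R x + t *\<^sub>R y))) \<le> ennreal (2 * r * norm (G ((1 - t) *\<^sub>R x + t *\<^sub>R y)))"
                by (intro ennreal_leI mult_right_mono xy) simp
              also have "\<dots> = ennreal (2 * r) * ennreal (norm (G ((1 - t) *\<^sub>R x + t *\<^sub>R y)))"
                using r by (intro ennreal_mult') simp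
              finally show ?thesis using True x y conv[OF x y True] by (simp add: F_def)
            qed simp
          qed
          also have "\<dots> = ennreal (2 * r) * (\<integral>\<^sup>+t. ?H x y t \<partial>lborel)"
            by (rule nn_integral_cmult) measurable
          finally show ?thesis using y by simp
        qed simp
      qed
      then show ?thesis using x by simp
    qed simp
  qed
  also have "\<dots> = ennreal (2 * r) * (\<integral>\<^sup>+x. (\<integral>\<^sup>+y. (\<integral>\<^sup>+t. ?H x y t \<partial>lborel) \<partial>lborel) \<partial>lborel)"
    by (subst nn_integral_cmult, measurable, subst nn_integral_cmult, measurable)
  also have "(\<integral>\<^sup>+x. (\<integral>\<^sup>+y. (\<integral>\<^sup>+t. ?H x y t \<partial>lborel) \<partial>lborel) \<partial>lborel) = (\<integral>\<^sup>+x. (\<integral>\<^sup>+t. (\<integral>\<^sup>+y. ?H x y t \<partial>lborel) \<partial>lborel) \<partial>lborel)"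
    by (rule nn_integral_cong, rule lborel_pair.Fubini') measurable
  also have "\<dots> = (\<integral>\<^sup>+t. (\<integral>\<^sup>+x. (\<integral>\<^sup>+y. ?H x y t \<partial>lborel) \<partial>lborel) \<partial>lborel)"
    by (rule lborel_pair.Fubini') measurable
  also have "\<dots> \<le> (\<integral>\<^sup>+t. ennreal (2 ^ DIM('a)) * (emeasure lborel B * I) * indicator {0..1::real} t \<partial>lborel)"
    by (rule nn_integral_mono) (rule slice)
  also have "\<dots> = ennreal (2 ^ DIM('a)) * (emeasure lborel B * I)"
    by (subst nn_integral_cmult_indicator) auto
  also have "ennreal (2 * r) * (ennreal (2 ^ DIM('a)) * (emeasure lborel B * I)) = ennreal (2 * r * 2 ^ DIM('a)) * (emeasure lborel B * I)"
    using r by (simp add: ennreal_mult' mult.assoc)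
  finally show ?thesis
    by (simp add: B_def I_def F_def mult_left_mono)
qed

section \<open>Approximation of superlevel sets\<close>

text \<open>A substitute for the coarea formula: by Fatou's lemma in the level \<open>t\<close>, the smoothed
  truncations of the approximants at some level \<open>t\<close> have controlled gradients and converge to
  the indicator of a superlevel set.\<close>

lemma superlevel_approximation:
  fixes u :: "'a::euclidean_space \<Rightarrow> real"
  assumes D: "D \<in> sets borel" "emeasure lborel D < \<infinity>" and u [measurable]: "u \<in> borel_measurable borel"
    and \<epsilon>: "0 < \<epsilon>"
    and ap: "\<And>e. 0 < e \<Longrightarrow> \<exists>w G. C1_gradient w G \<and> (\<integral>\<^sup>+x\<in>D. ennreal \<bar>w x - u x\<bar> \<partial>lborel) \<le> ennreal e \<and>
        (\<integral>\<^sup>+x\<in>D. ennreal (norm (G x)) \<partial>lborel) \<le> ennreal \<epsilon>"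
  obtains t where "1/4 \<le> t" "t \<le> 3/4"
    "\<And>e. 0 < e \<Longrightarrow> \<exists>w G. C1_gradient w G \<and> (\<integral>\<^sup>+x\<in>D. ennreal \<bar>w x - indicator {x. t < u x} x\<bar> \<partial>lborel) \<le> ennreal e \<and>
        (\<integral>\<^sup>+x\<in>D. ennreal (norm (G x)) \<partial>lborel) \<le> ennreal (5 * \<epsilon>)"
proof -
  note D(1) [measurable]
  obtain V where V: "emeasure lborel D = ennreal V" "0 \<le> V"
    using D(2) by (cases "emeasure lborel D") auto
  \<comment> \<open>Accuracy 4^-i leaves room for the weight 2^i that is placed on the L^1 errors
    below.\<close>
  define r where "r i = (1/4::real) ^ i" for i :: nat
  have r: "0 < r i" for i by (simp add: r_def)
  have "\<exists>w G. C1_gradient w G \<and> (\<integral>\<^sup>+x\<in>D. ennreal \<bar>w x - u x\<bar> \<partial>lborel) \<le> ennreal (r i) \<and>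
        (\<integral>\<^sup>+x\<in>D. ennreal (norm (G x)) \<partial>lborel) \<le> ennreal \<epsilon>" for i
    by (rule ap[OF r])
  from choice[OF allI[OF this]] obtain w where "\<forall>i. \<exists>G. C1_gradient (w i) G \<and> (\<integral>\<^sup>+x\<in>D. ennreal \<bar>w i x - u x\<bar> \<partial>lborel) \<le> ennreal (r i) \<and>
        (\<integral>\<^sup>+x\<in>D. ennreal (norm (G x)) \<partial>lborel) \<le> ennreal \<epsilon>"
    by (rule exE)
  from choice[OF this] obtain G where wG: "\<forall>i. C1_gradient (w i) (G i) \<and> (\<integral>\<^sup>+x\<in>D. ennreal \<bar>w i x - u x\<bar> \<partial>lborel) \<le> ennreal (r i) \<and>
        (\<integral>\<^sup>+x\<in>D. ennreal (norm (G i x)) \<partial>lborel) \<le> ennreal \<epsilon>"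
    by (rule exE)
  have C1: "C1_gradient (w i) (G i)" and wu: "(\<integral>\<^sup>+x\<in>D. ennreal \<bar>w i x - u x\<bar> \<partial>lborel) \<le> ennreal (r i)"
    and Ge: "(\<integral>\<^sup>+x\<in>D. ennreal (norm (G i x)) \<partial>lborel) \<le> ennreal \<epsilon>" for i
    using wG by blast+
  have [measurable]: "w i \<in> borel_measurable borel" "G i \<in> borel_measurable borel" for i
    using C1_gradientD(2,3)[OF C1, of UNIV] by (auto intro: borel_measurable_continuous_onI)
  \<comment> \<open>Width of the ramp that replaces the jump at level t. Smearing the jump over it
    costs at most \<open>r i\<close> in L^1 of D, after integration over the levels.\<close>
  define \<delta> where "\<delta> i = r i / (V + 1)" for i
  have \<delta>: "0 < \<delta> i" "\<delta> i * V \<le> r i" for i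
    using r[of i] V(2) by (auto simp: \<delta>_def field_simps)
  define h where "h i t x = smooth_step ((w i x - t) / \<delta> i)" for i t x
  define \<Gamma> where "\<Gamma> i t x = (1 / \<delta> i * smooth_step' ((w i x - t) / \<delta> i)) *\<^sub>R G i x" for i t x
  have h\<Gamma>: "C1_gradient (h i t) (\<Gamma> i t)" for i t
    unfolding h_def \<Gamma>_def
  proof (rule C1_gradient_compose[OF C1])
    show "((\<lambda>s. smooth_step ((s - t) / \<delta> i)) has_real_derivative 1 / \<delta> i * smooth_step' ((s - t) / \<delta> i)) (at s)" for s
    proof -
      have "((\<lambda>s. (s - t) / \<delta> i) has_real_derivative 1 / \<delta> i) (at s)"
        using \<delta>(1)[of i] by (auto intro!: derivative_eq_intros)
      from DERIV_chain2[OF DERIV_smooth_step this] show ?thesis by (simp add: mult.commute)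
    qed
    show "continuous_on UNIV (\<lambda>s. 1 / \<delta> i * smooth_step' ((s - t) / \<delta> i))"
      by (intro continuous_intros continuous_on_compose2[OF continuous_smooth_step'[of UNIV]])
         (use \<delta>(1)[of i] in auto)
  qed
  define a where "a i t = (\<integral>\<^sup>+x\<in>D. ennreal (norm (\<Gamma> i t x)) \<partial>lborel)" for i t
  define b where "b i t = (\<integral>\<^sup>+x\<in>D. ennreal \<bar>h i t x - indicator {x. t < u x} x\<bar> \<partial>lborel)" for i t
  have ind: "indicator {x. t < u x} x = (if t < u x then 1 else 0::real)" for t x by simp
  have am [measurable]: "a i \<in> borel_measurable borel" for i
    unfolding a_def \<Gamma>_def by measurable
  have bm [measurable]: "b i \<in> borel_measurable borel" for i
    unfolding b_def h_def ind by measurable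
  \<comment> \<open>For fixed x the derivative of the ramp lives on an interval of levels of length
    \<open>\<delta> i\<close> and has height at most 2 / \<open>\<delta> i\<close>, so integration
    over all levels costs the factor 2.\<close>
  have a_int: "(\<integral>\<^sup>+t. a i t \<partial>lborel) \<le> ennreal (2 * \<epsilon>)" for i
  proof -
    have "(\<integral>\<^sup>+t. a i t \<partial>lborel) = (\<integral>\<^sup>+x. (\<integral>\<^sup>+t. ennreal (norm (\<Gamma> i t x)) * indicator D x \<partial>lborel) \<partial>lborel)"
      unfolding a_def \<Gamma>_def by (rule lborel_pair.Fubini') measurable
    also have "\<dots> \<le> (\<integral>\<^sup>+x. ennreal 2 * (ennreal (norm (G i x)) * indicator D x) \<partial>lborel)"
    proof (rule nn_integral_mono)
      fix x
      have "(\<integral>\<^sup>+t. ennreal (norm (\<Gamma> i t x)) * indicator D x \<partial>lborel)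
         \<le> (\<integral>\<^sup>+t. (ennreal (2 / \<delta> i * norm (G i x)) * indicator D x) * indicator {w i x - \<delta> i..w i x} t \<partial>lborel)"
      proof (rule nn_integral_mono)
        fix t
        show "ennreal (norm (\<Gamma> i t x)) * indicator D x \<le> (ennreal (2 / \<delta> i * norm (G i x)) * indicator D x) * indicator {w i x - \<delta> i..w i x} t"
        proof (cases "t \<in> {w i x - \<delta> i..w i x}")
          case True
          have "norm (\<Gamma> i t x) = smooth_step' ((w i x - t) / \<delta> i) / \<delta> i * norm (G i x)"
            using \<delta>(1)[of i] smooth_step'_bounds(1) by (simp add: \<Gamma>_def abs_mult)
          also have "\<dots> \<le> 2 / \<delta> i * norm (G i x)"
            using \<delta>(1)[of i] smooth_step'_bounds(2) by (intro mult_right_mono divide_right_mono) auto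
          finally show ?thesis using True by (auto simp: indicator_def intro: ennreal_leI)
        next
          case False
          then have "(w i x - t) / \<delta> i \<le> 0 \<or> 1 \<le> (w i x - t) / \<delta> i"
            using \<delta>(1)[of i] by (auto simp: divide_le_0_iff le_divide_eq)
          then have "smooth_step' ((w i x - t) / \<delta> i) = 0" by (rule smooth_step'_eq_0)
          then show ?thesis by (simp add: \<Gamma>_def)
        qed
      qed
      also have "\<dots> = (ennreal (2 / \<delta> i * norm (G i x)) * indicator D x) * emeasure lborel {w i x - \<delta> i..w i x}"
        by (rule nn_integral_cmult_indicator) simp
      also have "\<dots> = ennreal (2 / \<delta> i * norm (G i x)) * ennreal (\<delta> i) * indicator D x"
        using \<delta>(1)[of i] by (simp add: mult_ac)
      also have "ennreal (2 / \<delta> i * norm (G i x)) * ennreal (\<delta> i) = ennreal (2 / \<delta> i * norm (G i x) * \<delta> i)"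
        using \<delta>(1)[of i] by (intro ennreal_mult[symmetric]) auto
      also have "2 / \<delta> i * norm (G i x) * \<delta> i = 2 * norm (G i x)" using \<delta>(1)[of i] by simp
      also have "ennreal (2 * norm (G i x)) = ennreal 2 * ennreal (norm (G i x))"
        by (rule ennreal_mult) auto
      finally show "(\<integral>\<^sup>+t. ennreal (norm (\<Gamma> i t x)) * indicator D x \<partial>lborel) \<le> ennreal 2 * (ennreal (norm (G i x)) * indicator D x)"
        by (simp only: mult.assoc)
    qed
    also have "\<dots> = ennreal 2 * (\<integral>\<^sup>+x\<in>D. ennreal (norm (G i x)) \<partial>lborel)"
      by (rule nn_integral_cmult) measurable
    also have "\<dots> \<le> ennreal 2 * ennreal \<epsilon>" by (intro mult_left_mono Ge) simp
    also have "\<dots> = ennreal (2 * \<epsilon>)" by (rule ennreal_mult'[symmetric]) simp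
    finally show ?thesis .
  qed
  \<comment> \<open>For fixed x the ramp and the jump differ only at levels between w and u, up to
    the ramp width.\<close>
  have b_int: "(\<integral>\<^sup>+t. b i t \<partial>lborel) \<le> ennreal (2 * r i)" for i
  proof -
    have "(\<integral>\<^sup>+t. b i t \<partial>lborel) = (\<integral>\<^sup>+x. (\<integral>\<^sup>+t. ennreal \<bar>h i t x - indicator {x. t < u x} x\<bar> * indicator D x \<partial>lborel) \<partial>lborel)"
      unfolding b_def h_def ind by (rule lborel_pair.Fubini') measurable
    also have "\<dots> \<le> (\<integral>\<^sup>+x. ennreal \<bar>w i x - u x\<bar> * indicator D x + ennreal (\<delta> i) * indicator D x \<partial>lborel)"
    proof (rule nn_integral_mono)
      fix x
      let ?I = "{min (w i x) (u x) - \<delta> i..max (w i x) (u x)}"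
      have "(\<integral>\<^sup>+t. ennreal \<bar>h i t x - indicator {x. t < u x} x\<bar> * indicator D x \<partial>lborel)
         \<le> (\<integral>\<^sup>+t. indicator D x * indicator ?I t \<partial>lborel)"
      proof (rule nn_integral_mono)
        fix t
        show "ennreal \<bar>h i t x - indicator {x. t < u x} x\<bar> * indicator D x \<le> indicator D x * indicator ?I t"
        proof (cases "t \<in> ?I")
          case True
          have "\<bar>h i t x - indicator {x. t < u x} x\<bar> \<le> 1"
            using smooth_step_bounds[of "(w i x - t) / \<delta> i"] by (auto simp: h_def indicator_def)
          then show ?thesis using True by (auto simp: indicator_def ennreal_le_1)
        next
          case False
          then consider "t < w i x - \<delta> i" "t < u x" | "w i x < t" "u x < t"
            using \<delta>(1)[of i] by fastforce
          then have "h i t x = indicator {x. t < u x} x"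
          proof cases
            case 1
            then have "1 \<le> (w i x - t) / \<delta> i" using \<delta>(1)[of i] by (simp add: le_divide_eq)
            then show ?thesis using 1 by (simp add: h_def smooth_step_eq_1)
          next
            case 2
            then have "(w i x - t) / \<delta> i \<le> 0" using \<delta>(1)[of i] by (simp add: divide_le_0_iff)
            then show ?thesis using 2 by (simp add: h_def smooth_step_eq_0)
          qed
          then show ?thesis by simp
        qed
      qed
      also have "\<dots> = indicator D x * emeasure lborel ?I"
        by (rule nn_integral_cmult_indicator) simp
      also have "emeasure lborel ?I = ennreal (\<bar>w i x - u x\<bar> + \<delta> i)"
      proof -
        have "max (w i x) (u x) - (min (w i x) (u x) - \<delta> i) = \<bar>w i x - u x\<bar> + \<delta> i"
          by (auto simp: min_def max_def abs_if)
        moreover have "min (w i x) (u x) - \<delta> i \<le> max (w i x) (u x)"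
          using \<delta>(1)[of i] by (auto simp: min_def max_def)
        ultimately show ?thesis by (simp only: emeasure_lborel_Icc)
      qed
      also have "\<dots> = ennreal \<bar>w i x - u x\<bar> + ennreal (\<delta> i)"
        using \<delta>(1)[of i] by (intro ennreal_plus) auto
      finally show "(\<integral>\<^sup>+t. ennreal \<bar>h i t x - indicator {x. t < u x} x\<bar> * indicator D x \<partial>lborel)
         \<le> ennreal \<bar>w i x - u x\<bar> * indicator D x + ennreal (\<delta> i) * indicator D x"
        by (simp add: distrib_left mult.commute)
    qed
    also have "\<dots> = (\<integral>\<^sup>+x\<in>D. ennreal \<bar>w i x - u x\<bar> \<partial>lborel) + (\<integral>\<^sup>+x. ennreal (\<delta> i) * indicator D x \<partial>lborel)"
      by (rule nn_integral_add) measurable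
    also have "(\<integral>\<^sup>+x. ennreal (\<delta> i) * indicator D x \<partial>lborel) = ennreal (\<delta> i) * emeasure lborel D"
      by (rule nn_integral_cmult_indicator) (use D in simp)
    also have "\<dots> = ennreal (\<delta> i * V)" using V \<delta>(1)[of i] by (simp add: ennreal_mult)
    also have "(\<integral>\<^sup>+x\<in>D. ennreal \<bar>w i x - u x\<bar> \<partial>lborel) + ennreal (\<delta> i * V) \<le> ennreal (r i) + ennreal (r i)"
      by (intro add_mono wu ennreal_leI \<delta>)
    also have "\<dots> = ennreal (2 * r i)" using r[of i] by (simp flip: ennreal_plus)
    finally show ?thesis .
  qed
  \<comment> \<open>Fatou's lemma yields one good level for one sequence, so both quantities are
    merged. A bound on c at infinitely many i forces b to be at most 2^-i times that bound, which
    gives the convergence.\<close>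
  define c where "c i t = a i t + ennreal (2 ^ i) * b i t" for i t
  have cm [measurable]: "c i \<in> borel_measurable borel" for i unfolding c_def by measurable
  have c_int: "(\<integral>\<^sup>+t. c i t \<partial>lborel) \<le> ennreal (2 * \<epsilon> + 2 * (1/2) ^ i)" for i
  proof -
    have "(\<integral>\<^sup>+t. c i t \<partial>lborel) = (\<integral>\<^sup>+t. a i t \<partial>lborel) + ennreal (2 ^ i) * (\<integral>\<^sup>+t. b i t \<partial>lborel)"
      unfolding c_def by (subst nn_integral_add, measurable, subst nn_integral_cmult, measurable)
    also have "\<dots> \<le> ennreal (2 * \<epsilon>) + ennreal (2 ^ i) * ennreal (2 * r i)"
      by (intro add_mono mult_left_mono a_int b_int) simp
    also have "\<dots> = ennreal (2 * \<epsilon> + 2 ^ i * (2 * r i))"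
    proof -
      have "ennreal (2 ^ i) * ennreal (2 * r i) = ennreal (2 ^ i * (2 * r i))"
        by (rule ennreal_mult'[symmetric]) simp
      moreover have "ennreal (2 * \<epsilon>) + ennreal (2 ^ i * (2 * r i)) = ennreal (2 * \<epsilon> + 2 ^ i * (2 * r i))"
        using \<epsilon> r[of i] by (intro ennreal_plus[symmetric]) auto
      ultimately show ?thesis by simp
    qed
    also have "2 ^ i * (2 * r i) = 2 * ((2::real) * (1/4)) ^ i"
      by (simp only: r_def power_mult_distrib)
    finally show ?thesis by simp
  qed
  \<comment> \<open>The levels have total length 1/2, so a liminf of at least 5
    \<open>\<epsilon>\<close> throughout would give an integral of at least 5/2
    \<open>\<epsilon>\<close>, above the bound 2 \<open>\<epsilon>\<close>.\<close>
  have "\<exists>t\<in>{1/4..3/4}. liminf (\<lambda>i. c i t) < ennreal (5 * \<epsilon>)"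
  proof (rule ccontr)
    assume neg: "\<not> ?thesis"
    have "ennreal (5 * \<epsilon> * (1/2)) = ennreal (5 * \<epsilon>) * emeasure lborel {1/4..3/4::real}"
    proof -
      have "emeasure lborel {1/4..3/4::real} = ennreal (3/4 - 1/4)"
        by (rule emeasure_lborel_Icc) simp
      moreover have "ennreal (5 * \<epsilon> * (3/4 - 1/4)) = ennreal (5 * \<epsilon>) * ennreal (3/4 - 1/4)"
        using \<epsilon> by (intro ennreal_mult') simp
      ultimately show ?thesis by simp
    qed
    also have "\<dots> = (\<integral>\<^sup>+t. ennreal (5 * \<epsilon>) * indicator {1/4..3/4::real} t \<partial>lborel)"
      by (rule nn_integral_cmult_indicator[symmetric]) simp
    also have "\<dots> \<le> (\<integral>\<^sup>+t. liminf (\<lambda>i. c i t) \<partial>lborel)"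
      using neg by (intro nn_integral_mono) (auto simp: indicator_def not_less)
    also have "\<dots> \<le> liminf (\<lambda>i. \<integral>\<^sup>+t. c i t \<partial>lborel)"
      by (rule nn_integral_liminf) measurable
    also have "\<dots> \<le> liminf (\<lambda>i. ennreal (2 * \<epsilon> + 2 * (1/2) ^ i))"
      by (intro Liminf_mono always_eventually allI c_int)
    also have "\<dots> = ennreal (2 * \<epsilon>)"
    proof (rule lim_imp_Liminf)
      have "(\<lambda>i. 2 * \<epsilon> + 2 * (1/2::real) ^ i) \<longlonglongrightarrow> 2 * \<epsilon> + 2 * 0"
        by (intro tendsto_intros LIMSEQ_power_zero) simp
      then show "(\<lambda>i. ennreal (2 * \<epsilon> + 2 * (1/2) ^ i)) \<longlonglongrightarrow> ennreal (2 * \<epsilon>)"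
        by (intro tendsto_ennrealI) simp
    qed simp
    finally show False using \<epsilon> by (simp add: ennreal_le_iff)
  qed
  then obtain t where t: "1/4 \<le> t" "t \<le> 3/4" "liminf (\<lambda>i. c i t) < ennreal (5 * \<epsilon>)" by auto
  have freq: "\<exists>\<^sub>F i in sequentially. c i t < ennreal (5 * \<epsilon>)"
  proof (rule ccontr)
    assume "\<not> ?thesis"
    then have "\<forall>\<^sub>F i in sequentially. ennreal (5 * \<epsilon>) \<le> c i t"
      by (simp add: not_frequently not_less)
    then have "ennreal (5 * \<epsilon>) \<le> liminf (\<lambda>i. c i t)" by (rule Liminf_bounded)
    then show False using t(3) by simp
  qed
  show thesis
  proof (rule that[OF t(1,2)])
    fix e :: real assume e: "0 < e"
    have "(\<lambda>i. 5 * \<epsilon> * (1/2) ^ i) \<longlonglongrightarrow> 5 * \<epsilon> * 0"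
      by (intro tendsto_intros LIMSEQ_power_zero) simp
    then have "\<forall>\<^sub>F i in sequentially. 5 * \<epsilon> * (1/2) ^ i < e"
      using e by (intro order_tendstoD(2)[where a=e]) auto
    with freq have "\<exists>\<^sub>F i in sequentially. c i t < ennreal (5 * \<epsilon>) \<and> 5 * \<epsilon> * (1/2) ^ i < e"
      by (rule frequently_eventually_frequently)
    then obtain i where i: "c i t < ennreal (5 * \<epsilon>)" "5 * \<epsilon> * (1/2) ^ i < e"
      by (auto dest: frequently_ex)
    have "a i t \<le> c i t" by (simp add: c_def)
    then have 1: "a i t \<le> ennreal (5 * \<epsilon>)" using i(1) by simp
    have "b i t = ennreal ((1/2) ^ i) * (ennreal (2 ^ i) * b i t)"
    proof -
      have "ennreal ((1/2) ^ i) * ennreal (2 ^ i) = 1"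
        by (simp flip: ennreal_mult' power_mult_distrib)
      then show ?thesis by (simp flip: mult.assoc)
    qed
    also have "\<dots> \<le> ennreal ((1/2) ^ i) * c i t"
      by (intro mult_left_mono) (auto simp: c_def)
    also have "\<dots> \<le> ennreal ((1/2) ^ i) * ennreal (5 * \<epsilon>)"
      using i(1) by (intro mult_left_mono) auto
    also have "\<dots> = ennreal (5 * \<epsilon> * (1/2) ^ i)"
      using \<epsilon> by (simp add: mult.commute flip: ennreal_mult')
    also have "\<dots> \<le> ennreal e" using i(2) by (intro ennreal_leI) simp
    finally have 2: "b i t \<le> ennreal e" .
    show "\<exists>w G. C1_gradient w G \<and> (\<integral>\<^sup>+x\<in>D. ennreal \<bar>w x - indicator {x. t < u x} x\<bar> \<partial>lborel) \<le> ennreal e \<and>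
        (\<integral>\<^sup>+x\<in>D. ennreal (norm (G x)) \<partial>lborel) \<le> ennreal (5 * \<epsilon>)"
      using h\<Gamma>[of i t] 1 2 unfolding a_def b_def by blast
  qed
qed

section \<open>Covering by balls of small total \<open>(n-1)\<close>-dimensional size\<close>

definition ball_vol :: "'a::euclidean_space itself \<Rightarrow> real" where
  "ball_vol _ = unit_ball_vol (real DIM('a))"

lemma ball_vol_pos: "0 < ball_vol TYPE('a::euclidean_space)"
  by (simp add: ball_vol_def)

lemma emeasure_ball_vol:
  fixes x :: "'a::euclidean_space"
  assumes "0 < r"
  shows "emeasure lborel (ball x r) = ennreal (ball_vol TYPE('a) * r ^ DIM('a))"
  using emeasure_ball[of r x] assms by (simp add: ball_vol_def)

text \<open>Pairs (y,z) with y in A and z outside have measure a (v - a) in the double ball.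
  Replacing the indicator by h on these pairs costs the L^1 error twice, and the Poincare inequality
  bounds the rest. The density bounds give a (v - a) >= v^2 2^-(n+2), and division by v and r leaves
  r^(n-1). The C^1 function h and its L^1 error stand in for the perimeter of A.\<close>

lemma relative_isoperimetric:
  fixes x :: "'a::euclidean_space"
  assumes A: "A \<in> sets borel" and h: "C1_gradient h G" and r: "0 < r"
    and large: "ball_vol TYPE('a) * r ^ DIM('a) * (1 / 2) ^ Suc DIM('a) \<le> measure lborel (A \<inter> ball x r)"
    and small: "measure lborel (A \<inter> ball x r) \<le> ball_vol TYPE('a) * r ^ DIM('a) / 2"
  shows "ennreal (ball_vol TYPE('a) * (1 / 2) ^ (DIM('a) + 2) * r ^ (DIM('a) - 1))
    \<le> ennreal (2 ^ Suc DIM('a)) * (\<integral>\<^sup>+y\<in>ball x r. ennreal (norm (G y)) \<partial>lborel)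
      + ennreal (2 / r) * (\<integral>\<^sup>+y\<in>ball x r. ennreal \<bar>h y - indicator A y\<bar> \<partial>lborel)"
proof -
  define n where "n = DIM('a)"
  have n: "0 < n" by (simp add: n_def)
  define B where "B = ball x r"
  define v where "v = ball_vol TYPE('a) * r ^ n"
  have v: "0 < v" using ball_vol_pos[where 'a='a] r by (simp add: v_def)
  note A [measurable]
  have B [measurable]: "B \<in> sets borel" by (simp add: B_def)
  have mh [measurable]: "h \<in> borel_measurable borel" "G \<in> borel_measurable borel"
    using C1_gradientD(2,3)[OF h, of UNIV] by (auto intro: borel_measurable_continuous_onI)
  have eB: "emeasure lborel B = ennreal v"
    using emeasure_ball_vol[OF r, of x] by (simp add: B_def v_def n_def)
  define a where "a = measure lborel (A \<inter> B)"
  have fin: "emeasure lborel (A \<inter> B) \<noteq> \<infinity>"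
    using emeasure_mono[of "A \<inter> B" B lborel] eB by (auto simp: top_unique)
  have ea: "emeasure lborel (A \<inter> B) = ennreal a" "0 \<le> a"
    using fin by (auto simp: a_def emeasure_eq_ennreal_measure)
  have av: "a \<le> v / 2" "v * (1 / 2) ^ Suc n \<le> a"
    using small large by (auto simp: a_def v_def n_def B_def)
  have eb: "emeasure lborel (B - A) = ennreal (v - a)"
  proof -
    have "emeasure lborel (B - A \<inter> B) = emeasure lborel B - emeasure lborel (A \<inter> B)"
      by (rule emeasure_Diff) (use fin in auto)
    also have "B - A \<inter> B = B - A" by auto
    finally show ?thesis using eB ea by (simp add: ennreal_minus)
  qed
  let ?I = "\<integral>\<^sup>+y\<in>B. ennreal (norm (G y)) \<partial>lborel"
  let ?e = "\<integral>\<^sup>+y\<in>B. ennreal \<bar>h y - indicator A y\<bar> \<partial>lborel"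
  let ?P = "\<integral>\<^sup>+y. (\<integral>\<^sup>+z. ennreal \<bar>h y - h z\<bar> * indicator B z \<partial>lborel) * indicator B y \<partial>lborel"
  have "ennreal (a * (v - a)) = ennreal a * ennreal (v - a)"
    using ea by (intro ennreal_mult') auto
  also have "\<dots> = (\<integral>\<^sup>+y. ennreal (v - a) * indicator (A \<inter> B) y \<partial>lborel)"
    using ea by (subst nn_integral_cmult_indicator) (auto simp: mult.commute)
  also have "\<dots> = (\<integral>\<^sup>+y. (\<integral>\<^sup>+z. indicator (B - A) z \<partial>lborel) * indicator (A \<inter> B) y \<partial>lborel)"
    using eb by simp
  also have "\<dots> \<le> (\<integral>\<^sup>+y. (\<integral>\<^sup>+z. ennreal \<bar>h y - h z\<bar> * indicator B z \<partial>lborel) * indicator B y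
      + (ennreal \<bar>h y - indicator A y\<bar> * indicator B y * ennreal v + ?e * indicator B y) \<partial>lborel)"
  proof (rule nn_integral_mono)
    fix y
    show "(\<integral>\<^sup>+z. indicator (B - A) z \<partial>lborel) * indicator (A \<inter> B) y
      \<le> (\<integral>\<^sup>+z. ennreal \<bar>h y - h z\<bar> * indicator B z \<partial>lborel) * indicator B y
      + (ennreal \<bar>h y - indicator A y\<bar> * indicator B y * ennreal v + ?e * indicator B y)"
    proof (cases "y \<in> A \<inter> B")
      case True
      have "(\<integral>\<^sup>+z. indicator (B - A) z \<partial>lborel)
        \<le> (\<integral>\<^sup>+z. ennreal \<bar>h y - h z\<bar> * indicator B z + (ennreal \<bar>h y - indicator A y\<bar> * indicator B z + ennreal \<bar>h z - indicator A z\<bar> * indicator B z) \<partial>lborel)"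
      proof (rule nn_integral_mono)
        fix z
        show "indicator (B - A) z \<le> ennreal \<bar>h y - h z\<bar> * indicator B z + (ennreal \<bar>h y - indicator A y\<bar> * indicator B z + ennreal \<bar>h z - indicator A z\<bar> * indicator B z)"
        proof (cases "z \<in> B - A")
          case z: True
          have "1 \<le> \<bar>h y - h z\<bar> + (\<bar>h y - indicator A y\<bar> + \<bar>h z - indicator A z\<bar>)"
            using True z by auto
          then have "ennreal 1 \<le> ennreal (\<bar>h y - h z\<bar> + (\<bar>h y - indicator A y\<bar> + \<bar>h z - indicator A z\<bar>))"
            by (rule ennreal_leI)
          also have "\<dots> = ennreal \<bar>h y - h z\<bar> + (ennreal \<bar>h y - indicator A y\<bar> + ennreal \<bar>h z - indicator A z\<bar>)"
            by (simp only: ennreal_plus abs_ge_zero add_nonneg_nonneg)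
          finally show ?thesis using z by simp
        qed simp
      qed
      also have "\<dots> = (\<integral>\<^sup>+z. ennreal \<bar>h y - h z\<bar> * indicator B z \<partial>lborel) + (ennreal \<bar>h y - indicator A y\<bar> * ennreal v + ?e)"
      proof -
        have 1: "(\<lambda>z. ennreal \<bar>h y - h z\<bar> * indicator B z) \<in> borel_measurable lborel"
          and 2: "(\<lambda>z. ennreal \<bar>h y - indicator A y\<bar> * indicator B z) \<in> borel_measurable lborel"
          and 3: "(\<lambda>z. ennreal \<bar>h z - indicator A z\<bar> * indicator B z) \<in> borel_measurable lborel"
          by measurable
        have 4: "(\<integral>\<^sup>+z. ennreal \<bar>h y - indicator A y\<bar> * indicator B z \<partial>lborel) = ennreal \<bar>h y - indicator A y\<bar> * ennreal v"
          using eB by (subst nn_integral_cmult_indicator) auto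
        show ?thesis
          by (simp only: nn_integral_add[OF 1 borel_measurable_add[OF 2 3]] nn_integral_add[OF 2 3] 4)
      qed
      finally show ?thesis using True by simp
    qed simp
  qed
  also have "\<dots> = ?P + (?e * ennreal v + ?e * ennreal v)"
  proof -
    have 1: "(\<lambda>y. (\<integral>\<^sup>+z. ennreal \<bar>h y - h z\<bar> * indicator B z \<partial>lborel) * indicator B y) \<in> borel_measurable lborel"
      and 2: "(\<lambda>y. ennreal \<bar>h y - indicator A y\<bar> * indicator B y * ennreal v) \<in> borel_measurable lborel"
      and 3: "(\<lambda>y. ?e * indicator B y) \<in> borel_measurable lborel"
      by measurable
    have 4: "(\<integral>\<^sup>+y. ?e * indicator B y \<partial>lborel) = ?e * ennreal v"
      using eB by (subst nn_integral_cmult_indicator) auto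
    have 5: "(\<integral>\<^sup>+y. ennreal \<bar>h y - indicator A y\<bar> * indicator B y * ennreal v \<partial>lborel) = ?e * ennreal v"
      by (rule nn_integral_multc) measurable
    show ?thesis
      by (simp only: nn_integral_add[OF 1 borel_measurable_add[OF 2 3]] nn_integral_add[OF 2 3] 4 5)
  qed
  also have "\<dots> \<le> ennreal (2 * r * 2 ^ n) * (ennreal v * ?I) + (?e * ennreal v + ?e * ennreal v)"
    using Poincare_ball[OF h r, of x] eB by (intro add_right_mono) (simp add: B_def n_def)
  finally have main: "ennreal (a * (v - a)) \<le> ennreal (2 * r * 2 ^ n) * (ennreal v * ?I) + (?e * ennreal v + ?e * ennreal v)" .
  show ?thesis
  proof (cases "?I = \<infinity> \<or> ?e = \<infinity>")
    case True
    then have top: "ennreal (2 ^ Suc n) * ?I + ennreal (2 / r) * ?e = top"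
      using r by (auto simp: ennreal_mult_top)
    show ?thesis
      unfolding B_def[symmetric] n_def[symmetric] top by simp
  next
    case False
    obtain I where I: "?I = ennreal I" "0 \<le> I"
      using False by (cases "?I" rule: ennreal_cases) auto
    obtain e where e: "?e = ennreal e" "0 \<le> e"
      using False by (cases "?e" rule: ennreal_cases) auto
    have "ennreal (a * (v - a)) \<le> ennreal (2 * r * 2 ^ n * (v * I) + (e * v + e * v))"
    proof -
      have nn: "0 \<le> r" "0 \<le> v" "0 \<le> 2 * r * 2 ^ n" using r v by auto
      have "ennreal (2 * r * 2 ^ n) * (ennreal v * ennreal I) = ennreal (2 * r * 2 ^ n * (v * I))"
        by (simp only: ennreal_mult[OF nn(3) mult_nonneg_nonneg[OF nn(2) I(2)]] ennreal_mult[OF nn(2) I(2)])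
      moreover have "ennreal e * ennreal v + ennreal e * ennreal v = ennreal (e * v + e * v)"
        by (simp only: ennreal_mult[OF e(2) nn(2)] ennreal_plus mult_nonneg_nonneg[OF e(2) nn(2)])
      moreover have "ennreal (2 * r * 2 ^ n * (v * I)) + ennreal (e * v + e * v) = ennreal (2 * r * 2 ^ n * (v * I) + (e * v + e * v))"
        using nn I e by (intro ennreal_plus[symmetric]) auto
      ultimately show ?thesis using main unfolding I e by simp
    qed
    then have "a * (v - a) \<le> 2 * r * 2 ^ n * (v * I) + (e * v + e * v)"
      using I e r v by (subst (asm) ennreal_le_iff) auto
    moreover have "(v * (1 / 2) ^ Suc n) * (v / 2) \<le> a * (v - a)"
      using av v ea by (intro mult_mono) auto
    ultimately have "v * (v * (1 / 2) ^ (n + 2)) \<le> v * (2 * r * 2 ^ n * I + 2 * e)"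
      by (simp add: algebra_simps)
    then have le: "v * (1 / 2) ^ (n + 2) \<le> 2 * r * 2 ^ n * I + 2 * e"
      using v by simp
    have "v = r * (ball_vol TYPE('a) * r ^ (n - 1))"
      using n by (cases n) (auto simp: v_def)
    then have "r * (ball_vol TYPE('a) * (1 / 2) ^ (n + 2) * r ^ (n - 1)) \<le> r * (2 ^ Suc n * I + 2 / r * e)"
      using le r by (simp add: algebra_simps)
    then have "ball_vol TYPE('a) * (1 / 2) ^ (n + 2) * r ^ (n - 1) \<le> 2 ^ Suc n * I + 2 / r * e"
      using r by simp
    then have "ennreal (ball_vol TYPE('a) * (1 / 2) ^ (n + 2) * r ^ (n - 1)) \<le> ennreal (2 ^ Suc n * I + 2 / r * e)"
      by (rule ennreal_leI)
    also have "\<dots> = ennreal (2 ^ Suc n) * ?I + ennreal (2 / r) * ?e"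
      unfolding I(1) e(1) using I e r by (intro ennreal_mult_add_mult[symmetric]) auto
    finally show ?thesis by (simp add: B_def n_def)
  qed
qed

text \<open>Among the radii 2^-k the density of A exceeds 1/2 for large k, as A has full measure
  near x, but not at radius 1. At the radius just before it first does, the density is at most 1/2,
  and at least 2^-(n+1) because the next ball has half the radius.\<close>

lemma density_radius:
  fixes x :: "'a::euclidean_space"
  assumes A: "A \<in> sets borel" and U: "open U" "x \<in> U" "AE y in lborel. y \<in> U \<longrightarrow> y \<in> A"
    and small: "measure lborel (A \<inter> ball x 1) \<le> ball_vol TYPE('a) / 2"
  obtains r where "0 < r" "r \<le> 1"
    "ball_vol TYPE('a) * r ^ DIM('a) * (1 / 2) ^ Suc DIM('a) \<le> measure lborel (A \<inter> ball x r)"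
    "measure lborel (A \<inter> ball x r) \<le> ball_vol TYPE('a) * r ^ DIM('a) / 2"
proof -
  define n where "n = DIM('a)"
  define \<omega> where "\<omega> = ball_vol TYPE('a)"
  have \<omega>: "0 < \<omega>" by (simp add: \<omega>_def ball_vol_pos)
  define r where "r k = (1/2::real) ^ k" for k :: nat
  have r: "0 < r k" "r k \<le> 1" "r (Suc k) = r k / 2" for k by (auto simp: r_def power_le_one)
  define Q where "Q k \<longleftrightarrow> \<omega> * r k ^ n / 2 < measure lborel (A \<inter> ball x (r k))" for k
  have "\<exists>k. Q k"
  proof -
    obtain s where s: "0 < s" "ball x s \<subseteq> U" using U(1,2) open_contains_ball by blast
    obtain k where k: "(1/2::real) ^ k < s" using real_arch_pow_inv[OF s(1), of "1/2"] by auto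
    have sub: "ball x (r k) \<subseteq> U" using s(2) k by (auto simp: r_def)
    have "AE y in lborel. (y \<in> A \<inter> ball x (r k)) = (y \<in> ball x (r k))"
      using U(3) by eventually_elim (use sub in auto)
    then have "measure lborel (A \<inter> ball x (r k)) = measure lborel (ball x (r k))"
      by (rule measure_eq_AE) (use A in auto)
    also have "\<dots> = \<omega> * r k ^ n"
      using emeasure_ball_vol[OF r(1)[of k], of x] \<omega> r(1)[of k] by (simp add: measure_def \<omega>_def n_def)
    finally show ?thesis using \<omega> r(1)[of k] by (intro exI[of _ k]) (simp add: Q_def)
  qed
  then have QL: "Q (LEAST k. Q k)" by (rule LeastI_ex)
  have "\<not> Q 0" using small by (simp add: Q_def r_def \<omega>_def)
  then obtain k where k: "(LEAST k. Q k) = Suc k"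
    using QL by (metis not0_implies_Suc)
  then have "\<not> Q k" using not_less_Least[of k Q] by simp
  have "\<omega> * r k ^ n * (1/2) ^ Suc n = \<omega> * r (Suc k) ^ n / 2"
    by (simp add: r(3) power_divide)
  also have "\<dots> < measure lborel (A \<inter> ball x (r (Suc k)))" using QL k by (simp add: Q_def)
  also have "\<dots> \<le> measure lborel (A \<inter> ball x (r k))"
  proof (rule measure_mono_fmeasurable)
    show "A \<inter> ball x (r (Suc k)) \<subseteq> A \<inter> ball x (r k)" using r[of k] by auto
    show "A \<inter> ball x (r k) \<in> fmeasurable lborel"
    proof (rule fmeasurableI2[of "ball x (r k)"])
      show "ball x (r k) \<in> fmeasurable lborel"
        using emeasure_lborel_ball_finite[of x "r k"] by (rule fmeasurableI[rotated]) simp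
    qed (use A in auto)
  qed (use A in auto)
  finally show thesis
    using that[OF r(1,2)[of k]] \<open>\<not> Q k\<close> by (simp add: Q_def \<omega>_def n_def)
qed

text \<open>Levels in [1/4, 3/4] serve twice: where u = 1 the superlevel set A has full measure, and
  by Chebyshev's inequality its measure in the large ball is at most 4 times \<open>ball_vol\<close>
  / 8, so a unit ball about a point of F is at most half filled. Disjointness of the Vitali balls
  lets the gradient integrals be added without overlap.\<close>

lemma boxing:
  fixes u :: "'a::euclidean_space \<Rightarrow> real"
  assumes u [measurable]: "u \<in> borel_measurable borel" and \<epsilon>: "0 < \<epsilon>" and m: "0 \<le> m"
    and F: "F \<subseteq> ball 0 m" "F \<subseteq> U" and U: "open U" "AE x in lborel. x \<in> U \<longrightarrow> u x = 1"
    and small: "(\<integral>\<^sup>+x\<in>ball 0 (m + 2). ennreal \<bar>u x\<bar> \<partial>lborel) \<le> ennreal (ball_vol TYPE('a) / 8)"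
    and ap: "\<And>e. 0 < e \<Longrightarrow> \<exists>w G. C1_gradient w G \<and> (\<integral>\<^sup>+x\<in>ball 0 (m + 2). ennreal \<bar>w x - u x\<bar> \<partial>lborel) \<le> ennreal e \<and>
        (\<integral>\<^sup>+x\<in>ball 0 (m + 2). ennreal (norm (G x)) \<partial>lborel) \<le> ennreal \<epsilon>"
  obtains C r where "countable C" "C \<subseteq> F" "\<And>x. x \<in> C \<Longrightarrow> 0 < r x \<and> r x \<le> 1" "F \<subseteq> (\<Union>x\<in>C. ball x (5 * r x))"
    "\<And>J. finite J \<Longrightarrow> J \<subseteq> C \<Longrightarrow>
      ball_vol TYPE('a) * (1 / 2) ^ (DIM('a) + 2) * (\<Sum>x\<in>J. r x ^ (DIM('a) - 1)) \<le> 2 ^ Suc DIM('a) * (5 * \<epsilon>)"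
proof -
  define D where "D = ball (0::'a) (m + 2)"
  have D: "D \<in> sets borel" "emeasure lborel D < \<infinity>"
    using emeasure_lborel_ball_finite[of "0::'a" "m + 2"] by (auto simp: D_def)
  note D(1) [measurable]
  obtain t where t: "1/4 \<le> t" "t \<le> 3/4"
    and ap': "\<And>e. 0 < e \<Longrightarrow> \<exists>w G. C1_gradient w G \<and> (\<integral>\<^sup>+x\<in>D. ennreal \<bar>w x - indicator {x. t < u x} x\<bar> \<partial>lborel) \<le> ennreal e \<and>
        (\<integral>\<^sup>+x\<in>D. ennreal (norm (G x)) \<partial>lborel) \<le> ennreal (5 * \<epsilon>)"
    by (rule superlevel_approximation[OF D u \<epsilon>]) (use ap in \<open>auto simp: D_def\<close>)
  define A where "A = {x. t < u x}"
  have A [measurable]: "A \<in> sets borel" unfolding A_def by measurable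
  have UA: "AE x in lborel. x \<in> U \<longrightarrow> x \<in> A"
    using U(2) by eventually_elim (use t in \<open>auto simp: A_def\<close>)
  have AD: "measure lborel (A \<inter> B) \<le> ball_vol TYPE('a) / 2" if B: "B \<subseteq> D" "B \<in> sets borel" for B
  proof -
    note B(2) [measurable]
    have "emeasure lborel (A \<inter> B) = (\<integral>\<^sup>+x. indicator (A \<inter> B) x \<partial>lborel)"
      by simp
    also have "\<dots> \<le> (\<integral>\<^sup>+x. ennreal 4 * (ennreal \<bar>u x\<bar> * indicator D x) \<partial>lborel)"
    proof (rule nn_integral_mono)
      fix x
      show "indicator (A \<inter> B) x \<le> ennreal 4 * (ennreal \<bar>u x\<bar> * indicator D x)"
      proof (cases "x \<in> A \<inter> B")
        case True
        then have "1 \<le> 4 * \<bar>u x\<bar>" using t by (auto simp: A_def)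
        then have "ennreal 1 \<le> ennreal (4 * \<bar>u x\<bar>)" by (rule ennreal_leI)
        also have "\<dots> = ennreal 4 * ennreal \<bar>u x\<bar>" by (rule ennreal_mult') simp
        finally show ?thesis using True B by auto
      qed simp
    qed
    also have "\<dots> = ennreal 4 * (\<integral>\<^sup>+x\<in>D. ennreal \<bar>u x\<bar> \<partial>lborel)"
      by (rule nn_integral_cmult) measurable
    also have "\<dots> \<le> ennreal 4 * ennreal (ball_vol TYPE('a) / 8)"
      using small by (intro mult_left_mono) (auto simp: D_def)
    also have "\<dots> = ennreal (4 * (ball_vol TYPE('a) / 8))"
      by (rule ennreal_mult'[symmetric]) simp
    also have "4 * (ball_vol TYPE('a) / 8) = ball_vol TYPE('a) / 2" by simp
    finally have "enn2real (emeasure lborel (A \<inter> B)) \<le> enn2real (ennreal (ball_vol TYPE('a) / 2))"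
      by (rule enn2real_mono) simp
    then show ?thesis using ball_vol_pos[where 'a='a] by (simp add: measure_def)
  qed
  have sub: "ball x r \<subseteq> D" if "x \<in> F" "r \<le> 1" for x r
  proof
    fix y assume "y \<in> ball x r"
    moreover have "norm x < m" using F(1) that by auto
    ultimately show "y \<in> D"
      using norm_triangle_ineq2[of y x] that by (simp add: D_def dist_norm norm_minus_commute)
  qed
  have "\<exists>r. x \<in> F \<longrightarrow> 0 < r \<and> r \<le> 1 \<and>
    ball_vol TYPE('a) * r ^ DIM('a) * (1 / 2) ^ Suc DIM('a) \<le> measure lborel (A \<inter> ball x r) \<and>
    measure lborel (A \<inter> ball x r) \<le> ball_vol TYPE('a) * r ^ DIM('a) / 2" for x
  proof (cases "x \<in> F")
    case True
    then have "x \<in> U" using F by auto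
    obtain r where "0 < r" "r \<le> 1"
      "ball_vol TYPE('a) * r ^ DIM('a) * (1 / 2) ^ Suc DIM('a) \<le> measure lborel (A \<inter> ball x r)"
      "measure lborel (A \<inter> ball x r) \<le> ball_vol TYPE('a) * r ^ DIM('a) / 2"
      by (rule density_radius[OF A U(1) \<open>x \<in> U\<close> UA AD[OF sub[OF True, of 1]]]) auto
    then show ?thesis by blast
  qed simp
  from choice[OF allI[OF this]] obtain r where r: "\<forall>x. x \<in> F \<longrightarrow> 0 < r x \<and> r x \<le> 1 \<and>
    ball_vol TYPE('a) * r x ^ DIM('a) * (1 / 2) ^ Suc DIM('a) \<le> measure lborel (A \<inter> ball x (r x)) \<and>
    measure lborel (A \<inter> ball x (r x)) \<le> ball_vol TYPE('a) * r x ^ DIM('a) / 2"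
    by (rule exE)
  have "F \<subseteq> (\<Union>x\<in>F. ball x (r x))" using r by force
  then obtain C where C: "countable C" "C \<subseteq> F"
     "pairwise (\<lambda>x y. disjnt (ball x (r x)) (ball y (r y))) C" "F \<subseteq> (\<Union>x\<in>C. ball x (5 * r x))"
    by (rule Vitali_covering_lemma_balls[where B=1 and r=r and a="\<lambda>x. x"]) (use r in auto)
  have sum: "ball_vol TYPE('a) * (1 / 2) ^ (DIM('a) + 2) * (\<Sum>x\<in>J. r x ^ (DIM('a) - 1)) \<le> 2 ^ Suc DIM('a) * (5 * \<epsilon>)"
    if J: "finite J" "J \<subseteq> C" for J
  proof (rule field_le_epsilon)
    fix \<eta> :: real assume \<eta>: "0 < \<eta>"
    have rJ: "0 < r x" if "x \<in> J" for x using r C J that by blast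
    \<comment> \<open>Each ball carries the error with a factor 2 / r, so the approximant is chosen
      after J and \<open>\<eta>\<close>. This is why the bound is stated for finite subsets of
      C.\<close>
    define s where "s = (\<Sum>x\<in>J. 2 / r x)"
    have s: "0 \<le> s" unfolding s_def using rJ by (intro sum_nonneg) (auto simp: less_imp_le)
    define e where "e = \<eta> / (s + 1)"
    have e: "0 < e" "s * e \<le> \<eta>" using \<eta> s by (auto simp: e_def field_simps)
    obtain w G where w: "C1_gradient w G" and we: "(\<integral>\<^sup>+x\<in>D. ennreal \<bar>w x - indicator A x\<bar> \<partial>lborel) \<le> ennreal e"
        and Ge: "(\<integral>\<^sup>+x\<in>D. ennreal (norm (G x)) \<partial>lborel) \<le> ennreal (5 * \<epsilon>)"
      using ap'[OF e(1)] unfolding A_def by blast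
    have [measurable]: "G \<in> borel_measurable borel"
      using C1_gradientD(2)[OF w, of UNIV] by (auto intro: borel_measurable_continuous_onI)
    define c where "c = ball_vol TYPE('a) * (1 / 2) ^ (DIM('a) + 2)"
    have c: "0 < c" using ball_vol_pos[where 'a='a] by (simp add: c_def)
    have "ennreal (c * (\<Sum>x\<in>J. r x ^ (DIM('a) - 1))) = (\<Sum>x\<in>J. ennreal (c * r x ^ (DIM('a) - 1)))"
      using c rJ by (subst sum_ennreal) (auto simp: sum_distrib_left less_imp_le)
    also have "\<dots> \<le> (\<Sum>x\<in>J. ennreal (2 ^ Suc DIM('a)) * (\<integral>\<^sup>+y\<in>ball x (r x). ennreal (norm (G y)) \<partial>lborel)
        + ennreal (2 / r x) * ennreal e)"
    proof (rule sum_mono)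
      fix x assume x: "x \<in> J"
      then have xF: "x \<in> F" using C J by blast
      have "ennreal (c * r x ^ (DIM('a) - 1)) \<le> ennreal (2 ^ Suc DIM('a)) * (\<integral>\<^sup>+y\<in>ball x (r x). ennreal (norm (G y)) \<partial>lborel)
         + ennreal (2 / r x) * (\<integral>\<^sup>+y\<in>ball x (r x). ennreal \<bar>w y - indicator A y\<bar> \<partial>lborel)"
        unfolding c_def by (rule relative_isoperimetric[OF A w rJ[OF x]]) (use r xF in auto)
      also have "\<dots> \<le> ennreal (2 ^ Suc DIM('a)) * (\<integral>\<^sup>+y\<in>ball x (r x). ennreal (norm (G y)) \<partial>lborel)
         + ennreal (2 / r x) * ennreal e"
      proof (intro add_left_mono mult_left_mono)
        have "(\<integral>\<^sup>+y\<in>ball x (r x). ennreal \<bar>w y - indicator A y\<bar> \<partial>lborel) \<le> (\<integral>\<^sup>+y\<in>D. ennreal \<bar>w y - indicator A y\<bar> \<partial>lborel)"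
        proof (rule nn_integral_mono)
          fix y
          have "ball x (r x) \<subseteq> D" using sub[OF xF, of "r x"] r xF by blast
          then show "ennreal \<bar>w y - indicator A y\<bar> * indicator (ball x (r x)) y \<le> ennreal \<bar>w y - indicator A y\<bar> * indicator D y"
            by (intro mult_left_mono) (auto simp: indicator_def)
        qed
        then show "(\<integral>\<^sup>+y\<in>ball x (r x). ennreal \<bar>w y - indicator A y\<bar> \<partial>lborel) \<le> ennreal e"
          using we by (rule order_trans)
      qed auto
      finally show "ennreal (c * r x ^ (DIM('a) - 1)) \<le> ennreal (2 ^ Suc DIM('a)) * (\<integral>\<^sup>+y\<in>ball x (r x). ennreal (norm (G y)) \<partial>lborel)
         + ennreal (2 / r x) * ennreal e" .
    qed
    also have "\<dots> = ennreal (2 ^ Suc DIM('a)) * (\<Sum>x\<in>J. \<integral>\<^sup>+y\<in>ball x (r x). ennreal (norm (G y)) \<partial>lborel)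
        + (\<Sum>x\<in>J. ennreal (2 / r x)) * ennreal e"
      by (simp only: sum.distrib sum_distrib_left sum_distrib_right)
    also have "(\<Sum>x\<in>J. \<integral>\<^sup>+y\<in>ball x (r x). ennreal (norm (G y)) \<partial>lborel) \<le> ennreal (5 * \<epsilon>)"
    proof -
      have "(\<Sum>x\<in>J. \<integral>\<^sup>+y\<in>ball x (r x). ennreal (norm (G y)) \<partial>lborel)
        = (\<integral>\<^sup>+y. (\<Sum>x\<in>J. ennreal (norm (G y)) * indicator (ball x (r x)) y) \<partial>lborel)"
      proof (rule nn_integral_sum[symmetric])
        show "(\<lambda>y. ennreal (norm (G y)) * indicator (ball x (r x)) y) \<in> borel_measurable lborel" for x
        proof (intro borel_measurable_times_ennreal borel_measurable_indicator)
          show "(\<lambda>y. ennreal (norm (G y))) \<in> borel_measurable lborel" by measurable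
        qed simp
      qed
      also have "\<dots> \<le> (\<integral>\<^sup>+y\<in>D. ennreal (norm (G y)) \<partial>lborel)"
      proof (rule nn_integral_mono)
        fix y
        have "disjoint_family_on (\<lambda>x. ball x (r x)) J"
          using C(3) J(2) unfolding disjoint_family_on_def pairwise_def disjnt_def by blast
        then have "(\<Sum>x\<in>J. indicator (ball x (r x)) y :: ennreal) = indicator (\<Union>x\<in>J. ball x (r x)) y"
          using J(1) by (simp add: indicator_UN_disjoint)
        moreover have "(\<Union>x\<in>J. ball x (r x)) \<subseteq> D"
          using sub r C J by (meson UN_least subsetD)
        ultimately have "(\<Sum>x\<in>J. indicator (ball x (r x)) y :: ennreal) \<le> indicator D y"
          by (metis indicator_leI subsetD)
        then show "(\<Sum>x\<in>J. ennreal (norm (G y)) * indicator (ball x (r x)) y) \<le> ennreal (norm (G y)) * indicator D y"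
          by (simp add: mult_left_mono flip: sum_distrib_left)
      qed
      finally show ?thesis using Ge by (rule order_trans)
    qed
    also have "(\<Sum>x\<in>J. ennreal (2 / r x)) = ennreal s"
      unfolding s_def using rJ by (intro sum_ennreal) (auto simp: less_imp_le)
    finally have "ennreal (c * (\<Sum>x\<in>J. r x ^ (DIM('a) - 1))) \<le> ennreal (2 ^ Suc DIM('a)) * ennreal (5 * \<epsilon>) + ennreal s * ennreal e"
      by (simp add: mult_left_mono add_right_mono)
    also have "\<dots> = ennreal (2 ^ Suc DIM('a) * (5 * \<epsilon>) + s * e)"
      using s e \<epsilon> by (intro ennreal_mult_add_mult) auto
    finally have "c * (\<Sum>x\<in>J. r x ^ (DIM('a) - 1)) \<le> 2 ^ Suc DIM('a) * (5 * \<epsilon>) + s * e"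
      using s e \<epsilon> by (subst (asm) ennreal_le_iff) auto
    then show "ball_vol TYPE('a) * (1 / 2) ^ (DIM('a) + 2) * (\<Sum>x\<in>J. r x ^ (DIM('a) - 1)) \<le> 2 ^ Suc DIM('a) * (5 * \<epsilon>) + \<eta>"
      using e(2) by (simp add: c_def)
  qed
  show thesis
    by (rule that[OF C(1,2) _ C(4) sum]) (use r C(2) in auto)
qed

section \<open>The region where the exponent equals one\<close>

context log_Holder_exponent
begin

text \<open>The scaling \<open>r ^ (n - 1)\<close> is the right one at a centre where \<open>p = 1\<close>: log-Hoelder continuity
  makes \<open>r powr (- n * p x)\<close> comparable to \<open>r powr (- n)\<close> on the ball.\<close>

lemma modular_ball_le:
  fixes f :: "'a \<Rightarrow> real"
  assumes M: "1 \<le> M" and r: "0 < r" "r \<le> 1" and c: "p c = 1"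
    and out: "\<And>x. x \<notin> ball c (10 * r) \<Longrightarrow> f x = 0" and le: "\<And>x. \<bar>f x\<bar> \<le> M * (1 / r) ^ DIM('a)"
  shows "modular p f \<le> ennreal (ball_vol TYPE('a) * 10 ^ DIM('a) * M powr P * exp (real DIM('a) * (c1 * ln 10 + c1)))"
proof -
  define n where "n = DIM('a)"
  define K where "K = exp (real n * (c1 * ln 10 + c1))"
  have pw: "\<bar>f x\<bar> powr p x \<le> M powr P * ((1 / r) ^ n * K)" if x: "x \<in> ball c (10 * r)" for x
  proof -
    have px: "p x \<le> 1 + osc (10 * r)"
      using p_osc[of x c "10 * r"] x r c by (simp add: dist_norm norm_minus_commute)
    \<comment> \<open>ln (1/r) and ln (1/(10 r)) differ by ln 10, so the logarithmic modulus at
      scale 10 r, the radius of the support, controls powers of 1/r.\<close>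
    have "osc (10 * r) * ln (1 / r) \<le> c1 * ln 10 + c1"
    proof -
      have "ln (1 / r) = ln 10 + ln (1 / (10 * r))"
        using r by (simp add: ln_div ln_mult)
      then have "osc (10 * r) * ln (1 / r) = osc (10 * r) * ln 10 + osc (10 * r) * ln (1 / (10 * r))"
        by (simp add: distrib_left)
      also have "\<dots> \<le> c1 * ln 10 + c1"
        using osc_le[of "10 * r"] osc_ln_le[of "10 * r"] r by (intro add_mono mult_right_mono) auto
      finally show ?thesis .
    qed
    then have osc_K: "(1 / r) powr (real n * osc (10 * r)) \<le> K"
      using r by (simp add: K_def powr_def mult_left_mono mult.assoc)
    have r1: "1 \<le> 1 / r" using r by simp
    have "\<bar>f x\<bar> powr p x \<le> (M * (1 / r) ^ n) powr p x"
      using le p_ge[of x] by (intro powr_mono2) (auto simp: n_def)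
    also have "\<dots> = M powr p x * ((1 / r) ^ n) powr p x"
      using M r by (simp add: powr_mult)
    also have "((1 / r) ^ n) powr p x = (1 / r) powr (real n * p x)"
      using r by (simp add: powr_powr flip: powr_realpow)
    also have "M powr p x * (1 / r) powr (real n * p x) \<le> M powr P * ((1 / r) ^ n * K)"
    proof (intro mult_mono)
      show "M powr p x \<le> M powr P" using M p_le by (intro powr_mono)
      have "(1 / r) powr (real n * p x) \<le> (1 / r) powr (real n + real n * osc (10 * r))"
        using r1 mult_left_mono[OF px, of "real n"] by (intro powr_mono) (auto simp: algebra_simps)
      also have "\<dots> = (1 / r) ^ n * (1 / r) powr (real n * osc (10 * r))"
        using r by (simp add: powr_add powr_realpow)
      also have "\<dots> \<le> (1 / r) ^ n * K"
        using r osc_K by (intro mult_left_mono) auto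
      finally show "(1 / r) powr (real n * p x) \<le> (1 / r) ^ n * K" .
    qed (use r in auto)
    finally show ?thesis .
  qed
  have "modular p f \<le> (\<integral>\<^sup>+x. ennreal (M powr P * ((1 / r) ^ n * K)) * indicator (ball c (10 * r)) x \<partial>lebesgue)"
    unfolding modular_def
  proof (rule nn_integral_mono)
    fix x
    show "ennreal (\<bar>f x\<bar> powr p x) \<le> ennreal (M powr P * ((1 / r) ^ n * K)) * indicator (ball c (10 * r)) x"
    proof (cases "x \<in> ball c (10 * r)")
      case True
      then show ?thesis using pw[OF True] by (simp add: ennreal_leI)
    next
      case False
      then show ?thesis using out[OF False] by simp
    qed
  qed
  also have "\<dots> = ennreal (M powr P * ((1 / r) ^ n * K)) * emeasure lebesgue (ball c (10 * r))"
    by (rule nn_integral_cmult_indicator) simp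
  also have "emeasure lebesgue (ball c (10 * r)) = ennreal (ball_vol TYPE('a) * (10 * r) ^ n)"
    using emeasure_ball_vol[of "10 * r" c] r by (simp add: n_def)
  also have "ennreal (M powr P * ((1 / r) ^ n * K)) * ennreal (ball_vol TYPE('a) * (10 * r) ^ n)
     = ennreal (M powr P * ((1 / r) ^ n * K) * (ball_vol TYPE('a) * (10 * r) ^ n))"
    using r by (intro ennreal_mult'[symmetric]) (auto simp: K_def)
  also have "M powr P * ((1 / r) ^ n * K) * (ball_vol TYPE('a) * (10 * r) ^ n)
     = ball_vol TYPE('a) * 10 ^ n * M powr P * K * ((1 / r) ^ n * r ^ n)"
    by (simp add: power_mult_distrib)
  also have "(1 / r) ^ n * r ^ n = 1" using r by (simp flip: power_mult_distrib)
  finally show ?thesis by (simp add: n_def K_def)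
qed

text \<open>v is r^-(n-1) times a bump at scale 5 r, the factor 5 being that of the Vitali
  enlargement. For r <= 1 both v and its gradient are at most a constant times r^-n and vanish off
  the ball of radius 10 r, so \<open>modular_ball_le\<close> gives a bound independent of c and
  r.\<close>

lemma ball_functions:
  obtains K where "0 < K" "\<And>c r. p c = 1 \<Longrightarrow> 0 < r \<Longrightarrow> r \<le> 1 \<Longrightarrow>
    \<exists>v g. v has_weak_gradient g \<and> (\<forall>x. 0 \<le> v x) \<and> (\<forall>x\<in>ball c (5 * r). 1 \<le> r ^ (DIM('a) - 1) * v x) \<and>
      modular p v \<le> ennreal K \<and> modular p (\<lambda>x. norm (g x)) \<le> ennreal K"
proof -
  define n where "n = DIM('a)"
  have n: "n = Suc (n - 1)" by (simp add: n_def)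
  obtain D R where cD: "C1c_gradient (bump :: 'a \<Rightarrow> real) D R"
    using test_function_C1_gradient[OF bump_test] by blast
  then have D: "C1_gradient (bump :: 'a \<Rightarrow> real) D" by (simp add: C1c_gradient_def)
  obtain B where B: "\<And>x::'a. \<bar>bump x\<bar> \<le> B" "\<And>x. norm (D x) \<le> B"
    using C1c_gradient_facts[OF cD] by metis
  define M where "M = max 1 B"
  have M: "1 \<le> M" "\<bar>bump x\<bar> \<le> M" "norm (D x) \<le> M" for x :: 'a
    using B(1)[of x] B(2)[of x] by (auto simp: M_def)
  define K where "K = ball_vol TYPE('a) * 10 ^ DIM('a) * M powr P * exp (real DIM('a) * (c1 * ln 10 + c1))"
  show thesis
  proof (rule that[of K])
    show "0 < K" unfolding K_def using ball_vol_pos[where 'a='a] M(1) by (intro mult_pos_pos) auto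
    fix c :: 'a and r :: real assume c: "p c = 1" and r: "0 < r" "r \<le> 1"
    define s where "s = 1 / (5 * r)"
    have s: "0 < s" using r by (simp add: s_def)
    define l where "l = r ^ (n - 1)"
    have l: "0 < l" using r by (simp add: l_def)
    define v where "v x = (1 / l) * bump (s *\<^sub>R x + (- s) *\<^sub>R c)" for x
    define g where "g x = (1 / l) *\<^sub>R (s *\<^sub>R D (s *\<^sub>R x + (- s) *\<^sub>R c))" for x
    have arg: "s *\<^sub>R x + (- s) *\<^sub>R c = s *\<^sub>R (x - c)" for x by (simp add: algebra_simps)
    have "(\<lambda>x. bump (s *\<^sub>R x + (- s) *\<^sub>R c)) has_weak_gradient (\<lambda>x. s *\<^sub>R D (s *\<^sub>R x + (- s) *\<^sub>R c))"
      by (rule C1_gradient_weak[OF C1_gradient_affine[OF D]])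
    from has_weak_gradient_linear[OF this this, of "1 / l" 0]
    have wg: "v has_weak_gradient g" by (simp add: v_def[abs_def] g_def[abs_def])
    have lr: "1 / l * (1 / r) = (1 / r) ^ n"
      unfolding l_def by (subst (2) n) (simp add: power_one_over mult.commute)
    have l1: "1 / l \<le> (1 / r) ^ n"
    proof -
      have "1 / l * 1 \<le> 1 / l * (1 / r)" using l r by (intro mult_left_mono) auto
      then show ?thesis using lr by simp
    qed
    have out: "v x = 0 \<and> g x = 0" if "x \<notin> ball c (10 * r)" for x
    proof -
      have nrm: "2 \<le> norm (s *\<^sub>R (x - c))"
        using that r by (simp add: s_def dist_norm norm_minus_commute le_divide_eq)
      show ?thesis
        unfolding v_def g_def arg using bump_eq_0[OF nrm] C1_gradient_zero_outside[OF D bump_eq_0 nrm] by simp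
    qed
    have "\<bar>v x\<bar> \<le> M * (1 / r) ^ n" for x
    proof -
      have "\<bar>v x\<bar> = \<bar>bump (s *\<^sub>R (x - c))\<bar> * (1 / l)" unfolding v_def arg using l by (simp add: abs_mult)
      also have "\<dots> \<le> M * (1 / r) ^ n" using M l l1 by (intro mult_mono) auto
      finally show ?thesis .
    qed
    then have mv: "modular p v \<le> ennreal K"
      unfolding K_def by (intro modular_ball_le[OF M(1) r c]) (use out in \<open>auto simp: n_def\<close>)
    have "\<bar>norm (g x)\<bar> \<le> M * (1 / r) ^ n" for x
    proof -
      have "\<bar>norm (g x)\<bar> = norm (D (s *\<^sub>R (x - c))) * (1 / l * s)" unfolding g_def arg using l s by simp
      also have "\<dots> \<le> M * (1 / l * (1 / r))"
      proof (intro mult_mono mult_left_mono)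
        show "s \<le> 1 / r" using r by (simp add: s_def divide_simps)
      qed (use M l s order_trans[OF zero_le_one M(1)] in auto)
      finally show ?thesis by (simp only: lr)
    qed
    then have mg: "modular p (\<lambda>x. norm (g x)) \<le> ennreal K"
      unfolding K_def by (intro modular_ball_le[OF M(1) r c]) (use out in \<open>auto simp: n_def\<close>)
    have "1 \<le> r ^ (DIM('a) - 1) * v x" if "x \<in> ball c (5 * r)" for x
    proof -
      have "norm (s *\<^sub>R (x - c)) \<le> 1"
        using that r by (simp add: s_def dist_norm norm_minus_commute)
      then have "1 \<le> bump (s *\<^sub>R (x - c))" by (rule bump_ge_1)
      then show ?thesis unfolding v_def arg n_def[symmetric] l_def[symmetric] using l by simp
    qed
    moreover have "0 \<le> v x" for x
      unfolding v_def by (intro mult_nonneg_nonneg bump_nonneg) (use l in simp)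
    ultimately show "\<exists>v g. v has_weak_gradient g \<and> (\<forall>x. 0 \<le> v x) \<and> (\<forall>x\<in>ball c (5 * r). 1 \<le> r ^ (DIM('a) - 1) * v x) \<and>
      modular p v \<le> ennreal K \<and> modular p (\<lambda>x. norm (g x)) \<le> ennreal K"
      using wg mv mg by blast
  qed
qed

text \<open>Translates modular data into the L^1 data of the boxing argument. Approximants are
  mollified to become C^1, with radius at most 1, hence the ball D' one unit larger for the
  gradients; u is replaced by a Borel representative.\<close>

lemma mixed_null_boxing:
  assumes E: "mixed_BV_capacity p E = 0" and m: "0 \<le> m" and \<epsilon>: "0 < \<epsilon>"
  obtains C r where "countable C" "C \<subseteq> E \<inter> {x. p x = 1} \<inter> ball 0 m" "\<And>x. x \<in> C \<Longrightarrow> 0 < r x \<and> r x \<le> 1"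
    "E \<inter> {x. p x = 1} \<inter> ball 0 m \<subseteq> (\<Union>x\<in>C. ball x (5 * r x))"
    "\<And>J. finite J \<Longrightarrow> J \<subseteq> C \<Longrightarrow>
      ball_vol TYPE('a) * (1 / 2) ^ (DIM('a) + 2) * (\<Sum>x\<in>J. r x ^ (DIM('a) - 1)) \<le> 2 ^ Suc DIM('a) * (5 * \<epsilon>)"
proof -
  define D where "D = ball (0::'a) (m + 2)"
  define D' where "D' = ball (0::'a) (m + 3)"
  have D: "D \<in> sets lebesgue" "emeasure lebesgue D < \<infinity>" "D' \<in> sets lebesgue" "emeasure lebesgue D' < \<infinity>"
    using emeasure_lborel_ball_finite[of "0::'a" "m + 2"] emeasure_lborel_ball_finite[of "0::'a" "m + 3"]
    by (auto simp: D_def D'_def)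
  note D(1) [measurable]
  define F where "F = E \<inter> {x. p x = 1} \<inter> ball 0 m"
  obtain d1 where d1: "0 < d1" "\<And>f :: 'a \<Rightarrow> 'a. f \<in> borel_measurable lebesgue \<Longrightarrow> modular p (\<lambda>x. norm (f x)) \<le> ennreal d1 \<Longrightarrow>
      (\<integral>\<^sup>+x\<in>D'. ennreal (norm (f x)) \<partial>lebesgue) \<le> ennreal \<epsilon>"
    by (rule modular_small_imp_integral_small[OF D(3,4) \<epsilon>]) (rule that)
  have b8: "0 < ball_vol TYPE('a) / 8" using ball_vol_pos[where 'a='a] by simp
  obtain d2 where d2: "0 < d2" "\<And>f :: 'a \<Rightarrow> real. f \<in> borel_measurable lebesgue \<Longrightarrow> modular p (\<lambda>x. norm (f x)) \<le> ennreal d2 \<Longrightarrow>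
      (\<integral>\<^sup>+x\<in>D. ennreal (norm (f x)) \<partial>lebesgue) \<le> ennreal (ball_vol TYPE('a) / 8)"
    by (rule modular_small_imp_integral_small[OF D(1,2) b8]) (rule that)
  define d where "d = min d1 d2"
  have d: "0 < d" "d \<le> d1" "d \<le> d2" using d1 d2 by (auto simp: d_def)
  obtain u0 U where "mixed_admissible d E U u0"
    using mixed_null_admissible[OF E d(1)] by blast
  then have um: "u0 \<in> borel_measurable lebesgue" and U: "open U" "E \<subseteq> U"
    and u1: "AE x in lebesgue. x \<in> U \<longrightarrow> u0 x = 1" and mu: "modular p u0 \<le> ennreal d"
    and ap: "\<And>e. 0 < e \<Longrightarrow> \<exists>w g. w has_weak_gradient g \<and>
        modular p (\<lambda>x. w x - u0 x) \<le> ennreal e \<and> modular p (\<lambda>x. norm (g x)) \<le> ennreal d"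
    unfolding mixed_admissible_def by blast+
  obtain u where ub [measurable]: "u \<in> borel_measurable borel" and ae0: "AE x in lborel. u0 x = u x"
    using completion_ex_borel_measurable_real[OF um] by auto
  have ae: "AE x in lebesgue. u0 x = u x" using ae0 by (rule AE_completion)
  have uL [measurable]: "u \<in> borel_measurable lebesgue" by (rule borel_imp_lebesgue) simp
  have mu': "modular p (\<lambda>x. norm (u x)) \<le> ennreal d2"
  proof -
    have "modular p (\<lambda>x. norm (u x)) = modular p u0"
      unfolding modular_def by (rule nn_integral_cong_AE, rule eventually_mono[OF ae]) simp
    then show ?thesis using mu ennreal_leI[OF d(3)] by simp
  qed
  have small: "(\<integral>\<^sup>+x\<in>D. ennreal \<bar>u x\<bar> \<partial>lborel) \<le> ennreal (ball_vol TYPE('a) / 8)"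
    using d2(2)[OF uL mu'] by (simp add: nn_integral_completion)
  have UA: "AE x in lborel. x \<in> U \<longrightarrow> u x = 1"
  proof -
    have "AE x in lborel. x \<in> U \<longrightarrow> u0 x = 1" using u1 by (simp add: AE_completion_iff)
    then show ?thesis using ae0 by eventually_elim auto
  qed
  have approx: "\<exists>w G. C1_gradient w G \<and> (\<integral>\<^sup>+x\<in>D. ennreal \<bar>w x - u x\<bar> \<partial>lborel) \<le> ennreal e \<and>
        (\<integral>\<^sup>+x\<in>D. ennreal (norm (G x)) \<partial>lborel) \<le> ennreal \<epsilon>" if e: "0 < e" for e
  proof -
    have e2: "0 < e / 2" using e by simp
    obtain d3 where d3: "0 < d3" "\<And>f :: 'a \<Rightarrow> real. f \<in> borel_measurable lebesgue \<Longrightarrow> modular p (\<lambda>x. norm (f x)) \<le> ennreal d3 \<Longrightarrow>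
      (\<integral>\<^sup>+x\<in>D. ennreal (norm (f x)) \<partial>lebesgue) \<le> ennreal (e / 2)"
      by (rule modular_small_imp_integral_small[OF D(1,2) e2]) (rule that)
    obtain w g where w: "w has_weak_gradient g" "modular p (\<lambda>x. w x - u0 x) \<le> ennreal d3"
      "modular p (\<lambda>x. norm (g x)) \<le> ennreal d"
      using ap[OF d3(1)] by blast
    note li = has_weak_gradientD(1,2)[OF w(1)]
    have [measurable]: "w \<in> borel_measurable lebesgue" "g \<in> borel_measurable lebesgue"
      using li by (auto intro: locally_integrable_measurable)
    have "modular p (\<lambda>x. norm (w x - u x)) = modular p (\<lambda>x. w x - u0 x)"
      unfolding modular_def by (rule nn_integral_cong_AE, rule eventually_mono[OF ae]) simp
    then have wu: "(\<integral>\<^sup>+x\<in>D. ennreal (norm (w x - u x)) \<partial>lebesgue) \<le> ennreal (e / 2)"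
      using w(2) by (intro d3(2)) auto
    obtain e0 where e0: "0 < e0" "e0 \<le> 1"
      "\<And>e'. 0 < e' \<Longrightarrow> e' \<le> e0 \<Longrightarrow> (\<integral>\<^sup>+x\<in>cball 0 (m + 2). ennreal \<bar>conv (moll e') w x - w x\<bar> \<partial>lebesgue) \<le> ennreal (e / 2)"
      by (rule conv_moll_L1_tendsto[OF li(1) e2, of "m + 2"]) (rule that)
    define W where "W = conv (moll e0) w"
    define G where "G = conv (moll e0) g"
    have WG: "C1_gradient W G"
      unfolding W_def G_def by (rule C1_gradient_conv_weak[OF w(1) moll_test[OF e0(1)]])
    have [measurable]: "W \<in> borel_measurable lebesgue"
      using C1_gradientD(3)[OF WG, of UNIV] by (intro borel_imp_lebesgue borel_measurable_continuous_onI)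
    have "(\<integral>\<^sup>+x\<in>D. ennreal \<bar>W x - u x\<bar> \<partial>lebesgue)
      \<le> (\<integral>\<^sup>+x. ennreal \<bar>W x - w x\<bar> * indicator D x + ennreal (norm (w x - u x)) * indicator D x \<partial>lebesgue)"
      by (rule nn_integral_mono) (auto simp: indicator_def intro!: ennreal_leI simp flip: ennreal_plus)
    also have "\<dots> = (\<integral>\<^sup>+x\<in>D. ennreal \<bar>W x - w x\<bar> \<partial>lebesgue) + (\<integral>\<^sup>+x\<in>D. ennreal (norm (w x - u x)) \<partial>lebesgue)"
      by (rule nn_integral_add; measurable)
    also have "\<dots> \<le> ennreal (e / 2) + ennreal (e / 2)"
    proof (intro add_mono wu)
      have "(\<integral>\<^sup>+x\<in>D. ennreal \<bar>W x - w x\<bar> \<partial>lebesgue) \<le> (\<integral>\<^sup>+x\<in>cball 0 (m + 2). ennreal \<bar>W x - w x\<bar> \<partial>lebesgue)"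
        by (rule nn_integral_mono) (auto simp: D_def indicator_def)
      also have "\<dots> \<le> ennreal (e / 2)" unfolding W_def by (rule e0(3)[OF e0(1) order_refl])
      finally show "(\<integral>\<^sup>+x\<in>D. ennreal \<bar>W x - w x\<bar> \<partial>lebesgue) \<le> ennreal (e / 2)" .
    qed
    also have "\<dots> = ennreal e" using e by (simp flip: ennreal_plus)
    finally have 1: "(\<integral>\<^sup>+x\<in>D. ennreal \<bar>W x - u x\<bar> \<partial>lborel) \<le> ennreal e" by (simp add: nn_integral_completion)
    have "(\<integral>\<^sup>+x\<in>D. ennreal (norm (G x)) \<partial>lebesgue) \<le> (\<integral>\<^sup>+x\<in>D'. ennreal (norm (g x)) \<partial>lebesgue)"
      unfolding G_def
    proof (rule conv_moll_L1[OF e0(1) li(2) D(3)])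
      fix x assume x: "x \<in> D"
      show "cball x e0 \<subseteq> D'"
      proof
        fix y assume "y \<in> cball x e0"
        then show "y \<in> D'"
          using x e0(2) norm_triangle_ineq2[of y x] by (simp add: D_def D'_def dist_norm norm_minus_commute)
      qed
    qed
    also have "\<dots> \<le> ennreal \<epsilon>"
      using w(3) ennreal_leI[OF d(2)] by (intro d1(2)) auto
    finally have 2: "(\<integral>\<^sup>+x\<in>D. ennreal (norm (G x)) \<partial>lborel) \<le> ennreal \<epsilon>" by (simp add: nn_integral_completion)
    show ?thesis using WG 1 2 by blast
  qed
  have F: "F \<subseteq> ball 0 m" "F \<subseteq> U" using U(2) by (auto simp: F_def)
  obtain C r where Cr: "countable C" "C \<subseteq> F" "\<And>x. x \<in> C \<Longrightarrow> 0 < r x \<and> r x \<le> 1" "F \<subseteq> (\<Union>x\<in>C. ball x (5 * r x))"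
    "\<And>J. finite J \<Longrightarrow> J \<subseteq> C \<Longrightarrow>
      ball_vol TYPE('a) * (1 / 2) ^ (DIM('a) + 2) * (\<Sum>x\<in>J. r x ^ (DIM('a) - 1)) \<le> 2 ^ Suc DIM('a) * (5 * \<epsilon>)"
    by (rule boxing[OF ub \<epsilon> m F U(1) UA small[unfolded D_def] approx[unfolded D_def]]) (assumption, rule that)
  show thesis
    by (rule that[OF Cr(1) Cr(2)[unfolded F_def] Cr(3) Cr(4)[unfolded F_def] Cr(5)])
qed

text \<open>Weights r^(n-1) of total at most q <= 1, against functions of modular at most K, give
  energy at most q K <= d. The union of the enlarged Vitali balls is the open neighbourhood on which
  the series is at least 1.\<close>

lemma cap_null_exponent_eq_1_ball:
  assumes E: "mixed_BV_capacity p E = 0" and m: "0 \<le> m"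
  shows "cap_null (E \<inter> {x. p x = 1} \<inter> ball 0 m)"
  unfolding cap_null_def
proof (intro allI impI)
  fix d :: real assume d: "0 < d"
  obtain K where K: "0 < K" "\<And>c r. p c = 1 \<Longrightarrow> 0 < r \<Longrightarrow> r \<le> 1 \<Longrightarrow>
    \<exists>v g. v has_weak_gradient g \<and> (\<forall>x. 0 \<le> v x) \<and> (\<forall>x\<in>ball c (5 * r). 1 \<le> r ^ (DIM('a) - 1) * v x) \<and>
      modular p v \<le> ennreal K \<and> modular p (\<lambda>x. norm (g x)) \<le> ennreal K"
    by (rule ball_functions) (rule that)
  define a where "a = ball_vol TYPE('a) * (1 / 2) ^ (DIM('a) + 2)"
  have a: "0 < a" using ball_vol_pos[where 'a='a] by (simp add: a_def)
  define q where "q = min 1 (d / K)"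
  have q: "0 < q" "q \<le> 1" "q * K \<le> d" using d K(1) by (auto simp: q_def min_def field_simps)
  \<comment> \<open>Solved from the covering bound, so that the weights of the balls have total at
    most q.\<close>
  define \<epsilon> where "\<epsilon> = a * q / (5 * 2 ^ Suc DIM('a))"
  have \<epsilon>: "0 < \<epsilon>" "2 ^ Suc DIM('a) * (5 * \<epsilon>) = a * q" using a q by (auto simp: \<epsilon>_def)
  obtain C r where C: "countable C" "C \<subseteq> E \<inter> {x. p x = 1} \<inter> ball 0 m"
    and r: "\<And>x. x \<in> C \<Longrightarrow> 0 < r x \<and> r x \<le> 1"
    and cover: "E \<inter> {x. p x = 1} \<inter> ball 0 m \<subseteq> (\<Union>x\<in>C. ball x (5 * r x))"
    and sum: "\<And>J. finite J \<Longrightarrow> J \<subseteq> C \<Longrightarrow> a * (\<Sum>x\<in>J. r x ^ (DIM('a) - 1)) \<le> a * q"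
    by (rule mixed_null_boxing[OF E m \<epsilon>(1), unfolded \<epsilon>(2), folded a_def]) (rule that)
  show "\<exists>v g U. v has_weak_gradient g \<and> (AE x in lebesgue. 0 \<le> v x) \<and> open U \<and>
      E \<inter> {x. p x = 1} \<inter> ball 0 m \<subseteq> U \<and> (AE x in lebesgue. x \<in> U \<longrightarrow> 1 \<le> v x) \<and>
      modular p v \<le> ennreal d \<and> modular p (\<lambda>x. norm (g x)) \<le> ennreal d"
  \<comment> \<open>The enumeration below requires C nonempty. In dimension one every weight is 1,
    so q < 1 forces the empty case.\<close>
  proof (cases "C = {}")
    case True
    then have "E \<inter> {x. p x = 1} \<inter> ball 0 m = {}" using cover by auto
    then show ?thesis using cap_null_empty[unfolded cap_null_def, rule_format, OF d] by simp
  next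
    case False
    define c where "c = from_nat_into C"
    have cC: "c k \<in> C" for k unfolding c_def by (rule from_nat_into[OF False])
    \<comment> \<open>For finite C the enumeration repeats elements; the zero weight at indices
      outside the image of \<open>to_nat_on\<close> prevents a ball from being counted
      twice.\<close>
    define l where "l k = (if k \<in> to_nat_on C ` C then r (c k) ^ (DIM('a) - 1) else 0)" for k
    have l0: "0 \<le> l k" for k using r[OF cC[of k]] by (simp add: l_def less_imp_le)
    have l1: "(\<Sum>k<N. l k) \<le> q" for N
    proof -
      define J where "J = {x \<in> C. to_nat_on C x < N}"
      have inj: "inj_on (to_nat_on C) C" by (rule inj_on_to_nat_on[OF C(1)])
      have fin: "finite J"
        by (rule finite_imageD[of "to_nat_on C"]) 
           (auto simp: J_def intro: finite_subset[of _ "{..<N}"] inj_on_subset[OF inj])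
      have "(\<Sum>k<N. l k) = (\<Sum>k\<in>to_nat_on C ` J. l k)"
        by (rule sum.mono_neutral_right) (auto simp: J_def l_def)
      also have "\<dots> = (\<Sum>x\<in>J. l (to_nat_on C x))"
        by (rule sum.reindex_cong[OF inj_on_subset[OF inj]]) (auto simp: J_def)
      also have "\<dots> = (\<Sum>x\<in>J. r x ^ (DIM('a) - 1))"
        by (rule sum.cong) (auto simp: J_def l_def c_def C(1))
      finally show ?thesis
        using sum[OF fin] a by (auto simp: J_def)
    qed
    have "\<exists>v g. v has_weak_gradient g \<and> (\<forall>x. 0 \<le> v x) \<and> (\<forall>x\<in>ball (c k) (5 * r (c k)). 1 \<le> r (c k) ^ (DIM('a) - 1) * v x) \<and>
      modular p v \<le> ennreal K \<and> modular p (\<lambda>x. norm (g x)) \<le> ennreal K" for k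
      using K(2)[of "c k" "r (c k)"] r[OF cC[of k]] cC[of k] C(2) by blast
    from choice[OF allI[OF this]] obtain v where "\<forall>k. \<exists>g. v k has_weak_gradient g \<and> (\<forall>x. 0 \<le> v k x) \<and>
      (\<forall>x\<in>ball (c k) (5 * r (c k)). 1 \<le> r (c k) ^ (DIM('a) - 1) * v k x) \<and>
      modular p (v k) \<le> ennreal K \<and> modular p (\<lambda>x. norm (g x)) \<le> ennreal K"
      by (rule exE)
    from choice[OF this] obtain g where vg: "\<forall>k. v k has_weak_gradient g k \<and> (\<forall>x. 0 \<le> v k x) \<and>
      (\<forall>x\<in>ball (c k) (5 * r (c k)). 1 \<le> r (c k) ^ (DIM('a) - 1) * v k x) \<and>
      modular p (v k) \<le> ennreal K \<and> modular p (\<lambda>x. norm (g k x)) \<le> ennreal K"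
      by (rule exE)
    have wg: "v k has_weak_gradient g k" and v0: "AE x in lebesgue. 0 \<le> v k x"
      and v1: "\<And>x. x \<in> ball (c k) (5 * r (c k)) \<Longrightarrow> 1 \<le> r (c k) ^ (DIM('a) - 1) * v k x"
      and mv: "modular p (v k) \<le> ennreal K" and mg: "modular p (\<lambda>x. norm (g k x)) \<le> ennreal K" for k
      using vg by blast+
    have l_le_1: "(\<Sum>k<N. l k) \<le> 1" for N using l1[of N] q(2) by simp
    have sumle: "(\<Sum>k<N. ennreal (l k) * f k) \<le> ennreal d" if "\<And>k. f k \<le> ennreal K" for f N
    proof -
      have "(\<Sum>k<N. ennreal (l k) * f k) \<le> (\<Sum>k<N. ennreal (l k) * ennreal K)"
        by (intro sum_mono mult_left_mono that) simp
      also have "\<dots> = ennreal (\<Sum>k<N. l k) * ennreal K"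
      proof -
        have "(\<Sum>k<N. ennreal (l k)) = ennreal (\<Sum>k<N. l k)"
          by (rule sum_ennreal) (rule l0)
        then show ?thesis by (simp only: sum_distrib_right[symmetric])
      qed
      also have "\<dots> \<le> ennreal q * ennreal K" by (intro mult_right_mono ennreal_leI l1) simp
      also have "\<dots> = ennreal (q * K)" using q by (intro ennreal_mult'[symmetric]) simp
      also have "\<dots> \<le> ennreal d" by (intro ennreal_leI q)
      finally show ?thesis .
    qed
    obtain V G where V: "V has_weak_gradient G" "AE x in lebesgue. 0 \<le> V x" "modular p V \<le> ennreal d"
      "modular p (\<lambda>x. norm (G x)) \<le> ennreal d" "AE x in lebesgue. \<forall>k. l k * v k x \<le> V x"
      by (rule has_weak_gradient_weighted_series[OF l0 l_le_1 wg v0 sumle[OF mv] sumle[OF mg]])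
    define U where "U = (\<Union>x\<in>C. ball x (5 * r x))"
    have "AE x in lebesgue. x \<in> U \<longrightarrow> 1 \<le> V x"
      using V(5)
    proof eventually_elim
      case (elim x)
      show ?case
      proof
        assume "x \<in> U"
        then obtain y where y: "y \<in> C" "x \<in> ball y (5 * r y)" by (auto simp: U_def)
        define k where "k = to_nat_on C y"
        have ck: "c k = y" using y(1) C(1) by (simp add: c_def k_def)
        have "1 \<le> r (c k) ^ (DIM('a) - 1) * v k x" by (rule v1) (use y ck in simp)
        also have "r (c k) ^ (DIM('a) - 1) = l k" using y(1) by (simp add: l_def k_def)
        also have "l k * v k x \<le> V x" using elim by blast
        finally show "1 \<le> V x" .
      qed
    qed
    then show ?thesis
      using V(1-4) cover by (intro exI[of _ V] exI[of _ G] exI[of _ U]) (auto simp: U_def)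
  qed
qed

text \<open>As p >= 1, E consists of its part in {p > 1} and countably many bounded parts in {p =
  1}; boundedness supplies the finite measure for the passage to L^1.\<close>

lemma mixed_BV_null_imp_Sobolev_null:
  assumes E: "mixed_BV_capacity p E = 0"
  shows "Sobolev_capacity p E = 0"
proof -
  let ?A = "insert (E \<inter> {x. 1 < p x}) (range (\<lambda>m::nat. E \<inter> {x. p x = 1} \<inter> ball 0 (real m)))"
  have "cap_null (\<Union>?A)"
    using cap_null_exponent_gt_1[OF E] cap_null_exponent_eq_1_ball[OF E] by (intro cap_null_Union) auto
  moreover have "E \<subseteq> \<Union>?A"
  proof
    fix x assume x: "x \<in> E"
    obtain m :: nat where "norm x < real m" using reals_Archimedean2 by blast
    then show "x \<in> \<Union>?A" using x p_ge[of x] by (cases "p x = 1") auto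
  qed
  ultimately show ?thesis
    using cap_null_mono cap_null_imp_Sobolev_null by blast
qed

end

section \<open>From the hypotheses to the locale, and conclusion\<close>

lemma global_log_Holder_imp_log_Holder_exponent:
  fixes p :: "'a::euclidean_space \<Rightarrow> real"
  assumes p: "\<And>x. 1 \<le> p x" and H: "global_log_Holder p"
  obtains P c1 where "log_Holder_exponent p P c1"
proof -
  obtain c1 c2 pinf where c: "0 < c1" "0 < c2" "1 \<le> pinf"
    and h1: "\<And>x y. x \<noteq> y \<Longrightarrow> \<bar>p x - p y\<bar> \<le> c1 / ln (exp 1 + 1 / norm (x - y))"
    and h2: "\<And>x. \<bar>p x - pinf\<bar> \<le> c2 / ln (exp 1 + norm x)"
    using H unfolding global_log_Holder_def by blast
  \<comment> \<open>The logarithm is at least 1, so the decay condition bounds p by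
    \<open>pinf + c2\<close>, which serves as P.\<close>
  have bound: "p x \<le> pinf + c2" for x
  proof -
    have "ln (exp 1) \<le> ln (exp 1 + norm x)"
      by (subst ln_le_cancel_iff) (auto intro: add_pos_nonneg)
    then have "c2 / ln (exp 1 + norm x) \<le> c2" using c by (simp add: divide_le_eq)
    then show ?thesis using h2[of x] by linarith
  qed
  have "isCont p x" for x
    unfolding continuous_at_eps_delta
  proof (intro allI impI)
    fix e :: real assume e: "0 < e"
    show "\<exists>d>0. \<forall>y. dist y x < d \<longrightarrow> dist (p y) (p x) < e"
      unfolding dist_norm
    \<comment> \<open>The distance t at which c1 / ln (1/t) equals e.\<close>
    proof (intro exI[of _ "exp (- c1 / e)"] conjI allI impI)
      fix y assume y: "norm (y - x) < exp (- c1 / e)"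
      show "norm (p y - p x) < e"
      proof (cases "y = x")
        case False
        then have n: "0 < norm (y - x)" by simp
        have "ln (norm (y - x)) < - c1 / e" using y n by (metis exp_gt_zero ln_exp ln_less_cancel_iff)
        then have "c1 / e < ln (1 / norm (y - x))" using n by (simp add: ln_div)
        also have "\<dots> \<le> ln (exp 1 + 1 / norm (y - x))"
          using n by (subst ln_le_cancel_iff) (auto intro: add_pos_pos)
        finally have lt: "c1 / e < ln (exp 1 + 1 / norm (y - x))" .
        have pos: "0 < ln (exp 1 + 1 / norm (y - x))" using lt c e by (meson divide_pos_pos order_less_trans)
        have "\<bar>p y - p x\<bar> \<le> c1 / ln (exp 1 + 1 / norm (y - x))" by (rule h1[OF False])
        also have "\<dots> < e" using lt e pos by (simp add: divide_less_eq mult.commute)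
        finally show ?thesis by simp
      qed (use e in simp)
    qed simp
  qed
  then have "continuous_on UNIV p" by (simp add: continuous_on_eq_continuous_at)
  then have "log_Holder_exponent p (pinf + c2) c1"
    using p bound c h1 by unfold_locales auto
  then show thesis by (rule that)
qed

theorem theorem6p1:
  fixes p :: "'a::euclidean_space \<Rightarrow> real" and E :: "'a set"
  assumes "\<And>x. 1 \<le> p x"
    and "global_log_Holder p"
    and "esssup lebesgue (\<lambda>x. ereal (p x)) < \<infinity>"
  shows "Sobolev_capacity p E = 0 \<longleftrightarrow> mixed_BV_capacity p E = 0"
proof -
  obtain P c1 where "log_Holder_exponent p P c1"
    by (rule global_log_Holder_imp_log_Holder_exponent[OF assms(1,2)])
  then interpret log_Holder_exponent p P c1 .
  show ?thesis
    using Sobolev_null_imp_mixed_BV_null mixed_BV_null_imp_Sobolev_null by blast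
qed

end
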